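(* Let $\mathcal{A}$ and $\mathcal{B}$ be finite-dimensional $\mathbb{Z}_2$-graded-simple associative algebras over an algebraically closed field $\mathbb{F}$ of characteristic zero. Let $m,m'\in\mathbb{N}\cup\{\infty\}$. If $$\mathrm{Id}(G_m(\mathcal{A}))=\mathrm{Id}(G_{m'}(\mathcal{B})),$$ then one of the following holds: (1) $\mathcal{A}\cong_2 M_n(\mathbb{F})$ and $\mathcal{B}\cong_2 M_n(\mathbb{F}\mathbb{Z}_2)$ for some $n$, and $m'=1$; or (2) the same as (1) with $\mathcal{A}$ and $\mathcal{B}$ switching places and $m$ and $m'$ switching places, i.e. $\mathcal{B}\cong_2 M_n(\mathbb{F})$ and $\mathcal{A}\cong_2 M_n(\mathbb{F}\mathbb{Z}_2)$ for some $n$, and $m=1$; or (3) $\mathcal{A}\cong_2\mathcal{B}$, and in addition: (a) if $\mathcal{A}\cong_2 M_n(\mathbb{F}\mathbb{Z}_2)$ for some $n$, then $\lfloor\frac{m}{2}\rfloor=\lfloor\frac{m'}{2}\rfloor$; (b) if $\mathcal{A}\cong_2 M_{k,\ell}$ for some $k,\ell$, then $m=m'$. Conversely, if any of the conditions (1), (2), (3) holds, then $\mathrm{Id}(G_m(\mathcal{A}))=\mathrm{Id}(G_{m'}(\mathcal{B}))$.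
   Context: $\mathbb{N}=\{1,2,\dots\}$, and $\lfloor\infty/2\rfloor=\infty$. $\mathrm{Id}(\cdot)$ denotes the set of ordinary (ungraded) associative polynomial identities; $\cong_2$ denotes isomorphism of $\mathbb{Z}_2$-graded algebras. $G=G_\infty$ is the unital Grassmann algebra over $\mathbb{F}$ on generators $e_1,e_2,\dots$, and $G_m$ ($m\in\mathbb{N}$) is the one generated by $e_1,\dots,e_m$; superscripts $0$, $1$ denote the spans of monomials of even, odd length. For a $\mathbb{Z}_2$-graded algebra $\mathcal{A}=\mathcal{A}^0\oplus\mathcal{A}^1$ and $m\in\mathbb{N}\cup\{\infty\}$, $G_m(\mathcal{A})=(G_m)^0\otimes\mathcal{A}^0\oplus(G_m)^1\otimes\mathcal{A}^1$. $M_n(\mathbb{F})$ carries the trivial grading (odd part zero). For $k\ge\ell\ge0$, $k>0$, $M_{k,\ell}$ is $M_{k+\ell}(\mathbb{F})$ with the $\mathbb{Z}_2$-grading whose even part consists of the block-diagonal matrices (blocks of sizes $k$ and $\ell$) and whose odd part consists of the block-off-diagonal matrices; the case $\ell=0$ is $M_k(\mathbb{F})$ with trivial grading. $M_n(\mathbb{F}\mathbb{Z}_2)=M_n(\mathbb{F})\oplus\varepsilon M_n(\mathbb{F})$, $\varepsilon^2=1$ ($\varepsilon$ central), with even part $M_n(\mathbb{F})$ and odd part $\varepsilon M_n(\mathbb{F})$. Every finite-dimensional $\mathbb{Z}_2$-graded-simple associative algebra over $\mathbb{F}$ is graded-isomorphic to some $M_{k,\ell}$ or some $M_n(\mathbb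{F}\mathbb{Z}_2)$.
   Formalization: Condition (3)(b) is imposed only for M_{k,ℓ} with ℓ>0: for ℓ=0 the forward claim is false, e.g. A=B=F, m=1, m'=2, where both envelopes are commutative unital and have the same identities; for A≅B≅M_n(F) equality is proved for all m, m'. *)

theory Defs
  imports
    "Jordan_Normal_Form.VS_Connect"
    "HOL-Library.Z2"
    "HOL-Library.Extended_Nat"
    "HOL-Library.Poly_Mapping"
begin

section \<open>Associative and graded algebras\<close>

text \<open>
  Algebras are not required to be unital: the field \<open>one\<close> that the record type \<open>module\<close>
  inherits from \<open>ring\<close> is never referred to.
\<close>

locale associative_algebra = vectorspace class_ring A
  for A :: "('f :: field, 'v, 'z) module_scheme" (structure) +
  assumes mult_closed: "\<lbrakk>x \<in> carrier A; y \<in> carrier A\<rbrakk> \<Longrightarrow> x \<otimes> y \<in> carrier A"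
    and mult_assoc: "\<lbrakk>x \<in> carrier A; y \<in> carrier A; z \<in> carrier A\<rbrakk>
          \<Longrightarrow> (x \<otimes> y) \<otimes> z = x \<otimes> (y \<otimes> z)"
    and distrib_left: "\<lbrakk>x \<in> carrier A; y \<in> carrier A; z \<in> carrier A\<rbrakk>
          \<Longrightarrow> x \<otimes> (y \<oplus> z) = x \<otimes> y \<oplus> x \<otimes> z"
    and distrib_right: "\<lbrakk>x \<in> carrier A; y \<in> carrier A; z \<in> carrier A\<rbrakk>
          \<Longrightarrow> (x \<oplus> y) \<otimes> z = x \<otimes> z \<oplus> y \<otimes> z"
    and smult_mult_left: "\<lbrakk>x \<in> carrier A; y \<in> carrier A\<rbrakk>
          \<Longrightarrow> (c \<odot> x) \<otimes> y = c \<odot> (x \<otimes> y)"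
    and smult_mult_right: "\<lbrakk>x \<in> carrier A; y \<in> carrier A\<rbrakk>
          \<Longrightarrow> x \<otimes> (c \<odot> y) = c \<odot> (x \<otimes> y)"

text \<open>The type \<^typ>\<open>bit\<close> is the field with two elements; it serves as the grading group.\<close>

record ('f, 'v) graded_algebra = "('f, 'v) module" +
  grade :: "bit \<Rightarrow> 'v set"

locale Z2_graded_algebra = associative_algebra A
  for A :: "('f :: field, 'v, 'z) graded_algebra_scheme" (structure) +
  assumes grade_subspace: "VectorSpace.subspace class_ring (grade A i) A"
    and grade_sum: "x \<in> carrier A \<Longrightarrow> \<exists>y\<in>grade A 0. \<exists>z\<in>grade A 1. x = y \<oplus> z"
    and grade_disjoint: "grade A 0 \<inter> grade A 1 = {\<zero>}"
    and grade_mult: "\<lbrakk>x \<in> grade A i; y \<in> grade A j\<rbrakk> \<Longrightarrow> x \<otimes> y \<in> grade A (i + j)"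

definition graded_ideal :: "'v set \<Rightarrow> ('f :: field, 'v, 'z) graded_algebra_scheme \<Rightarrow> bool" where
  "graded_ideal I A \<longleftrightarrow>
     VectorSpace.subspace class_ring I A \<and>
     (\<forall>x\<in>carrier A. \<forall>y\<in>I. x \<otimes>\<^bsub>A\<^esub> y \<in> I \<and> y \<otimes>\<^bsub>A\<^esub> x \<in> I) \<and>
     (\<forall>x\<in>I. \<exists>y\<in>I \<inter> grade A 0. \<exists>z\<in>I \<inter> grade A 1. x = y \<oplus>\<^bsub>A\<^esub> z)"

text \<open>As usual, simplicity includes that the multiplication is not identically zero.\<close>

locale graded_simple_algebra = Z2_graded_algebra +
  assumes mult_nonzero: "\<exists>x\<in>carrier A. \<exists>y\<in>carrier A. x \<otimes> y \<noteq> \<zero>"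
    and simple: "graded_ideal I A \<Longrightarrow> I = {\<zero>} \<or> I = carrier A"

definition graded_isomorphic ::
  "('f, 'v, 'y) graded_algebra_scheme \<Rightarrow> ('f, 'w, 'z) graded_algebra_scheme \<Rightarrow> bool"
  (infix \<open>\<cong>\<^sub>2\<close> 50) where
  "A \<cong>\<^sub>2 B \<longleftrightarrow> (\<exists>\<phi>. bij_betw \<phi> (carrier A) (carrier B) \<and>
     (\<forall>x\<in>carrier A. \<forall>y\<in>carrier A. \<phi> (x \<oplus>\<^bsub>A\<^esub> y) = \<phi> x \<oplus>\<^bsub>B\<^esub> \<phi> y) \<and>
     (\<forall>x\<in>carrier A. \<forall>y\<in>carrier A. \<phi> (x \<otimes>\<^bsub>A\<^esub> y) = \<phi> x \<otimes>\<^bsub>B\<^esub> \<phi> y) \<and>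
     (\<forall>c. \<forall>x\<in>carrier A. \<phi> (c \<odot>\<^bsub>A\<^esub> x) = c \<odot>\<^bsub>B\<^esub> \<phi> x) \<and>
     (\<forall>i. \<phi> ` grade A i = grade B i))"


section \<open>The standard graded-simple algebras\<close>

definition matrix_algebra :: "nat \<Rightarrow> ('f :: field, 'f mat) graded_algebra" where
  "matrix_algebra n = module.extend (module_mat TYPE('f) n n)
     (graded_algebra.fields (\<lambda>i. if i = 0 then carrier_mat n n else {0\<^sub>m n n}))"

text \<open>
  For \<open>l = 0\<close> the grading below is trivial (see the lemma). The Grassmann envelope is then the tensor
  product of matrices with a unital commutative algebra, so its identities do not depend on \<open>m\<close>;
  statements recovering \<open>m\<close> from the identities have to assume \<open>l > 0\<close>.
\<close>

definition block_matrix_algebra :: "nat \<Rightarrow> nat \<Rightarrow> ('f :: field, 'f mat) graded_algebra" where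
  "block_matrix_algebra k l = module.extend (module_mat TYPE('f) (k + l) (k + l))
     (graded_algebra.fields (\<lambda>i.
        if i = 0
        then {four_block_mat P (0\<^sub>m k l) (0\<^sub>m l k) S | P S. P \<in> carrier_mat k k \<and> S \<in> carrier_mat l l}
        else {four_block_mat (0\<^sub>m k k) Q R (0\<^sub>m l l) | Q R. Q \<in> carrier_mat k l \<and> R \<in> carrier_mat l k}))"

lemma block_matrix_algebra_0: "block_matrix_algebra n 0 = (matrix_algebra n :: ('f :: field, 'f mat) graded_algebra)"
proof -
  have "(carrier_mat n n :: 'f mat set) = {four_block_mat P (0\<^sub>m n 0) (0\<^sub>m 0 n) S | P S.
      P \<in> carrier_mat n n \<and> S \<in> carrier_mat 0 0}" (is "_ = ?E" is "?C = _")
  proof (intro equalityI subsetI)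
    fix X :: "'f mat" assume "X \<in> ?C"
    moreover from this have "X = four_block_mat X (0\<^sub>m n 0) (0\<^sub>m 0 n) (0\<^sub>m 0 0)"
      by (intro eq_matI) auto
    ultimately show "X \<in> ?E" using zero_carrier_mat by blast
  qed auto
  moreover have "{0\<^sub>m n n :: 'f mat} = {four_block_mat (0\<^sub>m n n) Q R (0\<^sub>m 0 0) | Q R.
      Q \<in> carrier_mat n 0 \<and> R \<in> carrier_mat 0 n}" (is "_ = ?O")
  proof -
    have "four_block_mat (0\<^sub>m n n) Q R (0\<^sub>m 0 0) = (0\<^sub>m n n :: 'f mat)" for Q R
      by (intro eq_matI) auto
    moreover have "(0\<^sub>m n 0 :: 'f mat) \<in> carrier_mat n 0" "(0\<^sub>m 0 n :: 'f mat) \<in> carrier_mat 0 n"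
      by auto
    ultimately show ?thesis by force
  qed
  ultimately show ?thesis
    unfolding block_matrix_algebra_def matrix_algebra_def by (simp only: add_0_right)
qed

text \<open>The pair \<open>(X, Y)\<close> stands for \<open>X + \<epsilon> Y\<close>, where \<open>\<epsilon>\<close> is central and \<open>\<epsilon>\<^sup>2 = 1\<close>.\<close>

definition group_matrix_algebra :: "nat \<Rightarrow> ('f :: field, 'f mat \<times> 'f mat) graded_algebra" where
  "group_matrix_algebra n =
     \<lparr> carrier = carrier_mat n n \<times> carrier_mat n n,
       mult = (\<lambda>(X, Y) (X', Y'). (X * X' + Y * Y', X * Y' + Y * X')),
       one = (1\<^sub>m n, 0\<^sub>m n n),
       zero = (0\<^sub>m n n, 0\<^sub>m n n),
       add = (\<lambda>(X, Y) (X', Y'). (X + X', Y + Y')),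
       smult = (\<lambda>c (X, Y). (c \<cdot>\<^sub>m X, c \<cdot>\<^sub>m Y)),
       grade = (\<lambda>i. if i = 0 then carrier_mat n n \<times> {0\<^sub>m n n} else {0\<^sub>m n n} \<times> carrier_mat n n) \<rparr>"


section \<open>Grassmann algebras and Grassmann envelopes\<close>

text \<open>
  The Grassmann algebra on \<open>e\<^sub>1, \<dots>, e\<^sub>m\<close> (on \<open>e\<^sub>1, e\<^sub>2, \<dots>\<close> if \<open>m = \<infinity>\<close>) has the basis of all
  \<open>e\<^sub>S = e\<^bsub>i\<^sub>1\<^esub> \<cdots> e\<^bsub>i\<^sub>r\<^esub>\<close>, where \<open>S = {i\<^sub>1 < \<dots> < i\<^sub>r}\<close> is a finite set of indices of generators.
  If \<open>S\<close> and \<open>T\<close> are disjoint, then \<open>e\<^sub>S e\<^sub>T = \<plusminus> e\<^bsub>S \<union> T\<^esub>\<close> with the sign below, and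
  \<open>e\<^sub>S e\<^sub>T = 0\<close> otherwise. An element is represented by its coefficient function.
\<close>

definition grassmann_index :: "enat \<Rightarrow> nat set set" where
  "grassmann_index m = {S. finite S \<and> (\<forall>i\<in>S. 1 \<le> i \<and> enat i \<le> m)}"

definition shuffle_sign :: "nat set \<Rightarrow> nat set \<Rightarrow> 'f :: field" where
  "shuffle_sign S T = (- 1) ^ card {(s, t). s \<in> S \<and> t \<in> T \<and> t < s}"

definition grassmann_algebra :: "enat \<Rightarrow> ('f :: field, nat set \<Rightarrow> 'f) graded_algebra" where
  "grassmann_algebra m =
     \<lparr> carrier = {g. finite {S. g S \<noteq> 0} \<and> {S. g S \<noteq> 0} \<subseteq> grassmann_index m},
       mult = (\<lambda>g h U. \<Sum>S\<in>Pow U. shuffle_sign S (U - S) * g S * h (U - S)),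
       one = (\<lambda>S. if S = {} then 1 else 0),
       zero = (\<lambda>S. 0),
       add = (\<lambda>g h S. g S + h S),
       smult = (\<lambda>c g S. c * g S),
       grade = (\<lambda>i. {g. finite {S. g S \<noteq> 0} \<and>
                        {S. g S \<noteq> 0} \<subseteq> {S \<in> grassmann_index m. of_nat (card S) = i}}) \<rparr>"

text \<open>
  Every element of the tensor product of a Grassmann algebra with \<open>A\<close> is uniquely a finite sum
  \<open>\<Sum>\<^sub>S e\<^sub>S \<otimes> a\<^sub>S\<close> and is represented by the function \<open>S \<mapsto> a\<^sub>S\<close>. It belongs to the span of the
  products of the even parts and of the odd parts iff every \<open>a\<^sub>S\<close> has the parity of \<open>card S\<close>.
  The lemmas below confirm that pure tensors lie in it, multiply as they should, and span it.
\<close>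

definition grassmann_envelope ::
  "enat \<Rightarrow> ('f :: field, 'v, 'z) graded_algebra_scheme \<Rightarrow> ('f, nat set \<Rightarrow> 'v) module" where
  "grassmann_envelope m A =
     \<lparr> carrier = {x. finite {S. x S \<noteq> \<zero>\<^bsub>A\<^esub>} \<and> {S. x S \<noteq> \<zero>\<^bsub>A\<^esub>} \<subseteq> grassmann_index m \<and>
                     (\<forall>S\<in>grassmann_index m. x S \<in> grade A (of_nat (card S)))},
       mult = (\<lambda>x y U. \<Oplus>\<^bsub>A\<^esub>S\<in>Pow U. shuffle_sign S (U - S) \<odot>\<^bsub>A\<^esub> (x S \<otimes>\<^bsub>A\<^esub> y (U - S))),
       one = (\<lambda>S. if S = {} then \<one>\<^bsub>A\<^esub> else \<zero>\<^bsub>A\<^esub>),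
       zero = (\<lambda>S. \<zero>\<^bsub>A\<^esub>),
       add = (\<lambda>x y S. x S \<oplus>\<^bsub>A\<^esub> y S),
       smult = (\<lambda>c x S. c \<odot>\<^bsub>A\<^esub> x S) \<rparr>"

definition pure_tensor ::
  "('f :: field, 'v, 'z) module_scheme \<Rightarrow> (nat set \<Rightarrow> 'f) \<Rightarrow> 'v \<Rightarrow> nat set \<Rightarrow> 'v" where
  "pure_tensor A g a = (\<lambda>S. g S \<odot>\<^bsub>A\<^esub> a)"

context Z2_graded_algebra
begin

lemma pure_tensor_in_envelope:
  assumes "g \<in> grade (grassmann_algebra m) i" "a \<in> grade A i"
  shows "pure_tensor A g a \<in> carrier (grassmann_envelope m A)"
proof -
  have a: "a \<in> carrier A"
    using assms(2) grade_subspace[of i] submodule.subset[OF subspace.submod] by blast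
  have "{S. pure_tensor A g a S \<noteq> \<zero>} \<subseteq> {S. g S \<noteq> 0}"
    using a lmult_0 by (auto simp: pure_tensor_def)
  moreover have "pure_tensor A g a S \<in> grade A (of_nat (card S))" for S
  proof (cases "g S = 0")
    case True
    then show ?thesis
      using a lmult_0 submodule.zero_closed[OF subspace.submod[OF grade_subspace]]
      by (auto simp: pure_tensor_def)
  next
    case False
    with assms(1) have "of_nat (card S) = i" by (auto simp: grassmann_algebra_def)
    with assms(2) show ?thesis
      using submodule.smult_closed[OF subspace.submod[OF grade_subspace]]
      by (auto simp: pure_tensor_def)
  qed
  ultimately show ?thesis
    using assms(1) finite_subset
    by (fastforce simp: grassmann_envelope_def grassmann_algebra_def)
qed

lemma pure_tensor_mult:
  assumes "a \<in> carrier A" "b \<in> carrier A"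
  shows "pure_tensor A g a \<otimes>\<^bsub>grassmann_envelope m A\<^esub> pure_tensor A h b =
         pure_tensor A (g \<otimes>\<^bsub>grassmann_algebra m\<^esub> h) (a \<otimes> b)"
proof
  fix U :: "nat set"
  let ?c = "\<lambda>S. shuffle_sign S (U - S) * g S * h (U - S)"
  have ab: "a \<otimes> b \<in> carrier A" using assms by (rule mult_closed)
  have *: "shuffle_sign S (U - S) \<odot> ((g S \<odot> a) \<otimes> (h (U - S) \<odot> b)) = ?c S \<odot> (a \<otimes> b)" for S
  proof -
    have "(g S \<odot> a) \<otimes> (h (U - S) \<odot> b) = g S \<odot> (h (U - S) \<odot> (a \<otimes> b))"
      using assms smult_mult_left[of a "h (U - S) \<odot> b" "g S"] smult_mult_right[of a b "h (U - S)"]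
      by simp
    moreover have "x \<odot> (y \<odot> (z \<odot> (a \<otimes> b))) = (x * y * z) \<odot> (a \<otimes> b)" for x y z
      using smult_assoc1[of "x * y" z "a \<otimes> b"] smult_assoc1[of x y "z \<odot> (a \<otimes> b)"] ab by simp
    ultimately show ?thesis by simp
  qed
  have "(\<Oplus>S\<in>X. ?c S \<odot> (a \<otimes> b)) = (\<Sum>S\<in>X. ?c S) \<odot> (a \<otimes> b)" for X
  proof (induction X rule: infinite_finite_induct)
    case (insert S X)
    then show ?case
      using smult_l_distr[of "?c S" "sum ?c X" "a \<otimes> b"] ab by (simp add: Pi_def)
  qed (use ab lmult_0 in auto)
  then show "(pure_tensor A g a \<otimes>\<^bsub>grassmann_envelope m A\<^esub> pure_tensor A h b) U =
      pure_tensor A (g \<otimes>\<^bsub>grassmann_algebra m\<^esub> h) (a \<otimes> b) U"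
    by (simp add: grassmann_envelope_def grassmann_algebra_def pure_tensor_def *)
qed

lemma envelope_sum_pure_tensors:
  assumes "x \<in> carrier (grassmann_envelope m A)"
  shows "x = (\<Oplus>\<^bsub>grassmann_envelope m A\<^esub>S\<in>{S. x S \<noteq> \<zero>}.
                pure_tensor A (\<lambda>T. if T = S then 1 else 0) (x S))"
proof -
  let ?E = "grassmann_envelope m A"
  let ?t = "\<lambda>S. pure_tensor A (\<lambda>T. if T = S then 1 else 0) (x S)"
  let ?X = "{S. x S \<noteq> \<zero>}"
  have grade_carrier: "grade A i \<subseteq> carrier A" for i
    using grade_subspace[of i] submodule.subset[OF subspace.submod] by blast
  have E_carrier: "y S \<in> carrier A" if "y \<in> carrier ?E" for y S
    using that grade_carrier by (cases "y S = \<zero>") (auto simp: grassmann_envelope_def)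
  have add_E: "y \<oplus>\<^bsub>?E\<^esub> z \<in> carrier ?E" if "y \<in> carrier ?E" "z \<in> carrier ?E" for y z
  proof -
    have "{S. y S \<oplus> z S \<noteq> \<zero>} \<subseteq> {S. y S \<noteq> \<zero>} \<union> {S. z S \<noteq> \<zero>}" by auto
    moreover from this have "finite {S. y S \<oplus> z S \<noteq> \<zero>}"
      using that by (auto simp: grassmann_envelope_def intro: finite_subset)
    ultimately show ?thesis
      using that submodule.m_closed[OF subspace.submod[OF grade_subspace]]
      by (auto simp: grassmann_envelope_def)
  qed
  have "\<zero>\<^bsub>?E\<^esub> \<in> carrier ?E"
    using submodule.zero_closed[OF subspace.submod[OF grade_subspace]]
    by (auto simp: grassmann_envelope_def)
  moreover have "y \<oplus>\<^bsub>?E\<^esub> z = (\<lambda>S. y S \<oplus> z S)" and zero_E: "\<zero>\<^bsub>?E\<^esub> = (\<lambda>S. \<zero>)" for y z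
    by (simp_all add: grassmann_envelope_def)
  ultimately interpret E: abelian_monoid ?E
    using add_E E_carrier by (intro abelian_monoidI) (auto simp: a_ac)
  have t: "?t S \<in> carrier ?E" if "S \<in> ?X" for S
  proof (rule pure_tensor_in_envelope)
    from that assms have S: "S \<in> grassmann_index m" by (auto simp: grassmann_envelope_def)
    then show "x S \<in> grade A (of_nat (card S))"
      using assms by (auto simp: grassmann_envelope_def)
    from S show "(\<lambda>T. if T = S then 1 else 0) \<in> grade (grassmann_algebra m) (of_nat (card S))"
      by (auto simp: grassmann_algebra_def)
  qed
  have "finsum ?E ?t Y T = (if T \<in> Y then x T else \<zero>)" if "finite Y" "Y \<subseteq> ?X" for Y T
    using that
  proof (induction Y)
    case empty
    then show ?case using E.finsum_empty by (simp add: zero_E)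
  next
    case (insert S Y)
    from insert.prems t have "?t \<in> Y \<rightarrow> carrier ?E" "?t S \<in> carrier ?E" by auto
    then have "finsum ?E ?t (insert S Y) = ?t S \<oplus>\<^bsub>?E\<^esub> finsum ?E ?t Y"
      using insert.hyps by (intro E.finsum_insert) auto
    then have "finsum ?E ?t (insert S Y) T = ?t S T \<oplus> finsum ?E ?t Y T"
      by (simp add: grassmann_envelope_def)
    moreover have "?t S T = (if T = S then x S else \<zero>)"
      using smult_one E_carrier[OF assms] lmult_0 by (simp add: pure_tensor_def)
    ultimately show ?case
      using insert E_carrier[OF assms] by auto
  qed
  moreover have "finite ?X" using assms by (simp add: grassmann_envelope_def)
  ultimately show ?thesis by (intro ext) auto
qed

end


section \<open>Polynomial identities\<close>

text \<open>
  A polynomial in the noncommuting variables \<open>x\<^sub>0, x\<^sub>1, \<dots>\<close> is represented by the finitely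
  supported family of coefficients of its monomials, a monomial being the list of the indices of
  its factors. As algebras need not be unital, identities are elements of the free algebra without
  unit, that is, have no constant term. (An identity of a unital algebra never has one.) The value
  of the empty word is immaterial.
\<close>

fun word_value :: "('f, 'v, 'z) module_scheme \<Rightarrow> (nat \<Rightarrow> 'v) \<Rightarrow> nat list \<Rightarrow> 'v" where
  "word_value A \<rho> [] = \<zero>\<^bsub>A\<^esub>"
| "word_value A \<rho> [i] = \<rho> i"
| "word_value A \<rho> (i # j # w) = \<rho> i \<otimes>\<^bsub>A\<^esub> word_value A \<rho> (j # w)"

definition poly_value ::
  "('f :: field, 'v, 'z) module_scheme \<Rightarrow> (nat \<Rightarrow> 'v) \<Rightarrow> (nat list \<Rightarrow>\<^sub>0 'f) \<Rightarrow> 'v" where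
  "poly_value A \<rho> f = (\<Oplus>\<^bsub>A\<^esub>w\<in>Poly_Mapping.keys f. Poly_Mapping.lookup f w \<odot>\<^bsub>A\<^esub> word_value A \<rho> w)"

definition identities :: "('f :: field, 'v, 'z) module_scheme \<Rightarrow> (nat list \<Rightarrow>\<^sub>0 'f) set" where
  "identities A = {f. Poly_Mapping.lookup f [] = 0 \<and>
              (\<forall>\<rho>. range \<rho> \<subseteq> carrier A \<longrightarrow> poly_value A \<rho> f = \<zero>\<^bsub>A\<^esub>)}"


fun enat_half :: "enat \<Rightarrow> enat" where
  "enat_half (enat k) = enat (k div 2)"
| "enat_half \<infinity> = \<infinity>"

end

theory Submission
  imports
    Defs
    "HOL-Combinatorics.Permutations"
    "Jordan_Normal_Form.Char_Poly"
    "HOL-Library.Nat_Bijection"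
    "HOL-Library.Multiset"
begin

text \<open>
  A graded-simple algebra is isomorphic to some \<open>M\<^bsub>k,l\<^esub>\<close> or \<open>M\<^sub>k(F
  Z\<^sub>2)\<close>: a minimal graded left ideal is generated by an idempotent \<open>e\<close> of degree
  \<open>0\<close>, and \<open>e A e\<close> is \<open>F\<close> or \<open>F Z\<^sub>2\<close>, respectively. In
  both cases the envelope becomes an algebra of matrices over the Grassmann algebra whose even monomials sit in
  the positions of the diagonal blocks and whose odd monomials sit in another set of positions, namely off the
  blocks, or everywhere in the case of \<open>M\<^sub>k(F Z\<^sub>2)\<close>.

  Let \<open>D\<^sub>d = \<Sum>\<^sub>\<sigma> sgn \<sigma> x\<^bsup>\<sigma>(0)\<^esup> z\<^sub>0 \<cdots>
  x\<^bsup>\<sigma>(d-1)\<^esup> z\<^bsub>d-1\<^esub>\<close>. Modulo the nilpotent ideal generated by the odd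
  entries, each block of \<open>x\<close> is annihilated by its characteristic polynomial, hence a power of
  \<open>D\<^bsub>k+1\<^esub>\<close> is an identity, while no power of \<open>D\<^bsub>k+1\<^esub>\<close> is
  one if the larger block has more than \<open>k\<close> rows. Alternating \<open>k + l + 1\<close> powers of
  \<open>x\<close> sufficiently often determines \<open>k + l\<close> likewise. In a product of values of
  \<open>D\<^bsub>k+1\<^esub>\<close> in disjoint sets of variables every factor has degree at least
  \<open>1\<close> in the generators if \<open>l > 0\<close>, and at least \<open>2\<close> if \<open>l =
  0\<close>, since terms of degree less than \<open>2\<close> can be detected in an algebra of matrices over a
  commutative ring. The longest nonzero products therefore have \<open>m\<close> factors and
  \<open>\<lfloor>m/2\<rfloor>\<close> factors, respectively.

  Conversely, for \<open>M\<^sub>n(F Z\<^sub>2)\<close> an additional generator, leading from an even number to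
  an odd one, does not create new non-identities: it could only matter for multilinear substitutions of an odd
  number of odd monomials, and these are sums of substitutions in which one odd monomial is pulled out to the
  front and replaced by \<open>1\<close>.
\<close>

section \<open>Grassmann elements and matrices of arbitrary size\<close>

text \<open>All algebras are compared inside one ring with 1, the row-finite matrices over the
  Grassmann elements in all generators, so one notion of alternating form and of evaluation serves
  every size and every number of generators.

  The obstacle is that odd entries do not commute, which rules out determinants. Only the even part
  of a value has characteristic polynomials. A matrix unit \<open>w\<close> with an odd coefficient
  satisfies \<open>w * y * w = 0\<close> for every \<open>y\<close>, so finitely many of them
  generate a nilpotent ideal. Its index is bounded by the number of values and positions alone,
  hence one polynomial works for all m, including infinity.

  The larger block can be detected by powers, because a closed path inside it yields a multiple of
  an idempotent. The size k + l cannot: a path through both blocks crosses between them and picks up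
  an odd generator, whose square is zero. The form is alternated r times instead: every alternation
  gains one factor of the characteristic polynomial, while on the path it only contributes one more
  Vandermonde determinant, and the generator still occurs once.\<close>

definition shuffle_count :: "nat set \<Rightarrow> nat set \<Rightarrow> nat" where
  "shuffle_count S T = card {(s, t). s \<in> S \<and> t \<in> T \<and> t < s}"

lemma shuffle_sign_count: "shuffle_sign S T = (- 1 :: 'f :: field) ^ shuffle_count S T"
  by (simp add: shuffle_sign_def shuffle_count_def)

lemma finite_shuffle:
  "finite S \<Longrightarrow> finite T \<Longrightarrow> finite {(s, t). s \<in> S \<and> t \<in> T \<and> t < (s :: nat)}"
  by (rule finite_subset[of _ "S \<times> T"]) auto

lemma shuffle_count_Un_left:
  assumes "finite S" "finite T" "finite W" "S \<inter> T = {}"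
  shows "shuffle_count (S \<union> T) W = shuffle_count S W + shuffle_count T W"
proof -
  have "{(s, t). s \<in> S \<union> T \<and> t \<in> W \<and> t < s} =
    {(s, t). s \<in> S \<and> t \<in> W \<and> t < s} \<union> {(s, t). s \<in> T \<and> t \<in> W \<and> t < s}" by auto
  then show ?thesis unfolding shuffle_count_def
    using assms finite_shuffle by (simp, subst card_Un_disjoint) auto
qed

lemma shuffle_count_Un_right:
  assumes "finite S" "finite T" "finite W" "S \<inter> T = {}"
  shows "shuffle_count W (S \<union> T) = shuffle_count W S + shuffle_count W T"
proof -
  have "{(s, t). s \<in> W \<and> t \<in> S \<union> T \<and> t < s} =
    {(s, t). s \<in> W \<and> t \<in> S \<and> t < s} \<union> {(s, t). s \<in> W \<and> t \<in> T \<and> t < s}" by auto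
  then show ?thesis unfolding shuffle_count_def
    using assms finite_shuffle by (simp, subst card_Un_disjoint) auto
qed

lemma shuffle_count_commute:
  assumes "finite S" "finite T" "S \<inter> T = {}"
  shows "shuffle_count S T + shuffle_count T S = card S * card T"
proof -
  let ?A = "{(s, t). s \<in> S \<and> t \<in> T \<and> t < s}" and ?B = "{(s, t). s \<in> S \<and> t \<in> T \<and> s < t}"
  have "{(s, t). s \<in> T \<and> t \<in> S \<and> t < s} = prod.swap ` ?B"
    by auto
  then have B: "shuffle_count T S = card ?B"
    unfolding shuffle_count_def by (simp add: card_image)
  have "S \<times> T = ?A \<union> ?B"
    using assms(3) by (auto simp: disjoint_iff) (metis linorder_neqE_nat)
  moreover have "finite ?B"
    by (rule finite_subset[of _ "S \<times> T"]) (use assms(1,2) in auto)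
  then have "card (?A \<union> ?B) = card ?A + card ?B"
    by (intro card_Un_disjoint finite_shuffle[OF assms(1,2)]) auto
  ultimately show ?thesis
    unfolding B by (simp only: card_cartesian_product[symmetric] shuffle_count_def[of S T])
qed

lemma shuffle_sign_empty [simp]: "shuffle_sign {} T = 1" "shuffle_sign S {} = 1"
  by (simp_all add: shuffle_sign_def)

text \<open>Both sides are the sign of the inversions among the three disjoint pieces
  \<open>S\<close>, \<open>V - S\<close> and \<open>U - V\<close>. This cocycle identity is what
  makes the Grassmann product associative.\<close>

lemma shuffle_sign_assoc:
  assumes "finite U" "S \<subseteq> V" "V \<subseteq> U"
  shows "shuffle_sign V (U - V) * shuffle_sign S (V - S) =
    (shuffle_sign S (U - S) * shuffle_sign (V - S) (U - V) :: 'f :: field)"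
proof -
  have fin: "finite V" "finite S" using assms by (meson finite_subset)+
  have "shuffle_count (S \<union> (V - S)) (U - V) = shuffle_count S (U - V) + shuffle_count (V - S) (U - V)"
    using fin assms by (intro shuffle_count_Un_left) auto
  moreover have "shuffle_count S ((V - S) \<union> (U - V)) = shuffle_count S (V - S) + shuffle_count S (U - V)"
    using fin assms by (intro shuffle_count_Un_right) auto
  moreover have "S \<union> (V - S) = V" "(V - S) \<union> (U - V) = U - S" using assms by auto
  ultimately show ?thesis
    by (simp add: shuffle_sign_count power_add)
qed

lemma shuffle_sign_commute:
  assumes "finite S" "finite T" "S \<inter> T = {}"
  shows "shuffle_sign T S = (- 1) ^ (card S * card T) * (shuffle_sign S T :: 'f :: field)"
proof -
  have "(- 1 :: 'f) ^ (shuffle_count S T + shuffle_count T S) * (-1) ^ shuffle_count S T =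
     (-1) ^ (2 * shuffle_count S T) * (-1) ^ shuffle_count T S"
    by (simp only: power_add [symmetric]) (rule arg_cong[where f = "(^) (- 1)"], simp)
  then show ?thesis
    by (simp add: shuffle_sign_count shuffle_count_commute[OF assms])
qed

text \<open>Infinite sums of monomials are allowed; this does no harm, as each coefficient of a product is a
  finite sum, and it makes the Grassmann elements in all generators a type.\<close>

typedef (overloaded) 'f gr = "{g :: nat set \<Rightarrow> 'f :: field. \<forall>S. infinite S \<longrightarrow> g S = 0}"
  morphisms coef Abs_gr
  by (rule exI[of _ "\<lambda>_. 0"]) auto

setup_lifting type_definition_gr

lemma coef_infinite: "infinite S \<Longrightarrow> coef g S = 0"
  using coef[of g] by blast

lemma gr_eqI: assumes "\<And>S. finite S \<Longrightarrow> coef g S = coef h S" shows "g = h"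
proof -
  have "coef g S = coef h S" for S using assms by (cases "finite S") (simp_all add: coef_infinite)
  then show ?thesis by (metis coef_inject ext)
qed

instantiation gr :: (field) ring_1
begin

lift_definition zero_gr :: "'a gr" is "\<lambda>_. 0" by simp
lift_definition one_gr :: "'a gr" is "\<lambda>S. if S = {} then 1 else 0" by auto
lift_definition plus_gr :: "'a gr \<Rightarrow> 'a gr \<Rightarrow> 'a gr" is "\<lambda>g h S. g S + h S" by simp
lift_definition minus_gr :: "'a gr \<Rightarrow> 'a gr \<Rightarrow> 'a gr" is "\<lambda>g h S. g S - h S" by simp
lift_definition uminus_gr :: "'a gr \<Rightarrow> 'a gr" is "\<lambda>g S. - g S" by simp
lift_definition times_gr :: "'a gr \<Rightarrow> 'a gr \<Rightarrow> 'a gr" is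
  "\<lambda>g h U. \<Sum>S\<in>Pow U. shuffle_sign S (U - S) * g S * h (U - S)" by simp

instance
proof
  fix a b c :: "'a gr"
  show "a * b * c = a * (b * c)"
  proof (rule gr_eqI)
    fix U :: "nat set" assume U: "finite U"
    have fin: "finite (Pow U)" "\<And>V. V \<in> Pow U \<Longrightarrow> finite V" using U finite_subset by auto
    have "coef (a * b * c) U = (\<Sum>V\<in>Pow U. \<Sum>S\<in>Pow V.
        shuffle_sign V (U - V) * shuffle_sign S (V - S) * coef a S * coef b (V - S) * coef c (U - V))"
      by (simp add: times_gr.rep_eq sum_distrib_left sum_distrib_right mult_ac)
    also have "\<dots> = (\<Sum>(V, S)\<in>(SIGMA V:Pow U. Pow V).
        shuffle_sign V (U - V) * shuffle_sign S (V - S) * coef a S * coef b (V - S) * coef c (U - V))"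
      using fin by (subst sum.Sigma) auto
    also have "\<dots> = (\<Sum>(V, S)\<in>(SIGMA V:Pow U. Pow V).
        shuffle_sign S (U - S) * shuffle_sign (V - S) (U - V) * coef a S * coef b (V - S) * coef c (U - V))"
      by (rule sum.cong) (auto simp: shuffle_sign_assoc[OF U])
    also have "\<dots> = (\<Sum>(S, T)\<in>(SIGMA S:Pow U. Pow (U - S)).
        shuffle_sign S (U - S) * shuffle_sign T ((U - S) - T) * coef a S * coef b T * coef c ((U - S) - T))"
    proof (rule sum.reindex_bij_witness[where i = "\<lambda>(S, T). (S \<union> T, S)" and j = "\<lambda>(V, S). (S, V - S)"], goal_cases)
      case (5 x)
      obtain V S where x: "x = (V, S)" by (cases x)
      with 5 have "U - S - (V - S) = U - V" by auto
      then show ?case by (simp add: x)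
    qed auto
    also have "\<dots> = (\<Sum>S\<in>Pow U. \<Sum>T\<in>Pow (U - S).
        shuffle_sign S (U - S) * shuffle_sign T ((U - S) - T) * coef a S * coef b T * coef c ((U - S) - T))"
      using fin U by (subst sum.Sigma) auto
    also have "\<dots> = coef (a * (b * c)) U"
      by (simp add: times_gr.rep_eq sum_distrib_left sum_distrib_right mult_ac)
    finally show "coef (a * b * c) U = coef (a * (b * c)) U" .
  qed
  show "1 * a = a"
  proof (rule gr_eqI)
    fix U :: "nat set" assume U: "finite U"
    have "coef (1 * a) U = (\<Sum>S\<in>Pow U. if S = {} then coef a U else 0)"
      unfolding times_gr.rep_eq one_gr.rep_eq by (rule sum.cong) auto
    then show "coef (1 * a) U = coef a U" using U by simp
  qed
  show "a * 1 = a"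
  proof (rule gr_eqI)
    fix U :: "nat set" assume U: "finite U"
    have "coef (a * 1) U = (\<Sum>S\<in>Pow U. if S = U then coef a U else 0)"
      unfolding times_gr.rep_eq one_gr.rep_eq by (rule sum.cong) auto
    then show "coef (a * 1) U = coef a U" using U by simp
  qed
  show "(a + b) * c = a * c + b * c" "a * (b + c) = a * b + a * c"
    by (transfer, simp add: algebra_simps sum.distrib)+
  show "(0 :: 'a gr) \<noteq> 1" by transfer (auto dest: fun_cong[of _ _ "{}"])
  show "a + b + c = a + (b + c)" "a + b = b + a" "0 + a = a" "- a + a = 0" "a - b = a + - b"
    by (transfer, auto)+
qed

end

lemma coef_simps [simp]:
  "coef 0 S = 0" "coef (g + h) S = coef g S + coef h S" "coef (- g) S = - coef g S"
  "coef (g - h) S = coef g S - coef h S"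
  by (transfer, simp)+

lemma coef_one: "coef 1 S = (if S = {} then 1 else 0)" by transfer simp

lemma coef_sum [simp]: "coef (sum f A) S = (\<Sum>a\<in>A. coef (f a) S)"
  by (induction A rule: infinite_finite_induct) auto

lift_definition gscale :: "'f :: field \<Rightarrow> 'f gr \<Rightarrow> 'f gr" is "\<lambda>c g S. c * g S" by simp

lift_definition ge :: "nat set \<Rightarrow> 'f :: field gr" is "\<lambda>S T. if T = S \<and> finite S then 1 else 0" by auto

abbreviation "gconst c \<equiv> gscale c 1"

lemma coef_gscale [simp]: "coef (gscale c g) S = c * coef g S" by transfer simp

lemma coef_ge: "finite S \<Longrightarrow> coef (ge S) T = (if T = S then 1 else 0)" by transfer simp

lemma gscale_mult: "gscale c g * h = gscale c (g * h)" "g * gscale c h = gscale c (g * h)"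
  by (transfer, simp add: sum_distrib_left mult_ac)+

lemma gscale_simps [simp]: "gscale 1 g = g" "gscale 0 g = 0" "gscale c 0 = 0"
  "gscale c (gscale d g) = gscale (c * d) g" "gscale (- 1) g = - g"
  by (transfer, simp add: mult_ac)+

lemma gscale_add: "gscale c (g + h) = gscale c g + gscale c h" "gscale (c + d) g = gscale c g + gscale d g"
  by (transfer, simp add: algebra_simps)+

lemma ge_empty: "ge {} = 1" by transfer (auto simp: fun_eq_iff)

lemma ge_mult:
  assumes "finite S" "finite T"
  shows "ge S * ge T = (if S \<inter> T = {} then gscale (shuffle_sign S T) (ge (S \<union> T)) else (0 :: 'f :: field gr))"
proof (rule gr_eqI)
  fix U :: "nat set" assume U: "finite U"
  have "coef (ge S * ge T :: 'f gr) U =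
     (\<Sum>V\<in>Pow U. if V = S then (if U - S = T then shuffle_sign S T else 0) else 0)"
    unfolding times_gr.rep_eq by (rule sum.cong) (auto simp: coef_ge assms)
  also have "\<dots> = (if S \<subseteq> U \<and> U - S = T then shuffle_sign S T else 0)"
    using U by (simp add: sum.delta)
  also have "(S \<subseteq> U \<and> U - S = T) \<longleftrightarrow> (S \<inter> T = {} \<and> U = S \<union> T)" by auto
  finally show "coef (ge S * ge T :: 'f gr) U =
     coef (if S \<inter> T = {} then gscale (shuffle_sign S T) (ge (S \<union> T)) else (0 :: 'f gr)) U"
    using assms by (simp add: coef_ge)
qed

section \<open>Parity, commutation and anticommutation of Grassmann elements\<close>

definition geven :: "'f :: field gr \<Rightarrow> bool" where "geven g \<longleftrightarrow> (\<forall>S. odd (card S) \<longrightarrow> coef g S = 0)"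
definition godd :: "'f :: field gr \<Rightarrow> bool" where "godd g \<longleftrightarrow> (\<forall>S. even (card S) \<longrightarrow> coef g S = 0)"

lemma geven_simps [simp]:
  "geven 0" "geven 1" "geven g \<Longrightarrow> geven h \<Longrightarrow> geven (g + h)" "geven g \<Longrightarrow> geven h \<Longrightarrow> geven (g - h)"
  "geven g \<Longrightarrow> geven (- g)" "geven g \<Longrightarrow> geven (gscale c g)"
  by (auto simp: geven_def coef_one)

lemma geven_mult [simp]: assumes "geven g" "geven h" shows "geven (g * h)"
  unfolding geven_def
proof (intro allI impI)
  fix U :: "nat set" assume U: "odd (card U)"
  then have fin: "finite U" using card.infinite by fastforce
  show "coef (g * h) U = 0" unfolding times_gr.rep_eq
  proof (rule sum.neutral, safe)
    fix S assume S: "S \<subseteq> U"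
    then have "card S + card (U - S) = card U" using fin by (metis card_Diff_subset card_mono finite_subset le_add_diff_inverse)
    then have "odd (card S) \<or> odd (card (U - S))" using U by presburger
    then show "shuffle_sign S (U - S) * coef g S * coef h (U - S) = 0" using assms by (auto simp: geven_def)
  qed
qed

lift_definition gev :: "'f :: field gr \<Rightarrow> 'f gr" is "\<lambda>g S. if even (card S) then g S else 0" by simp
lift_definition god :: "'f :: field gr \<Rightarrow> 'f gr" is "\<lambda>g S. if odd (card S) then g S else 0" by simp

lemma gev_god: "gev g + god g = g" by transfer auto
lemma geven_gev [simp]: "geven (gev g)" by (auto simp: geven_def gev.rep_eq)
lemma godd_god [simp]: "godd (god g)" by (auto simp: godd_def god.rep_eq)

text \<open>Substituting \<open>U - S\<close> for \<open>S\<close> turns both orders of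
  multiplication into sums over the same subsets, so that commutation rules follow by comparing
  signs term by term.\<close>

lemma coef_mult_swap:
  assumes "finite U"
  shows "coef (h * g) U = (\<Sum>S\<in>Pow U. (- 1) ^ (card S * card (U - S)) * shuffle_sign S (U - S) * coef g S * coef h (U - S))"
proof -
  have "coef (h * g) U = (\<Sum>S\<in>Pow U. shuffle_sign (U - S) S * coef h (U - S) * coef g S)"
    unfolding times_gr.rep_eq
    by (rule sum.reindex_bij_witness[where i = "\<lambda>S. U - S" and j = "\<lambda>S. U - S"])
       (auto simp: double_diff)
  also have "\<dots> = (\<Sum>S\<in>Pow U. (- 1) ^ (card S * card (U - S)) * shuffle_sign S (U - S) * coef g S * coef h (U - S))"
  proof (rule sum.cong)
    fix S assume "S \<in> Pow U"
    then have "shuffle_sign (U - S) S = (- 1) ^ (card S * card (U - S)) * (shuffle_sign S (U - S) :: 'a)"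
      using assms by (intro shuffle_sign_commute) (auto intro: finite_subset)
    then show "shuffle_sign (U - S) S * coef h (U - S) * coef g S =
      (- 1) ^ (card S * card (U - S)) * shuffle_sign S (U - S) * coef g S * coef h (U - S)" by simp
  qed simp
  finally show ?thesis .
qed

lemma geven_commute: assumes "geven g" shows "g * h = h * g"
proof (rule gr_eqI)
  fix U :: "nat set" assume U: "finite U"
  show "coef (g * h) U = coef (h * g) U"
    unfolding coef_mult_swap[OF U, of h g] unfolding times_gr.rep_eq
  proof (rule sum.cong)
    fix S
    show "shuffle_sign S (U - S) * coef g S * coef h (U - S) =
      (- 1) ^ (card S * card (U - S)) * shuffle_sign S (U - S) * coef g S * coef h (U - S)"
      using assms by (cases "even (card S)") (auto simp: geven_def)
  qed simp
qed

lemma godd_anticommute: assumes "godd g" "godd h" shows "g * h = - (h * g)"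
proof (rule gr_eqI)
  fix U :: "nat set" assume U: "finite U"
  show "coef (g * h) U = coef (- (h * g)) U"
    unfolding coef_simps coef_mult_swap[OF U, of h g] unfolding times_gr.rep_eq sum_negf[symmetric]
  proof (rule sum.cong)
    fix S
    show "shuffle_sign S (U - S) * coef g S * coef h (U - S) =
      - ((- 1) ^ (card S * card (U - S)) * shuffle_sign S (U - S) * coef g S * coef h (U - S))"
      using assms by (cases "odd (card S) \<and> odd (card (U - S))") (auto simp: godd_def)
  qed simp
qed

lemma gr_double_zero: assumes "(g :: 'f :: field_char_0 gr) + g = 0" shows "g = 0"
proof (rule gr_eqI)
  fix S from assms have "coef g S + coef g S = 0" by (metis coef_simps(1,2))
  then show "coef g S = coef 0 S" by simp
qed

text \<open>The even part of \<open>g\<close> commutes with \<open>xi\<close> and the odd part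
  anticommutes, so in either case the two factors \<open>xi\<close> meet, and their product is zero
  in characteristic 0. This is what makes ideals generated by finitely many odd entries
  nilpotent.\<close>

lemma godd_sandwich: fixes xi :: "'f :: field_char_0 gr" assumes "godd xi" shows "xi * g * xi = 0"
proof -
  have sq: "xi * xi = 0"
    by (rule gr_double_zero) (use godd_anticommute[OF assms assms] eq_neg_iff_add_eq_0 in blast)
  have "xi * gev g * xi = xi * xi * gev g"
    using geven_commute[OF geven_gev, of g xi] by (simp add: mult.assoc)
  moreover have "xi * god g * xi = - (xi * xi * god g)"
    using godd_anticommute[OF godd_god[of g] assms] by (simp add: mult.assoc)
  moreover have "xi * g * xi = xi * gev g * xi + xi * god g * xi"
    by (simp add: gev_god flip: distrib_left distrib_right)
  ultimately show ?thesis by (simp add: sq)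
qed

lemma geven_ge: "even (card S) \<Longrightarrow> geven (ge S)" by (simp add: geven_def ge.rep_eq)
lemma godd_ge: "odd (card S) \<Longrightarrow> godd (ge S)" by (auto simp: godd_def ge.rep_eq)

text \<open>A type of its own, because determinants, adjugates and characteristic polynomials are
  available over types of class \<open>comm_ring_1\<close>.\<close>

typedef (overloaded) 'f evgr = "{g :: 'f :: field gr. geven g}" morphisms ev_gr Abs_evgr
  by (rule exI[of _ 0]) simp

setup_lifting type_definition_evgr

instantiation evgr :: (field) comm_ring_1
begin
lift_definition zero_evgr :: "'a evgr" is 0 by simp
lift_definition one_evgr :: "'a evgr" is 1 by simp
lift_definition plus_evgr :: "'a evgr \<Rightarrow> 'a evgr \<Rightarrow> 'a evgr" is "(+)" by simp
lift_definition minus_evgr :: "'a evgr \<Rightarrow> 'a evgr \<Rightarrow> 'a evgr" is "(-)" by simp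
lift_definition uminus_evgr :: "'a evgr \<Rightarrow> 'a evgr" is "uminus" by simp
lift_definition times_evgr :: "'a evgr \<Rightarrow> 'a evgr \<Rightarrow> 'a evgr" is "(*)" by simp
instance
  by standard (transfer, auto simp: algebra_simps geven_commute)+
end

text \<open>Row-finite infinite matrices form a ring with \<open>1\<close> that contains the matrices of every size.\<close>

typedef (overloaded) 'g rfm = "{M :: nat \<Rightarrow> nat \<Rightarrow> 'g :: zero. \<forall>i. finite {j. M i j \<noteq> 0}}"
  morphisms ent Abs_rfm
  by (rule exI[of _ "\<lambda>_ _. 0"]) simp

setup_lifting type_definition_rfm

lemma rfm_eqI: "(\<And>i j. ent M i j = ent N i j) \<Longrightarrow> M = N"
  by (metis ent_inject ext)

lemma finite_row: "finite {j. ent M i j \<noteq> 0}"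
  using ent[of M] by blast

instantiation rfm :: (ring_1) ring_1
begin

lift_definition zero_rfm :: "'a rfm" is "\<lambda>_ _. 0" by simp
lift_definition one_rfm :: "'a rfm" is "\<lambda>i j. if i = j then 1 else 0" by simp
lift_definition plus_rfm :: "'a rfm \<Rightarrow> 'a rfm \<Rightarrow> 'a rfm" is "\<lambda>M N i j. M i j + N i j"
proof -
  fix f g :: "nat \<Rightarrow> nat \<Rightarrow> 'a" and i assume "\<And>i. finite {j. f i j \<noteq> 0}" "\<And>i. finite {j. g i j \<noteq> 0}"
  then show "finite {j. f i j + g i j \<noteq> 0}"
    by (intro finite_subset[of "{j. f i j + g i j \<noteq> 0}" "{j. f i j \<noteq> 0} \<union> {j. g i j \<noteq> 0}"]) auto
qed
lift_definition minus_rfm :: "'a rfm \<Rightarrow> 'a rfm \<Rightarrow> 'a rfm" is "\<lambda>M N i j. M i j - N i j"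
proof -
  fix f g :: "nat \<Rightarrow> nat \<Rightarrow> 'a" and i assume "\<And>i. finite {j. f i j \<noteq> 0}" "\<And>i. finite {j. g i j \<noteq> 0}"
  then show "finite {j. f i j - g i j \<noteq> 0}"
    by (intro finite_subset[of "{j. f i j - g i j \<noteq> 0}" "{j. f i j \<noteq> 0} \<union> {j. g i j \<noteq> 0}"]) auto
qed
lift_definition uminus_rfm :: "'a rfm \<Rightarrow> 'a rfm" is "\<lambda>M i j. - M i j" by simp
lift_definition times_rfm :: "'a rfm \<Rightarrow> 'a rfm \<Rightarrow> 'a rfm" is
  "\<lambda>M N i j. \<Sum>k | M i k \<noteq> 0. M i k * N k j"
proof -
  fix f g :: "nat \<Rightarrow> nat \<Rightarrow> 'a" and i assume *: "\<And>i. finite {j. f i j \<noteq> 0}" "\<And>i. finite {j. g i j \<noteq> 0}"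
  have "{j. (\<Sum>k | f i k \<noteq> 0. f i k * g k j) \<noteq> 0} \<subseteq> (\<Union>k\<in>{k. f i k \<noteq> 0}. {j. g k j \<noteq> 0})"
  proof
    fix j assume "j \<in> {j. (\<Sum>k | f i k \<noteq> 0. f i k * g k j) \<noteq> 0}"
    then have "\<exists>k\<in>{k. f i k \<noteq> 0}. f i k * g k j \<noteq> 0" by (metis (mono_tags) mem_Collect_eq sum.neutral)
    then show "j \<in> (\<Union>k\<in>{k. f i k \<noteq> 0}. {j. g k j \<noteq> 0})" by auto
  qed
  then show "finite {j. (\<Sum>k | f i k \<noteq> 0. f i k * g k j) \<noteq> 0}"
    by (rule finite_subset) (use * in auto)
qed

lemma ent_mult:
  assumes "finite K" "\<And>k. ent M i k \<noteq> 0 \<Longrightarrow> k \<in> K"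
  shows "ent (M * N) i j = (\<Sum>k\<in>K. ent M i k * ent (N :: 'a rfm) k j)"
  unfolding times_rfm.rep_eq by (rule sum.mono_neutral_left) (use assms in auto)

instance
proof
  fix a b c :: "'a rfm"
  show "a * b * c = a * (b * c)"
  proof (rule rfm_eqI)
    fix i j
    let ?K = "{k. ent a i k \<noteq> 0}"
    let ?L = "(\<Union>k\<in>?K. {l. ent b k l \<noteq> 0})"
    have fin: "finite ?K" "finite ?L" using finite_row by auto
    have L: "l \<in> ?L" if "ent (a * b) i l \<noteq> 0" for l
    proof (rule ccontr)
      assume "l \<notin> ?L"
      then have "(\<Sum>k\<in>?K. ent a i k * ent b k l) = 0" by (intro sum.neutral) auto
      moreover have "ent (a * b) i l = (\<Sum>k\<in>?K. ent a i k * ent b k l)"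
        by (rule ent_mult[OF fin(1)]) simp
      ultimately have "ent (a * b) i l = 0" by simp
      with that show False by simp
    qed
    have "ent (a * b * c) i j = (\<Sum>l\<in>?L. (\<Sum>k\<in>?K. ent a i k * ent b k l) * ent c l j)"
      by (subst ent_mult[OF fin(2) L], assumption) (intro sum.cong refl, subst ent_mult[OF fin(1)], auto)
    also have "\<dots> = (\<Sum>k\<in>?K. ent a i k * (\<Sum>l\<in>?L. ent b k l * ent c l j))"
      by (simp only: sum_distrib_left sum_distrib_right mult.assoc) (rule sum.swap)
    also have "\<dots> = (\<Sum>k\<in>?K. ent a i k * ent (b * c) k j)"
      by (rule sum.cong[OF refl], subst ent_mult[OF fin(2)]) auto
    also have "\<dots> = ent (a * (b * c)) i j" using ent_mult[OF fin(1) CollectI, of a i] by simp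
    finally show "ent (a * b * c) i j = ent (a * (b * c)) i j" .
  qed
  show "1 * a = a"
  proof (rule rfm_eqI)
    fix i j show "ent (1 * a) i j = ent a i j"
      by (subst ent_mult[of "{i}"]) (auto simp: one_rfm.rep_eq split: if_splits)
  qed
  show "a * 1 = a"
  proof (rule rfm_eqI)
    fix i j
    have "ent (a * 1) i j = (\<Sum>k\<in>insert j {k. ent a i k \<noteq> 0}. ent a i k * ent 1 k j)"
      by (rule ent_mult) (auto simp: finite_row)
    also have "\<dots> = (\<Sum>k\<in>insert j {k. ent a i k \<noteq> 0}. if k = j then ent a i j else 0)"
      by (rule sum.cong) (auto simp: one_rfm.rep_eq)
    finally show "ent (a * 1) i j = ent a i j" by (simp add: finite_row)
  qed
  show "(a + b) * c = a * c + b * c"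
  proof (rule rfm_eqI)
    fix i j
    let ?K = "{k. ent a i k \<noteq> 0} \<union> {k. ent b i k \<noteq> 0}"
    have "finite ?K" using finite_row by auto
    then show "ent ((a + b) * c) i j = ent (a * c + b * c) i j"
      unfolding plus_rfm.rep_eq
      by (subst (1 2 3) ent_mult[of ?K]) (auto simp: plus_rfm.rep_eq algebra_simps sum.distrib)
  qed
  show "a * (b + c) = a * b + a * c"
    by (rule rfm_eqI) (simp add: plus_rfm.rep_eq times_rfm.rep_eq algebra_simps sum.distrib)
  show "(0 :: 'a rfm) \<noteq> 1"
    by (metis one_rfm.rep_eq zero_rfm.rep_eq zero_neq_one)
  show "a + b + c = a + (b + c)" "a + b = b + a" "0 + a = a" "- a + a = 0" "a - b = a + - b"
    by (rule rfm_eqI, simp add: plus_rfm.rep_eq minus_rfm.rep_eq zero_rfm.rep_eq uminus_rfm.rep_eq add_ac)+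
qed

end

lemma ent_simps [simp]:
  "ent 0 i j = 0" "ent (M + N) i j = ent M i j + ent N i j" "ent (- M) i j = - ent M i j"
  "ent (M - N) i j = ent M i j - ent N i j" for M N :: "'g :: ring_1 rfm"
  by (simp_all add: plus_rfm.rep_eq minus_rfm.rep_eq zero_rfm.rep_eq uminus_rfm.rep_eq)

lemma ent_one: "ent 1 i j = (if i = j then 1 else 0)" by (simp add: one_rfm.rep_eq)

lemma ent_sum [simp]: "ent (sum f A) i j = (\<Sum>a\<in>A. ent (f a :: 'g :: ring_1 rfm) i j)"
  by (induction A rule: infinite_finite_induct) auto

section \<open>Diagonal matrices, scalars and matrix units\<close>

lift_definition rdiag :: "(nat \<Rightarrow> 'g :: ring_1) \<Rightarrow> 'g rfm" is "\<lambda>d i j. if i = j then d i else 0"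
  by simp

lift_definition runit :: "'g :: ring_1 \<Rightarrow> nat \<Rightarrow> nat \<Rightarrow> 'g rfm" is "\<lambda>g a b i j. if i = a \<and> j = b then g else 0"
  by simp

abbreviation rscal :: "'g :: ring_1 \<Rightarrow> 'g rfm" where "rscal g \<equiv> rdiag (\<lambda>_. g)"

lemma ent_rdiag: "ent (rdiag d) i j = (if i = j then d i else 0)" by (simp add: rdiag.rep_eq)
lemma ent_runit: "ent (runit g a b) i j = (if i = a \<and> j = b then g else 0)" by (simp add: runit.rep_eq)

lemma ent_rdiag_mult [simp]: "ent (rdiag d * M) i j = d i * ent M i j"
  by (subst ent_mult[of "{i}"]) (auto simp: ent_rdiag split: if_splits)

lemma ent_mult_rdiag [simp]: "ent (M * rdiag d) i j = ent M i j * d j"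
proof -
  have "ent (M * rdiag d) i j = (\<Sum>k\<in>insert j {k. ent M i k \<noteq> 0}. ent M i k * ent (rdiag d) k j)"
    by (rule ent_mult) (auto simp: finite_row)
  also have "\<dots> = (\<Sum>k\<in>insert j {k. ent M i k \<noteq> 0}. if k = j then ent M i j * d j else 0)"
    by (rule sum.cong) (auto simp: ent_rdiag)
  finally show ?thesis by (simp add: finite_row)
qed

lemma rdiag_mult: "rdiag d * rdiag e = rdiag (\<lambda>i. d i * e i)"
  by (rule rfm_eqI) (simp add: ent_rdiag)

lemma rdiag_one: "rdiag (\<lambda>_. 1) = 1" by (rule rfm_eqI) (simp add: ent_rdiag ent_one)

lemma rdiag_power: "rdiag d ^ n = rdiag (\<lambda>i. d i ^ n)"
  by (induction n) (auto simp: rdiag_one rdiag_mult)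

lemma rscal_add: "rscal (a + b) = rscal a + rscal b" by (rule rfm_eqI) (simp add: ent_rdiag)
lemma rscal_zero: "rscal 0 = 0" by (rule rfm_eqI) (simp add: ent_rdiag)

lemma rscal_commute: "(\<And>h. g * h = h * g) \<Longrightarrow> rscal g * M = M * rscal g"
  by (rule rfm_eqI) simp

lemma rdiag_runit: "rdiag d * runit g a b = runit (d a * g) a b"
  by (rule rfm_eqI) (simp add: ent_runit)

lemma runit_mult: "runit g a b * runit h c d = (if b = c then runit (g * h) a d else 0)"
proof (rule rfm_eqI)
  fix i j show "ent (runit g a b * runit h c d) i j = ent (if b = c then runit (g * h) a d else 0) i j"
    by (subst ent_mult[of "{b}"]) (auto simp: ent_runit split: if_splits)
qed

lemma runit_zero [simp]: "runit 0 a b = 0" by (rule rfm_eqI) (simp add: ent_runit)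

lemma runit_eq_0 [simp]: "runit g a b = 0 \<longleftrightarrow> g = 0"
  by (metis runit_zero ent_runit ent_simps(1))

text \<open>Only a single entry of \<open>M\<close> survives between two matrix units. With
  \<open>godd_sandwich\<close> this gives \<open>w * y * w = 0\<close> for a matrix unit
  \<open>w\<close> with an odd coefficient.\<close>

lemma runit_sandwich: "runit g a b * M * runit h c d = runit (g * ent M b c * h) a d"
proof (rule rfm_eqI)
  fix i j
  have "ent (runit g a b * M) i k = (if i = a then g * ent M b k else 0)" for k
    by (subst ent_mult[of "{b}"]) (auto simp: ent_runit split: if_splits)
  moreover have "ent (runit g a b * M * runit h c d) i j =
      (\<Sum>k\<in>insert c {k. ent (runit g a b * M) i k \<noteq> 0}. ent (runit g a b * M) i k * ent (runit h c d) k j)"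
    by (rule ent_mult) (auto simp: finite_row)
  moreover have "\<dots> = (\<Sum>k\<in>insert c {k. ent (runit g a b * M) i k \<noteq> 0}.
      if k = c then ent (runit g a b * M) i c * ent (runit h c d) c j else 0)"
    by (rule sum.cong) (auto simp: ent_runit)
  moreover have "\<dots> = ent (runit g a b * M) i c * ent (runit h c d) c j"
    by (simp add: finite_row)
  ultimately show "ent (runit g a b * M * runit h c d) i j = ent (runit (g * ent M b c * h) a d) i j"
    by (simp only: ent_runit) auto
qed

lemma rfm_double_zero: assumes "(M :: 'f :: field_char_0 gr rfm) + M = 0" shows "M = 0"
proof (rule rfm_eqI)
  fix i j from assms have "ent M i j + ent M i j = 0" by (metis ent_simps(1,2))
  then show "ent M i j = ent 0 i j" using gr_double_zero by simp
qed

definition blocked :: "nat \<Rightarrow> 'g :: ring_1 rfm \<Rightarrow> bool" where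
  "blocked h M \<longleftrightarrow> (\<forall>i j. ent M i j \<noteq> 0 \<longrightarrow> i < h \<and> j < h)"

lemma blocked_sum_runit:
  assumes "blocked h M" shows "M = (\<Sum>i<h. \<Sum>j<h. runit (ent M i j) i j)"
proof (rule rfm_eqI)
  fix a b
  have "ent (\<Sum>i<h. \<Sum>j<h. runit (ent M i j) i j) a b = (\<Sum>i<h. \<Sum>j<h. if i = a then if j = b then ent M a b else 0 else 0)"
    unfolding ent_sum by (intro sum.cong refl) (simp add: ent_runit)
  also have "\<dots> = (\<Sum>i<h. if i = a then (\<Sum>j<h. if j = b then ent M a b else 0) else 0)"
    by (intro sum.cong refl) simp
  also have "\<dots> = ent M a b" using assms by (auto simp: blocked_def)
  finally show "ent M a b = ent (\<Sum>i<h. \<Sum>j<h. runit (ent M i j) i j) a b" by simp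
qed

section \<open>Alternating forms\<close>

definition slots :: "nat \<Rightarrow> (nat \<Rightarrow> 'q :: ring_1) \<Rightarrow> (nat \<Rightarrow> 'q) \<Rightarrow> 'q" where
  "slots d s z = prod_list (map (\<lambda>i. s i * z i) [0..<d])"

lemma slots_split:
  assumes "k < d"
  shows "slots d s z = slots k s z * s k * z k * prod_list (map (\<lambda>i. s i * z i) [Suc k..<d])"
proof -
  have "[0..<d] = [0..<k] @ k # [Suc k..<d]"
    using assms by (metis add_0 le_add1 le_add_same_cancel1 less_imp_add_positive upt_add_eq_append upt_conv_Cons)
  then show ?thesis by (simp add: slots_def mult.assoc)
qed

lemma slots_upd_split:
  assumes "k < d"
  shows "slots d (s(k := u)) z = slots k s z * u * z k * prod_list (map (\<lambda>i. s i * z i) [Suc k..<d])"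
proof -
  have "slots k (s(k := u)) z = slots k s z" unfolding slots_def by (intro arg_cong[where f = prod_list] map_cong) auto
  moreover have "map (\<lambda>i. (s(k := u)) i * z i) [Suc k..<d] = map (\<lambda>i. s i * z i) [Suc k..<d]" by simp
  ultimately show ?thesis by (subst slots_split[OF assms]) (simp only: fun_upd_same)
qed

lemma prod_list_commute:
  "(\<And>y. y \<in> set ys \<Longrightarrow> x * y = y * x) \<Longrightarrow> x * prod_list ys = prod_list ys * (x :: 'q :: monoid_mult)"
proof (induction ys)
  case (Cons y ys)
  have "x * (y * prod_list ys) = y * (x * prod_list ys)"
    using Cons.prems[of y] by (metis list.set_intros(1) mult.assoc)
  then show ?case using Cons by (simp add: mult.assoc)
qed simp

text \<open>Alternation acts on the exponents and can be iterated: the result is a signed sum over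
  \<open>r\<close>-tuples of permutations, whose values are added to \<open>a\<close>. For
  \<open>r = 1\<close> and zero \<open>a\<close> it is the form D_d of the overview.\<close>

fun alt_form :: "nat \<Rightarrow> 'q :: ring_1 \<Rightarrow> (nat \<Rightarrow> 'q) \<Rightarrow> nat \<Rightarrow> (nat \<Rightarrow> nat) \<Rightarrow> 'q" where
  "alt_form d x z 0 a = slots d (\<lambda>i. x ^ a i) z"
| "alt_form d x z (Suc r) a =
     (\<Sum>\<sigma> | \<sigma> permutes {..<d}. of_int (sign \<sigma>) * alt_form d x z r (\<lambda>i. a i + \<sigma> i))"

text \<open>Composition with the transposition reverses the sign of each permutation and keeps
  \<open>f\<close>, so the sum is its own negative. The absence of 2-torsion is an assumption
  because the ring is arbitrary.\<close>

lemma alternating_sum_zero: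
  fixes f :: "(nat \<Rightarrow> nat) \<Rightarrow> 'q :: ring_1"
  assumes no2: "\<And>X :: 'q. X + X = 0 \<Longrightarrow> X = 0"
    and jn: "j < d" "n < d" "j \<noteq> n"
    and f: "\<And>\<sigma>. \<sigma> permutes {..<d} \<Longrightarrow> f (Transposition.transpose j n \<circ> \<sigma>) = f \<sigma>"
  shows "(\<Sum>\<sigma> | \<sigma> permutes {..<d}. of_int (sign \<sigma>) * f \<sigma>) = 0" (is "?S = 0")
proof -
  let ?t = "Transposition.transpose j n"
  have t: "?t permutes {..<d}" using jn by (intro permutes_swap_id) auto
  have tt: "?t \<circ> (?t \<circ> \<sigma>) = \<sigma>" for \<sigma> :: "nat \<Rightarrow> nat" by (simp add: fun_eq_iff)
  have sgn: "sign (?t \<circ> \<sigma>) = - sign \<sigma>" if "\<sigma> permutes {..<d}" for \<sigma>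
  proof -
    have "permutation ?t" "permutation \<sigma>"
      using t that permutation_permutes by (metis finite_lessThan)+
    then show ?thesis using jn by (simp add: sign_compose sign_swap_id)
  qed
  have "?S = (\<Sum>\<sigma> | \<sigma> permutes {..<d}. of_int (sign (?t \<circ> \<sigma>)) * f (?t \<circ> \<sigma>))"
    by (rule sum.reindex_bij_witness[where i = "\<lambda>\<sigma>. ?t \<circ> \<sigma>" and j = "\<lambda>\<sigma>. ?t \<circ> \<sigma>"])
       (use t tt permutes_compose in \<open>auto simp only: mem_Collect_eq\<close>)
  also have "\<dots> = - ?S"
    unfolding sum_negf[symmetric] by (rule sum.cong) (auto simp: sgn f)
  finally have "?S + ?S = 0" by (simp add: eq_neg_iff_add_eq_0)
  then show ?thesis by (rule no2)
qed

text \<open>Evaluation of polynomials at an element of a noncommutative ring is multiplicative as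
  long as the coefficients act centrally. The coefficients will be even Grassmann scalars, for
  characteristic polynomials of supermatrices, and field scalars, for polynomials of least degree in
  the classification.\<close>

locale central_hom =
  fixes \<gamma> :: "'c :: comm_ring_1 \<Rightarrow> 'q :: ring_1"
  assumes add: "\<gamma> (a + b) = \<gamma> a + \<gamma> b" and mult: "\<gamma> (a * b) = \<gamma> a * \<gamma> b"
    and one: "\<gamma> 1 = 1" and central: "\<gamma> a * x = x * \<gamma> a"
begin

lemma zero: "\<gamma> 0 = 0" using add[of 0 0] by simp

definition peval :: "'q \<Rightarrow> 'c poly \<Rightarrow> 'q" where
  "peval x p = fold_coeffs (\<lambda>a y. \<gamma> a + x * y) p 0"

lemma peval_0 [simp]: "peval x 0 = 0" by (simp add: peval_def)

lemma peval_pCons [simp]: "peval x (pCons a p) = \<gamma> a + x * peval x p"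
  by (cases "a = 0 \<and> p = 0") (auto simp: peval_def zero)

lemma peval_add: "peval x (p + q) = peval x p + peval x q"
  by (induction p q rule: poly_induct2) (auto simp: add algebra_simps)

lemma peval_smult: "peval x (Polynomial.smult c p) = \<gamma> c * peval x p"
proof (induction p)
  case (pCons a p)
  then show ?case by (simp add: mult distrib_left) (metis central mult.assoc)
qed simp

lemma peval_commute: "x * y = y * x \<Longrightarrow> peval x p * y = y * peval x p"
proof (induction p)
  case (pCons a p)
  have "x * (peval x p * y) = y * (x * peval x p)"
    using pCons by (metis mult.assoc)
  then show ?case using central[of a y] by (simp add: algebra_simps)
qed simp

lemma peval_mult: "peval x (p * q) = peval x p * peval x q"
  by (induction p) (auto simp: peval_add peval_smult zero algebra_simps)

lemma peval_1 [simp]: "peval x 1 = 1" unfolding one_pCons by (simp add: one)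

lemma peval_power: "peval x (p ^ n) = peval x p ^ n"
  by (induction n) (auto simp: peval_mult)

lemma peval_monom: "peval x (monom 1 n) = x ^ n"
  by (induction n) (auto simp: monom_0 monom_Suc one zero)

lemma peval_sum: "peval x (sum f A) = (\<Sum>a\<in>A. peval x (f a))"
  by (induction A rule: infinite_finite_induct) (auto simp: peval_add)

lemma peval_expand: "peval x p = (\<Sum>i\<le>degree p. \<gamma> (coeff p i) * x ^ i)"
proof -
  have "peval x p = peval x (\<Sum>i\<le>degree p. Polynomial.smult (coeff p i) (monom 1 i))"
    by (simp add: smult_monom poly_as_sum_of_monoms)
  then show ?thesis by (simp only: peval_sum peval_smult peval_monom)
qed

context
  fixes d :: nat and x :: 'q and z :: "nat \<Rightarrow> 'q" and L :: 'q
begin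

text \<open>The powers of \<open>x\<close> in \<open>alt_form\<close> are replaced by arbitrary polynomials, as reducing the highest power
  by the characteristic polynomial leads out of the monomials.\<close>

fun pform :: "nat \<Rightarrow> (nat \<Rightarrow> 'c poly) \<Rightarrow> 'q" where
  "pform 0 s = L * slots d (\<lambda>i. peval x (s i)) z"
| "pform (Suc r) s = (\<Sum>\<sigma> | \<sigma> permutes {..<d}. of_int (sign \<sigma>) * pform r (\<lambda>i. monom 1 (\<sigma> i) * s i))"

lemma of_int_left_commute: "y * (of_int k * w) = of_int k * (y * (w :: 'q))"
  by (metis mult.assoc mult_of_int_commute)

lemma pform_alt_form: "pform r (\<lambda>i. monom 1 (a i)) = L * alt_form d x z r a"
  by (induction r arbitrary: a)
     (auto simp: peval_monom sum_distrib_left of_int_left_commute mult_monom add.commute intro!: sum.cong)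

lemma pform_add:
  "k < d \<Longrightarrow> pform r (s(k := p + q)) = pform r (s(k := p)) + pform r (s(k := q))"
proof (induction r arbitrary: s p q)
  case 0
  have *: "(\<lambda>i. peval x ((s(k := u)) i)) = (\<lambda>i. peval x (s i))(k := peval x u)" for u by auto
  show ?case unfolding pform.simps * slots_upd_split[OF 0] by (simp add: peval_add algebra_simps)
next
  case (Suc r)
  have *: "(\<lambda>i. monom 1 (\<sigma> i) * (s(k := u)) i) = (\<lambda>i. monom 1 (\<sigma> i) * s i)(k := monom 1 (\<sigma> k) * u)"
    for \<sigma> u by auto
  show ?case unfolding pform.simps * distrib_left Suc.IH[OF Suc.prems] sum.distrib ..
qed

lemma pform_smult: "k < d \<Longrightarrow> pform r (s(k := Polynomial.smult c p)) = \<gamma> c * pform r (s(k := p))"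
proof (induction r arbitrary: s p)
  case 0
  have *: "(\<lambda>i. peval x ((s(k := u)) i)) = (\<lambda>i. peval x (s i))(k := peval x u)" for u by auto
  have left_commute: "y * (\<gamma> c * w) = \<gamma> c * (y * w)" for y w by (metis central mult.assoc)
  show ?case unfolding pform.simps * slots_upd_split[OF 0] peval_smult
    by (simp only: mult.assoc left_commute)
next
  case (Suc r)
  have *: "(\<lambda>i. monom 1 (\<sigma> i) * (s(k := u)) i) = (\<lambda>i. monom 1 (\<sigma> i) * s i)(k := monom 1 (\<sigma> k) * u)"
    for \<sigma> u by auto
  show ?case unfolding pform.simps * mult_smult_right Suc.IH[OF Suc.prems] sum_distrib_left
    by (simp add: of_int_left_commute)
qed

lemma pform_sum:
  "finite A \<Longrightarrow> A \<noteq> {} \<Longrightarrow> k < d \<Longrightarrow> pform r (s(k := sum f A)) = (\<Sum>a\<in>A. pform r (s(k := f a)))"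
  by (induction A rule: finite_ne_induct) (simp_all add: pform_add)

text \<open>\<open>v i\<close> counts the factors \<chi> known in slot \<open>i\<close>, and each
  alternation adds one to the total: the slot that receives the exponent \<open>n\<close> has its
  power rewritten as \<chi> plus lower powers, and the lower powers cancel because two slots then
  carry the same exponent. Once the total reaches \<open>d * (M - 1) + 1\<close>, some slot contains
  \<open>\<chi> ^ M\<close> by the pigeonhole principle, and \<open>base\<close> applies.\<close>

lemma pform_zero:
  assumes no2: "\<And>X :: 'q. X + X = 0 \<Longrightarrow> X = 0"
    and d: "d = Suc n" and chi: "degree \<chi> = n" "lead_coeff \<chi> = 1"
    and base: "\<And>s k. k < d \<Longrightarrow> \<chi> ^ M dvd s k \<Longrightarrow> L * slots d (\<lambda>i. peval x (s i)) z = 0"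
  shows "(\<And>i. i < d \<Longrightarrow> \<chi> ^ v i dvd s i) \<Longrightarrow> d * (M - 1) + 1 \<le> (\<Sum>i<d. v i) + r \<Longrightarrow> pform r s = 0"
proof (induction r arbitrary: s v)
  case 0
  have "\<exists>i<d. M \<le> v i"
  proof (rule ccontr)
    assume "\<not> ?thesis"
    then have "v i \<le> M - 1" if "i < d" for i using that by (metis Suc_pred' less_Suc_eq_le not_le not_less_zero gr0I)
    then have "(\<Sum>i<d. v i) \<le> (\<Sum>i<d. M - 1)" by (intro sum_mono) auto
    with 0 show False by simp
  qed
  then obtain i where "i < d" "M \<le> v i" by blast
  then have "\<chi> ^ M dvd s i" using 0(1) by (meson dvd_trans le_imp_power_dvd)
  with \<open>i < d\<close> show ?case by (simp add: base)
next
  case (Suc r)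
  have chi_exp: "monom 1 n = \<chi> + (\<Sum>j<n. Polynomial.smult (- coeff \<chi> j) (monom 1 j))"
  proof -
    have "\<chi> = (\<Sum>j\<le>n. monom (coeff \<chi> j) j)" using chi(1) by (metis poly_as_sum_of_monoms)
    also have "\<dots> = monom 1 n + (\<Sum>j<n. monom (coeff \<chi> j) j)"
      using chi by (simp add: lessThan_Suc_atMost[symmetric] add.commute)
    finally have "\<chi> - (\<Sum>j<n. monom (coeff \<chi> j) j) = monom 1 n" by (simp add: algebra_simps)
    then show ?thesis by (simp add: smult_monom minus_monom[symmetric] sum_negf algebra_simps)
  qed
  \<comment> \<open>The value \<open>n\<close> of a permutation is replaced by \<open>j\<close>. As
    \<open>j\<close> is itself a value, the exponents are unchanged when \<open>j\<close> and
    \<open>n\<close> are transposed, which makes the alternating sum vanish.\<close>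
  define \<kappa> where "\<kappa> j i = (if i = n then j else i)" for j i :: nat
  have step: "pform r (\<lambda>i. monom 1 (\<sigma> i) * s i) =
      (\<Sum>j<n. \<gamma> (- coeff \<chi> j) * pform r (\<lambda>i. monom 1 (\<kappa> j (\<sigma> i)) * s i))"
    if \<sigma>: "\<sigma> permutes {..<d}" for \<sigma>
  proof -
    obtain k where k: "k < d" "\<sigma> k = n"
      using permutes_surj[OF \<sigma>] \<sigma> d by (metis lessI lessThan_iff permutes_in_image surj_def)
    let ?s = "\<lambda>i. monom 1 (\<sigma> i) * s i"
    have k_unique: "\<sigma> i = n \<longleftrightarrow> i = k" for i using k(2) permutes_inj[OF \<sigma>] by (auto dest: injD)
    have "?s = ?s(k := \<chi> * s k + (\<Sum>j<n. Polynomial.smult (- coeff \<chi> j) (monom 1 j * s k)))"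
      by (rule ext) (auto simp: k(2) chi_exp distrib_right sum_distrib_right)
    then have "pform r ?s = pform r (?s(k := \<chi> * s k)) +
        pform r (?s(k := (\<Sum>j<n. Polynomial.smult (- coeff \<chi> j) (monom 1 j * s k))))"
      using pform_add[OF k(1)] by metis
    moreover have "pform r (?s(k := \<chi> * s k)) = 0"
    proof (rule Suc.IH[of "v(k := Suc (v k))"])
      fix i assume "i < d"
      then show "\<chi> ^ (v(k := Suc (v k))) i dvd (?s(k := \<chi> * s k)) i"
        using Suc.prems(1)[of i] by (auto intro: mult_dvd_mono dvd_mult)
    next
      have "(\<Sum>i<d. (v(k := Suc (v k))) i) = Suc (\<Sum>i<d. v i)"
        using k(1) by (simp add: sum.remove[of _ k])
      then show "d * (M - 1) + 1 \<le> (\<Sum>i<d. (v(k := Suc (v k))) i) + r" using Suc.prems(2) by simp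
    qed
    moreover have "pform r (?s(k := (\<Sum>j<n. Polynomial.smult (- coeff \<chi> j) (monom 1 j * s k)))) =
        (\<Sum>j<n. \<gamma> (- coeff \<chi> j) * pform r (?s(k := monom 1 j * s k)))"
    \<comment> \<open>For \<open>n = 0\<close> the sum over \<open>j\<close> is empty, whereas
      \<open>pform_sum\<close> speaks of nonempty sums; extracting the scalar 0 covers this
      case.\<close>
    proof (cases "n = 0")
      case True
      have "pform r (?s(k := Polynomial.smult 0 0)) = 0" using pform_smult[OF k(1), of r ?s 0 0] by (simp add: zero)
      with True show ?thesis by simp
    qed (simp add: pform_sum[OF _ _ k(1)] pform_smult[OF k(1)] lessThan_empty_iff del: smult_minus_left)
    moreover have "?s(k := monom 1 j * s k) = (\<lambda>i. monom 1 (\<kappa> j (\<sigma> i)) * s i)" for j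
      by (auto simp: \<kappa>_def k_unique)
    ultimately show ?thesis by simp
  qed
  have "pform (Suc r) s = (\<Sum>\<sigma> | \<sigma> permutes {..<d}. \<Sum>j<n.
      \<gamma> (- coeff \<chi> j) * (of_int (sign \<sigma>) * pform r (\<lambda>i. monom 1 (\<kappa> j (\<sigma> i)) * s i)))"
    unfolding pform.simps by (rule sum.cong) (auto simp: step sum_distrib_left of_int_left_commute)
  also have "\<dots> = (\<Sum>j<n. \<gamma> (- coeff \<chi> j) *
      (\<Sum>\<sigma> | \<sigma> permutes {..<d}. of_int (sign \<sigma>) * pform r (\<lambda>i. monom 1 (\<kappa> j (\<sigma> i)) * s i)))"
    by (subst sum.swap) (simp add: sum_distrib_left)
  also have "\<dots> = 0"
  proof (rule sum.neutral, safe)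
    fix j assume j: "j < n"
    have "\<kappa> j (Transposition.transpose j n i) = \<kappa> j i" for i
      using j by (auto simp: \<kappa>_def Transposition.transpose_def)
    then have "(\<Sum>\<sigma> | \<sigma> permutes {..<d}. of_int (sign \<sigma>) * pform r (\<lambda>i. monom 1 (\<kappa> j (\<sigma> i)) * s i)) = 0"
      using j d by (intro alternating_sum_zero[OF no2, of j d n]) auto
    then show "\<gamma> (- coeff \<chi> j) * (\<Sum>\<sigma> | \<sigma> permutes {..<d}. of_int (sign \<sigma>) * pform r (\<lambda>i. monom 1 (\<kappa> j (\<sigma> i)) * s i)) = 0"
      by simp
  qed
  finally show ?case .
qed

end

text \<open>\<open>L\<close> will be the projection onto a block, so that \<chi> has to annihilate
  \<open>x\<close> on this block only. It commutes with all slots and can be moved next to the one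
  divisible by \<open>\<chi> ^ M\<close>. The bound on \<open>r\<close> is the pigeonhole bound with
  no factor \<chi> present at the start.\<close>

lemma alt_form_vanish:
  assumes no2: "\<And>X :: 'q. X + X = 0 \<Longrightarrow> X = 0"
    and chi: "degree \<chi> = n" "lead_coeff \<chi> = 1"
    and Lx: "L * x = x * L" and Lz: "\<And>i. L * z i = z i * L"
    and nil: "peval x \<chi> ^ M * L = 0"
    and r: "Suc n * (M - 1) + 1 \<le> r"
  shows "L * alt_form (Suc n) x z r (\<lambda>_. 0) = 0"
proof -
  have "pform (Suc n) x z L r (\<lambda>i. monom 1 0) = 0"
  proof (rule pform_zero[OF no2 refl chi, where M = M and v = "\<lambda>_. 0"])
    fix s :: "nat \<Rightarrow> 'c poly" and k assume k: "k < Suc n" and "\<chi> ^ M dvd s k"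
    then obtain p where p: "s k = \<chi> ^ M * p" by blast
    have L: "peval x q * L = L * peval x q" for q using Lx peval_commute[of x L q] by simp
    have "L * slots k (\<lambda>i. peval x (s i)) z = slots k (\<lambda>i. peval x (s i)) z * L"
      unfolding slots_def
    proof (rule prod_list_commute, clarsimp)
      fix i show "L * (peval x (s i) * z i) = peval x (s i) * z i * L"
        by (metis L Lz mult.assoc)
    qed
    moreover have "L * peval x (s k) = 0"
      using nil by (simp add: p peval_mult peval_power) (metis L mult.assoc mult_zero_left peval_power)
    ultimately show "L * slots (Suc n) (\<lambda>i. peval x (s i)) z = 0"
      by (simp add: slots_split[OF k] flip: mult.assoc) (simp add: mult.assoc)
  qed (use r in auto)
  then show ?thesis by (simp only: pform_alt_form)
qed

end

section \<open>Congruences modulo an ideal, and nilpotent ideals\<close>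

definition two_sided :: "('q :: ring_1 \<Rightarrow> bool) \<Rightarrow> bool" where
  "two_sided I \<longleftrightarrow> I 0 \<and> (\<forall>a b. I a \<longrightarrow> I b \<longrightarrow> I (a + b)) \<and> (\<forall>a b. I a \<longrightarrow> I (a * b) \<and> I (b * a))"

context
  fixes I :: "'q :: ring_1 \<Rightarrow> bool"
  assumes I: "two_sided I"
begin

lemma ideal_rules: "I 0" "I a \<Longrightarrow> I b \<Longrightarrow> I (a + b)" "I a \<Longrightarrow> I (a * b)" "I a \<Longrightarrow> I (b * a)"
  using I by (auto simp: two_sided_def)

lemma ideal_cong_refl: "I (a - a)" by (simp add: ideal_rules)

lemma ideal_cong_add: "I (a - a') \<Longrightarrow> I (b - b') \<Longrightarrow> I ((a + b) - (a' + b'))"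
  using ideal_rules(2)[of "a - a'" "b - b'"] by (simp add: algebra_simps)

lemma ideal_cong_mult: "I (a - a') \<Longrightarrow> I (b - b') \<Longrightarrow> I (a * b - a' * b')"
  using ideal_rules(2)[of "(a - a') * b" "a' * (b - b')"] ideal_rules(3)[of "a - a'" b] ideal_rules(4)[of "b - b'" a']
  by (simp add: algebra_simps)

lemma ideal_cong_power: "I (a - a') \<Longrightarrow> I (a ^ n - a' ^ n)"
  by (induction n) (auto simp: ideal_rules ideal_cong_mult)

lemma ideal_cong_sum: "(\<And>i. i \<in> A \<Longrightarrow> I (f i - g i)) \<Longrightarrow> I (sum f A - sum g A)"
proof (induction A rule: infinite_finite_induct)
  case (insert i A)
  then show ?case using ideal_cong_add[of "f i" "g i" "sum f A" "sum g A"] by simp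
qed (auto simp: ideal_rules)

lemma ideal_cong_prod_list: "(\<And>i. i \<in> set xs \<Longrightarrow> I (f i - g i)) \<Longrightarrow> I (prod_list (map f xs) - prod_list (map g xs))"
  by (induction xs) (auto simp: ideal_rules ideal_cong_mult)

lemma ideal_cong_alt_form:
  assumes "I (x - x')" "\<And>i. I (z i - z' i)"
  shows "I (alt_form d x z r a - alt_form d x' z' r a)"
  by (induction r arbitrary: a)
     (auto simp: slots_def assms intro!: ideal_cong_sum ideal_cong_mult ideal_cong_prod_list ideal_cong_power ideal_cong_refl)

end

text \<open>The \<open>n\<close>-th power of the two-sided ideal generated by \<Omega>. The 0-th
  power is the whole ring, so the first generator already has an arbitrary left factor, and closure
  under multiplication from the left follows.\<close>

inductive nil_power :: "'q :: ring_1 set \<Rightarrow> nat \<Rightarrow> 'q \<Rightarrow> bool" for \<Omega> where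
  base: "nil_power \<Omega> 0 a"
| zero: "nil_power \<Omega> n 0"
| add: "nil_power \<Omega> n a \<Longrightarrow> nil_power \<Omega> n b \<Longrightarrow> nil_power \<Omega> n (a + b)"
| step: "nil_power \<Omega> n a \<Longrightarrow> w \<in> \<Omega> \<Longrightarrow> nil_power \<Omega> (Suc n) (a * w * b)"

lemma nil_power_mult_right: "nil_power \<Omega> n a \<Longrightarrow> nil_power \<Omega> n (a * c)"
proof (induction rule: nil_power.induct)
  case (step n a w b)
  then show ?case using nil_power.step[of \<Omega> n a w "b * c"] by (simp add: mult.assoc)
qed (auto simp: distrib_right intro: nil_power.intros)

lemma nil_power_mult: "nil_power \<Omega> m b \<Longrightarrow> nil_power \<Omega> n a \<Longrightarrow> nil_power \<Omega> (n + m) (a * b)"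
proof (induction rule: nil_power.induct)
  case (step m b w c)
  then show ?case using nil_power.step[of \<Omega> "n + m" "a * b" w c] by (simp add: mult.assoc)
qed (auto simp: distrib_left intro: nil_power.intros nil_power_mult_right)

lemma two_sided_nil_power: "two_sided (nil_power \<Omega> n)"
  unfolding two_sided_def
  using nil_power_mult[of \<Omega> n _ 0] by (auto intro: nil_power.intros nil_power_mult_right)

lemma nil_power_power: "nil_power \<Omega> 1 a \<Longrightarrow> nil_power \<Omega> n (a ^ n)"
proof (induction n)
  case (Suc n)
  then show ?case using nil_power_mult[of \<Omega> n "a ^ n" 1 a] by simp
qed (auto intro: nil_power.intros)

text \<open>Every element of the \<open>n\<close>-th power of the ideal is a sum of elements which annihilate \<open>n\<close>
  of the generators from the left.\<close>

lemma nil_power_eq_0: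
  assumes "finite \<Omega>" and sandwich: "\<And>w y. w \<in> \<Omega> \<Longrightarrow> w * y * w = (0 :: 'q :: ring_1)"
    and "nil_power \<Omega> n a" "card \<Omega> < n"
  shows "a = 0"
proof -
  define G where "G n = {c :: 'q. \<exists>T\<subseteq>\<Omega>. card T = n \<and> (\<forall>w\<in>T. \<forall>y. c * y * w = 0)}" for n
  have "\<exists>cs. set cs \<subseteq> G n \<and> a = sum_list cs"
    using \<open>nil_power \<Omega> n a\<close>
  proof (induction rule: nil_power.induct)
    case (base a)
    then show ?case by (intro exI[of _ "[a]"]) (auto simp: G_def)
  next
    case (zero n)
    then show ?case by (intro exI[of _ "[]"]) auto
  next
    case (add n a b)
    then obtain as bs where "set as \<subseteq> G n" "a = sum_list as" "set bs \<subseteq> G n" "b = sum_list bs" by blast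
    then show ?case by (intro exI[of _ "as @ bs"]) auto
  next
    case (step n a w b)
    then obtain cs where cs: "set cs \<subseteq> G n" "a = sum_list cs" by blast
    have "\<exists>ds. set ds \<subseteq> G (Suc n) \<and> c * w * b = sum_list ds" if "c \<in> G n" for c
    proof -
      from that obtain T where T: "T \<subseteq> \<Omega>" "card T = n" "\<And>w y. w \<in> T \<Longrightarrow> c * y * w = 0"
        unfolding G_def by blast
      show ?thesis
      proof (cases "w \<in> T")
        case True
        then have "c * w = 0" using T(3)[of w 1] by simp
        then show ?thesis by (intro exI[of _ "[]"]) auto
      next
        case False
        have "c * w * b * y * v = 0" if "v \<in> insert w T" for v y
        proof (cases "v = w")
          case True
          then show ?thesis using sandwich[OF step.hyps(2), of "b * y"] by (simp add: mult.assoc)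
        next
          case False
          then show ?thesis using T(3)[of v "w * b * y"] that by (simp add: mult.assoc)
        qed
        moreover have "card (insert w T) = Suc n" using False T \<open>finite \<Omega>\<close> by (simp add: finite_subset)
        ultimately have "c * w * b \<in> G (Suc n)"
          unfolding G_def using T(1) step.hyps(2) by (intro CollectI exI[of _ "insert w T"]) auto
        then show ?thesis by (intro exI[of _ "[c * w * b]"]) auto
      qed
    qed
    with cs(1) have "\<exists>ds. set ds \<subseteq> G (Suc n) \<and> sum_list cs * w * b = sum_list ds"
    proof (induction cs)
      case Nil
      then show ?case by (intro exI[of _ "[]"]) auto
    next
      case (Cons c cs)
      from Cons.prems Cons.IH obtain ds where "set ds \<subseteq> G (Suc n)" "sum_list cs * w * b = sum_list ds" by auto
      moreover from Cons.prems obtain ds' where "set ds' \<subseteq> G (Suc n)" "c * w * b = sum_list ds'" by (metis list.set_intros(1) subsetD)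
      ultimately show ?case by (intro exI[of _ "ds' @ ds"]) (auto simp: distrib_right)
    qed
    then show ?case by (simp add: cs(2))
  qed
  moreover have "G n = {}"
  proof -
    have "card T \<noteq> n" if "T \<subseteq> \<Omega>" for T using card_mono[OF \<open>finite \<Omega>\<close> that] \<open>card \<Omega> < n\<close> by simp
    then show ?thesis unfolding G_def by blast
  qed
  ultimately show ?thesis by auto
qed

section \<open>Supermatrices\<close>

lift_definition rmap :: "('g :: zero \<Rightarrow> 'h :: zero) \<Rightarrow> 'g rfm \<Rightarrow> 'h rfm" is
  "\<lambda>f M i j. if M i j = 0 then 0 else f (M i j)"
  by (auto intro: finite_subset)

lemma ent_rmap: "f 0 = 0 \<Longrightarrow> ent (rmap f M) i j = f (ent M i j)"
  by (simp add: rmap.rep_eq)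

definition rproj :: "nat \<Rightarrow> nat \<Rightarrow> 'g :: ring_1 rfm" where
  "rproj a n = rdiag (\<lambda>i. if a \<le> i \<and> i < a + n then 1 else 0)"

lemma ent_rproj [simp]:
  "ent (rproj a n * X) i j = (if a \<le> i \<and> i < a + n then ent X i j else 0)"
  "ent (X * rproj a n) i j = (if a \<le> j \<and> j < a + n then ent X i j else 0)"
  "ent (rproj a n) i j = (if i = j \<and> a \<le> i \<and> i < a + n then 1 else 0)"
  by (auto simp: rproj_def ent_rdiag)

definition evscal :: "'f :: field evgr \<Rightarrow> 'f gr rfm" where "evscal c = rscal (ev_gr c)"

interpretation ev: central_hom "evscal :: 'f :: field evgr \<Rightarrow> 'f gr rfm"
proof
  fix a b :: "'f evgr" and x :: "'f gr rfm"
  show "evscal (a + b) = evscal a + evscal b" by (simp add: evscal_def plus_evgr.rep_eq rscal_add)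
  show "evscal (a * b) = evscal a * evscal b" by (simp add: evscal_def times_evgr.rep_eq rdiag_mult)
  show "evscal 1 = (1 :: 'f gr rfm)" by (simp add: evscal_def one_evgr.rep_eq rdiag_one)
  show "evscal a * x = x * evscal a"
    unfolding evscal_def using ev_gr[of a] by (intro rscal_commute) (auto intro: geven_commute)
qed

lemma rproj_commute:
  assumes "\<And>i j. ent X i j \<noteq> 0 \<Longrightarrow> (a \<le> i \<and> i < a + n) = (a \<le> j \<and> j < a + n)"
  shows "rproj a n * X = X * rproj a n"
proof (rule rfm_eqI)
  fix i j show "ent (rproj a n * X) i j = ent (X * rproj a n) i j"
    using assms[of i j] by (cases "ent X i j = 0") auto
qed

text \<open>The Cayley--Hamilton theorem for the block of \<open>X\<close> with rows and columns \<open>a, \<dots>, a + n - 1\<close>: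
  if \<open>B\<^sub>m\<close> are the coefficients of the adjugate of the characteristic matrix, then
  \<open>B\<^bsub>m-1\<^esub> - X B\<^sub>m\<close> is the \<open>m\<close>-th coefficient of the characteristic polynomial, and the sum
  over all \<open>m\<close>, multiplied by \<open>X\<^sup>m\<close>, telescopes.\<close>

lemma block_cayley_hamilton:
  fixes X :: "'f :: field gr rfm"
  assumes ev: "\<And>i j. geven (ent X i j)"
    and blk: "\<And>i j. ent X i j \<noteq> 0 \<Longrightarrow> (a \<le> i \<and> i < a + n) = (a \<le> j \<and> j < a + n)"
  shows "\<exists>\<chi>. degree \<chi> = n \<and> lead_coeff \<chi> = 1 \<and> ev.peval X \<chi> * rproj a n = 0"
proof -
  define x where "x i j = Abs_evgr (ent X (a + i) (a + j))" for i j
  have x: "ev_gr (x i j) = ent X (a + i) (a + j)" for i j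
    using ev by (simp add: x_def Abs_evgr_inverse)
  define A where "A = mat n n (\<lambda>(i, j). x i j)"
  have A: "A \<in> carrier_mat n n" by (simp add: A_def)
  define \<chi> where "\<chi> = char_poly A"
  define C where "C = char_poly_matrix A"
  have C: "C \<in> carrier_mat n n" by (simp add: C_def A)
  define B where "B = adj_mat C"
  have B: "B \<in> carrier_mat n n" "C * B = \<chi> \<cdot>\<^sub>m 1\<^sub>m n"
    using adj_mat[OF C] by (simp_all add: B_def \<chi>_def char_poly_def C_def)
  have eq: "(if m = 0 then 0 else coeff (B $$ (i, j)) (m - 1)) - (\<Sum>k<n. x i k * coeff (B $$ (k, j)) m) =
      (if i = j then coeff \<chi> m else 0)" if ij: "i < n" "j < n" for i j m
  proof -
    have "(C * B) $$ (i, j) = (\<Sum>k<n. C $$ (i, k) * B $$ (k, j))"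
      using ij B(1) C by (simp add: scalar_prod_def atLeast0LessThan)
    also have "\<dots> = (\<Sum>k<n. (if k = i then [:0, 1:] * B $$ (k, j) else 0) + [:- x i k:] * B $$ (k, j))"
      using ij A unfolding C_def char_poly_matrix_def
      by (intro sum.cong refl) (auto simp: A_def algebra_simps)
    also have "\<dots> = [:0, 1:] * B $$ (i, j) + (\<Sum>k<n. [:- x i k:] * B $$ (k, j))"
      unfolding sum.distrib using ij by simp
    finally have "(C * B) $$ (i, j) = [:0, 1:] * B $$ (i, j) + (\<Sum>k<n. [:- x i k:] * B $$ (k, j))" .
    moreover have "(C * B) $$ (i, j) = (if i = j then \<chi> else 0)" using ij unfolding B(2) by simp
    ultimately have "coeff ([:0, 1:] * B $$ (i, j) + (\<Sum>k<n. [:- x i k:] * B $$ (k, j))) m = (if i = j then coeff \<chi> m else 0)"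
      by (metis coeff_0)
    then show ?thesis
      by (cases m) (simp_all add: coeff_sum sum_negf)
  qed
  define E where "E m = (\<Sum>i<n. \<Sum>j<n. runit (ev_gr (coeff (B $$ (i, j)) m)) (a + i) (a + j))" for m
  have ent_E: "ent (E m) i j = (if a \<le> i \<and> i < a + n \<and> a \<le> j \<and> j < a + n
      then ev_gr (coeff (B $$ (i - a, j - a)) m) else 0)" for m i j
  proof -
    have "ent (E m) i j = (\<Sum>p<n. \<Sum>q<n. if q = j - a then if p = i - a then if a \<le> i \<and> a \<le> j
        then ev_gr (coeff (B $$ (i - a, j - a)) m) else 0 else 0 else 0)"
      unfolding E_def ent_sum by (intro sum.cong refl) (auto simp: ent_runit)
    also have "\<dots> = (\<Sum>p<n. if p = i - a then if a \<le> i \<and> a \<le> j \<and> j < a + n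
        then ev_gr (coeff (B $$ (i - a, j - a)) m) else 0 else 0)"
      by (intro sum.cong refl) auto
    finally show ?thesis by auto
  qed
  have ev_sum: "ev_gr (sum f K) = (\<Sum>k\<in>K. ev_gr (f k))" for f :: "nat \<Rightarrow> 'f evgr" and K
    by (induction K rule: infinite_finite_induct) (auto simp: zero_evgr.rep_eq plus_evgr.rep_eq)
  have rec: "evscal (coeff \<chi> m) * rproj a n = (if m = 0 then 0 else E (m - 1)) - X * E m" for m
  proof (rule rfm_eqI)
    fix i j
    consider (out) "\<not> (a \<le> i \<and> i < a + n)" | (out') "\<not> (a \<le> j \<and> j < a + n)"
      | (inside) i' j' where "i = a + i'" "j = a + j'" "i' < n" "j' < n"
      by (metis le_add_diff_inverse nat_add_left_cancel_less)
    moreover have lhs: "ent (evscal (coeff \<chi> m) * rproj a n) i j =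
        (if i = j \<and> a \<le> i \<and> i < a + n then ev_gr (coeff \<chi> m) else 0)"
      by (auto simp: evscal_def ent_rdiag)
    ultimately show "ent (evscal (coeff \<chi> m) * rproj a n) i j = ent ((if m = 0 then 0 else E (m - 1)) - X * E m) i j"
    proof cases
      case out
      have "ent (X * E m) i j = (\<Sum>k | ent X i k \<noteq> 0. ent X i k * ent (E m) k j)"
        by (rule ent_mult) (auto simp: finite_row)
      also have "\<dots> = 0" using blk[of i] out by (intro sum.neutral) (auto simp: ent_E)
      finally show ?thesis using out unfolding lhs by (auto simp: ent_E)
    next
      case out'
      have "ent (X * E m) i j = (\<Sum>k | ent X i k \<noteq> 0. ent X i k * ent (E m) k j)"
        by (rule ent_mult) (auto simp: finite_row)
      also have "\<dots> = 0" using out' by (intro sum.neutral) (auto simp: ent_E)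
      finally show ?thesis using out' unfolding lhs by (auto simp: ent_E)
    next
      case inside
      have "ent (X * E m) i j = (\<Sum>k\<in>{a..<a + n}. ent X i k * ent (E m) k j)"
        by (rule ent_mult) (use blk[of i] inside in auto)
      also have "\<dots> = (\<Sum>k<n. ent X i (a + k) * ent (E m) (a + k) j)"
        by (rule sum.reindex_bij_witness[where i = "\<lambda>k. a + k" and j = "\<lambda>k. k - a"]) auto
      also have "\<dots> = ev_gr (\<Sum>k<n. x i' k * coeff (B $$ (k, j')) m)"
        using inside by (auto simp: ev_sum times_evgr.rep_eq x ent_E)
      finally have "ent ((if m = 0 then 0 else E (m - 1)) - X * E m) i j =
          ev_gr ((if m = 0 then 0 else coeff (B $$ (i', j')) (m - 1)) - (\<Sum>k<n. x i' k * coeff (B $$ (k, j')) m))"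
        using inside by (simp add: ent_E minus_evgr.rep_eq zero_evgr.rep_eq)
      then show ?thesis unfolding lhs using inside by (simp add: eq zero_evgr.rep_eq)
    qed
  qed
  have deg: "degree \<chi> = n" "lead_coeff \<chi> = 1"
    using degree_monic_char_poly[OF A] by (auto simp: \<chi>_def)
  \<comment> \<open>Every entry of the adjugate has degree below \<open>D\<close>, so
    \<open>E\<close> vanishes from \<open>D\<close> on and the last term of the telescoping sum is
    zero; going up to \<open>D + n\<close> also covers the degree of \<chi>.\<close>
  define D where "D = (\<Sum>i<n. \<Sum>j<n. Suc (degree (B $$ (i, j))))"
  have "degree (B $$ (i, j)) < D" if "i < n" "j < n" for i j
  proof -
    have "Suc (degree (B $$ (i, j))) \<le> (\<Sum>j<n. Suc (degree (B $$ (i, j))))"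
      using that by (intro member_le_sum) auto
    also have "\<dots> \<le> D" unfolding D_def
      using that by (intro member_le_sum[of i _ "\<lambda>i. \<Sum>j<n. Suc (degree (B $$ (i, j)))"]) auto
    finally show ?thesis by simp
  qed
  then have E0: "E m = 0" if "D \<le> m" for m
    unfolding E_def using that by (intro sum.neutral ballI)
      (metis (no_types, lifting) coeff_eq_0 lessThan_iff order_less_le_trans runit_zero zero_evgr.rep_eq)
  define P where "P m = X ^ m * (if m = 0 then 0 else E (m - 1))" for m
  have "ev.peval X \<chi> = (\<Sum>i\<le>D + n. evscal (coeff \<chi> i) * X ^ i)"
    unfolding ev.peval_expand
    by (rule sum.mono_neutral_left) (auto simp: deg(1) ev.zero coeff_eq_0)
  then have "ev.peval X \<chi> * rproj a n = (\<Sum>i\<le>D + n. X ^ i * (evscal (coeff \<chi> i) * rproj a n))"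
    by (simp add: sum_distrib_right ev.central mult.assoc)
  also have "\<dots> = (\<Sum>i\<le>D + n. P i - P (Suc i))"
    unfolding rec by (rule sum.cong) (auto simp: P_def right_diff_distrib power_Suc2 mult.assoc simp del: power_Suc)
  also have "\<dots> = P 0 - P (Suc (D + n))" by (rule sum_telescope)
  also have "\<dots> = 0" by (simp add: P_def E0)
  finally show ?thesis using deg by blast
qed

section \<open>Supermatrices with prescribed positions, and the vanishing of alternating forms on
  them\<close>

definition block_pos :: "nat \<Rightarrow> nat \<Rightarrow> (nat \<times> nat) set" where
  "block_pos k l = {..<k} \<times> {..<k} \<union> {k..<k + l} \<times> {k..<k + l}"

definition off_pos :: "nat \<Rightarrow> nat \<Rightarrow> (nat \<times> nat) set" where
  "off_pos k l = {..<k} \<times> {k..<k + l} \<union> {k..<k + l} \<times> {..<k}"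

definition supermats :: "enat \<Rightarrow> (nat \<times> nat) set \<Rightarrow> (nat \<times> nat) set \<Rightarrow> 'f :: field gr rfm set" where
  "supermats m P Q = {X. finite {(i, j, S). coef (ent X i j) S \<noteq> 0} \<and>
     (\<forall>i j S. coef (ent X i j) S \<noteq> 0 \<longrightarrow>
        S \<in> grassmann_index m \<and> (i, j) \<in> (if even (card S) then P else Q))}"

definition even_block :: "nat \<Rightarrow> nat \<Rightarrow> 'f :: field gr rfm \<Rightarrow> bool" where
  "even_block k l X \<longleftrightarrow> (\<forall>i j. geven (ent X i j) \<and> (ent X i j \<noteq> 0 \<longrightarrow> (i, j) \<in> block_pos k l))"

lemma even_blockD:
  "even_block k l X \<Longrightarrow> ent X i j \<noteq> 0 \<Longrightarrow> i < k \<and> j < k \<or> k \<le> i \<and> i < k + l \<and> k \<le> j \<and> j < k + l"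
  unfolding even_block_def block_pos_def by (metis (no_types, lifting) Un_iff atLeastLessThan_iff lessThan_iff mem_Sigma_iff)

lemma even_block_commute:
  assumes "even_block k l X"
  shows "rproj 0 k * X = X * rproj 0 k" "rproj k l * X = X * rproj k l" "rproj 0 (k + l) * X = X"
proof -
  show "rproj 0 (k + l) * X = X"
  proof (rule rfm_eqI)
    fix i j have "i < k + l" if "ent X i j \<noteq> 0" using even_blockD[OF assms that] by auto
    then show "ent (rproj 0 (k + l) * X) i j = ent X i j" by auto
  qed
  show "rproj 0 k * X = X * rproj 0 k"
    by (rule rproj_commute) (drule even_blockD[OF assms], auto)
  show "rproj k l * X = X * rproj k l"
    by (rule rproj_commute) (drule even_blockD[OF assms], auto)
qed

lemma rproj_split: "rproj 0 (k + l) = rproj 0 k + (rproj k l :: 'g :: ring_1 rfm)"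
  by (rule rfm_eqI) auto

lemma even_block_char_polys:
  assumes "even_block k l X"
  shows "\<exists>\<chi>. degree \<chi> = k \<and> lead_coeff \<chi> = 1 \<and> ev.peval X \<chi> * rproj 0 k = 0"
    "\<exists>\<chi>. degree \<chi> = l \<and> lead_coeff \<chi> = 1 \<and> ev.peval X \<chi> * rproj k l = 0"
proof -
  have "geven (ent X i j)" for i j using assms by (simp add: even_block_def)
  note ch = block_cayley_hamilton[OF this]
  show "\<exists>\<chi>. degree \<chi> = k \<and> lead_coeff \<chi> = 1 \<and> ev.peval X \<chi> * rproj 0 k = 0"
    by (rule ch) (drule even_blockD[OF assms], auto)
  show "\<exists>\<chi>. degree \<chi> = l \<and> lead_coeff \<chi> = 1 \<and> ev.peval X \<chi> * rproj k l = 0"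
    by (rule ch) (drule even_blockD[OF assms], auto)
qed

text \<open>\<open>L\<close> passes the power of \<open>x\<close> in the first slot and is absorbed
  by \<open>z 0\<close>.\<close>

lemma alt_form_proj:
  assumes "L * x = x * L" "L * z 0 = z 0"
  shows "L * alt_form (Suc n) x z r a = alt_form (Suc n) x z r a"
proof (induction r arbitrary: a)
  case 0
  have "L * x ^ a 0 = x ^ a 0 * L" using assms(1) by (metis power_commuting_commutes)
  then have "L * (x ^ a 0 * z 0) = x ^ a 0 * z 0" using assms(2) by (metis mult.assoc)
  then show ?case by (simp add: slots_def upt_conv_Cons mult.assoc[symmetric] del: upt_Suc)
next
  case (Suc r)
  have "L * (of_int c * w) = of_int c * (L * w)" for c w by (metis mult.assoc mult_of_int_commute)
  then show ?case using Suc by (simp add: sum_distrib_left)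
qed

text \<open>The even Grassmann elements have zero divisors, so additivity of the degree rests on the
  leading coefficients being 1.\<close>

lemma monic_mult:
  fixes p q :: "'c :: comm_ring_1 poly"
  assumes "lead_coeff p = 1" "lead_coeff q = 1"
  shows "degree (p * q) = degree p + degree q" "lead_coeff (p * q) = 1"
proof -
  have "coeff (p * q) (degree p + degree q) = 1" by (simp add: coeff_mult_degree_sum assms)
  then have "degree p + degree q \<le> degree (p * q)" by (intro le_degree) simp
  then show "degree (p * q) = degree p + degree q" using degree_mult_le[of p q] by simp
  then show "lead_coeff (p * q) = 1" by (simp add: coeff_mult_degree_sum assms)
qed

text \<open>On each block the characteristic polynomial itself annihilates \<open>X\<close>, so
  \<open>M = 1\<close> and a single alternation is enough. For the smaller block it is multiplied by
  a power of the indeterminate to reach degree \<open>k\<close>; this is where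
  \<open>l \<le> k\<close> enters.\<close>

lemma even_block_alt_form_zero:
  fixes X :: "'f :: field_char_0 gr rfm"
  assumes "l \<le> k" and X: "even_block k l X" and z: "\<And>i. even_block k l (z i)"
  shows "alt_form (Suc k) X z 1 (\<lambda>_. 0) = 0"
proof -
  obtain \<chi>1 where c1: "degree \<chi>1 = k" "lead_coeff \<chi>1 = 1" "ev.peval X \<chi>1 * rproj 0 k = 0"
    using even_block_char_polys(1)[OF X] by blast
  obtain \<chi>2 where c2: "degree \<chi>2 = l" "lead_coeff \<chi>2 = 1" "ev.peval X \<chi>2 * rproj k l = 0"
    using even_block_char_polys(2)[OF X] by blast
  have "rproj 0 k * alt_form (Suc k) X z 1 (\<lambda>_. 0) = 0"
    by (rule ev.alt_form_vanish[OF rfm_double_zero c1(1,2), where M = 1])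
       (use c1(3) even_block_commute[OF X] even_block_commute[OF z] in auto)
  moreover have "rproj k l * alt_form (Suc k) X z 1 (\<lambda>_. 0) = 0"
  proof (rule ev.alt_form_vanish[OF rfm_double_zero, where M = 1 and \<chi> = "monom 1 (k - l) * \<chi>2"])
    show "degree (monom 1 (k - l) * \<chi>2) = k" "lead_coeff (monom 1 (k - l) * \<chi>2) = 1"
      using monic_mult[of "monom 1 (k - l)" \<chi>2] c2 \<open>l \<le> k\<close> by (auto simp: degree_monom_eq)
    show "ev.peval X (monom 1 (k - l) * \<chi>2) ^ 1 * rproj k l = 0"
      using c2(3) by (simp add: ev.peval_mult mult.assoc)
  qed (use even_block_commute[OF X] even_block_commute[OF z] in auto)
  moreover have "rproj 0 (k + l) * alt_form (Suc k) X z 1 (\<lambda>_. 0) = alt_form (Suc k) X z 1 (\<lambda>_. 0)"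
    using even_block_commute[OF X] even_block_commute[OF z] unfolding rproj_split
    by (intro alt_form_proj) (auto simp: distrib_left distrib_right)
  ultimately show ?thesis unfolding rproj_split distrib_right by simp
qed

definition even_part :: "'f :: field gr rfm \<Rightarrow> 'f gr rfm" where "even_part X = rmap gev X"

lemma coef_gev: "coef (gev g) S = (if even (card S) then coef g S else 0)" by (simp add: gev.rep_eq)
lemma coef_god: "coef (god g) S = (if odd (card S) then coef g S else 0)" by (simp add: god.rep_eq)

lemma gev_zero [simp]: "gev 0 = 0" "god 0 = 0"
  by (auto intro!: gr_eqI simp: coef_gev coef_god)

lemma gr_neq_0: "g \<noteq> 0 \<Longrightarrow> \<exists>S. finite S \<and> coef g S \<noteq> 0"
  by (metis coef_simps(1) gr_eqI)

lemma even_block_even_part: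
  assumes "X \<in> supermats m (block_pos k l) Q"
  shows "even_block k l (even_part X)"
  unfolding even_block_def even_part_def ent_rmap[of gev, OF gev_zero(1)]
proof (intro allI conjI impI)
  fix i j assume "gev (ent X i j) \<noteq> 0"
  then obtain S where "coef (gev (ent X i j)) S \<noteq> 0" using gr_neq_0 by blast
  then have "even (card S)" "coef (ent X i j) S \<noteq> 0" by (auto simp: coef_gev split: if_splits)
  then show "(i, j) \<in> block_pos k l" using assms unfolding supermats_def mem_Collect_eq by metis
qed simp

text \<open>One generator per position carries the whole odd part of that entry, so their number is
  at most \<open>card Q\<close>, however many monomials occur.\<close>

definition odd_units :: "(nat \<times> nat) set \<Rightarrow> 'f :: field gr rfm \<Rightarrow> 'f gr rfm set" where
  "odd_units Q X = (\<lambda>(i, j). runit (god (ent X i j)) i j) ` Q"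

lemma odd_units_sandwich:
  fixes X :: "'f :: field_char_0 gr rfm"
  assumes "w \<in> odd_units Q X" shows "w * y * w = 0"
  using assms by (auto simp: odd_units_def runit_sandwich godd_sandwich)

lemma runit_add: "runit (g + h) a b = runit g a b + runit h a b"
  by (rule rfm_eqI) (simp add: ent_runit)

lemma even_part_cong:
  fixes X :: "'f :: field_char_0 gr rfm"
  assumes X: "X \<in> supermats m P Q" and Q: "Q \<subseteq> {..<h} \<times> {..<h}" and \<Omega>: "odd_units Q X \<subseteq> \<Omega>"
  shows "nil_power \<Omega> 1 (X - even_part X)"
proof -
  have ent: "ent (X - even_part X) i j = god (ent X i j)" for i j
    unfolding even_part_def ent_simps ent_rmap[of gev, OF gev_zero(1)]
    using gev_god[of "ent X i j"] by (simp add: algebra_simps)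
  have out: "god (ent X i j) = 0" if "(i, j) \<notin> Q" for i j
  proof (rule ccontr)
    assume "god (ent X i j) \<noteq> 0"
    then obtain S where "coef (god (ent X i j)) S \<noteq> 0" using gr_neq_0 by blast
    then have "odd (card S)" "coef (ent X i j) S \<noteq> 0" by (auto simp: coef_god split: if_splits)
    then show False using X that unfolding supermats_def mem_Collect_eq by metis
  qed
  have "i < h \<and> j < h" if "god (ent X i j) \<noteq> 0" for i j using out[of i j] Q that by blast
  then have "blocked h (X - even_part X)" unfolding blocked_def ent by blast
  from blocked_sum_runit[OF this] have "X - even_part X = (\<Sum>i<h. \<Sum>j<h. runit (god (ent X i j)) i j)"
    unfolding ent .
  moreover have "nil_power \<Omega> 1 (runit (god (ent X i j)) i j)" for i j
  proof (cases "(i, j) \<in> Q")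
    case True
    then have "runit (god (ent X i j)) i j \<in> \<Omega>" using \<Omega> by (auto simp: odd_units_def)
    then show ?thesis using nil_power.step[OF nil_power.base, of _ \<Omega> 1 1] by simp
  qed (simp add: out nil_power.zero)
  moreover have "nil_power \<Omega> 1 (sum f K)" if "\<And>k. nil_power \<Omega> 1 (f k)" for f and K :: "nat set"
    by (induction K rule: infinite_finite_induct) (auto intro: nil_power.intros that[unfolded One_nat_def])
  ultimately show ?thesis by simp
qed

lemma supermats_rproj:
  assumes "X \<in> supermats m (block_pos k l) Q" "Q \<subseteq> {..<k + l} \<times> {..<k + l}"
  shows "rproj 0 (k + l) * X = X" "X * rproj 0 (k + l) = X"
proof -
  have "i < k + l \<and> j < k + l" if nz: "ent X i j \<noteq> 0" for i j
  proof -
    obtain S where S: "coef (ent X i j) S \<noteq> 0" using gr_neq_0[OF nz] by blast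
    then have "(i, j) \<in> (if even (card S) then block_pos k l else Q)"
      using assms(1) unfolding supermats_def mem_Collect_eq by metis
    with assms(2) show ?thesis by (auto simp: block_pos_def split: if_splits)
  qed
  then have "ent X i j = 0" if "\<not> i < k + l \<or> \<not> j < k + l" for i j using that by blast
  then show "rproj 0 (k + l) * X = X" "X * rproj 0 (k + l) = X"
    by (auto intro!: rfm_eqI)
qed

text \<open>Modulo the odd units of \<open>X\<close> and of \<open>z 0\<close>, ...,
  \<open>z k\<close> the form only involves even blocks and vanishes. These are \<open>k + 2\<close>
  matrices with at most \<open>card Q\<close> odd units each, so a product of more than that many
  values is zero.\<close>

lemma supermats_alt_form_nilpotent:
  fixes X :: "'f :: field_char_0 gr rfm"
  assumes "l \<le> k" and Q: "Q \<subseteq> {..<k + l} \<times> {..<k + l}"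
    and X: "X \<in> supermats m (block_pos k l) Q" and z: "\<And>i. z i \<in> supermats m (block_pos k l) Q"
    and M: "(Suc (Suc k)) * card Q < M"
  shows "alt_form (Suc k) X z 1 (\<lambda>_. 0) ^ M = 0"
proof -
  have finQ: "finite Q" using Q by (rule finite_subset) simp
  define \<Omega> where "\<Omega> = (\<Union>Y\<in>insert X (z ` {..k}). odd_units Q Y)"
  \<comment> \<open>The congruence of alternating forms speaks of all \<open>z i\<close>, whereas
    \<Omega> has to be finite. Cutting \<open>z\<close> off behind the last slot does not change the
    form.\<close>
  define z' where "z' i = (if i \<le> k then z i else 0)" for i
  have fin: "finite \<Omega>" using finQ by (auto simp: \<Omega>_def odd_units_def)
  have "card \<Omega> \<le> (\<Sum>Y\<in>insert X (z ` {..k}). card (odd_units Q Y))"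
    unfolding \<Omega>_def by (rule card_UN_le) simp
  also have "\<dots> \<le> (\<Sum>Y\<in>insert X (z ` {..k}). card Q)"
    by (rule sum_mono) (auto simp: odd_units_def card_image_le finQ)
  also have "\<dots> \<le> Suc (Suc k) * card Q"
  proof -
    have "card (insert X (z ` {..k})) \<le> Suc (card (z ` {..k}))" by (rule card_insert_le_m1) auto
    also have "\<dots> \<le> Suc (Suc k)" using card_image_le[of "{..k}" z] by simp
    finally have "card (insert X (z ` {..k})) * card Q \<le> Suc (Suc k) * card Q" by (rule mult_le_mono1)
    then show ?thesis by simp
  qed
  finally have card: "card \<Omega> < M" using M by simp
  have alt: "alt_form (Suc k) X z r a = alt_form (Suc k) X z' r a" for r a
  proof (induction r arbitrary: a)
    case 0
    show ?case unfolding alt_form.simps slots_def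
      by (intro arg_cong[where f = prod_list] map_cong) (auto simp: z'_def)
  qed simp
  have "nil_power \<Omega> 1 (X - even_part X)"
    by (rule even_part_cong[OF X Q]) (auto simp: \<Omega>_def)
  moreover have "nil_power \<Omega> 1 (z' i - even_part (z' i))" for i
  proof (cases "i \<le> k")
    case True
    then show ?thesis unfolding z'_def using even_part_cong[OF z Q, of i \<Omega>] by (auto simp: \<Omega>_def)
  next
    case False
    have "even_part (0 :: 'f gr rfm) = 0" by (rule rfm_eqI) (simp add: even_part_def ent_rmap)
    with False show ?thesis by (simp add: z'_def nil_power.zero)
  qed
  ultimately have "nil_power \<Omega> 1 (alt_form (Suc k) X z' 1 (\<lambda>_. 0) -
      alt_form (Suc k) (even_part X) (\<lambda>i. even_part (z' i)) 1 (\<lambda>_. 0))"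
    by (rule ideal_cong_alt_form[OF two_sided_nil_power])
  moreover have "even_block k l (even_part (z' i))" for i
  proof (cases "i \<le> k")
    case False
    then show ?thesis by (simp add: z'_def even_block_def even_part_def ent_rmap)
  qed (simp add: z'_def even_block_even_part[OF z])
  then have "alt_form (Suc k) (even_part X) (\<lambda>i. even_part (z' i)) 1 (\<lambda>_. 0) = 0"
    by (intro even_block_alt_form_zero[OF \<open>l \<le> k\<close> even_block_even_part[OF X]])
  ultimately have "nil_power \<Omega> 1 (alt_form (Suc k) X z 1 (\<lambda>_. 0))" by (simp add: alt del: alt_form.simps)
  then have "nil_power \<Omega> M (alt_form (Suc k) X z 1 (\<lambda>_. 0) ^ M)" by (rule nil_power_power)
  moreover have "w * y * w = 0" if "w \<in> \<Omega>" for w y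
    using that odd_units_sandwich by (auto simp: \<Omega>_def)
  ultimately show ?thesis using nil_power_eq_0[OF fin _ _ card] by blast
qed

text \<open>The characteristic polynomials of the two blocks are those of the even part of
  \<open>X\<close>, but their product is evaluated at \<open>X\<close> itself. The value lies in the
  ideal of at most \<open>card Q\<close> odd units, so its power with exponent
  \<open>card Q + 1\<close> is zero, and the bound on \<open>r\<close> is that of
  \<open>alt_form_vanish\<close> for this exponent. The \<open>z i\<close> are not reduced modulo
  the ideal, hence the form itself vanishes and not only a power of it.\<close>

lemma supermats_alt_form_zero:
  fixes X :: "'f :: field_char_0 gr rfm"
  assumes Q: "Q \<subseteq> {..<k + l} \<times> {..<k + l}"
    and X: "X \<in> supermats m (block_pos k l) Q" and z: "\<And>i. z i \<in> supermats m (block_pos k l) Q"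
    and r: "Suc (k + l) * card Q + 1 \<le> r"
  shows "alt_form (Suc (k + l)) X z r (\<lambda>_. 0) = 0"
proof -
  let ?L = "rproj 0 (k + l) :: 'f gr rfm" and ?X = "even_part X"
  have finQ: "finite Q" using Q by (rule finite_subset) simp
  note X0 = even_block_even_part[OF X]
  obtain \<chi>1 where c1: "degree \<chi>1 = k" "lead_coeff \<chi>1 = 1" "ev.peval ?X \<chi>1 * rproj 0 k = 0"
    using even_block_char_polys(1)[OF X0] by blast
  obtain \<chi>2 where c2: "degree \<chi>2 = l" "lead_coeff \<chi>2 = 1" "ev.peval ?X \<chi>2 * rproj k l = 0"
    using even_block_char_polys(2)[OF X0] by blast
  let ?\<chi> = "\<chi>1 * \<chi>2"
  have chi: "degree ?\<chi> = k + l" "lead_coeff ?\<chi> = 1" using monic_mult[of \<chi>1 \<chi>2] c1 c2 by simp_all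
  have "ev.peval ?X ?\<chi> * rproj k l = 0" using c2(3) by (simp add: ev.peval_mult mult.assoc)
  moreover have "ev.peval ?X (\<chi>2 * \<chi>1) * rproj 0 k = 0"
    using c1(3) by (simp only: ev.peval_mult mult.assoc mult_zero_right)
  ultimately have chi0: "ev.peval ?X ?\<chi> * ?L = 0"
    unfolding rproj_split by (simp add: distrib_left mult.commute)
  let ?\<Omega> = "odd_units Q X"
  have fin: "finite ?\<Omega>" and card: "card ?\<Omega> < Suc (card Q)"
    using finQ by (auto simp: odd_units_def le_imp_less_Suc card_image_le)
  have "nil_power ?\<Omega> 1 (X - ?X)" by (rule even_part_cong[OF X Q]) auto
  then have "nil_power ?\<Omega> 1 (ev.peval X ?\<chi> - ev.peval ?X ?\<chi>)"
    unfolding ev.peval_expand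
    by (intro ideal_cong_sum[OF two_sided_nil_power] ideal_cong_mult[OF two_sided_nil_power]
        ideal_cong_power[OF two_sided_nil_power] ideal_cong_refl[OF two_sided_nil_power])
  then have "nil_power ?\<Omega> 1 ((ev.peval X ?\<chi> - ev.peval ?X ?\<chi>) * ?L)" by (rule nil_power_mult_right)
  then have "nil_power ?\<Omega> 1 (ev.peval X ?\<chi> * ?L)" unfolding left_diff_distrib chi0 diff_zero .
  then have "nil_power ?\<Omega> (Suc (card Q)) ((ev.peval X ?\<chi> * ?L) ^ Suc (card Q))" by (rule nil_power_power)
  note N = this
  have nil: "(ev.peval X ?\<chi> * ?L) ^ Suc (card Q) = 0"
    by (rule nil_power_eq_0[OF fin _ N card]) (rule odd_units_sandwich)
  have XL: "X * ?L = ?L * X" using supermats_rproj[OF X Q] by simp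
  have LL: "?L * ?L = ?L" by (rule rfm_eqI) simp
  have "(ev.peval X ?\<chi> * ?L) ^ n * ?L = ev.peval X ?\<chi> ^ n * ?L" for n
  proof (induction n)
    case (Suc n)
    have "(ev.peval X ?\<chi> * ?L) ^ Suc n * ?L = ev.peval X ?\<chi> * (?L * ((ev.peval X ?\<chi> * ?L) ^ n * ?L))"
      by (simp add: mult.assoc)
    also have "\<dots> = ev.peval X ?\<chi> * (?L * (ev.peval X ?\<chi> ^ n * ?L))" by (simp only: Suc.IH)
    also have "ev.peval X ?\<chi> ^ n * ?L = ?L * ev.peval X ?\<chi> ^ n"
      using ev.peval_commute[OF XL] by (metis power_commuting_commutes)
    also have "ev.peval X ?\<chi> * (?L * (?L * ev.peval X ?\<chi> ^ n)) = ev.peval X ?\<chi> * (?L * ev.peval X ?\<chi> ^ n)"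
      by (simp only: mult.assoc[symmetric] LL)
    also have "?L * ev.peval X ?\<chi> ^ n = ev.peval X ?\<chi> ^ n * ?L"
      using ev.peval_commute[OF XL] by (metis power_commuting_commutes)
    finally show ?case by (simp add: mult.assoc)
  qed simp
  then have "ev.peval X ?\<chi> ^ Suc (card Q) * ?L = 0" using nil by (metis mult_zero_left)
  then have "?L * alt_form (Suc (k + l)) X z r (\<lambda>_. 0) = 0"
    using r supermats_rproj[OF X Q] supermats_rproj[OF z Q]
    by (intro ev.alt_form_vanish[OF rfm_double_zero chi, where M = "Suc (card Q)"]) auto
  moreover have "?L * alt_form (Suc (k + l)) X z r (\<lambda>_. 0) = alt_form (Suc (k + l)) X z r (\<lambda>_. 0)"
    using supermats_rproj[OF X Q] supermats_rproj[OF z Q] by (intro alt_form_proj) auto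
  ultimately show ?thesis by simp
qed

section \<open>Identities which separate the algebras\<close>

text \<open>The Leibniz determinant of a coefficient function, over the same permutations of
  \<open>{..<d}\<close> as in \<open>alt_form\<close>.\<close>

definition gdet :: "nat \<Rightarrow> (nat \<Rightarrow> nat \<Rightarrow> 'f :: comm_ring_1) \<Rightarrow> 'f" where
  "gdet d c = (\<Sum>\<sigma> | \<sigma> permutes {..<d}. of_int (sign \<sigma>) * (\<Prod>i<d. c i (\<sigma> i)))"

lemma gdet_nonzero:
  fixes c :: "nat \<Rightarrow> nat \<Rightarrow> 'f :: field"
  assumes "\<And>v. (\<And>i. i < d \<Longrightarrow> (\<Sum>j<d. c i j * v j) = 0) \<Longrightarrow> (\<forall>j<d. v j = 0)"
  shows "gdet d c \<noteq> 0"
proof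
  let ?A = "mat d d (\<lambda>(i, j). c i j)"
  assume "gdet d c = 0"
  moreover have "det ?A = gdet d c"
  proof -
    have "det ?A = (\<Sum>p | p permutes {0..<d}. of_int (sign p) * (\<Prod>i = 0..<d. ?A $$ (i, p i)))"
      by (rule det_def') simp
    also have "\<dots> = (\<Sum>p | p permutes {0..<d}. of_int (sign p) * (\<Prod>i = 0..<d. c i (p i)))"
    proof (rule sum.cong[OF refl])
      fix p assume "p \<in> {p. p permutes {0..<d}}"
      then have "i < d \<Longrightarrow> p i < d" for i by (simp add: permutes_in_image[of p "{0..<d}", simplified])
      then show "of_int (sign p) * (\<Prod>i = 0..<d. ?A $$ (i, p i)) = of_int (sign p) * (\<Prod>i = 0..<d. c i (p i))" by simp
    qed
    finally show ?thesis by (simp add: gdet_def atLeast0LessThan)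
  qed
  ultimately obtain v where v: "v \<in> carrier_vec d" "v \<noteq> 0\<^sub>v d" "?A *\<^sub>v v = 0\<^sub>v d"
    using det_0_iff_vec_prod_zero_field[of ?A d] by auto
  have "(\<Sum>j<d. c i j * v $ j) = 0" if "i < d" for i
  proof -
    have "(?A *\<^sub>v v) $ i = (\<Sum>j<d. c i j * v $ j)"
      using that v(1) by (simp add: scalar_prod_def atLeast0LessThan)
    then show ?thesis using that by (simp add: v(3))
  qed
  then have "\<forall>j<d. v $ j = 0" by (rule assms)
  then have "v = 0\<^sub>v d" using v(1) by (intro eq_vecI) auto
  with v(2) show False by simp
qed

lemma poly_from_coeffs:
  fixes v :: "nat \<Rightarrow> 'f :: field"
  assumes "0 < d"
  obtains p where "\<And>j. coeff p j = (if j < d then v j else 0)" "degree p < d"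
    "\<And>x. poly p x = (\<Sum>j<d. x ^ j * v j)"
proof
  let ?p = "\<Sum>j<d. monom (v j) j"
  show c: "coeff ?p j = (if j < d then v j else 0)" for j
    by (simp add: coeff_sum)
  show "degree ?p < d" using assms c by (metis leading_coeff_0_iff degree_0)
  show "poly ?p x = (\<Sum>j<d. x ^ j * v j)" for x
    by (simp add: poly_sum poly_monom mult.commute)
qed

text \<open>A kernel vector is the coefficient list of a polynomial of degree below \<open>d\<close>
  with the \<open>d\<close> roots \<open>t i\<close>.\<close>

lemma vandermonde_nonzero:
  fixes t :: "nat \<Rightarrow> 'f :: field"
  assumes "inj_on t {..<d}"
  shows "gdet d (\<lambda>i j. t i ^ j) \<noteq> 0"
proof (rule gdet_nonzero)
  fix v assume v: "\<And>i. i < d \<Longrightarrow> (\<Sum>j<d. t i ^ j * v j) = 0"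
  show "\<forall>j<d. v j = 0"
  proof (cases "d = 0")
    case False
    then obtain p where p: "\<And>j. coeff p j = (if j < d then v j else 0)" "degree p < d"
      "\<And>x. poly p x = (\<Sum>j<d. x ^ j * v j)" using poly_from_coeffs by blast
    have "p = 0"
    proof (rule ccontr)
      assume "p \<noteq> 0"
      then have "card {x. poly p x = 0} \<le> degree p" "finite {x. poly p x = 0}"
        by (simp_all add: card_poly_roots_bound poly_roots_finite)
      moreover have "t ` {..<d} \<subseteq> {x. poly p x = 0}" using v p(3) by auto
      ultimately have "card (t ` {..<d}) \<le> degree p" using card_mono by (metis le_trans)
      then show False using p(2) assms by (simp add: card_image)
    qed
    with p(1) show ?thesis by (metis coeff_0)
  qed simp
qed

section \<open>Evaluation of noncommutative polynomials at matrices\<close>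

definition rsc :: "'f :: field \<Rightarrow> 'f gr rfm" where "rsc c = rscal (gconst c)"

lemma ent_rsc_mult [simp]: "ent (rsc c * X) i j = gscale c (ent X i j)"
  by (simp add: rsc_def gscale_mult)

lemma rsc_central: "rsc c * X = X * rsc c"
  unfolding rsc_def by (rule rscal_commute) (simp add: gscale_mult mult.commute)

lemma rsc_left_commute: "X * (rsc c * Y) = rsc c * (X * Y)"
  by (metis mult.assoc rsc_central)

lemma rsc_simps [simp]: "rsc 0 = 0" "rsc 1 = 1" "rsc c * rsc d = rsc (c * d)" "rsc (- 1) = - 1"
  by (auto simp: rsc_def rdiag_mult gscale_mult rscal_zero rdiag_one intro!: rfm_eqI)
     (auto simp: ent_rdiag ent_one mult.commute)

lemma rsc_product: "(rsc c * X) * (rsc d * Y) = rsc (c * d) * (X * Y)"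
  by (metis mult.assoc rsc_left_commute rsc_simps(3))

lemma rsc_uminus: "rsc (- c) * X = - (rsc c * X)"
  by (rule rfm_eqI) (auto intro!: gr_eqI)

lemma rsc_add: "rsc (c + d) = rsc c + rsc d"
  by (simp add: rsc_def gscale_add rscal_add)

lemma rsc_runit: "rsc c * runit g a b = runit (gscale c g) a b"
  by (rule rfm_eqI) (simp add: ent_runit)

definition meval :: "(nat list \<Rightarrow>\<^sub>0 'f :: field) \<Rightarrow> (nat \<Rightarrow> 'f gr rfm) \<Rightarrow> 'f gr rfm" where
  "meval f \<rho> = (\<Sum>w\<in>Poly_Mapping.keys f. rsc (Poly_Mapping.lookup f w) * prod_list (map \<rho> w))"

lemma meval_superset:
  assumes "finite W" "Poly_Mapping.keys f \<subseteq> W"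
  shows "meval f \<rho> = (\<Sum>w\<in>W. rsc (Poly_Mapping.lookup f w) * prod_list (map \<rho> w))"
  unfolding meval_def using assms
  by (intro sum.mono_neutral_left) (auto simp: in_keys_iff)

lemma meval_zero [simp]: "meval 0 \<rho> = 0" by (simp add: meval_def)

lemma meval_add: "meval (f + g) \<rho> = meval f \<rho> + meval g \<rho>"
proof -
  let ?W = "Poly_Mapping.keys f \<union> Poly_Mapping.keys g"
  have "Poly_Mapping.keys (f + g) \<subseteq> ?W" by (rule Poly_Mapping.keys_add)
  then show ?thesis
    by (simp add: meval_superset[of ?W] lookup_add rsc_add distrib_right sum.distrib)
qed

lemma meval_single: "meval (Poly_Mapping.single w c) \<rho> = rsc c * prod_list (map \<rho> w)"
  by (subst meval_superset[of "{w}"]) auto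

lemma meval_sum: "meval (sum f I) \<rho> = (\<Sum>i\<in>I. meval (f i) \<rho>)"
  by (induction I rule: infinite_finite_induct) (auto simp: meval_add)

definition mat_identities :: "'f :: field gr rfm set \<Rightarrow> (nat list \<Rightarrow>\<^sub>0 'f) set" where
  "mat_identities R = {f. Poly_Mapping.lookup f [] = 0 \<and> (\<forall>\<rho>. range \<rho> \<subseteq> R \<longrightarrow> meval f \<rho> = 0)}"

text \<open>The closure properties of this predicate replace explicit coefficients: a separating
  polynomial is given by an expression for its values.\<close>

definition expressible :: "((nat \<Rightarrow> 'f :: field gr rfm) \<Rightarrow> 'f gr rfm) \<Rightarrow> bool" where
  "expressible E \<longleftrightarrow> (\<exists>f. Poly_Mapping.lookup f [] = 0 \<and> (\<forall>\<rho>. meval f \<rho> = E \<rho>))"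

lemma expressibleI:
  assumes "finite I" "\<And>t. t \<in> I \<Longrightarrow> w t \<noteq> []"
    and "\<And>\<rho>. E \<rho> = (\<Sum>t\<in>I. rsc (c t) * prod_list (map \<rho> (w t)))"
  shows "expressible E"
  unfolding expressible_def
proof (intro exI conjI allI)
  let ?f = "\<Sum>t\<in>I. Poly_Mapping.single (w t) (c t)"
  show "Poly_Mapping.lookup ?f [] = 0"
    using assms(2) by (simp add: lookup_sum lookup_single)
  show "meval ?f \<rho> = E \<rho>" for \<rho> by (simp add: meval_sum meval_single assms(3))
qed

lemma expressible_var: "expressible (\<lambda>\<rho>. \<rho> i)"
  by (rule expressibleI[of "{()}" "\<lambda>_. [i]" _ "\<lambda>_. 1"]) auto

lemma expressible_zero: "expressible (\<lambda>\<rho>. 0)"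
  by (rule expressibleI[of "{}"]) auto

lemma expressible_add: "expressible E \<Longrightarrow> expressible E' \<Longrightarrow> expressible (\<lambda>\<rho>. E \<rho> + E' \<rho>)"
  unfolding expressible_def by (metis (no_types, lifting) lookup_add add_0 meval_add)

lemma lookup_Nil_keys: "Poly_Mapping.lookup f [] = 0 \<Longrightarrow> w \<in> Poly_Mapping.keys f \<Longrightarrow> w \<noteq> []"
  by (auto simp: in_keys_iff)

lemma expressible_mult:
  assumes "expressible E" "expressible E'" shows "expressible (\<lambda>\<rho>. E \<rho> * E' \<rho>)"
proof -
  from assms obtain f g where f: "Poly_Mapping.lookup f [] = 0" "\<And>\<rho>. meval f \<rho> = E \<rho>"
    and g: "Poly_Mapping.lookup g [] = 0" "\<And>\<rho>. meval g \<rho> = E' \<rho>" unfolding expressible_def by blast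
  show ?thesis
  proof (rule expressibleI[of "Poly_Mapping.keys f \<times> Poly_Mapping.keys g" "\<lambda>(u, v). u @ v" _
        "\<lambda>(u, v). Poly_Mapping.lookup f u * Poly_Mapping.lookup g v"])
    fix \<rho>
    have "E \<rho> * E' \<rho> = (\<Sum>u\<in>Poly_Mapping.keys f. \<Sum>v\<in>Poly_Mapping.keys g.
       rsc (Poly_Mapping.lookup f u * Poly_Mapping.lookup g v) * (prod_list (map \<rho> u) * prod_list (map \<rho> v)))"
      unfolding f(2)[symmetric] g(2)[symmetric] meval_def sum_product
      by (intro sum.cong refl) (rule rsc_product)
    then show "E \<rho> * E' \<rho> = (\<Sum>t\<in>Poly_Mapping.keys f \<times> Poly_Mapping.keys g.
        rsc (case t of (u, v) \<Rightarrow> Poly_Mapping.lookup f u * Poly_Mapping.lookup g v) *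
        prod_list (map \<rho> (case t of (u, v) \<Rightarrow> u @ v)))"
      by (simp add: sum.cartesian_product case_prod_beta)
  qed (auto dest: lookup_Nil_keys[OF f(1)])
qed

lemma expressible_uminus: assumes "expressible E" shows "expressible (\<lambda>\<rho>. - E \<rho>)"
proof -
  from assms obtain f where f: "Poly_Mapping.lookup f [] = 0" "\<And>\<rho>. meval f \<rho> = E \<rho>"
    unfolding expressible_def by blast
  show ?thesis
    by (rule expressibleI[of "Poly_Mapping.keys f" "\<lambda>w. w" _ "\<lambda>w. - Poly_Mapping.lookup f w"])
       (auto simp: f(2)[symmetric] meval_def rsc_uminus sum_negf dest: lookup_Nil_keys[OF f(1)])
qed

lemma expressible_sum: "(\<And>i. i \<in> I \<Longrightarrow> expressible (E i)) \<Longrightarrow> expressible (\<lambda>\<rho>. \<Sum>i\<in>I. E i \<rho>)"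
  by (induction I rule: infinite_finite_induct) (auto intro: expressible_zero expressible_add)

lemma expressible_prod_list:
  "xs \<noteq> [] \<Longrightarrow> (\<And>i. i \<in> set xs \<Longrightarrow> expressible (E i)) \<Longrightarrow> expressible (\<lambda>\<rho>. prod_list (map (\<lambda>i. E i \<rho>) xs))"
proof (induction xs rule: list_nonempty_induct)
  case (cons x xs)
  then show ?case by (auto intro!: expressible_mult)
qed simp

text \<open>The extra factor is there because \<open>E \<rho> ^ 0 = 1\<close> is not the value of a
  polynomial without constant term.\<close>

lemma expressible_power_mult:
  "expressible E \<Longrightarrow> expressible E' \<Longrightarrow> expressible (\<lambda>\<rho>. E \<rho> ^ n * E' \<rho>)"
  by (induction n) (auto simp: mult.assoc intro: expressible_mult)

lemma expressible_alt_form: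
  assumes "0 < d" "expressible X" "\<And>i. expressible (Z i)"
  shows "expressible (\<lambda>\<rho>. alt_form d (X \<rho>) (\<lambda>i. Z i \<rho>) r a)"
proof (induction r arbitrary: a)
  case 0
  show ?case unfolding alt_form.simps slots_def
    using assms by (intro expressible_prod_list expressible_power_mult) auto
next
  case (Suc r)
  have "expressible (\<lambda>\<rho>. of_int (sign \<sigma>) * alt_form d (X \<rho>) (\<lambda>i. Z i \<rho>) r (\<lambda>i. a i + \<sigma> i))" for \<sigma>
    by (cases \<sigma> rule: sign_cases) (use Suc in \<open>simp_all add: expressible_uminus\<close>)
  then show ?case unfolding alt_form.simps by (intro expressible_sum)
qed

lemma expressible_separates:
  assumes "expressible E" "\<And>\<rho>. range \<rho> \<subseteq> R \<Longrightarrow> E \<rho> = 0" "range \<rho>' \<subseteq> R'" "E \<rho>' \<noteq> 0"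
  shows "\<not> mat_identities R \<subseteq> mat_identities R'"
proof -
  from assms(1) obtain f where f: "Poly_Mapping.lookup f [] = 0" "\<And>\<rho>. meval f \<rho> = E \<rho>"
    unfolding expressible_def by auto
  have "f \<in> mat_identities R" using assms(2) f by (simp add: mat_identities_def)
  moreover have "f \<notin> mat_identities R'" using assms(3,4) f by (auto simp: mat_identities_def)
  ultimately show ?thesis by blast
qed

section \<open>Values on diagonal matrices and paths of matrix units\<close>

lemma slots_path:
  assumes "0 < d" "\<And>i. i < d \<Longrightarrow> z i = runit (g i) (p i) (p (Suc i))"
  shows "slots d (\<lambda>i. rdiag y ^ a i) z =
    runit (prod_list (map (\<lambda>i. y (p i) ^ a i * g i) [0..<d])) (p 0) (p d)"
  using assms
proof (induction d rule: nat_induct_non_zero)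
  case 1
  then show ?case by (simp add: slots_def rdiag_power rdiag_runit)
next
  case (Suc d)
  have "slots (Suc d) (\<lambda>i. rdiag y ^ a i) z = slots d (\<lambda>i. rdiag y ^ a i) z * (rdiag y ^ a d * z d)"
    by (simp add: slots_def)
  then show ?case using Suc by (simp add: rdiag_power rdiag_runit runit_mult)
qed

lemma prod_list_gscale: "prod_list (map (\<lambda>i. gscale (c i) (g i)) xs) = gscale (prod_list (map c xs)) (prod_list (map g xs))"
  by (induction xs) (auto simp: gscale_mult mult.commute)

lemma prod_list_upt: "prod_list (map c [0..<d]) = (\<Prod>i<d. c i :: 'f :: comm_ring_1)"
  by (induction d) (auto simp: mult.commute)

lemma gconst_power: "gconst c ^ n = gconst (c ^ n)"
  by (induction n) (auto simp: gscale_mult mult.commute)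

lemma runit_sum: "(\<Sum>i\<in>I. runit (g i) a b) = runit (\<Sum>i\<in>I. g i) a b"
  by (induction I rule: infinite_finite_induct) (auto simp: runit_add)

lemma gscale_sum_left: "(\<Sum>i\<in>I. gscale (c i) g) = gscale (\<Sum>i\<in>I. c i) g"
  by (induction I rule: infinite_finite_induct) (auto simp: gscale_add)

lemma of_int_sign_runit: "of_int (sign \<sigma>) * runit g a b = runit (gscale (of_int (sign \<sigma>)) g) a b"
  by (cases \<sigma> rule: sign_cases) (auto intro!: rfm_eqI simp: ent_runit)

text \<open>The slot at the vertex \<open>p i\<close> reads off the power of \<open>t i\<close>
  given by its exponent, so every alternation multiplies the value by the Leibniz sum of the matrix
  of the powers \<open>t i ^ j\<close>.\<close>

lemma alt_form_path:
  assumes "0 < d" and z: "\<And>i. i < d \<Longrightarrow> z i = runit (g i) (p i) (p (Suc i))"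
    and y: "\<And>i. i < d \<Longrightarrow> y (p i) = gconst (t i)"
  shows "alt_form d (rdiag y) z r a = runit (gscale ((\<Prod>i<d. t i ^ a i) * gdet d (\<lambda>i j. t i ^ j) ^ r)
    (prod_list (map g [0..<d]))) (p 0) (p d)"
proof (induction r arbitrary: a)
  case 0
  have "map (\<lambda>i. y (p i) ^ a i * g i) [0..<d] = map (\<lambda>i. gscale (t i ^ a i) (g i)) [0..<d]"
    by (auto simp: y gconst_power gscale_mult)
  then show ?case
    using slots_path[OF assms(1), of z g p y a] z
    by (simp add: prod_list_gscale prod_list_upt del: map_eq_conv)
next
  case (Suc r)
  show ?case unfolding alt_form.simps Suc.IH of_int_sign_runit runit_sum gscale_simps gscale_sum_left gdet_def power_Suc
    by (rule arg_cong[where f = "\<lambda>c. runit (gscale c _) _ _"])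
       (simp add: sum_distrib_left sum_distrib_right power_add prod.distrib mult_ac)
qed

lemma grassmann_index_empty [simp]: "{} \<in> grassmann_index m"
  by (simp add: grassmann_index_def)

lemma supermatsI:
  assumes "finite F" "\<And>i j S. coef (ent X i j) S \<noteq> 0 \<Longrightarrow> (i, j, S) \<in> F"
    and "\<And>i j S. coef (ent X i j) S \<noteq> 0 \<Longrightarrow> S \<in> grassmann_index m \<and> (i, j) \<in> (if even (card S) then P else Q)"
  shows "X \<in> supermats m P Q"
proof -
  have "{(i, j, S). coef (ent X i j) S \<noteq> 0} \<subseteq> F" using assms(2) by blast
  then have "finite {(i, j, S). coef (ent X i j) S \<noteq> 0}" using assms(1) by (rule finite_subset)
  then show ?thesis using assms(3) unfolding supermats_def by blast
qed

lemma supermats_zero [simp]: "0 \<in> supermats m P Q"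
  by (rule supermatsI[of "{}"]) auto

lemma supermats_runit:
  assumes "S \<in> grassmann_index m" "(a, b) \<in> (if even (card S) then P else Q)"
  shows "runit (ge S) a b \<in> supermats m P Q"
proof -
  have "finite S" using assms(1) by (simp add: grassmann_index_def)
  then have *: "coef (ent (runit (ge S) a b) i j) T = (if i = a \<and> j = b \<and> T = S then 1 else 0)" for i j T
    by (simp add: ent_runit coef_ge)
  show ?thesis
    by (rule supermatsI[of "{(a, b, S)}"]) (use assms in \<open>auto simp: * split: if_splits\<close>)
qed

lemma supermats_runit_1:
  "(a, b) \<in> P \<Longrightarrow> runit 1 a b \<in> supermats m P Q"
  using supermats_runit[of "{}" m a b P Q] by (simp add: ge_empty)

lemma supermats_runit_gen:
  "(a, b) \<in> Q \<Longrightarrow> 1 \<le> s \<Longrightarrow> enat s \<le> m \<Longrightarrow> runit (ge {s}) a b \<in> supermats m P Q"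
  using supermats_runit[of "{s}" m a b P Q] by (simp add: grassmann_index_def)

lemma supermats_diag:
  assumes "\<And>i. i < h \<Longrightarrow> (i, i) \<in> P"
  shows "rdiag (\<lambda>i. if i < h then gconst (t i) else 0) \<in> supermats m P Q"
proof -
  have *: "coef (ent (rdiag (\<lambda>i. if i < h then gconst (t i) else 0)) i j) S =
     (if i = j \<and> i < h \<and> S = {} then t i else 0)" for i j S
    by (simp add: ent_rdiag coef_one)
  show ?thesis
    by (rule supermatsI[of "(\<lambda>i. (i, i, {})) ` {..<h}"]) (use assms in \<open>auto simp: * split: if_splits\<close>)
qed

text \<open>The positions of the even monomials are \<open>block_pos k l\<close>, those of the odd ones are \<open>Q\<close>. The first
  possibility for \<open>Q\<close> belongs to \<open>M\<^bsub>k,l\<^esub>\<close>, the second to \<open>M\<^sub>k(F Z\<^sub>2)\<close>.\<close>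

definition admissible :: "nat \<Rightarrow> nat \<Rightarrow> (nat \<times> nat) set \<Rightarrow> bool" where
  "admissible k l Q \<longleftrightarrow> 0 < k \<and> l \<le> k \<and> (Q = off_pos k l \<or> l = 0 \<and> Q = block_pos k 0)"

lemma admissible_subset: "admissible k l Q \<Longrightarrow> Q \<subseteq> {..<k + l} \<times> {..<k + l}"
  by (auto simp: admissible_def off_pos_def block_pos_def)

lemma inj_of_nat_gconst: "inj_on (\<lambda>i. of_nat (p i) :: 'f :: field_char_0) {..<d}" if "inj_on p {..<d}"
  using that by (auto simp: inj_on_def)

lemma prod_list_ones: "(\<And>x. x \<in> set xs \<Longrightarrow> g x = 1) \<Longrightarrow> prod_list (map g xs) = (1 :: 'q :: monoid_mult)"
  by (induction xs) auto

lemma gscale_eq_0: "gscale c g = 0 \<longleftrightarrow> c = 0 \<or> g = 0"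
proof (cases "c = 0")
  case False
  then have "gscale (inverse c) (gscale c g) = g" by simp
  then show ?thesis by (metis False gscale_simps(3))
qed simp

abbreviation dvar :: "'f :: field_char_0 itself \<Rightarrow> nat \<Rightarrow> 'f gr rfm" where
  "dvar _ h \<equiv> rdiag (\<lambda>i. if i < h then gconst (of_nat i) else 0)"

lemma identities_bound_block:
  assumes R: "admissible k l Q" and R': "admissible k' l' Q'" and "k < k'"
  shows "\<not> mat_identities (supermats m (block_pos k l) Q :: 'f :: field_char_0 gr rfm set)
     \<subseteq> mat_identities (supermats m' (block_pos k' l') Q')"
proof -
  \<comment> \<open>One more than the bound on the number of odd units in
    \<open>supermats_alt_form_nilpotent\<close>.\<close>
  define M where "M = Suc (Suc (Suc k) * card Q)"
  define E where "E \<rho> = alt_form (Suc k) (\<rho> 0) (\<lambda>i. \<rho> (Suc i)) 1 (\<lambda>_. 0) ^ M" for \<rho> :: "nat \<Rightarrow> 'f gr rfm"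
  \<comment> \<open>The path visits the \<open>k + 1\<close> vertices 0, ..., \<open>k\<close>, all
    inside the larger block, and returns to 0. Being closed, it gives a multiple of the idempotent
    at position (0, 0), whose powers are nonzero.\<close>
  define p where "p i = (if i \<le> k then i else 0)" for i :: nat
  define \<rho>' where "\<rho>' i = (case i of 0 \<Rightarrow> dvar TYPE('f) k' | Suc i \<Rightarrow> if i \<le> k then runit 1 (p i) (p (Suc i)) else 0)" for i
  show ?thesis
  proof (rule expressible_separates[of E _ \<rho>'])
    have "expressible (\<lambda>\<rho>. alt_form (Suc k) (\<rho> 0) (\<lambda>i. \<rho> (Suc i)) 1 (\<lambda>_. 0))"
      by (intro expressible_alt_form expressible_var) simp
    note * = this
    show "expressible E" unfolding E_def M_def power_Suc2 by (rule expressible_power_mult[OF * *])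
    fix \<rho> :: "nat \<Rightarrow> 'f gr rfm" assume "range \<rho> \<subseteq> supermats m (block_pos k l) Q"
    then show "E \<rho> = 0" unfolding E_def
      using R by (intro supermats_alt_form_nilpotent[OF _ admissible_subset[OF R]]) (auto simp: M_def admissible_def)
  next
    show "range \<rho>' \<subseteq> supermats m' (block_pos k' l') Q'"
      using \<open>k < k'\<close> by (auto simp: \<rho>'_def p_def block_pos_def split: nat.splits
          intro!: supermats_diag supermats_runit_1)
    have "alt_form (Suc k) (\<rho>' 0) (\<lambda>i. \<rho>' (Suc i)) 1 (\<lambda>_. 0) =
        runit (gscale ((\<Prod>i<Suc k. (of_nat i) ^ 0) * gdet (Suc k) (\<lambda>i j. (of_nat i :: 'f) ^ j) ^ 1)
          (prod_list (map (\<lambda>_. 1) [0..<Suc k]))) (p 0) (p (Suc k))"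
      unfolding \<rho>'_def nat.case using \<open>k < k'\<close> by (intro alt_form_path) (auto simp: p_def)
    also have "\<dots> = runit (gconst (gdet (Suc k) (\<lambda>i j. (of_nat i :: 'f) ^ j))) 0 0"
      by (subst prod_list_ones) (auto simp: p_def)
    finally have "E \<rho>' = runit (gconst (gdet (Suc k) (\<lambda>i j. (of_nat i :: 'f) ^ j))) 0 0 ^ M"
      by (simp add: E_def)
    moreover have "runit g 0 0 ^ Suc n = runit (g ^ Suc n) 0 0" for g :: "'f gr" and n
      by (induction n) (auto simp: runit_mult)
    ultimately have "E \<rho>' = runit (gconst (gdet (Suc k) (\<lambda>i j. (of_nat i :: 'f) ^ j) ^ M)) 0 0"
      unfolding M_def gconst_power[symmetric] by simp
    then show "E \<rho>' \<noteq> 0"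
      using vandermonde_nonzero[OF inj_of_nat_gconst[of "\<lambda>i. i" "Suc k"], where 'f1 = 'f]
      by (simp add: gscale_eq_0)
  qed
qed

text \<open>A path through all of \<open>0\<close>, ..., \<open>k + l\<close> may have to leave the
  first block of the second algebra, which costs one odd generator. Its square is zero, so the test
  uses one value of a repeatedly alternated form instead of a power.\<close>

lemma identities_bound_size:
  assumes R: "admissible k l Q" and R': "admissible k' l' Q'" and h: "k + l < k' + l'" and m': "1 \<le> m'"
  shows "\<not> mat_identities (supermats m (block_pos k l) Q :: 'f :: field_char_0 gr rfm set)
     \<subseteq> mat_identities (supermats m' (block_pos k' l') Q')"
proof -
  define d where "d = Suc (k + l)"
  define r where "r = Suc (Suc (k + l) * card Q)"
  define E where "E \<rho> = alt_form d (\<rho> 0) (\<lambda>i. \<rho> (Suc i)) r (\<lambda>_. 0)" for \<rho> :: "nat \<Rightarrow> 'f gr rfm"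
  \<comment> \<open>Vertices 0, ..., \<open>d - 1\<close> in this order; the last step is a loop at
    \<open>d - 1\<close>, so that it stays inside a block.\<close>
  define p where "p i = (if i < d then i else d - 1)" for i :: nat
  \<comment> \<open>The step from \<open>k' - 1\<close> to \<open>k'\<close> is the only one that
    changes blocks, and it is taken only if \<open>k' < d\<close>. The product of the coefficients
    is therefore the first generator or 1.\<close>
  define g where "g i = (if Suc i = k' \<and> Suc i < d then ge {1} else 1 :: 'f gr)" for i
  define \<rho>' where "\<rho>' i = (case i of 0 \<Rightarrow> dvar TYPE('f) (k' + l') |
    Suc i \<Rightarrow> if i < d then runit (g i) (p i) (p (Suc i)) else 0)" for i
  have d: "d \<le> k' + l'" "0 < d" using h by (auto simp: d_def)
  show ?thesis
  proof (rule expressible_separates[of E _ \<rho>'])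
    show "expressible E" unfolding E_def
      by (intro expressible_alt_form expressible_var) (simp add: d_def)
    fix \<rho> :: "nat \<Rightarrow> 'f gr rfm" assume "range \<rho> \<subseteq> supermats m (block_pos k l) Q"
    then show "E \<rho> = 0" unfolding E_def d_def
      by (intro supermats_alt_form_zero[OF admissible_subset[OF R]]) (auto simp: r_def)
  next
    have "runit (g i) (p i) (p (Suc i)) \<in> supermats m' (block_pos k' l') Q'" if "i < d" for i
    proof (cases "Suc i = k' \<and> Suc i < d")
      case True
      then have "l' \<noteq> 0" using d by auto
      then have "(p i, p (Suc i)) \<in> Q'" using True d that R' by (auto simp: p_def admissible_def off_pos_def)
      then have "runit (ge {1}) (p i) (p (Suc i)) \<in> supermats m' (block_pos k' l') Q'"
        using m' by (intro supermats_runit_gen) (auto simp: one_enat_def)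
      with True show ?thesis by (simp add: g_def)
    next
      case False
      then have "g i = 1" by (auto simp: g_def)
      moreover have "(p i, p (Suc i)) \<in> block_pos k' l'"
        using that d False by (cases "Suc i < d") (auto simp: p_def block_pos_def)
      ultimately show ?thesis using supermats_runit_1[of _ _ "block_pos k' l'"] by simp
    qed
    then show "range \<rho>' \<subseteq> supermats m' (block_pos k' l') Q'"
      by (auto simp: \<rho>'_def block_pos_def split: nat.splits intro!: supermats_diag)
    have "E \<rho>' = runit (gscale ((\<Prod>i<d. (of_nat i) ^ 0) * gdet d (\<lambda>i j. (of_nat i :: 'f) ^ j) ^ r)
          (prod_list (map g [0..<d]))) (p 0) (p d)"
      unfolding E_def \<rho>'_def nat.case using d by (intro alt_form_path) (auto simp: p_def)
    moreover have "prod_list (map g [0..<d]) \<noteq> 0"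
    proof -
      have "prod_list (map g [0..<n]) = (if k' < d \<and> k' \<le> n then ge {1} else 1)" if "n \<le> d" for n
        using that R' by (induction n) (auto simp: g_def admissible_def)
      moreover have "(ge {1} :: 'f gr) \<noteq> 0" using coef_ge[of "{1}" "{1}"] by (metis coef_simps(1) finite.simps zero_neq_one)
      ultimately show ?thesis by auto
    qed
    ultimately show "E \<rho>' \<noteq> 0"
      using vandermonde_nonzero[OF inj_of_nat_gconst[of "\<lambda>i. i" d], where 'f1 = 'f]
      by (simp add: gscale_eq_0)
  qed
qed

section \<open>Degrees in the generators, and products of alternating forms\<close>

definition gdeg :: "nat \<Rightarrow> 'f :: field gr \<Rightarrow> bool" where
  "gdeg n g \<longleftrightarrow> (\<forall>S. coef g S \<noteq> 0 \<longrightarrow> n \<le> card S)"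

definition rdeg :: "nat \<Rightarrow> 'f :: field gr rfm \<Rightarrow> bool" where
  "rdeg n X \<longleftrightarrow> (\<forall>i j. gdeg n (ent X i j))"

lemma coef_mult_nonzero:
  assumes "coef (g * h) U \<noteq> 0"
  obtains S T where "coef g S \<noteq> 0" "coef h T \<noteq> 0" "S \<inter> T = {}" "S \<union> T = U" "finite U"
proof -
  have fin: "finite U" using assms coef_infinite by blast
  from assms obtain S where "S \<in> Pow U" "shuffle_sign S (U - S) * coef g S * coef h (U - S) \<noteq> 0"
    unfolding times_gr.rep_eq by (meson sum.not_neutral_contains_not_neutral)
  then show ?thesis using that[of S "U - S"] fin by auto
qed

lemma gdeg_mult: "gdeg a g \<Longrightarrow> gdeg b h \<Longrightarrow> gdeg (a + b) (g * h)"
  unfolding gdeg_def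
proof (intro allI impI)
  fix U assume *: "\<forall>S. coef g S \<noteq> 0 \<longrightarrow> a \<le> card S" "\<forall>S. coef h S \<noteq> 0 \<longrightarrow> b \<le> card S" and nz: "coef (g * h) U \<noteq> 0"
  obtain S T where "coef g S \<noteq> 0" "coef h T \<noteq> 0" "S \<inter> T = {}" "S \<union> T = U" "finite U"
    by (rule coef_mult_nonzero[OF nz])
  then show "a + b \<le> card U" using * by (metis add_mono card_Un_disjoint finite_Un)
qed

lemma gdeg_sum: "(\<And>i. i \<in> I \<Longrightarrow> gdeg n (f i)) \<Longrightarrow> gdeg n (sum f I)"
  unfolding gdeg_def coef_sum by (meson sum.not_neutral_contains_not_neutral)

lemma rdeg_mult: "rdeg a X \<Longrightarrow> rdeg b Y \<Longrightarrow> rdeg (a + b) (X * Y)"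
  unfolding rdeg_def times_rfm.rep_eq by (auto intro!: gdeg_sum gdeg_mult)

lemma rdeg_prod_list: "(\<And>x. x \<in> set xs \<Longrightarrow> rdeg n (f x)) \<Longrightarrow> rdeg (length xs * n) (prod_list (map f xs))"
proof (induction xs)
  case Nil
  show ?case by (simp add: rdeg_def gdeg_def)
next
  case (Cons x xs)
  then show ?case using rdeg_mult[of n "f x" "length xs * n" "prod_list (map f xs)"] by simp
qed

definition indexed :: "enat \<Rightarrow> 'f :: field gr rfm \<Rightarrow> bool" where
  "indexed m X \<longleftrightarrow> (\<forall>i j S. coef (ent X i j) S \<noteq> 0 \<longrightarrow> S \<in> grassmann_index m)"

lemma indexed_mult: "indexed m X \<Longrightarrow> indexed m Y \<Longrightarrow> indexed m (X * Y)"
  unfolding indexed_def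
proof (intro allI impI)
  fix i j U
  assume X: "\<forall>i j S. coef (ent X i j) S \<noteq> 0 \<longrightarrow> S \<in> grassmann_index m"
    and Y: "\<forall>i j S. coef (ent Y i j) S \<noteq> 0 \<longrightarrow> S \<in> grassmann_index m" and nz: "coef (ent (X * Y) i j) U \<noteq> 0"
  from nz obtain k where nz': "coef (ent X i k * ent Y k j) U \<noteq> 0"
    unfolding times_rfm.rep_eq coef_sum by (meson sum.not_neutral_contains_not_neutral)
  obtain S T where "coef (ent X i k) S \<noteq> 0" "coef (ent Y k j) T \<noteq> 0" "S \<union> T = U"
    by (rule coef_mult_nonzero[OF nz'])
  then show "U \<in> grassmann_index m" using X Y by (fastforce simp: grassmann_index_def)
qed

lemma indexed_simps: "indexed m 0" "indexed m 1" "indexed m X \<Longrightarrow> indexed m (- X)"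
  "indexed m X \<Longrightarrow> indexed m Y \<Longrightarrow> indexed m (X + Y)"
  by (auto simp: indexed_def ent_one coef_one split: if_splits) (metis add.right_neutral)

lemma indexed_sum: "(\<And>i. i \<in> I \<Longrightarrow> indexed m (f i)) \<Longrightarrow> indexed m (sum f I)"
  by (induction I rule: infinite_finite_induct) (auto simp: indexed_simps)

lemma indexed_prod_list: "(\<And>i. i \<in> set xs \<Longrightarrow> indexed m (f i)) \<Longrightarrow> indexed m (prod_list (map f xs))"
  by (induction xs) (auto simp: indexed_simps indexed_mult)

lemma indexed_alt_form:
  assumes "indexed m x" "\<And>i. indexed m (z i)" shows "indexed m (alt_form d x z r a)"
proof (induction r arbitrary: a)
  case 0
  have "indexed m (x ^ n)" for n by (induction n) (auto simp: indexed_simps indexed_mult assms)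
  then show ?case using assms by (auto simp: slots_def intro!: indexed_prod_list indexed_mult)
next
  case (Suc r)
  have "indexed m (of_int (sign \<sigma>) * alt_form d x z r (\<lambda>i. a i + \<sigma> i))" for \<sigma>
    by (cases \<sigma> rule: sign_cases) (use Suc in \<open>simp_all add: indexed_simps\<close>)
  then show ?case by (auto intro: indexed_sum)
qed

lemma supermats_indexed: "X \<in> supermats m P Q \<Longrightarrow> indexed m X"
  by (auto simp: supermats_def indexed_def)

lemma card_grassmann_index: "S \<in> grassmann_index (enat m) \<Longrightarrow> card S \<le> m"
  using card_mono[of "{1..m}" S] by (auto simp: grassmann_index_def subset_eq)

lemma rdeg_indexed_zero: "rdeg n X \<Longrightarrow> indexed (enat m) X \<Longrightarrow> m < n \<Longrightarrow> X = 0"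
  unfolding rdeg_def gdeg_def indexed_def
  by (intro rfm_eqI gr_eqI) (metis card_grassmann_index coef_simps(1) ent_simps(1) leD le_less_trans)

text \<open>Both are ring homomorphisms into the commutative even part, \<open>e\<^sub>1 e\<^sub>2\<close> serving as a dual number.
  Together they detect the components of degree \<open>0\<close> and \<open>1\<close>.\<close>

definition gtrunc :: "'f :: field gr \<Rightarrow> 'f gr" where "gtrunc g = gconst (coef g {})"

definition gdual :: "nat \<Rightarrow> 'f :: field gr \<Rightarrow> 'f gr" where
  "gdual i g = gconst (coef g {}) + gscale (coef g {i}) (ge {1, 2})"

definition gr_hom :: "('f :: field gr \<Rightarrow> 'f gr) \<Rightarrow> bool" where
  "gr_hom \<tau> \<longleftrightarrow> \<tau> 1 = 1 \<and> (\<forall>g h. \<tau> (g + h) = \<tau> g + \<tau> h) \<and> (\<forall>g h. \<tau> (g * h) = \<tau> g * \<tau> h)"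

lemma gr_hom_zero: "gr_hom \<tau> \<Longrightarrow> \<tau> 0 = 0"
  unfolding gr_hom_def by (metis add_cancel_right_right)

lemma gr_hom_sum: "gr_hom \<tau> \<Longrightarrow> \<tau> (sum f I) = (\<Sum>i\<in>I. \<tau> (f i))"
  by (induction I rule: infinite_finite_induct) (auto simp: gr_hom_zero, auto simp: gr_hom_def)

lemma coef_mult_empty: "coef (g * h) {} = coef g {} * coef h {}"
  by (simp add: times_gr.rep_eq)

lemma coef_mult_singleton: "coef (g * h) {i} = coef g {} * coef h {i} + coef g {i} * coef h {}"
proof -
  have "Pow {i} = {{}, {i}}" by auto
  then show ?thesis by (simp add: times_gr.rep_eq)
qed

lemma gr_hom_gtrunc: "gr_hom gtrunc"
  by (auto simp: gr_hom_def gtrunc_def coef_one coef_mult_empty gscale_add gscale_mult mult.commute)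

lemma gr_hom_gdual: "gr_hom (gdual i)"
proof -
  have "ge {1, 2} * ge {1, 2} = (0 :: 'a gr)" by (simp add: ge_mult)
  then show ?thesis
    by (auto simp: gr_hom_def gdual_def coef_one coef_mult_empty coef_mult_singleton gscale_add gscale_mult
        distrib_left distrib_right mult.commute add_ac)
qed

context
  fixes \<tau> :: "'f :: field gr \<Rightarrow> 'f gr" assumes \<tau>: "gr_hom \<tau>"
begin

lemma ent_rmap_hom [simp]: "ent (rmap \<tau> X) i j = \<tau> (ent X i j)"
  by (simp add: ent_rmap gr_hom_zero[OF \<tau>])

lemma rmap_add: "rmap \<tau> (X + Y) = rmap \<tau> X + rmap \<tau> Y"
  using \<tau> by (intro rfm_eqI) (simp add: gr_hom_def)

lemma rmap_one: "rmap \<tau> 1 = 1"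
  using \<tau> by (intro rfm_eqI) (simp add: gr_hom_def ent_one gr_hom_zero[OF \<tau>])

lemma rmap_mult: "rmap \<tau> (X * Y) = rmap \<tau> X * rmap \<tau> Y"
proof (rule rfm_eqI)
  fix i j
  have "ent (rmap \<tau> X * rmap \<tau> Y) i j = (\<Sum>k | ent X i k \<noteq> 0. \<tau> (ent X i k) * \<tau> (ent Y k j))"
    by (subst ent_mult[OF finite_row[of X i]]) (auto simp: gr_hom_zero[OF \<tau>])
  also have "\<dots> = \<tau> (ent (X * Y) i j)"
    unfolding times_rfm.rep_eq using \<tau> by (simp add: gr_hom_sum[OF \<tau>] gr_hom_def)
  finally show "ent (rmap \<tau> (X * Y)) i j = ent (rmap \<tau> X * rmap \<tau> Y) i j" by simp
qed

lemma rmap_zero: "rmap \<tau> 0 = 0"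
  by (rule rfm_eqI) (simp add: gr_hom_zero[OF \<tau>])

lemma rmap_sum: "rmap \<tau> (sum f I) = (\<Sum>i\<in>I. rmap \<tau> (f i))"
  by (induction I rule: infinite_finite_induct) (auto simp: rmap_add rmap_zero)

lemma rmap_uminus: "rmap \<tau> (- X) = - rmap \<tau> X"
  using rmap_add[of X "- X"] rmap_zero by (simp add: eq_neg_iff_add_eq_0 add.commute)

lemma rmap_power: "rmap \<tau> (X ^ n) = rmap \<tau> X ^ n"
  by (induction n) (auto simp: rmap_one rmap_mult)

lemma rmap_alt_form: "rmap \<tau> (alt_form d x z r a) = alt_form d (rmap \<tau> x) (\<lambda>i. rmap \<tau> (z i)) r a"
proof (induction r arbitrary: a)
  case 0
  have "rmap \<tau> (prod_list (map (\<lambda>i. x ^ a i * z i) xs)) = prod_list (map (\<lambda>i. rmap \<tau> x ^ a i * rmap \<tau> (z i)) xs)" for xs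
    by (induction xs) (auto simp: rmap_one rmap_mult rmap_power)
  then show ?case by (simp add: slots_def)
next
  case (Suc r)
  have "rmap \<tau> (of_int (sign \<sigma>) * X) = of_int (sign \<sigma>) * rmap \<tau> X" for \<sigma> :: "nat \<Rightarrow> nat" and X
    by (cases \<sigma> rule: sign_cases) (auto simp: rmap_uminus)
  then show ?case by (simp add: rmap_sum Suc)
qed

end

lemma alt_form_gr_hom_zero:
  fixes X :: "'f :: field_char_0 gr rfm"
  assumes "gr_hom \<tau>" "l \<le> k" "even_block k l (rmap \<tau> X)" "\<And>i. even_block k l (rmap \<tau> (z i))"
  shows "\<tau> (ent (alt_form (Suc k) X z 1 (\<lambda>_. 0)) i j) = 0"
proof -
  have "rmap \<tau> (alt_form (Suc k) X z 1 (\<lambda>_. 0)) = 0"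
    unfolding rmap_alt_form[OF assms(1)] by (rule even_block_alt_form_zero[OF assms(2-4)])
  then show ?thesis using ent_rmap_hom[OF assms(1)] ent_simps(1) by metis
qed

lemma even_block_gtrunc:
  assumes "X \<in> supermats m (block_pos k l) Q" shows "even_block k l (rmap gtrunc X)"
  unfolding even_block_def ent_rmap_hom[OF gr_hom_gtrunc]
proof (intro allI conjI impI)
  fix i j assume "gtrunc (ent X i j) \<noteq> 0"
  then have "coef (ent X i j) {} \<noteq> 0" by (auto simp: gtrunc_def)
  then show "(i, j) \<in> block_pos k l"
    using assms unfolding supermats_def mem_Collect_eq by (metis card.empty even_zero)
qed (simp add: gtrunc_def)

text \<open>The coefficient of the generator \<open>c\<close> reappears in the same entry, but at an
  even monomial. Hence the odd monomials must be confined to the positions of the even ones; for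
  positions off the blocks this fails, and only degree 1 is gained there.\<close>

lemma even_block_gdual:
  assumes "X \<in> supermats m (block_pos k l) (block_pos k l)" shows "even_block k l (rmap (gdual c) X)"
  unfolding even_block_def ent_rmap_hom[OF gr_hom_gdual]
proof (intro allI conjI impI)
  fix i j assume "gdual c (ent X i j) \<noteq> 0"
  then have "coef (ent X i j) {} \<noteq> 0 \<or> coef (ent X i j) {c} \<noteq> 0" by (auto simp: gdual_def)
  then show "(i, j) \<in> block_pos k l"
    using assms unfolding supermats_def mem_Collect_eq by metis
qed (simp add: gdual_def geven_ge)

lemma supermats_alt_form_rdeg_1:
  fixes X :: "'f :: field_char_0 gr rfm"
  assumes "l \<le> k" "X \<in> supermats m (block_pos k l) Q" "\<And>i. z i \<in> supermats m (block_pos k l) Q"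
  shows "rdeg 1 (alt_form (Suc k) X z 1 (\<lambda>_. 0))" (is "rdeg 1 ?D")
proof -
  have "coef (ent ?D i j) S = 0" if "card S = 0" for i j S
  proof -
    have "gtrunc (ent ?D i j) = 0"
      by (rule alt_form_gr_hom_zero[OF gr_hom_gtrunc assms(1)]) (rule even_block_gtrunc, rule assms)+
    then have "coef (ent ?D i j) {} = 0" by (simp add: gtrunc_def gscale_eq_0)
    then show ?thesis using that by (auto simp: card_eq_0_iff coef_infinite simp del: alt_form.simps)
  qed
  then show ?thesis unfolding rdeg_def gdeg_def by (metis One_nat_def Suc_leI neq0_conv)
qed

text \<open>All homomorphisms \<open>gdual c\<close> annihilate the form. Their constant coefficient
  shows that the component of degree 0 is zero, and the coefficient at \<open>{1, 2}\<close> does so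
  for the generator \<open>c\<close>.\<close>

lemma supermats_alt_form_rdeg_2:
  fixes X :: "'f :: field_char_0 gr rfm"
  assumes "l \<le> k" "X \<in> supermats m (block_pos k l) (block_pos k l)"
    "\<And>i. z i \<in> supermats m (block_pos k l) (block_pos k l)"
  shows "rdeg 2 (alt_form (Suc k) X z 1 (\<lambda>_. 0))" (is "rdeg 2 ?D")
proof -
  have "coef (ent ?D i j) S = 0" if "card S < 2" for i j S
  proof -
    have *: "gdual c (ent ?D i j) = 0" for c
      by (rule alt_form_gr_hom_zero[OF gr_hom_gdual assms(1)]) (rule even_block_gdual, rule assms)+
    have "coef (gdual c (ent ?D i j)) {} = coef (ent ?D i j) {}" for c
      by (simp add: gdual_def coef_one coef_ge)
    moreover have "coef (gdual c (ent ?D i j)) {1, 2} = coef (ent ?D i j) {c}" for c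
      by (simp add: gdual_def coef_one coef_ge)
    ultimately have "coef (ent ?D i j) {} = 0" "coef (ent ?D i j) {c} = 0" for c
      unfolding * by simp_all
    moreover have "card S = 0 \<or> card S = 1" using that by linarith
    ultimately show ?thesis
      by (auto simp: card_eq_0_iff card_1_singleton_iff coef_infinite simp del: alt_form.simps)
  qed
  then show ?thesis unfolding rdeg_def gdeg_def by (metis not_le)
qed

text \<open>The pairing codes give the factors disjoint sets of variables: \<open>(b, 0)\<close>
  encodes the variable x of factor \<open>b\<close>, and \<open>(b, Suc i)\<close> its
  \<open>z\<close> of index \<open>i\<close>.\<close>

definition prod_form :: "nat \<Rightarrow> nat \<Rightarrow> (nat \<Rightarrow> 'f :: field gr rfm) \<Rightarrow> 'f gr rfm" where
  "prod_form k n \<rho> = prod_list (map (\<lambda>b. alt_form (Suc k) (\<rho> (prod_encode (b, 0)))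
     (\<lambda>i. \<rho> (prod_encode (b, Suc i))) 1 (\<lambda>_. 0)) [0..<n])"

lemma expressible_prod_form: "0 < n \<Longrightarrow> expressible (prod_form k n)"
  unfolding prod_form_def by (intro expressible_prod_list expressible_alt_form expressible_var) auto

lemma prod_form_zero:
  fixes R :: "'f :: field gr rfm set"
  assumes "R \<subseteq> Collect (indexed (enat m))" "m < n * c" "range \<rho> \<subseteq> R"
    and "\<And>X z. X \<in> R \<Longrightarrow> (\<And>i. z i \<in> R) \<Longrightarrow> rdeg c (alt_form (Suc k) X z 1 (\<lambda>_. 0))"
  shows "prod_form k n \<rho> = 0"
proof (rule rdeg_indexed_zero)
  show "indexed (enat m) (prod_form k n \<rho>)" unfolding prod_form_def
    using assms(1,3) by (intro indexed_prod_list indexed_alt_form) auto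
  have "rdeg (length [0..<n] * c) (prod_form k n \<rho>)" unfolding prod_form_def
    using assms(3) by (intro rdeg_prod_list assms(4)) auto
  then show "rdeg (n * c) (prod_form k n \<rho>)" by simp
qed (rule assms(2))

lemma ge_Suc: "ge {1..n} * ge {Suc n} = (ge {1..Suc n} :: 'a :: field gr)"
proof -
  have "{(s, t). s \<in> {1..n} \<and> t \<in> {Suc n} \<and> t < s} = {}" by auto
  then have "shuffle_sign {1..n} {Suc n} = (1 :: 'a)"
    unfolding shuffle_sign_def by (simp only: card.empty power_0)
  moreover have "{1..n} \<union> {Suc n} = {1..Suc n}" by auto
  ultimately show ?thesis by (simp add: ge_mult)
qed

lemma ge_neq_0: "finite S \<Longrightarrow> ge S \<noteq> 0"
  using coef_ge[of S S] by (metis coef_simps(1) zero_neq_one)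

text \<open>With \<open>m\<close> generators a product of \<open>m + 1\<close> factors of degree at
  least 1 vanishes. With one more generator it need not: factor \<open>b\<close> is made to carry
  exactly the generator of index \<open>b + 1\<close>, so that the product is a multiple of the
  monomial in the first \<open>m + 1\<close> generators.\<close>

lemma identities_bound_generators:
  assumes l: "0 < l" "l \<le> k" and m': "enat m < m'"
  shows "\<not> mat_identities (supermats (enat m) (block_pos k l) (off_pos k l) :: 'f :: field_char_0 gr rfm set)
     \<subseteq> mat_identities (supermats m' (block_pos k l) (off_pos k l))"
proof -
  let ?R' = "supermats m' (block_pos k l) (off_pos k l) :: 'f gr rfm set"
  \<comment> \<open>Each path visits the \<open>k\<close> vertices of the first block and the vertex
    \<open>k\<close> of the second. For even \<open>b\<close> it runs from 0 to \<open>k\<close>,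
    for odd \<open>b\<close> from \<open>k\<close> to 0, so that consecutive factors can be
    multiplied.\<close>
  define p where "p b i = (if even b then min i k else case i of 0 \<Rightarrow> k | Suc i \<Rightarrow> if i < k then i else 0)" for b i :: nat
  \<comment> \<open>The unique step between the blocks, from \<open>k - 1\<close> to
    \<open>k\<close> or from \<open>k\<close> to 0, carries the generator of its factor.\<close>
  define g where "g b i = (if i = (if even b then k - 1 else 0) then ge {Suc b} else 1 :: 'f gr)" for b i :: nat
  define \<rho>' where "\<rho>' c = (case prod_decode c of (b, 0) \<Rightarrow> dvar TYPE('f) (k + l) |
    (b, Suc i) \<Rightarrow> if i \<le> k \<and> b \<le> m then runit (g b i) (p b i) (p b (Suc i)) else 0)" for c
  have mem: "runit (g b i) (p b i) (p b (Suc i)) \<in> ?R'" if "i \<le> k" "b \<le> m" for b i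
  proof (cases "i = (if even b then k - 1 else 0)")
    case True
    then have "(p b i, p b (Suc i)) \<in> off_pos k l"
      using l by (auto simp: p_def off_pos_def split: if_splits)
    then have "runit (ge {Suc b}) (p b i) (p b (Suc i)) \<in> ?R'"
      using m' that by (intro supermats_runit_gen) (auto, metis Suc_ile_eq enat_ord_simps(1) le_less_trans)
    then show ?thesis using True by (simp add: g_def)
  next
    case False
    then have "(p b i, p b (Suc i)) \<in> block_pos k l"
      using l that by (cases "even b"; cases i) (auto simp: p_def block_pos_def)
    then have "runit 1 (p b i) (p b (Suc i)) \<in> ?R'" by (rule supermats_runit_1)
    then show ?thesis using False by (simp add: g_def)
  qed
  have D: "\<exists>c \<noteq> 0. alt_form (Suc k) (\<rho>' (prod_encode (b, 0))) (\<lambda>i. \<rho>' (prod_encode (b, Suc i))) 1 (\<lambda>_. 0) =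
      runit (gscale c (ge {Suc b})) (p b 0) (p b (Suc k))" if "b \<le> m" for b
  proof -
    have inj: "inj_on (p b) {..<Suc k}"
      by (auto simp: inj_on_def p_def split: nat.splits)
    have "alt_form (Suc k) (\<rho>' (prod_encode (b, 0))) (\<lambda>i. \<rho>' (prod_encode (b, Suc i))) 1 (\<lambda>_. 0) =
      runit (gscale ((\<Prod>i<Suc k. (of_nat (p b i)) ^ 0) * gdet (Suc k) (\<lambda>i j. (of_nat (p b i) :: 'f) ^ j) ^ 1)
          (prod_list (map (g b) [0..<Suc k]))) (p b 0) (p b (Suc k))"
      unfolding \<rho>'_def prod_encode_inverse prod.case nat.case using that l
      by (intro alt_form_path) (auto simp: p_def split: nat.splits)
    moreover have "prod_list (map (g b) [0..<Suc k]) = ge {Suc b}"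
    proof -
      define c where "c = (if even b then k - 1 else 0)"
      have "prod_list (map (g b) [0..<n]) = (if c < n then ge {Suc b} else 1)" for n
        by (induction n) (auto simp: g_def c_def[symmetric])
      moreover have "c < Suc k" by (auto simp: c_def)
      ultimately show ?thesis by (simp only: if_True)
    qed
    moreover have "gdet (Suc k) (\<lambda>i j. (of_nat (p b i) :: 'f) ^ j) \<noteq> 0"
      by (rule vandermonde_nonzero) (rule inj_of_nat_gconst[OF inj])
    ultimately show ?thesis by (intro exI[of _ "gdet (Suc k) (\<lambda>i j. (of_nat (p b i) :: 'f) ^ j)"]) simp
  qed
  have P: "\<exists>c \<noteq> 0. prod_form k (Suc n) \<rho>' = runit (gscale c (ge {1..Suc n})) 0 (if even n then k else 0)" if "n \<le> m" for n
    using that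
  proof (induction n)
    case 0
    from D[of 0] l show ?case by (auto simp: prod_form_def p_def simp del: alt_form.simps)
  next
    case (Suc n)
    then obtain c where c: "c \<noteq> 0" "prod_form k (Suc n) \<rho>' = runit (gscale c (ge {1..Suc n})) 0 (if even n then k else 0)"
      by auto
    from Suc.prems obtain c' where c': "c' \<noteq> 0"
      "alt_form (Suc k) (\<rho>' (prod_encode (Suc n, 0))) (\<lambda>i. \<rho>' (prod_encode (Suc n, Suc i))) 1 (\<lambda>_. 0) =
        runit (gscale c' (ge {Suc (Suc n)})) (p (Suc n) 0) (p (Suc n) (Suc k))" using D[of "Suc n"] by blast
    have "prod_form k (Suc (Suc n)) \<rho>' = prod_form k (Suc n) \<rho>' *
      runit (gscale c' (ge {Suc (Suc n)})) (p (Suc n) 0) (p (Suc n) (Suc k))"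
      by (simp add: prod_form_def c'(2)[symmetric] mult.assoc del: alt_form.simps)
    also have "\<dots> = runit (gscale (c * c') (ge {1..Suc (Suc n)})) 0 (p (Suc n) (Suc k))"
      unfolding c(2) runit_mult gscale_mult gscale_simps ge_Suc by (simp add: p_def mult.commute)
    finally show ?case using c(1) c'(1) by (intro exI[of _ "c * c'"]) (auto simp: p_def)
  qed
  show ?thesis
  proof (rule expressible_separates[OF expressible_prod_form[of "Suc m" k]])
    fix \<rho> :: "nat \<Rightarrow> 'f gr rfm" assume \<rho>: "range \<rho> \<subseteq> supermats (enat m) (block_pos k l) (off_pos k l)"
    show "prod_form k (Suc m) \<rho> = 0"
    proof (rule prod_form_zero[OF _ _ \<rho>])
      show "supermats (enat m) (block_pos k l) (off_pos k l) \<subseteq> Collect (indexed (enat m))"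
        by (auto simp: supermats_indexed)
      show "m < Suc m * 1" by simp
    qed (rule supermats_alt_form_rdeg_1[OF l(2)], auto)
  next
    show "range \<rho>' \<subseteq> ?R'"
      using mem l by (auto simp: \<rho>'_def block_pos_def split: nat.splits prod.splits intro!: supermats_diag)
    obtain c where "c \<noteq> 0" "prod_form k (Suc m) \<rho>' = runit (gscale c (ge {1..Suc m})) 0 (if even m then k else 0)"
      using P by blast
    then show "prod_form k (Suc m) \<rho>' \<noteq> 0" by (simp add: gscale_eq_0 ge_neq_0)
  qed simp
qed

section \<open>Odd monomials in all positions: two generators for each factor\<close>

lemma few_coeffs_zero:
  fixes t :: "'i \<Rightarrow> 'f :: field"
  assumes "finite I" "inj_on t I" "d \<le> card I" "\<And>i. i \<in> I \<Longrightarrow> (\<Sum>j<d. t i ^ j * v j) = 0"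
  shows "\<forall>j<d. v j = 0"
proof (cases "d = 0")
  case False
  then obtain p where p: "\<And>j. coeff p j = (if j < d then v j else 0)" "degree p < d"
    "\<And>x. poly p x = (\<Sum>j<d. x ^ j * v j)" using poly_from_coeffs by blast
  have "p = 0"
  proof (rule ccontr)
    assume "p \<noteq> 0"
    then have "card {x. poly p x = 0} \<le> degree p" "finite {x. poly p x = 0}"
      by (simp_all add: card_poly_roots_bound poly_roots_finite)
    moreover have "t ` I \<subseteq> {x. poly p x = 0}" using assms(4) p(3) by auto
    ultimately have "card (t ` I) \<le> degree p" using card_mono by (metis le_trans)
    then show False using p(2) assms by (simp add: card_image)
  qed
  with p(1) show ?thesis by (metis coeff_0)
qed simp

lemma gdet_swap_rows:
  assumes "a < d" "b < d" "a \<noteq> b"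
  shows "gdet d (\<lambda>i. c (Transposition.transpose a b i)) = - gdet d c"
proof -
  let ?t = "Transposition.transpose a b"
  have t: "?t permutes {..<d}" using assms by (intro permutes_swap_id) auto
  have inv: "\<sigma> \<circ> ?t \<circ> ?t = \<sigma>" for \<sigma> :: "nat \<Rightarrow> nat" by (simp add: fun_eq_iff)
  have sgn: "sign (\<sigma> \<circ> ?t) = - sign \<sigma>" if "\<sigma> permutes {..<d}" for \<sigma>
  proof -
    have "permutation ?t" "permutation \<sigma>"
      using t that permutation_permutes by (metis finite_lessThan)+
    then show ?thesis using assms by (simp add: sign_compose sign_swap_id)
  qed
  have "gdet d (\<lambda>i. c (?t i)) = (\<Sum>\<sigma> | \<sigma> permutes {..<d}. of_int (sign (\<sigma> \<circ> ?t)) * (\<Prod>i<d. c (?t i) (\<sigma> (?t i))))"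
    unfolding gdet_def
    by (rule sum.reindex_bij_witness[where i = "\<lambda>\<sigma>. \<sigma> \<circ> ?t" and j = "\<lambda>\<sigma>. \<sigma> \<circ> ?t"])
       (use t inv permutes_compose in \<open>auto simp: fun_eq_iff comp_def\<close>)
  also have "\<dots> = (\<Sum>\<sigma> | \<sigma> permutes {..<d}. - (of_int (sign \<sigma>) * (\<Prod>i<d. c i (\<sigma> i))))"
  proof (rule sum.cong[OF refl])
    fix \<sigma> assume \<sigma>: "\<sigma> \<in> {\<sigma>. \<sigma> permutes {..<d}}"
    have "(\<Prod>i<d. c (?t i) (\<sigma> (?t i))) = (\<Prod>i<d. c i (\<sigma> i))"
      by (rule prod.reindex_bij_betw[OF permutes_imp_bij[OF t]])
    then show "of_int (sign (\<sigma> \<circ> ?t)) * (\<Prod>i<d. c (?t i) (\<sigma> (?t i))) = - (of_int (sign \<sigma>) * (\<Prod>i<d. c i (\<sigma> i)))"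
      using sgn \<sigma> by simp
  qed
  finally show ?thesis by (simp add: gdet_def sum_negf)
qed

text \<open>The path has only \<open>n\<close> vertices for \<open>n + 1\<close> slots and meets the
  vertex 0 twice. There \<open>e\<close> occurs with two different exponents, and since its square
  is zero only \<open>e * f\<close> and \<open>f * e\<close> remain. Exchanging the exponents
  changes the sign of the permutation as well as the order of \<open>e\<close> and \<open>f\<close>,
  so the two contributions add up instead of cancelling. This is the purpose of \<open>f\<close>,
  and the origin of the factor 2.\<close>

lemma full_alt_form_value:
  fixes e f :: "'f :: field_char_0 gr" and n :: nat
  assumes n: "0 < n" and e: "e * e = 0" and ef: "f * e = - (e * f)"
  defines "y \<equiv> \<lambda>i. if i = 0 then e else if i < n then gconst (of_nat i) else 0"
  defines "p \<equiv> \<lambda>i. if i < n then i else (0 :: nat)"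
  assumes z: "\<And>i. i \<le> n \<Longrightarrow> z i = runit (if i = 0 then f else 1) (p i) (p (Suc i))"
  shows "\<exists>c\<noteq>0. alt_form (Suc n) (rdiag y) z 1 (\<lambda>_. 0) = runit (gscale c (e * f)) 0 0"
proof -
  define \<kappa> where "\<kappa> a b = (if a = 1 \<and> b = 0 then 1 else if a = 0 \<and> b = 1 then - 1 else 0 :: 'f)" for a b :: nat
  have pow: "e ^ a * f * e ^ b = gscale (\<kappa> a b) (e * f)" if "a \<noteq> b" for a b
  proof -
    have e2: "e ^ c = 0" if "2 \<le> c" for c
      using that e by (metis le_add_diff_inverse mult_zero_left power2_eq_square power_add)
    have "2 \<le> a \<or> 2 \<le> b \<or> a = 1 \<and> b = 0 \<or> a = 0 \<and> b = 1" using that by arith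
    then show ?thesis by (elim disjE conjE) (auto simp: e2 \<kappa>_def ef)
  qed
  define t where "t i \<sigma> = (\<Prod>i\<in>{1..<n}. of_nat i ^ \<sigma> i :: 'f)" for i :: nat and \<sigma> :: "nat \<Rightarrow> nat"
  have slot: "slots (Suc n) (\<lambda>i. rdiag y ^ \<sigma> i) z =
      runit (gscale ((\<Prod>i\<in>{1..<n}. of_nat i ^ \<sigma> i) * \<kappa> (\<sigma> 0) (\<sigma> n)) (e * f)) 0 0"
    if \<sigma>: "\<sigma> permutes {..<Suc n}" for \<sigma>
  proof -
    have "[0..<Suc n] = 0 # [1..<n] @ [n]" using n by (simp add: upt_conv_Cons)
    then have "prod_list (map (\<lambda>i. y (p i) ^ \<sigma> i * (if i = 0 then f else 1)) [0..<Suc n]) =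
       e ^ \<sigma> 0 * f * prod_list (map (\<lambda>i. y (p i) ^ \<sigma> i * (if i = 0 then f else 1)) [1..<n]) * e ^ \<sigma> n"
      using n by (simp add: y_def p_def mult.assoc del: upt_Suc)
    also have "map (\<lambda>i. y (p i) ^ \<sigma> i * (if i = 0 then f else 1)) [1..<n] = map (\<lambda>i. gscale (of_nat i ^ \<sigma> i) 1) [1..<n]"
      by (auto simp: y_def p_def gconst_power)
    also have "prod_list (map (\<lambda>i. gscale (of_nat i ^ \<sigma> i) (1 :: 'f gr)) [1..<n]) = gconst (\<Prod>i\<in>{1..<n}. of_nat i ^ \<sigma> i)"
      unfolding prod_list_gscale by (simp add: prod_list_ones prod.distinct_set_conv_list[symmetric])
    also have "e ^ \<sigma> 0 * f * gconst (\<Prod>i\<in>{1..<n}. of_nat i ^ \<sigma> i) * e ^ \<sigma> n =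
        gscale (\<Prod>i\<in>{1..<n}. of_nat i ^ \<sigma> i) (e ^ \<sigma> 0 * f * e ^ \<sigma> n)"
      by (simp add: gscale_mult)
    also have "e ^ \<sigma> 0 * f * e ^ \<sigma> n = gscale (\<kappa> (\<sigma> 0) (\<sigma> n)) (e * f)"
      using permutes_inj[OF \<sigma>] n by (intro pow) (auto dest: injD)
    finally have eq: "prod_list (map (\<lambda>i. y (p i) ^ \<sigma> i * (if i = 0 then f else 1)) [0..<Suc n]) =
       gscale ((\<Prod>i\<in>{1..<n}. of_nat i ^ \<sigma> i) * \<kappa> (\<sigma> 0) (\<sigma> n)) (e * f)" by simp
    have "slots (Suc n) (\<lambda>i. rdiag y ^ \<sigma> i) z =
      runit (prod_list (map (\<lambda>i. y (p i) ^ \<sigma> i * (if i = 0 then f else 1)) [0..<Suc n])) (p 0) (p (Suc n))"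
      by (rule slots_path) (auto simp: z)
    then show ?thesis using n unfolding eq by (simp add: p_def)
  qed
  \<comment> \<open>Row 0 only admits the exponent 1 and row \<open>n\<close> the exponent 0, so the
    determinant of \<open>c\<close> collects the permutations that lead to \<open>e * f\<close>.
    Exchanging these rows collects those that lead to \<open>f * e\<close>.\<close>
  define c where "c i j = (if i = 0 then if j = 1 then 1 else 0 else if i = n then if j = 0 then 1 else 0 else of_nat i ^ j :: 'f)"
    for i j :: nat
  have split: "(\<Prod>i<Suc n. h i) = h 0 * h n * (\<Prod>i\<in>{1..<n}. h i)" for h :: "nat \<Rightarrow> 'f"
  proof -
    have "{..<Suc n} = insert 0 (insert n {1..<n})" using n by auto
    then show ?thesis using n by (simp add: mult.assoc)
  qed
  have c1: "(\<Prod>i<Suc n. c i (\<sigma> i)) = (if \<sigma> 0 = 1 \<and> \<sigma> n = 0 then (\<Prod>i\<in>{1..<n}. of_nat i ^ \<sigma> i) else 0)" for \<sigma>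
    unfolding split using n by (auto simp: c_def intro!: prod.cong)
  have c2: "(\<Prod>i<Suc n. c (Transposition.transpose 0 n i) (\<sigma> i)) =
     (if \<sigma> 0 = 0 \<and> \<sigma> n = 1 then (\<Prod>i\<in>{1..<n}. of_nat i ^ \<sigma> i) else 0)" for \<sigma>
    unfolding split using n by (auto simp: c_def Transposition.transpose_def intro!: prod.cong)
  let ?K = "\<Sum>\<sigma> | \<sigma> permutes {..<Suc n}. of_int (sign \<sigma>) * ((\<Prod>i\<in>{1..<n}. of_nat i ^ \<sigma> i) * \<kappa> (\<sigma> 0) (\<sigma> n)) :: 'f"
  have "?K = gdet (Suc n) c - gdet (Suc n) (\<lambda>i. c (Transposition.transpose 0 n i))"
    unfolding gdet_def c1 c2 sum_subtractf[symmetric] by (rule sum.cong) (auto simp: \<kappa>_def)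
  also have "\<dots> = 2 * gdet (Suc n) c" using n by (simp add: gdet_swap_rows)
  finally have K: "?K = 2 * gdet (Suc n) c" .
  have "gdet (Suc n) c \<noteq> 0"
  proof (rule gdet_nonzero)
    fix v assume v: "\<And>i. i < Suc n \<Longrightarrow> (\<Sum>j<Suc n. c i j * v j) = 0"
    obtain n' where n': "n = Suc n'" using n gr0_implies_Suc by blast
    have sum: "(\<Sum>j<Suc n. h j) = h 0 + h 1 + (\<Sum>j<n'. h (Suc (Suc j)))" for h :: "nat \<Rightarrow> 'f"
      by (simp only: n' sum.lessThan_Suc_shift) simp
    have v1: "v 1 = 0" using v[of 0] unfolding sum by (simp add: c_def)
    have v0: "v 0 = 0" using v[of n] n unfolding sum by (simp add: c_def)
    have "\<forall>j<n'. v (Suc (Suc j)) = 0"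
    \<comment> \<open>With the first two coefficients gone, the polynomial is divisible by the
      square of the indeterminate. The quotient has \<open>n - 1\<close> coefficients and vanishes
      at the \<open>n - 1\<close> nonzero points 1, ..., \<open>n - 1\<close>.\<close>
    proof (rule few_coeffs_zero[of "{1..<n}" "of_nat"])
      fix i assume i: "i \<in> {1..<n}"
      then have "of_nat i ^ 2 * (\<Sum>j<n'. (of_nat i) ^ j * v (Suc (Suc j))) = 0"
        using v[of i] unfolding sum v0 v1 by (simp add: c_def sum_distrib_left power2_eq_square mult.assoc)
      then show "(\<Sum>j<n'. (of_nat i) ^ j * v (Suc (Suc j))) = 0" using i by simp
    qed (auto simp: n')
    then show "\<forall>j<Suc n. v j = 0" using v0 v1 unfolding n' by (metis One_nat_def less_Suc_eq_0_disj)
  qed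
  moreover have "alt_form (Suc n) (rdiag y) z 1 (\<lambda>_. 0) = runit (gscale ?K (e * f)) 0 0"
  proof -
    have "alt_form (Suc n) (rdiag y) z 1 (\<lambda>_. 0) =
      (\<Sum>\<sigma> | \<sigma> permutes {..<Suc n}. of_int (sign \<sigma>) * slots (Suc n) (\<lambda>i. rdiag y ^ \<sigma> i) z)" by simp
    also have "\<dots> = (\<Sum>\<sigma> | \<sigma> permutes {..<Suc n}. runit (gscale (of_int (sign \<sigma>) *
        ((\<Prod>i\<in>{1..<n}. of_nat i ^ \<sigma> i) * \<kappa> (\<sigma> 0) (\<sigma> n))) (e * f)) 0 0)"
      by (rule sum.cong) (auto simp: slot of_int_sign_runit)
    finally show ?thesis by (simp only: runit_sum gscale_sum_left)
  qed
  ultimately show ?thesis unfolding K by (intro exI[of _ "2 * gdet (Suc n) c"]) simp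
qed

text \<open>Factor \<open>b\<close> uses the generators of index \<open>2 * b + 1\<close> and
  \<open>2 * b + 2\<close> in the roles of \<open>e\<close> and \<open>f\<close>, so
  \<open>s + 1\<close> factors give a multiple of the monomial in the first
  \<open>2 * (s + 1)\<close> generators.\<close>

lemma identities_bound_full:
  assumes n: "0 < n" and m': "enat (2 * Suc s) \<le> m'"
    and zero: "\<And>\<rho>. range \<rho> \<subseteq> R \<Longrightarrow> prod_form n (Suc s) \<rho> = 0"
  shows "\<not> mat_identities (R :: 'f :: field_char_0 gr rfm set)
     \<subseteq> mat_identities (supermats m' (block_pos n 0) (block_pos n 0))"
proof -
  let ?R' = "supermats m' (block_pos n 0) (block_pos n 0) :: 'f gr rfm set"
  define p where "p i = (if i < n then i else 0)" for i :: nat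
  define y where "y b i = (if i = 0 then ge {2 * b + 1} else if i < n then gconst (of_nat i) else 0 :: 'f gr)" for b i :: nat
  define \<rho>' where "\<rho>' c = (case prod_decode c of (b, 0) \<Rightarrow> if b \<le> s then rdiag (y b) else 0 |
    (b, Suc i) \<Rightarrow> if i \<le> n \<and> b \<le> s then runit (if i = 0 then ge {2 * b + 2} else 1 :: 'f gr) (p i) (p (Suc i)) else 0)" for c
  have pos: "(p i, p j) \<in> block_pos n 0" for i j using n by (auto simp: p_def block_pos_def)
  have le: "enat (2 * b + 2) \<le> m'" if "b \<le> s" for b
    by (rule order_trans[OF _ m']) (use that in simp)
  have mem_y: "rdiag (y b) \<in> ?R'" if "b \<le> s" for b
  proof -
    have le': "enat (2 * b + 1) \<le> m'" by (rule order_trans[OF _ le[OF that]]) simp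
    have *: "coef (ent (rdiag (y b)) i j) S = (if i = j \<and> i < n then if i = 0 then if S = {2 * b + 1} then 1 else 0
        else if S = {} then of_nat i else 0 else 0)" for i j S
      using n by (auto simp: ent_rdiag y_def coef_one coef_ge)
    show ?thesis
      by (rule supermatsI[of "{..<n} \<times> {..<n} \<times> {{2 * b + 1}, {}}"])
         (use le' in \<open>auto simp: * block_pos_def grassmann_index_def split: if_splits\<close>)
  qed
  have mem_z: "runit (if i = 0 then ge {2 * b + 2} else 1) (p i) (p (Suc i)) \<in> ?R'" if "b \<le> s" for b i
    using supermats_runit_1[OF pos] supermats_runit_gen[OF pos _ le[OF that]] by auto
  have D: "\<exists>c \<noteq> 0. alt_form (Suc n) (\<rho>' (prod_encode (b, 0))) (\<lambda>i. \<rho>' (prod_encode (b, Suc i))) 1 (\<lambda>_. 0) =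
      runit (gscale c (ge {2 * b + 1} * ge {2 * b + 2})) 0 0" if "b \<le> s" for b
  proof -
    have "ge {2 * b + 1} * ge {2 * b + 1} = (0 :: 'f gr)" by (simp add: ge_mult)
    moreover have "ge {2 * b + 2} * ge {2 * b + 1} = - (ge {2 * b + 1} * ge {2 * b + 2} :: 'f gr)"
      by (rule godd_anticommute) (auto intro: godd_ge)
    moreover have "\<rho>' (prod_encode (b, 0)) = rdiag (\<lambda>i. if i = 0 then ge {2 * b + 1} else if i < n then gconst (of_nat i) else 0)"
      using that by (simp add: \<rho>'_def y_def[abs_def])
    ultimately show ?thesis using that
      by (simp only: ) (rule full_alt_form_value[OF n], auto simp: \<rho>'_def p_def)
  qed
  have P: "\<exists>c \<noteq> 0. prod_form n (Suc b) \<rho>' = runit (gscale c (ge {1..2 * Suc b})) 0 0" if "b \<le> s" for b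
    using that
  proof (induction b)
    case 0
    have "ge {1} * ge {2} = (ge {1..2} :: 'f gr)" using ge_Suc[of 1] by (simp add: numeral_2_eq_2)
    with D[of 0] show ?case by (simp add: prod_form_def numeral_2_eq_2 del: alt_form.simps)
  next
    case (Suc b)
    then obtain c where c: "c \<noteq> 0" "prod_form n (Suc b) \<rho>' = runit (gscale c (ge {1..2 * Suc b})) 0 0" by auto
    from Suc.prems obtain c' where c': "c' \<noteq> 0"
      "alt_form (Suc n) (\<rho>' (prod_encode (Suc b, 0))) (\<lambda>i. \<rho>' (prod_encode (Suc b, Suc i))) 1 (\<lambda>_. 0) =
        runit (gscale c' (ge {2 * Suc b + 1} * ge {2 * Suc b + 2})) 0 0" using D[of "Suc b"] by blast
    have ge: "ge {1..2 * Suc b} * (ge {2 * Suc b + 1} * ge {2 * Suc b + 2}) = (ge {1..2 * Suc (Suc b)} :: 'f gr)"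
      using ge_Suc[of "2 * Suc b", where 'a = 'f] ge_Suc[of "Suc (2 * Suc b)", where 'a = 'f] by (simp add: mult.assoc[symmetric])
    have "prod_form n (Suc (Suc b)) \<rho>' = prod_form n (Suc b) \<rho>' *
      runit (gscale c' (ge {2 * Suc b + 1} * ge {2 * Suc b + 2})) 0 0"
      by (simp only: prod_form_def c'(2)[symmetric]) (simp add: mult.assoc del: alt_form.simps)
    also have "\<dots> = runit (gscale (c' * c) (ge {1..2 * Suc (Suc b)})) 0 0"
      unfolding c(2) runit_mult gscale_mult gscale_simps ge by simp
    finally show ?case using c(1) c'(1) by (intro exI[of _ "c' * c"]) auto
  qed
  show ?thesis
  proof (rule expressible_separates[OF expressible_prod_form[of "Suc s" n] zero])
    show "range \<rho>' \<subseteq> ?R'"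
      using mem_y mem_z by (auto simp: \<rho>'_def split: nat.splits prod.splits)
    obtain c where "c \<noteq> 0" "prod_form n (Suc s) \<rho>' = runit (gscale c (ge {1..2 * Suc s})) 0 0"
      using P by blast
    then show "prod_form n (Suc s) \<rho>' \<noteq> 0" by (simp add: gscale_eq_0 ge_neq_0)
  qed auto
qed

text \<open>For \<open>l = 0\<close> this is the largest number of factors in a nonzero product of
  values of D_{n+1} in disjoint sets of variables. Without odd positions already a single value is
  zero, whatever \<open>m\<close> is.\<close>

definition depth :: "enat \<Rightarrow> (nat \<times> nat) set \<Rightarrow> enat" where
  "depth m Q = (if Q = {} then 0 else enat_half m)"

lemma identities_bound_depth:
  assumes R: "admissible n 0 Q" and R': "admissible n 0 Q'" and lt: "depth m Q < depth m' Q'"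
  shows "\<not> mat_identities (supermats m (block_pos n 0) Q :: 'f :: field_char_0 gr rfm set)
     \<subseteq> mat_identities (supermats m' (block_pos n 0) Q')"
proof -
  have n: "0 < n" and Q: "Q = {} \<or> Q = block_pos n 0" and Q': "Q' = block_pos n 0"
    using assms by (auto simp: admissible_def off_pos_def depth_def split: if_splits)
  have ne: "block_pos n 0 \<noteq> {}" using n by (auto simp: block_pos_def)
  obtain s where s: "depth m Q = enat s" using lt by (cases "depth m Q") auto
  have m': "enat (2 * Suc s) \<le> m'"
    using lt s ne by (cases m') (auto simp: depth_def Q')
  show ?thesis unfolding Q'
  proof (rule identities_bound_full[OF n m'])
    fix \<rho> :: "nat \<Rightarrow> 'f gr rfm" assume \<rho>: "range \<rho> \<subseteq> supermats m (block_pos n 0) Q"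
    show "prod_form n (Suc s) \<rho> = 0"
    proof (cases "Q = {}")
      case True
      have "even_block n 0 (\<rho> i)" for i
      proof -
        have "\<rho> i \<in> supermats m (block_pos n 0) {}" using \<rho> True by blast
        then have *: "coef (ent (\<rho> i) a b) S \<noteq> 0 \<Longrightarrow> even (card S) \<and> (a, b) \<in> block_pos n 0" for a b S
          unfolding supermats_def mem_Collect_eq by (metis empty_iff)
        then have "geven (ent (\<rho> i) a b)" for a b unfolding geven_def by blast
        moreover have "ent (\<rho> i) a b \<noteq> 0 \<Longrightarrow> (a, b) \<in> block_pos n 0" for a b using * gr_neq_0 by metis
        ultimately show ?thesis unfolding even_block_def by blast
      qed
      then have "alt_form (Suc n) (\<rho> (prod_encode (b, 0))) (\<lambda>i. \<rho> (prod_encode (b, Suc i))) 1 (\<lambda>_. 0) = 0" for b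
        by (intro even_block_alt_form_zero[of 0 n]) auto
      then show ?thesis by (simp add: prod_form_def del: alt_form.simps)
    next
      case False
      then have Q: "Q = block_pos n 0" using Q by simp
      obtain c where c: "m = enat c" "c div 2 = s" using s False by (cases m) (auto simp: depth_def)
      show ?thesis
      proof (rule prod_form_zero[OF _ _ \<rho>])
        show "supermats m (block_pos n 0) Q \<subseteq> Collect (indexed (enat c))"
          by (auto simp: c(1) supermats_indexed)
        show "c < Suc s * 2" using c(2) by simp
      qed (unfold Q, rule supermats_alt_form_rdeg_2, auto)
    qed
  qed
qed

text \<open>The tests for \<open>m\<close> and for \<open>depth\<close> compare algebras with the
  same \<open>k\<close> and \<open>l\<close>, so these are settled first, \<open>k\<close> by the
  larger block and \<open>l\<close> by the total size.\<close>

theorem mat_identities_determine: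
  assumes R: "admissible k l Q" and R': "admissible k' l' Q'" and m: "1 \<le> m" "1 \<le> m'"
    and eq: "mat_identities (supermats m (block_pos k l) Q :: 'f :: field_char_0 gr rfm set) =
      mat_identities (supermats m' (block_pos k' l') Q')"
  shows "k = k' \<and> l = l' \<and> (0 < l \<longrightarrow> m = m') \<and> (l = 0 \<longrightarrow> depth m Q = depth m' Q')"
proof -
  have "\<not> k < k'" "\<not> k' < k"
    using identities_bound_block[OF R R', of m m', where 'f = 'f] identities_bound_block[OF R' R, of m' m, where 'f = 'f]
    unfolding eq by blast+
  moreover have "\<not> k + l < k' + l'" "\<not> k' + l' < k + l"
    using identities_bound_size[OF R R' _ m(2), of m, where 'f = 'f] identities_bound_size[OF R' R _ m(1), of m', where 'f = 'f]
    unfolding eq by blast+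
  ultimately have kl: "k' = k" "l' = l" by auto
  have "m = m'" if l: "0 < l"
  proof (rule ccontr)
    assume "m \<noteq> m'"
    have Q: "Q = off_pos k l" "Q' = off_pos k l" "l \<le> k" using R R' l by (auto simp: admissible_def kl)
    note neq = identities_bound_generators[OF l Q(3), where 'f = 'f]
    from \<open>m \<noteq> m'\<close> have "m < m' \<or> m' < m" by auto
    then show False
    proof
      assume "m < m'"
      then obtain a where "m = enat a" by (cases m) auto
      with \<open>m < m'\<close> neq[of a m'] eq show False by (simp add: Q kl)
    next
      assume "m' < m"
      then obtain a where "m' = enat a" by (cases m') auto
      with \<open>m' < m\<close> neq[of a m] eq show False by (simp add: Q kl)
    qed
  qed
  moreover have "depth m Q = depth m' Q'" if "l = 0"
  proof -
    have adm: "admissible k 0 Q" "admissible k 0 Q'" using R R' that kl by auto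
    have "\<not> depth m Q < depth m' Q'" "\<not> depth m' Q' < depth m Q"
      using identities_bound_depth[OF adm, of m m', where 'f = 'f]
        identities_bound_depth[OF adm(2) adm(1), of m' m, where 'f = 'f] eq that
      unfolding kl by auto
    then show ?thesis by auto
  qed
  ultimately show ?thesis using kl by simp
qed

section \<open>Coincidences of identities\<close>

text \<open>A multihomogeneous component. When each variable \<open>v\<close> is replaced by the sum
  of the \<open>\<beta> t\<close> over the labels \<open>t\<close> with \<open>var t = v\<close>, it
  is the part of the value of \<open>f\<close> in which every label occurs as often as in
  \<mu>.\<close>

definition component :: "(nat list \<Rightarrow>\<^sub>0 'f :: field) \<Rightarrow> ('l \<Rightarrow> nat) \<Rightarrow> 'l multiset \<Rightarrow> ('l \<Rightarrow> 'f gr rfm) \<Rightarrow> 'f gr rfm" where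
  "component f var \<mu> \<beta> = (\<Sum>u | mset u = \<mu>. rsc (Poly_Mapping.lookup f (map var u)) * prod_list (map \<beta> u))"

lemma finite_mset_lists: "finite {u. mset u = \<mu>}"
proof -
  have "{u. mset u = \<mu>} \<subseteq> {u. set u \<subseteq> set_mset \<mu> \<and> length u = size \<mu>}" by auto
  then show ?thesis by (rule finite_subset) (simp add: finite_lists_length_eq)
qed

definition label_words :: "'l set \<Rightarrow> ('l \<Rightarrow> nat) \<Rightarrow> nat list \<Rightarrow> 'l list set" where
  "label_words \<Lambda> var w = {u. set u \<subseteq> \<Lambda> \<and> map var u = w}"

lemma finite_label_words: "finite \<Lambda> \<Longrightarrow> finite (label_words \<Lambda> var w)"
  by (rule finite_subset[OF _ finite_lists_length_eq[of \<Lambda> "length w"]]) (auto simp: label_words_def)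

lemma prod_list_sum_labels:
  assumes "finite \<Lambda>"
  shows "prod_list (map (\<lambda>v. \<Sum>t | t \<in> \<Lambda> \<and> var t = v. \<beta> t) w) = (\<Sum>u\<in>label_words \<Lambda> var w. prod_list (map \<beta> u) :: 'q :: ring_1)"
proof (induction w)
  case Nil
  have "label_words \<Lambda> var [] = {[]}" by (auto simp: label_words_def)
  then show ?case by simp
next
  case (Cons v w)
  have "prod_list (map (\<lambda>v. \<Sum>t | t \<in> \<Lambda> \<and> var t = v. \<beta> t) (v # w)) =
      (\<Sum>t | t \<in> \<Lambda> \<and> var t = v. \<Sum>u\<in>label_words \<Lambda> var w. \<beta> t * prod_list (map \<beta> u))"
    by (simp add: Cons.IH sum_product)
  also have "\<dots> = (\<Sum>(t, u)\<in>{t. t \<in> \<Lambda> \<and> var t = v} \<times> label_words \<Lambda> var w. \<beta> t * prod_list (map \<beta> u))"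
    by (rule sum.cartesian_product)
  also have "\<dots> = (\<Sum>u\<in>label_words \<Lambda> var (v # w). prod_list (map \<beta> u))"
    by (rule sum.reindex_bij_witness[where i = "\<lambda>u. (hd u, tl u)" and j = "\<lambda>(t, u). t # u"])
       (auto simp: label_words_def)
  finally show ?case .
qed

lemma meval_labels:
  fixes f :: "nat list \<Rightarrow>\<^sub>0 'f :: field" and var :: "'l \<Rightarrow> nat"
  assumes "finite \<Lambda>"
  defines "U \<equiv> \<Union>w\<in>Poly_Mapping.keys f. label_words \<Lambda> var w"
  shows "finite U" "meval f (\<lambda>v. \<Sum>t | t \<in> \<Lambda> \<and> var t = v. \<beta> t) =
    (\<Sum>u\<in>U. rsc (Poly_Mapping.lookup f (map var u)) * prod_list (map \<beta> u))"
proof -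
  show "finite U" using assms by (auto simp: U_def finite_label_words)
  have "meval f (\<lambda>v. \<Sum>t | t \<in> \<Lambda> \<and> var t = v. \<beta> t) = (\<Sum>w\<in>Poly_Mapping.keys f. \<Sum>u\<in>label_words \<Lambda> var w.
      rsc (Poly_Mapping.lookup f (map var u)) * prod_list (map \<beta> u))"
    unfolding meval_def prod_list_sum_labels[OF assms(1)] sum_distrib_left
    by (intro sum.cong refl) (auto simp: label_words_def)
  also have "\<dots> = (\<Sum>u\<in>U. rsc (Poly_Mapping.lookup f (map var u)) * prod_list (map \<beta> u))"
    unfolding U_def using assms(1)
    by (intro sum.UNION_disjoint[symmetric]) (auto simp: finite_label_words, auto simp: label_words_def)
  finally show "meval f (\<lambda>v. \<Sum>t | t \<in> \<Lambda> \<and> var t = v. \<beta> t) =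
    (\<Sum>u\<in>U. rsc (Poly_Mapping.lookup f (map var u)) * prod_list (map \<beta> u))" .
qed

lemma component_label_words:
  fixes f :: "nat list \<Rightarrow>\<^sub>0 'f :: field" and var :: "'l \<Rightarrow> nat"
  assumes "finite \<Lambda>" "set_mset \<mu> \<subseteq> \<Lambda>"
  defines "U \<equiv> \<Union>w\<in>Poly_Mapping.keys f. label_words \<Lambda> var w"
  shows "component f var \<mu> \<beta> = (\<Sum>u | u \<in> U \<and> mset u = \<mu>. rsc (Poly_Mapping.lookup f (map var u)) * prod_list (map \<beta> u))"
  unfolding component_def
proof (rule sum.mono_neutral_right[OF finite_mset_lists])
  show "\<forall>u\<in>{u. mset u = \<mu>} - {u. u \<in> U \<and> mset u = \<mu>}.
      rsc (Poly_Mapping.lookup f (map var u)) * prod_list (map \<beta> u) = 0"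
  proof
    fix u assume "u \<in> {u. mset u = \<mu>} - {u. u \<in> U \<and> mset u = \<mu>}"
    then have "map var u \<notin> Poly_Mapping.keys f"
      using assms(2) by (auto simp: U_def label_words_def)
    then show "rsc (Poly_Mapping.lookup f (map var u)) * prod_list (map \<beta> u) = 0"
      by (simp add: in_keys_iff)
  qed
qed auto

text \<open>A polynomial in commuting variables that vanishes as a function on an infinite field has
  zero coefficients; the words with a common multiset are those that yield the same
  monomial.\<close>

lemma poly_function_coeffs:
  fixes a :: "'l list \<Rightarrow> 'f :: field_char_0"
  assumes fin: "finite U" and zero: "\<And>c. (\<Sum>u\<in>U. a u * prod_list (map c u)) = 0"
  shows "(\<Sum>u | u \<in> U \<and> mset u = \<mu>. a u) = 0"
proof -
  \<comment> \<open>The variables in \<open>T\<close> have already been split off.\<close>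
  have "(\<Sum>u | u \<in> U \<and> (\<forall>t\<in>T. count (mset u) t = count \<mu> t).
      a u * prod_list (map c (filter (\<lambda>t. t \<notin> T) u))) = 0" if "finite T" for T c
    using that
  proof (induction T arbitrary: c)
    case empty
    then show ?case using zero[of c] by simp
  next
    case (insert s T)
    let ?V = "{u \<in> U. \<forall>t\<in>T. count (mset u) t = count \<mu> t}"
    let ?b = "\<lambda>u. a u * prod_list (map c (filter (\<lambda>t. t \<notin> insert s T) u))"
    have split: "prod_list (map (c(s := x)) (filter (\<lambda>t. t \<notin> T) u)) =
        x ^ count (mset u) s * prod_list (map c (filter (\<lambda>t. t \<notin> insert s T) u))" for x u
      using insert.hyps by (induction u) (auto simp: mult_ac)
    define p where "p = (\<Sum>u\<in>?V. monom (?b u) (count (mset u) s))"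
    have "poly p x = 0" for x
    proof -
      have "poly p x = (\<Sum>u\<in>?V. a u * prod_list (map (c(s := x)) (filter (\<lambda>t. t \<notin> T) u)))"
        unfolding p_def poly_sum poly_monom split by (intro sum.cong refl) (simp add: mult_ac)
      then show ?thesis using insert.IH by simp
    qed
    then have "p = 0" by (simp add: poly_all_0_iff_0[symmetric])
    then have "0 = coeff p (count \<mu> s)" by simp
    also have "\<dots> = (\<Sum>u\<in>?V. if count (mset u) s = count \<mu> s then ?b u else 0)"
      by (simp add: p_def coeff_sum del: insert_iff)
    also have "\<dots> = (\<Sum>u | u \<in> U \<and> (\<forall>t\<in>insert s T. count (mset u) t = count \<mu> t). ?b u)"
      using fin by (subst sum.inter_filter[symmetric]) (auto intro: sum.cong)
    finally show ?case by simp
  qed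
  note key = this
  define T where "T = (\<Union>u\<in>U. set u) \<union> set_mset \<mu>"
  have "finite T" using fin by (auto simp: T_def)
  moreover have "{u \<in> U. \<forall>t\<in>T. count (mset u) t = count \<mu> t} = {u \<in> U. mset u = \<mu>}"
  proof (intro equalityI subsetI CollectI conjI)
    fix u assume u: "u \<in> {u \<in> U. \<forall>t\<in>T. count (mset u) t = count \<mu> t}"
    show "mset u = \<mu>"
    proof (rule multiset_eqI)
      fix t show "count (mset u) t = count \<mu> t"
        using u by (cases "t \<in> T") (auto simp: T_def not_in_iff count_mset)
    qed
  qed auto
  moreover have "filter (\<lambda>t. t \<notin> T) u = []" if "u \<in> U" for u
    using that by (auto simp: T_def filter_empty_conv)
  ultimately show ?thesis using key[of T "\<lambda>_. 0"] by simp
qed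

definition lin_closed :: "'f :: field gr rfm set \<Rightarrow> bool" where
  "lin_closed R \<longleftrightarrow> 0 \<in> R \<and> (\<forall>X\<in>R. \<forall>Y\<in>R. X + Y \<in> R) \<and> (\<forall>c. \<forall>X\<in>R. rsc c * X \<in> R)"

lemma lin_closed_sum: "lin_closed R \<Longrightarrow> (\<And>i. i \<in> I \<Longrightarrow> g i \<in> R) \<Longrightarrow> sum g I \<in> R"
  by (induction I rule: infinite_finite_induct) (auto simp: lin_closed_def)

lemma lin_closed_supermats: "lin_closed (supermats m P Q)"
  unfolding lin_closed_def
proof (intro conjI ballI allI)
  fix X Y :: "'a gr rfm" and c
  assume X: "X \<in> supermats m P Q" and Y: "Y \<in> supermats m P Q"
  let ?s = "\<lambda>X. {(i, j, S). coef (ent X i j) S \<noteq> 0}"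
  have fin: "finite (?s X)" "finite (?s Y)" using X Y by (auto simp: supermats_def)
  have mem: "coef (ent X i j) S \<noteq> 0 \<Longrightarrow> S \<in> grassmann_index m \<and> (i, j) \<in> (if even (card S) then P else Q)"
    "coef (ent Y i j) S \<noteq> 0 \<Longrightarrow> S \<in> grassmann_index m \<and> (i, j) \<in> (if even (card S) then P else Q)" for i j S
    using X Y unfolding supermats_def by blast+
  show "X + Y \<in> supermats m P Q"
  proof (rule supermatsI[of "?s X \<union> ?s Y"])
    fix i j S assume "coef (ent (X + Y) i j) S \<noteq> 0"
    then have *: "coef (ent X i j) S \<noteq> 0 \<or> coef (ent Y i j) S \<noteq> 0" by auto
    then show "(i, j, S) \<in> ?s X \<union> ?s Y" by blast
    show "S \<in> grassmann_index m \<and> (i, j) \<in> (if even (card S) then P else Q)" using * mem by blast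
  qed (use fin in simp)
  show "rsc c * X \<in> supermats m P Q"
  proof (rule supermatsI[of "?s X"])
    fix i j S assume "coef (ent (rsc c * X) i j) S \<noteq> 0"
    then have *: "coef (ent X i j) S \<noteq> 0" by auto
    then show "(i, j, S) \<in> ?s X" by blast
    show "S \<in> grassmann_index m \<and> (i, j) \<in> (if even (card S) then P else Q)" using * mem by blast
  qed (use fin in simp)
qed simp

lemma rfm_coef_eqI: "(\<And>i j S. coef (ent X i j) S = coef (ent Y i j) S) \<Longrightarrow> X = Y"
  by (intro rfm_eqI gr_eqI)

lemma prod_list_rsc: "prod_list (map (\<lambda>t. rsc (c t) * \<beta> t) u) = rsc (prod_list (map c u)) * prod_list (map \<beta> u)"
  by (induction u) (auto simp: rsc_product)

text \<open>Rescaling every label by a scalar \<open>c t\<close> stays inside \<open>R\<close>, and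
  each coefficient of the value is a polynomial function of these scalars. As it vanishes
  identically, so does its part of each multidegree.\<close>

lemma component_zero:
  fixes f :: "nat list \<Rightarrow>\<^sub>0 'f :: field_char_0"
  assumes f: "f \<in> mat_identities R" and R: "lin_closed R" and \<beta>: "\<And>t. t \<in># \<mu> \<Longrightarrow> \<beta> t \<in> R"
  shows "component f var \<mu> \<beta> = 0"
proof (rule rfm_coef_eqI)
  fix i j S
  let ?\<Lambda> = "set_mset \<mu>"
  define U where "U = (\<Union>w\<in>Poly_Mapping.keys f. label_words ?\<Lambda> var w)"
  define a where "a u = coef (ent (rsc (Poly_Mapping.lookup f (map var u)) * prod_list (map \<beta> u)) i j) S" for u
  have "(\<Sum>u | u \<in> U \<and> mset u = \<mu>. a u) = 0"
  proof (rule poly_function_coeffs)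
    show "finite U" unfolding U_def by (rule meval_labels) simp
    fix c :: "'a \<Rightarrow> 'f"
    let ?\<rho> = "\<lambda>v. \<Sum>t | t \<in> ?\<Lambda> \<and> var t = v. rsc (c t) * \<beta> t"
    have "range ?\<rho> \<subseteq> R" using \<beta> R by (auto intro!: lin_closed_sum) (simp add: lin_closed_def)
    then have "meval f ?\<rho> = 0" using f by (simp add: mat_identities_def)
    then have "coef (ent (\<Sum>u\<in>U. rsc (Poly_Mapping.lookup f (map var u)) * prod_list (map (\<lambda>t. rsc (c t) * \<beta> t) u)) i j) S = 0"
      by (simp add: meval_labels(2) U_def)
    then show "(\<Sum>u\<in>U. a u * prod_list (map c u)) = 0"
      by (simp add: a_def prod_list_rsc mult_ac)
  qed
  moreover have "component f var \<mu> \<beta> = (\<Sum>u | u \<in> U \<and> mset u = \<mu>. rsc (Poly_Mapping.lookup f (map var u)) * prod_list (map \<beta> u))"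
    unfolding U_def by (rule component_label_words) auto
  ultimately show "coef (ent (component f var \<mu> \<beta>) i j) S = coef (ent 0 i j) S"
    by (simp add: a_def)
qed

lemma meval_components:
  assumes "finite \<Lambda>" "\<And>\<mu>. set_mset \<mu> \<subseteq> \<Lambda> \<Longrightarrow> component f var \<mu> \<beta> = 0"
  shows "meval f (\<lambda>v. \<Sum>t | t \<in> \<Lambda> \<and> var t = v. \<beta> t) = 0"
proof -
  define U where "U = (\<Union>w\<in>Poly_Mapping.keys f. label_words \<Lambda> var w)"
  have fin: "finite U" unfolding U_def by (rule meval_labels[OF assms(1)])
  have "meval f (\<lambda>v. \<Sum>t | t \<in> \<Lambda> \<and> var t = v. \<beta> t) =
      (\<Sum>u\<in>U. rsc (Poly_Mapping.lookup f (map var u)) * prod_list (map \<beta> u))"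
    unfolding U_def by (rule meval_labels[OF assms(1)])
  also have "\<dots> = (\<Sum>\<mu>\<in>mset ` U. \<Sum>u | u \<in> U \<and> mset u = \<mu>. rsc (Poly_Mapping.lookup f (map var u)) * prod_list (map \<beta> u))"
    by (rule sum.image_gen[OF fin])
  also have "\<dots> = 0"
  proof (rule sum.neutral, safe)
    fix u assume "u \<in> U"
    then have "set_mset (mset u) \<subseteq> \<Lambda>" by (auto simp: U_def label_words_def)
    then show "(\<Sum>u' | u' \<in> U \<and> mset u' = mset u. rsc (Poly_Mapping.lookup f (map var u')) * prod_list (map \<beta> u')) = 0"
      using assms component_label_words[OF assms(1), of "mset u" f var \<beta>] by (simp add: U_def)
  qed
  finally show ?thesis .
qed

type_synonym label = "nat \<times> nat \<times> nat \<times> nat set"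

fun unit_of :: "label \<Rightarrow> 'f :: field gr rfm" where "unit_of (v, i, j, S) = runit 1 i j"
fun index_of :: "label \<Rightarrow> nat set" where "index_of (v, i, j, S) = S"

lemma rscal_runit: "rscal g * runit 1 i j = runit g i j" "runit 1 i j * rscal g = runit g i j"
  by (auto intro!: rfm_eqI simp: ent_runit)

text \<open>Grassmann scalars do not commute with each other, but they commute with matrix units of
  coefficient 1. So the coefficients can be collected in front, in the order of the word.\<close>

lemma prod_list_rscal_unit:
  "prod_list (map (\<lambda>t. rscal (\<gamma> t) * unit_of t) u) = rscal (prod_list (map \<gamma> u)) * prod_list (map unit_of u)"
proof (induction u)
  case (Cons t u)
  have comm: "unit_of t * rscal g = rscal g * unit_of t" for g
    by (cases t) (simp add: rscal_runit)
  have "prod_list (map (\<lambda>t. rscal (\<gamma> t) * unit_of t) (t # u)) =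
      rscal (\<gamma> t) * ((unit_of t * rscal (prod_list (map \<gamma> u))) * prod_list (map unit_of u))"
    by (simp add: Cons.IH mult.assoc)
  also have "\<dots> = (rscal (\<gamma> t) * rscal (prod_list (map \<gamma> u))) * (unit_of t * prod_list (map unit_of u))"
    unfolding comm by (simp add: mult.assoc)
  finally show ?case by (simp add: rdiag_mult)
qed (simp add: rdiag_one)

text \<open>The coefficients \<gamma> are arbitrary, not tied to the index sets in the labels, so
  that they can be renamed or replaced by 1 while the labels stay the same.\<close>

definition gcomponent :: "(nat list \<Rightarrow>\<^sub>0 'f :: field) \<Rightarrow> label multiset \<Rightarrow> (label \<Rightarrow> 'f gr) \<Rightarrow> 'f gr rfm" where
  "gcomponent f \<mu> \<gamma> = component f fst \<mu> (\<lambda>t. rscal (\<gamma> t) * unit_of t)"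

lemma gcomponent_alt:
  "gcomponent f \<mu> \<gamma> = (\<Sum>u | mset u = \<mu>. rsc (Poly_Mapping.lookup f (map fst u)) *
     (rscal (prod_list (map \<gamma> u)) * prod_list (map unit_of u)))"
  unfolding gcomponent_def component_def prod_list_rscal_unit ..

text \<open>A label \<open>(v, i, j, S)\<close> stands for a summand \<open>c e\<^sub>S E\<^sub>i\<^sub>j\<close> of the value of the variable \<open>v\<close>. As the scalars
  \<open>c\<close> are arbitrary, the part of each multidegree in the labels vanishes separately.\<close>

lemma identity_if_gcomponents:
  fixes f :: "nat list \<Rightarrow>\<^sub>0 'f :: field"
  assumes nil: "Poly_Mapping.lookup f [] = 0"
    and comp: "\<And>\<mu> c. (\<And>v i j S. (v, i, j, S) \<in># \<mu> \<Longrightarrow> S \<in> grassmann_index m \<and> (i, j) \<in> (if even (card S) then P else Q))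
       \<Longrightarrow> gcomponent f \<mu> (\<lambda>t. gscale (c t) (ge (index_of t))) = 0"
  shows "f \<in> mat_identities (supermats m P Q)"
  unfolding mat_identities_def
proof (intro CollectI conjI nil allI impI)
  fix \<rho> :: "nat \<Rightarrow> 'f gr rfm" assume \<rho>: "range \<rho> \<subseteq> supermats m P Q"
  define V where "V = (\<Union>w\<in>Poly_Mapping.keys f. set w)"
  define supp where "supp v = {(i, j, S). coef (ent (\<rho> v) i j) S \<noteq> 0}" for v
  define \<Lambda> where "\<Lambda> = Sigma V supp"
  define c :: "label \<Rightarrow> 'f" where "c = (\<lambda>(v, i, j, S). coef (ent (\<rho> v) i j) S)"
  define \<beta> :: "label \<Rightarrow> 'f gr rfm" where "\<beta> t = rscal (gscale (c t) (ge (index_of t))) * unit_of t" for t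
  have \<rho>v: "\<rho> v \<in> supermats m P Q" for v using \<rho> by blast
  have finsupp: "finite (supp v)" for v using \<rho>v[of v] by (simp add: supp_def supermats_def)
  have fin: "finite \<Lambda>" unfolding \<Lambda>_def V_def using finsupp by auto
  have supp: "S \<in> grassmann_index m \<and> (i, j) \<in> (if even (card S) then P else Q)" if "(i, j, S) \<in> supp v" for v i j S
    using \<rho>v[of v] that unfolding supp_def supermats_def by blast
  have eq: "\<rho> v = (\<Sum>t | t \<in> \<Lambda> \<and> fst t = v. \<beta> t)" if "v \<in> V" for v
  proof -
    have "{t. t \<in> \<Lambda> \<and> fst t = v} = Pair v ` supp v" using that by (auto simp: \<Lambda>_def)
    then have "(\<Sum>t | t \<in> \<Lambda> \<and> fst t = v. \<beta> t) = (\<Sum>x\<in>supp v. \<beta> (v, x))"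
      by (simp add: sum.reindex inj_on_def)
    moreover have "\<rho> v = (\<Sum>x\<in>supp v. \<beta> (v, x))"
    proof (rule rfm_coef_eqI)
      fix i j S
      have "coef (ent (\<beta> (v, x)) i j) S = (if x = (i, j, S) then coef (ent (\<rho> v) i j) S else 0)" if "x \<in> supp v" for x
      proof -
        obtain i' j' S' where x: "x = (i', j', S')" by (cases x)
        then have "finite S'" using supp that by (auto simp: grassmann_index_def)
        then show ?thesis by (auto simp: \<beta>_def c_def x rscal_runit ent_runit coef_ge)
      qed
      then have "coef (ent (\<Sum>x\<in>supp v. \<beta> (v, x)) i j) S =
          (\<Sum>x\<in>supp v. if x = (i, j, S) then coef (ent (\<rho> v) i j) S else 0)"
        unfolding ent_sum coef_sum by (intro sum.cong) auto
      also have "\<dots> = coef (ent (\<rho> v) i j) S" using finsupp by (auto simp: supp_def)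
      finally show "coef (ent (\<rho> v) i j) S = coef (ent (\<Sum>x\<in>supp v. \<beta> (v, x)) i j) S" ..
    qed
    ultimately show ?thesis by simp
  qed
  have "meval f \<rho> = meval f (\<lambda>v. \<Sum>t | t \<in> \<Lambda> \<and> fst t = v. \<beta> t)"
    unfolding meval_def
  proof (rule sum.cong[OF refl])
    fix w assume "w \<in> Poly_Mapping.keys f"
    then have "map \<rho> w = map (\<lambda>v. \<Sum>t | t \<in> \<Lambda> \<and> fst t = v. \<beta> t) w"
      by (intro map_cong refl eq) (auto simp: V_def)
    then show "rsc (Poly_Mapping.lookup f w) * prod_list (map \<rho> w) =
       rsc (Poly_Mapping.lookup f w) * prod_list (map (\<lambda>v. \<Sum>t | t \<in> \<Lambda> \<and> fst t = v. \<beta> t) w)" by (simp only:)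
  qed
  also have "\<dots> = 0"
  proof (rule meval_components[OF fin])
    fix \<mu> assume "set_mset \<mu> \<subseteq> \<Lambda>"
    then have "(i, j, S) \<in> supp v" if "(v, i, j, S) \<in># \<mu>" for v i j S
      using that by (auto simp: \<Lambda>_def)
    then have "gcomponent f \<mu> (\<lambda>t. gscale (c t) (ge (index_of t))) = 0"
      by (intro comp supp)
    then show "component f fst \<mu> \<beta> = 0" by (simp add: gcomponent_def \<beta>_def[abs_def])
  qed
  finally show "meval f \<rho> = 0" .
qed

lemma prod_list_perm:
  assumes "mset u = mset u'" "\<And>s t. s \<in> set u \<Longrightarrow> t \<in> set u \<Longrightarrow> \<gamma> s * \<gamma> t = \<gamma> t * \<gamma> s"
  shows "prod_list (map \<gamma> u) = (prod_list (map \<gamma> u') :: 'q :: monoid_mult)"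
  using assms
proof (induction u arbitrary: u')
  case (Cons a u)
  then have "a \<in> set u'" by (metis list.set_intros(1) mset_eq_setD)
  then obtain x y where u': "u' = x @ a # y" by (meson split_list)
  then have "mset u = mset (x @ y)" using Cons.prems(1) by simp
  then have "prod_list (map \<gamma> u) = prod_list (map \<gamma> (x @ y))" using Cons.prems(2) by (intro Cons.IH) auto
  moreover have "\<gamma> a * prod_list (map \<gamma> x) = prod_list (map \<gamma> x) * \<gamma> a"
  proof (rule prod_list_commute)
    fix z assume "z \<in> set (map \<gamma> x)"
    moreover have "set x \<subseteq> set u" using \<open>mset u = mset (x @ y)\<close> by (metis mset_eq_setD set_append Un_upper1)
    ultimately show "\<gamma> a * z = z * \<gamma> a" using Cons.prems(2) by auto
  qed
  ultimately show ?case by (simp add: u' mult.assoc[symmetric])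
qed simp

text \<open>When all occurring monomials commute, the product of the coefficients of a word depends
  on its multiset of labels only and can be taken out of the component. What remains is a component
  in plain matrix units, which vanishes as these lie in \<open>R\<close>.\<close>

lemma commuting_identities:
  fixes R :: "'f :: field_char_0 gr rfm set"
  assumes R: "lin_closed R" "\<And>i j. (i, j) \<in> P \<union> Q \<Longrightarrow> runit 1 i j \<in> R"
    and comm: "\<And>S T i j i' j'. S \<in> grassmann_index m \<Longrightarrow> T \<in> grassmann_index m \<Longrightarrow>
      (i, j) \<in> (if even (card S) then P else Q) \<Longrightarrow> (i', j') \<in> (if even (card T) then P else Q) \<Longrightarrow>
      ge S * ge T = (ge T * ge S :: 'f gr)"
  shows "mat_identities R \<subseteq> mat_identities (supermats m P Q)"
proof
  fix f assume f: "f \<in> mat_identities R"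
  show "f \<in> mat_identities (supermats m P Q)"
  proof (rule identity_if_gcomponents)
    show "Poly_Mapping.lookup f [] = 0" using f by (simp add: mat_identities_def)
    fix \<mu> :: "label multiset" and c :: "label \<Rightarrow> 'f"
    assume \<mu>: "\<And>v i j S. (v, i, j, S) \<in># \<mu> \<Longrightarrow> S \<in> grassmann_index m \<and> (i, j) \<in> (if even (card S) then P else Q)"
    let ?\<gamma> = "\<lambda>t. gscale (c t) (ge (index_of t))"
    obtain u0 where u0: "mset u0 = \<mu>" using ex_mset by blast
    have eq: "prod_list (map ?\<gamma> u) = prod_list (map ?\<gamma> u0)" if "mset u = \<mu>" for u
    proof (rule prod_list_perm)
      show "mset u = mset u0" using that u0 by simp
      fix s t assume st: "s \<in> set u" "t \<in> set u"
      obtain v i j S where s: "s = (v, i, j, S)" by (cases s)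
      obtain v' i' j' T where t: "t = (v', i', j', T)" by (cases t)
      have "s \<in># \<mu>" "t \<in># \<mu>" using st that by auto
      then have "ge S * ge T = (ge T * ge S :: 'f gr)" using \<mu> s t by (intro comm) blast+
      then show "?\<gamma> s * ?\<gamma> t = ?\<gamma> t * ?\<gamma> s" by (simp add: s t gscale_mult mult.commute)
    qed
    have "gcomponent f \<mu> ?\<gamma> = (\<Sum>u | mset u = \<mu>. rscal (prod_list (map ?\<gamma> u0)) *
        (rsc (Poly_Mapping.lookup f (map fst u)) * prod_list (map unit_of u)))"
      unfolding gcomponent_alt by (rule sum.cong) (auto simp: eq rsc_left_commute)
    also have "\<dots> = rscal (prod_list (map ?\<gamma> u0)) * component f fst \<mu> unit_of"
      by (simp add: component_def sum_distrib_left)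
    also have "component f fst \<mu> (unit_of :: label \<Rightarrow> 'f gr rfm) = 0"
    proof (rule component_zero[OF f R(1)])
      fix t assume t: "t \<in># \<mu>"
      obtain v i j S where t': "t = (v, i, j, S)" by (cases t)
      then have "(i, j) \<in> (if even (card S) then P else Q)" using \<mu>[of v i j S] t by simp
      then have "(i, j) \<in> P \<union> Q" by (auto split: if_splits)
      then show "unit_of t \<in> R" using R(2) by (simp add: t')
    qed
    finally show "gcomponent f \<mu> ?\<gamma> = 0" by simp
  qed
qed

section \<open>Renaming generators along an increasing map that omits one index\<close>

definition skip :: "nat \<Rightarrow> nat \<Rightarrow> nat" where "skip c i = (if i < c then i else Suc i)"

lemma skip_inj: "inj (skip c)" by (auto simp: inj_def skip_def split: if_splits)

lemma skip_less [simp]: "skip c i < skip c j \<longleftrightarrow> i < j" by (auto simp: skip_def)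

lemma range_skip: "range (skip c) = - {c}"
proof -
  have "x \<in> range (skip c)" if "x \<noteq> c" for x
  proof (cases "x < c")
    case True then show ?thesis by (intro image_eqI[of _ _ x]) (auto simp: skip_def)
  next
    case False with that show ?thesis by (intro image_eqI[of _ _ "x - 1"]) (auto simp: skip_def)
  qed
  then show ?thesis by (auto simp: skip_def)
qed

lemma skip_image_vimage: "c \<notin> S \<Longrightarrow> skip c ` (skip c -` S) = S"
  by (auto simp: range_skip image_vimage_eq)

lemma shuffle_sign_skip: "shuffle_sign (skip c ` S) (skip c ` T) = shuffle_sign S T"
proof -
  have "{(s, t). s \<in> skip c ` S \<and> t \<in> skip c ` T \<and> t < s} = map_prod (skip c) (skip c) ` {(s, t). s \<in> S \<and> t \<in> T \<and> t < s}"
    by force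
  moreover have "inj_on (map_prod (skip c) (skip c)) X" for X
    using skip_inj by (meson inj_on_subset prod.inj_map subset_UNIV)
  ultimately show ?thesis by (simp add: shuffle_sign_def card_image)
qed

lemma infinite_vimage_skip: "infinite S \<Longrightarrow> c \<notin> S \<Longrightarrow> infinite (skip c -` S)"
  using skip_image_vimage finite_imageI by metis

text \<open>The generator of index \<open>i\<close> becomes the one of index
  \<open>skip c i\<close>, so the values are free of the generator \<open>c\<close>. As
  \<open>skip c\<close> is increasing, it preserves shuffle signs and the map is a ring
  homomorphism.\<close>

lift_definition rename :: "nat \<Rightarrow> 'f :: field gr \<Rightarrow> 'f gr" is
  "\<lambda>c g S. if c \<in> S then 0 else g (skip c -` S)"
  by (auto simp: infinite_vimage_skip)

lemma coef_rename: "coef (rename c g) S = (if c \<in> S then 0 else coef g (skip c -` S))"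
  by (simp add: rename.rep_eq)

lemma gr_hom_rename: "gr_hom (rename c)"
  unfolding gr_hom_def
proof (intro conjI allI)
  show "rename c 1 = (1 :: 'a gr)"
  proof (rule gr_eqI)
    fix S
    have "skip c -` S = {} \<longleftrightarrow> S = {}" if "c \<notin> S"
      using skip_image_vimage[OF that] by (metis image_is_empty)
    then show "coef (rename c 1) S = coef (1 :: 'a gr) S" by (auto simp: coef_rename coef_one)
  qed
  fix g h :: "'a gr"
  show "rename c (g + h) = rename c g + rename c h" by (rule gr_eqI) (simp add: coef_rename)
  show "rename c (g * h) = rename c g * rename c h"
  proof (rule gr_eqI)
    fix U :: "nat set" assume U: "finite U"
    show "coef (rename c (g * h)) U = coef (rename c g * rename c h) U"
    proof (cases "c \<in> U")
      case True
      then have "coef (rename c g * rename c h) U = 0"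
        unfolding times_gr.rep_eq by (intro sum.neutral) (auto simp: coef_rename)
      with True show ?thesis by (simp add: coef_rename)
    next
      case False
      let ?V = "skip c -` U"
      have img: "skip c ` (?V - S) = U - skip c ` S" for S
        using skip_image_vimage[OF False] by (simp add: image_set_diff[OF skip_inj])
      have "coef (rename c (g * h)) U = (\<Sum>S\<in>Pow ?V. shuffle_sign S (?V - S) * coef g S * coef h (?V - S))"
        using False by (simp add: coef_rename times_gr.rep_eq)
      also have "\<dots> = (\<Sum>S\<in>Pow U. shuffle_sign S (U - S) * coef (rename c g) S * coef (rename c h) (U - S))"
      proof (rule sum.reindex_bij_witness[where i = "\<lambda>S. skip c -` S" and j = "\<lambda>S. skip c ` S"])
        fix S assume S: "S \<in> Pow ?V"
        show "skip c -` (skip c ` S) = S" by (simp add: inj_vimage_image_eq[OF skip_inj])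
        show "skip c ` S \<in> Pow U" using S by auto
        have "skip c -` (U - skip c ` S) = ?V - S"
          unfolding img[symmetric] by (simp add: inj_vimage_image_eq[OF skip_inj])
        moreover have "shuffle_sign (skip c ` S) (U - skip c ` S) = (shuffle_sign S (?V - S) :: 'a)"
          unfolding img[symmetric] by (rule shuffle_sign_skip)
        moreover have "c \<notin> skip c ` S" by (auto simp: skip_def split: if_splits)
        ultimately show "shuffle_sign (skip c ` S) (U - skip c ` S) * coef (rename c g) (skip c ` S) * coef (rename c h) (U - skip c ` S) =
           shuffle_sign S (?V - S) * coef g S * coef h (?V - S)"
          using False by (simp add: coef_rename inj_vimage_image_eq[OF skip_inj])
      qed (use False in \<open>auto simp: range_skip image_vimage_eq\<close>)
      finally show ?thesis by (simp add: times_gr.rep_eq)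
    qed
  qed
qed

lemma rename_one: "rename c 1 = 1" by (metis gr_hom_def gr_hom_rename)

lemma rename_gscale: "rename a (gscale c g) = gscale c (rename a g)"
  by (rule gr_eqI) (simp add: coef_rename)

lemma rename_ge:
  assumes "finite S" "c \<notin> S" shows "rename c (ge (skip c -` S)) = ge S"
proof (rule gr_eqI)
  fix T
  have "finite (skip c -` S)" using assms(1) by (intro finite_vimageI skip_inj)
  moreover have "(skip c -` T = skip c -` S) = (T = S)" if "c \<notin> T"
    using skip_image_vimage[OF that] skip_image_vimage[OF assms(2)] by metis
  ultimately show "coef (rename c (ge (skip c -` S))) T = coef (ge S) T"
    using assms by (auto simp: coef_rename coef_ge)
qed

lemma rmap_rename_rscal: "rmap (rename c) (rscal g) = rscal (rename c g)"
  by (rule rfm_eqI) (simp add: ent_rmap_hom[OF gr_hom_rename] ent_rdiag gr_hom_zero[OF gr_hom_rename])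

lemma rmap_rename_unit: "rmap (rename c) (unit_of t) = unit_of t"
  by (cases t) (auto intro!: rfm_eqI
      simp: ent_rmap_hom[OF gr_hom_rename] ent_runit gr_hom_zero[OF gr_hom_rename] rename_one)

lemma gcomponent_rename:
  fixes f :: "nat list \<Rightarrow>\<^sub>0 'a :: field"
  shows "gcomponent f \<mu> (\<lambda>t. rename c (\<gamma> t)) = rmap (rename c) (gcomponent f \<mu> \<gamma>)"
proof -
  note hom = gr_hom_rename[of c]
  have "rmap (rename c) (prod_list (map g u)) = prod_list (map (\<lambda>t. rmap (rename c) (g t)) u)"
    for g :: "label \<Rightarrow> 'a gr rfm" and u
    by (induction u) (auto simp: rmap_one[OF hom] rmap_mult[OF hom])
  moreover have "rmap (rename c) (rsc a) = (rsc a :: 'a gr rfm)" for a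
    unfolding rsc_def rmap_rename_rscal rename_gscale rename_one ..
  ultimately show ?thesis
    unfolding gcomponent_def component_def
    by (simp add: rmap_sum[OF hom] rmap_mult[OF hom] rmap_rename_rscal rmap_rename_unit)
qed

text \<open>If the generator \<open>c\<close> occurs in no coefficient, closing the gap in the
  numbering leaves at most \<open>N\<close> generators, where \<open>f\<close> is an identity;
  \<open>rename c\<close> transports the vanishing back.\<close>

lemma gcomponent_zero_if_missing:
  fixes f :: "nat list \<Rightarrow>\<^sub>0 'f :: field_char_0"
  assumes f: "f \<in> mat_identities (supermats (enat N) B B)" and c: "c \<in> {1..Suc N}"
    and \<gamma>: "\<And>v i j S. (v, i, j, S) \<in># \<mu> \<Longrightarrow>
      (i, j) \<in> B \<and> (\<exists>a T. \<gamma> (v, i, j, S) = gscale a (ge T) \<and> T \<subseteq> {1..Suc N} - {c})"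
  shows "gcomponent f \<mu> \<gamma> = 0"
proof -
  have "\<exists>\<delta>. \<gamma> t = rename c \<delta> \<and> rscal \<delta> * unit_of t \<in> supermats (enat N) B B" if t: "t \<in># \<mu>" for t
  proof -
    obtain v i j S where t': "t = (v, i, j, S)" by (cases t)
    obtain a T where T: "(i, j) \<in> B" "\<gamma> t = gscale a (ge T)" "T \<subseteq> {1..Suc N} - {c}"
      using \<gamma> t unfolding t' by blast
    have fin: "finite T" by (rule finite_subset[OF T(3)]) simp
    have cT: "c \<notin> T" using T(3) by blast
    have "skip c -` T \<subseteq> {1..N}"
    proof
      fix x assume "x \<in> skip c -` T"
      then have "skip c x \<in> {1..Suc N} - {c}" using T(3) by auto
      then show "x \<in> {1..N}" using c by (auto simp: skip_def split: if_splits)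
    qed
    then have "skip c -` T \<in> grassmann_index (enat N)"
      using fin by (auto simp: grassmann_index_def finite_vimageI[OF _ skip_inj])
    then have "(runit (ge (skip c -` T)) i j :: 'f gr rfm) \<in> supermats (enat N) B B"
      using T(1) by (intro supermats_runit) auto
    then have "rsc a * runit (ge (skip c -` T)) i j \<in> supermats (enat N) B B"
      using lin_closed_supermats[of "enat N" B B, where 'a = 'f] unfolding lin_closed_def by blast
    then have "rscal (gscale a (ge (skip c -` T))) * unit_of t \<in> supermats (enat N) B B"
      by (simp add: t' rscal_runit rsc_runit)
    moreover have "\<gamma> t = rename c (gscale a (ge (skip c -` T)))"
      using T(2) by (simp add: rename_gscale rename_ge[OF fin cT])
    ultimately show ?thesis by blast
  qed
  then obtain \<delta> where \<delta>: "\<And>t. t \<in># \<mu> \<Longrightarrow> \<gamma> t = rename c (\<delta> t)"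
    "\<And>t. t \<in># \<mu> \<Longrightarrow> rscal (\<delta> t) * unit_of t \<in> supermats (enat N) B B" by metis
  have "gcomponent f \<mu> \<gamma> = gcomponent f \<mu> (\<lambda>t. rename c (\<delta> t))"
    unfolding gcomponent_alt
  proof (rule sum.cong[OF refl])
    fix u assume "u \<in> {u. mset u = \<mu>}"
    then have "map \<gamma> u = map (\<lambda>t. rename c (\<delta> t)) u" using \<delta>(1) by auto
    then show "rsc (Poly_Mapping.lookup f (map fst u)) * (rscal (prod_list (map \<gamma> u)) * prod_list (map unit_of u)) =
      rsc (Poly_Mapping.lookup f (map fst u)) * (rscal (prod_list (map (\<lambda>t. rename c (\<delta> t)) u)) * prod_list (map unit_of u))"
      by (simp only:)
  qed
  also have "\<dots> = rmap (rename c) (gcomponent f \<mu> \<delta>)" by (rule gcomponent_rename)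
  also have "gcomponent f \<mu> \<delta> = 0"
    unfolding gcomponent_def by (rule component_zero[OF f lin_closed_supermats \<delta>(2)])
  finally show ?thesis by (simp add: rmap_zero[OF gr_hom_rename])
qed

text \<open>If an odd number of the factors are odd, then moving each odd factor to the front produces
  the signs \<open>+, -, \<dots>, +\<close>, so the sum of the results is the product itself.\<close>

lemma odd_factors_to_front:
  fixes \<gamma> :: "'l \<Rightarrow> 'f :: field gr"
  assumes "distinct (filter par u)" and "\<And>t. t \<in> set u \<Longrightarrow> if par t then godd (\<gamma> t) else geven (\<gamma> t)"
  shows "(\<Sum>j | j \<in> set u \<and> par j. \<gamma> j * prod_list (map (\<gamma>(j := 1)) u)) =
    (if odd (length (filter par u)) then prod_list (map \<gamma> u) else 0)"
  using assms
proof (induction u)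
  case (Cons a u)
  let ?F = "\<lambda>u. \<Sum>j | j \<in> set u \<and> par j. \<gamma> j * prod_list (map (\<gamma>(j := 1)) u)"
  have IH: "?F u = (if odd (length (filter par u)) then prod_list (map \<gamma> u) else 0)"
    using Cons.prems by (intro Cons.IH) (auto split: if_splits)
  show ?case
  proof (cases "par a")
    case False
    then have ev: "geven (\<gamma> a)" using Cons.prems(2)[of a] by simp
    have "{j. j \<in> set (a # u) \<and> par j} = {j. j \<in> set u \<and> par j}" using False by auto
    then have "?F (a # u) = (\<Sum>j | j \<in> set u \<and> par j. \<gamma> a * (\<gamma> j * prod_list (map (\<gamma>(j := 1)) u)))"
    proof (rule sum.cong)
      fix j assume "j \<in> {j. j \<in> set u \<and> par j}"
      then have "j \<noteq> a" using False by auto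
      then show "\<gamma> j * prod_list (map (\<gamma>(j := 1)) (a # u)) = \<gamma> a * (\<gamma> j * prod_list (map (\<gamma>(j := 1)) u))"
        using geven_commute[OF ev, of "\<gamma> j"] by (simp add: mult.assoc[symmetric] del: fun_upd_apply) simp
    qed
    also have "\<dots> = \<gamma> a * ?F u" by (simp only: sum_distrib_left)
    finally show ?thesis unfolding IH by (rule trans) (use False in simp)
  next
    case True
    then have od: "godd (\<gamma> a)" using Cons.prems(2)[of a] by simp
    have a: "a \<notin> set u" using Cons.prems(1) True by auto
    have set: "{j. j \<in> set (a # u) \<and> par j} = insert a {j. j \<in> set u \<and> par j}" using True by auto
    have "map (\<gamma>(a := 1)) u = map \<gamma> u" using a by auto
    then have "?F (a # u) = \<gamma> a * prod_list (map \<gamma> u) +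
        (\<Sum>j | j \<in> set u \<and> par j. \<gamma> j * prod_list (map (\<gamma>(j := 1)) (a # u)))"
      unfolding set using a by (subst sum.insert) (auto simp del: fun_upd_apply, simp)
    also have "(\<Sum>j | j \<in> set u \<and> par j. \<gamma> j * prod_list (map (\<gamma>(j := 1)) (a # u))) =
        (\<Sum>j | j \<in> set u \<and> par j. - (\<gamma> a * (\<gamma> j * prod_list (map (\<gamma>(j := 1)) u))))"
    proof (rule sum.cong[OF refl])
      fix j assume j: "j \<in> {j. j \<in> set u \<and> par j}"
      then have "j \<noteq> a" using a by auto
      have "godd (\<gamma> j)" using Cons.prems(2)[of j] j by auto
      then have "\<gamma> j * \<gamma> a = - (\<gamma> a * \<gamma> j)" using od by (rule godd_anticommute)
      then show "\<gamma> j * prod_list (map (\<gamma>(j := 1)) (a # u)) = - (\<gamma> a * (\<gamma> j * prod_list (map (\<gamma>(j := 1)) u)))"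
        using \<open>j \<noteq> a\<close> by (simp add: mult.assoc[symmetric] del: fun_upd_apply) simp
    qed
    also have "\<dots> = - (\<gamma> a * ?F u)" by (simp only: sum_negf sum_distrib_left)
    finally show ?thesis unfolding IH by (rule trans) (use True in auto)
  qed
qed simp

section \<open>One more generator after an even number of them\<close>

lemma gdeg_gscale_ge: "finite S \<Longrightarrow> gdeg (card S) (gscale a (ge S))"
  by (simp add: gdeg_def coef_ge)

lemma gdeg_prod_list: "(\<And>t. t \<in> set u \<Longrightarrow> gdeg (d t) (\<gamma> t)) \<Longrightarrow> gdeg (sum_list (map d u)) (prod_list (map \<gamma> u))"
  by (induction u) (auto intro: gdeg_mult simp: gdeg_def[of 0])

lemma coef_prod_list_index:
  "(\<And>t S. t \<in> set u \<Longrightarrow> coef (\<gamma> t) S \<noteq> 0 \<Longrightarrow> S \<subseteq> A) \<Longrightarrow> coef (prod_list (map \<gamma> u)) S \<noteq> 0 \<Longrightarrow> S \<subseteq> A"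
proof (induction u arbitrary: S)
  case (Cons a u)
  have nz: "coef (\<gamma> a * prod_list (map \<gamma> u)) S \<noteq> 0" using Cons.prems(2) by simp
  obtain V W where "coef (\<gamma> a) V \<noteq> 0" "coef (prod_list (map \<gamma> u)) W \<noteq> 0" "V \<union> W = S"
    by (rule coef_mult_nonzero[OF nz])
  moreover from this have "W \<subseteq> A" using Cons.IH Cons.prems(1) by auto
  ultimately show ?case using Cons.prems(1)[of a V] by auto
qed (auto simp: coef_one split: if_splits)

text \<open>Double counting of the pairs consisting of a label, with multiplicity, and an element of
  its index set.\<close>

lemma sum_card_eq_sum_count:
  assumes "finite A" "\<And>t. t \<in># \<mu> \<Longrightarrow> S t \<subseteq> A"
  shows "(\<Sum>t\<in>#\<mu>. card (S t)) = (\<Sum>c\<in>A. size (filter_mset (\<lambda>t. c \<in> S t) \<mu>))"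
  using assms
proof (induction \<mu>)
  case (add t \<mu>)
  have "card (S t) = (\<Sum>c\<in>A. if c \<in> S t then 1 else 0)"
    using add.prems by (simp add: sum.If_cases Int_absorb1)
  moreover have "size (filter_mset (\<lambda>t. c \<in> S t) (add_mset t \<mu>)) =
      (if c \<in> S t then 1 else 0) + size (filter_mset (\<lambda>t. c \<in> S t) \<mu>)" for c by simp
  moreover have "(\<Sum>t\<in>#\<mu>. card (S t)) = (\<Sum>c\<in>A. size (filter_mset (\<lambda>t. c \<in> S t) \<mu>))"
    using add.prems by (intro add.IH) auto
  ultimately show ?case by (simp only: sum.distrib image_mset_add_mset sum_mset.add_mset)
qed simp

lemma rscal_mult: "rscal (a * b) = rscal a * rscal b"
  by (simp add: rdiag_mult)

lemma gcomponent_front: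
  assumes "\<And>u. mset u = \<mu> \<Longrightarrow> prod_list (map \<gamma> u) = (\<Sum>j\<in>J. \<gamma> j * prod_list (map (\<gamma>(j := 1)) u))"
  shows "gcomponent f \<mu> \<gamma> = (\<Sum>j\<in>J. rscal (\<gamma> j) * gcomponent f \<mu> (\<gamma>(j := 1)))"
proof -
  have rs: "rscal (\<Sum>j\<in>J. g j) = (\<Sum>j\<in>J. rscal (g j))" for g :: "label \<Rightarrow> 'a gr"
    by (induction J rule: infinite_finite_induct) (auto simp: rscal_add rscal_zero)
  have "gcomponent f \<mu> \<gamma> = (\<Sum>u | mset u = \<mu>. \<Sum>j\<in>J. rscal (\<gamma> j) * (rsc (Poly_Mapping.lookup f (map fst u)) *
     (rscal (prod_list (map (\<gamma>(j := 1)) u)) * prod_list (map unit_of u))))"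
    unfolding gcomponent_alt
  proof (rule sum.cong[OF refl])
    fix u assume "u \<in> {u. mset u = \<mu>}"
    then have "prod_list (map \<gamma> u) = (\<Sum>j\<in>J. \<gamma> j * prod_list (map (\<gamma>(j := 1)) u))" using assms by blast
    then show "rsc (Poly_Mapping.lookup f (map fst u)) * (rscal (prod_list (map \<gamma> u)) * prod_list (map unit_of u)) =
      (\<Sum>j\<in>J. rscal (\<gamma> j) * (rsc (Poly_Mapping.lookup f (map fst u)) *
         (rscal (prod_list (map (\<gamma>(j := 1)) u)) * prod_list (map unit_of u))))"
      by (simp only: rs rscal_mult sum_distrib_left sum_distrib_right rsc_left_commute mult.assoc)
  qed
  also have "\<dots> = (\<Sum>j\<in>J. rscal (\<gamma> j) * gcomponent f \<mu> (\<gamma>(j := 1)))"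
    unfolding gcomponent_alt by (subst sum.swap) (simp add: sum_distrib_left)
  finally show ?thesis .
qed

text \<open>Each multihomogeneous component is treated by how often the generators occur in its
  labels. If one is missing, renaming reduces to \<open>N\<close> generators; if one is repeated,
  all products are zero. In the remaining case each occurs exactly once, and since their number
  \<open>N + 1\<close> is odd, odd coefficients can be pulled out to the front.\<close>

lemma even_generators_suffice:
  fixes B :: "(nat \<times> nat) set" and N :: nat
  assumes "even N"
  shows "mat_identities (supermats (enat N) B B :: 'f :: field_char_0 gr rfm set) \<subseteq>
    mat_identities (supermats (enat (Suc N)) B B)"
proof
  fix f :: "nat list \<Rightarrow>\<^sub>0 'f" assume f: "f \<in> mat_identities (supermats (enat N) B B)"
  show "f \<in> mat_identities (supermats (enat (Suc N)) B B)"
  proof (rule identity_if_gcomponents)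
    show "Poly_Mapping.lookup f [] = 0" using f by (simp add: mat_identities_def)
    fix \<mu> :: "label multiset" and a :: "label \<Rightarrow> 'f"
    assume "\<And>v i j S. (v, i, j, S) \<in># \<mu> \<Longrightarrow> S \<in> grassmann_index (enat (Suc N)) \<and> (i, j) \<in> (if even (card S) then B else B)"
    then have \<mu>: "S \<subseteq> {1..Suc N}" "(i, j) \<in> B" if "(v, i, j, S) \<in># \<mu>" for v i j S
      using that by (auto simp: grassmann_index_def)
    define \<gamma> where "\<gamma> t = gscale (a t) (ge (index_of t))" for t
    have sub: "index_of t \<subseteq> {1..Suc N}" if "t \<in># \<mu>" for t using that \<mu>(1) by (cases t) auto
    have fin: "finite (index_of t)" if "t \<in># \<mu>" for t using sub[OF that] finite_subset by blast
    define n where "n c = size (filter_mset (\<lambda>t. c \<in> index_of t) \<mu>)" for c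
    define w where "w = (\<Sum>t\<in>#\<mu>. card (index_of t))"
    have w: "w = (\<Sum>c\<in>{1..Suc N}. n c)"
      unfolding w_def n_def by (rule sum_card_eq_sum_count) (use sub in auto)
    have "gcomponent f \<mu> \<gamma> = 0"
    proof (cases "\<exists>c\<in>{1..Suc N}. n c = 0")
      case True
      then obtain c where c: "c \<in> {1..Suc N}" "n c = 0" by blast
      have "c \<notin> index_of t" if "t \<in># \<mu>" for t
      proof
        assume "c \<in> index_of t"
        then have "t \<in># filter_mset (\<lambda>t. c \<in> index_of t) \<mu>" using that by simp
        then show False using c(2) unfolding n_def by (metis size_eq_0_iff_empty empty_iff set_mset_empty)
      qed
      note missing = this
      show ?thesis
      proof (rule gcomponent_zero_if_missing[OF f c(1)])
        fix v i j S assume t: "(v, i, j, S) \<in># \<mu>"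
        have "S \<subseteq> {1..Suc N} - {c}" using missing[OF t] \<mu>(1)[OF t] by auto
        then show "(i, j) \<in> B \<and> (\<exists>b T. \<gamma> (v, i, j, S) = gscale b (ge T) \<and> T \<subseteq> {1..Suc N} - {c})"
          using \<mu>(2)[OF t] by (auto simp: \<gamma>_def)
      qed
    next
      case False
      then have n1: "1 \<le> n c" if "c \<in> {1..Suc N}" for c using that by (metis One_nat_def Suc_leI neq0_conv)
      show ?thesis
      \<comment> \<open>All generators occur, so the total degree \<open>w\<close> is at least their
        number. If it is larger, every product vanishes, because no monomial has more than
        \<open>N + 1\<close> factors.\<close>
      proof (cases "Suc N < w")
        case True
        have "prod_list (map \<gamma> u) = 0" if u: "mset u = \<mu>" for u
        proof (rule gr_eqI, rule ccontr)
          fix S assume "finite S" and nz: "coef (prod_list (map \<gamma> u)) S \<noteq> coef 0 S"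
          have "gdeg (sum_list (map (\<lambda>t. card (index_of t)) u)) (prod_list (map \<gamma> u))"
            using u fin by (intro gdeg_prod_list) (auto simp: \<gamma>_def intro: gdeg_gscale_ge)
          moreover have "sum_list (map (\<lambda>t. card (index_of t)) u) = w"
            unfolding w_def u[symmetric] by (metis mset_map sum_mset_sum_list)
          ultimately have "w \<le> card S" using nz by (simp add: gdeg_def)
          moreover have "S \<subseteq> {1..Suc N}"
          proof (rule coef_prod_list_index)
            show "coef (prod_list (map \<gamma> u)) S \<noteq> 0" using nz by simp
            fix t T assume t: "t \<in> set u" "coef (\<gamma> t) T \<noteq> 0"
            then have "t \<in># \<mu>" using u by auto
            then have "T = index_of t" using t(2) fin by (auto simp: \<gamma>_def coef_ge split: if_splits)
            then show "T \<subseteq> {1..Suc N}" using sub \<open>t \<in># \<mu>\<close> by simp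
          qed
          then have "card S \<le> Suc N" using card_mono[of "{1..Suc N}" S] by simp
          ultimately show False using True by simp
        qed
        then show ?thesis unfolding gcomponent_alt by (intro sum.neutral) (auto simp: rscal_zero)
      next
        case False
        have "(\<Sum>c\<in>{1..Suc N}. n c - 1) = w - (\<Sum>c\<in>{1..Suc N}. 1)"
          unfolding w by (rule sum_subtractf_nat) (use n1 in auto)
        then have "(\<Sum>c\<in>{1..Suc N}. n c - 1) = 0" using False by simp
        then have n: "n c = 1" if "c \<in> {1..Suc N}" for c using that n1[OF that] by (metis One_nat_def diff_is_0_eq' finite_atLeastAtMost le_antisym sum_eq_0_iff diff_is_0_eq)
        then have wN: "w = Suc N" by (simp add: w)
        \<comment> \<open>Labels that share a generator coincide and have multiplicity 1. Odd labels
          have nonempty index sets, so they are distinct, as \<open>odd_factors_to_front\<close>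
          demands.\<close>
        have unique: "t = s \<and> count \<mu> s = 1" if "s \<in># \<mu>" "t \<in># \<mu>" "c \<in> index_of s" "c \<in> index_of t" for s t c
        proof -
          have "c \<in> {1..Suc N}" using sub that by blast
          then have "size (filter_mset (\<lambda>t. c \<in> index_of t) \<mu>) = 1" using n unfolding n_def by blast
          then obtain x where x: "filter_mset (\<lambda>t. c \<in> index_of t) \<mu> = {#x#}" using size_1_singleton_mset by blast
          have "s \<in># filter_mset (\<lambda>t. c \<in> index_of t) \<mu>" "t \<in># filter_mset (\<lambda>t. c \<in> index_of t) \<mu>"
            using that by simp_all
          then have "s = x" "t = x" unfolding x by simp_all
          moreover have "count \<mu> x = count {#x#} x" unfolding x[symmetric] using that \<open>s = x\<close> by simp
          ultimately show ?thesis by simp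
        qed
        define o' where "o' t = odd (card (index_of t))" for t :: label
        let ?J = "{j. j \<in># \<mu> \<and> o' j}"
        have "gcomponent f \<mu> \<gamma> = (\<Sum>j\<in>?J. rscal (\<gamma> j) * gcomponent f \<mu> (\<gamma>(j := 1)))"
        proof (rule gcomponent_front)
          fix u assume u: "mset u = \<mu>"
          have set: "set u = set_mset \<mu>" using u by auto
          have "distinct (filter o' u)"
            unfolding distinct_count_atmost_1 mset_filter u
          proof
            fix t show "count (filter_mset o' \<mu>) t = (if t \<in> set (filter o' u) then 1 else 0)"
            proof (cases "t \<in># \<mu> \<and> o' t")
              case True
              then obtain c where "c \<in> index_of t" by (metis o'_def card.empty equals0I even_zero)
              then show ?thesis using unique[of t t c] True set by simp
            qed (auto simp: set not_in_iff[symmetric])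
          qed
          moreover have "if o' t then godd (\<gamma> t) else geven (\<gamma> t)" if "t \<in> set u" for t
            using that fin[of t] set by (auto simp: o'_def \<gamma>_def godd_def geven_def coef_ge)
          \<comment> \<open>The number of odd labels has the parity of the total degree
            \<open>N + 1\<close>; this is where \<open>N\<close> being even enters.\<close>
          moreover have "odd (length (filter o' u))"
          proof -
            have "odd (sum_list (map (\<lambda>t. card (index_of t)) u)) = odd (length (filter o' u))"
              by (induction u) (auto simp: o'_def)
            moreover have "sum_list (map (\<lambda>t. card (index_of t)) u) = w"
              unfolding w_def u[symmetric] by (metis mset_map sum_mset_sum_list)
            ultimately show ?thesis using wN \<open>even N\<close> by simp
          qed
          ultimately show "prod_list (map \<gamma> u) = (\<Sum>j\<in>?J. \<gamma> j * prod_list (map (\<gamma>(j := 1)) u))"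
            using odd_factors_to_front[of o' u \<gamma>] set by (simp del: fun_upd_apply)
        qed
        also have "\<dots> = 0"
        \<comment> \<open>An odd label has a nonempty index set. With its coefficient replaced by 1,
          the generators in this set occur nowhere else, so one of them is missing.\<close>
        proof (rule sum.neutral, clarify)
          fix v i j S assume J: "(v, i, j, S) \<in># \<mu>" "o' (v, i, j, S)"
          then obtain c where c: "c \<in> S" by (auto simp: o'_def) (metis card.empty equals0I even_zero)
          then have cN: "c \<in> {1..Suc N}" using sub[OF J(1)] by auto
          have "gcomponent f \<mu> (\<gamma>((v, i, j, S) := 1)) = 0"
          proof (rule gcomponent_zero_if_missing[OF f cN])
            fix v' i' j' S' assume t: "(v', i', j', S') \<in># \<mu>"
            show "(i', j') \<in> B \<and> (\<exists>b T. (\<gamma>((v, i, j, S) := 1)) (v', i', j', S') = gscale b (ge T) \<and> T \<subseteq> {1..Suc N} - {c})"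
            proof (cases "(v', i', j', S') = (v, i, j, S)")
              case True
              then show ?thesis using \<mu>(2)[OF t] by (intro conjI exI[of _ 1] exI[of _ "{}"]) (auto simp: ge_empty)
            next
              case False
              then have "c \<notin> S'" using unique[OF J(1) t, of c] c by auto
              then show ?thesis using False \<mu>[OF t] by (auto simp: \<gamma>_def)
            qed
          qed
          then show "rscal (\<gamma> (v, i, j, S)) * gcomponent f \<mu> (\<gamma>((v, i, j, S) := 1)) = 0" by simp
        qed
        finally show ?thesis .
      qed
    qed
    then show "gcomponent f \<mu> (\<lambda>t. gscale (a t) (ge (index_of t))) = 0" by (simp add: \<gamma>_def[abs_def])
  qed
qed

lemma supermats_mono: "m \<le> m' \<Longrightarrow> supermats m P Q \<subseteq> supermats m' P Q"
  unfolding supermats_def grassmann_index_def by (fastforce intro: order_trans)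

lemma mat_identities_antimono: "R \<subseteq> R' \<Longrightarrow> mat_identities R' \<subseteq> mat_identities R"
  by (auto simp: mat_identities_def)

text \<open>Unless both algebras have odd positions, the common depth is 0: then each has no odd
  positions or only one generator, and its monomials commute. If both have odd positions, two
  different numbers of generators with the same half are 2j and 2j + 1.\<close>

theorem mat_identities_depth:
  assumes R: "admissible n 0 Q" and R': "admissible n 0 Q'" and m: "1 \<le> m" "1 \<le> m'"
    and eq: "depth m Q = depth m' Q'"
  shows "mat_identities (supermats m (block_pos n 0) Q :: 'f :: field_char_0 gr rfm set) =
    mat_identities (supermats m' (block_pos n 0) Q')"
proof -
  let ?B = "block_pos n 0"
  have ne: "?B \<noteq> {}" using R by (auto simp: admissible_def block_pos_def)
  have comm: "mat_identities (supermats m1 ?B Q1 :: 'f gr rfm set) \<subseteq> mat_identities (supermats m2 ?B Q2)"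
    if "Q2 \<subseteq> ?B" "Q2 = {} \<or> m2 = 1" for m1 m2 Q1 Q2
  proof (rule commuting_identities[OF lin_closed_supermats])
    fix i j assume "(i, j) \<in> ?B \<union> Q2"
    then show "runit 1 i j \<in> (supermats m1 ?B Q1 :: 'f gr rfm set)" using that by (auto intro: supermats_runit_1)
  next
    fix S T i j i' j'
    assume *: "S \<in> grassmann_index m2" "T \<in> grassmann_index m2"
      "(i, j) \<in> (if even (card S) then ?B else Q2)" "(i', j') \<in> (if even (card T) then ?B else Q2)"
    show "ge S * ge T = (ge T * ge S :: 'f gr)"
    proof (cases "Q2 = {}")
      case True
      then have "even (card S)" using * by (auto split: if_splits)
      then show ?thesis by (intro geven_commute geven_ge)
    next
      case False
      then have "S \<subseteq> {1}" "T \<subseteq> {1}" using * that by (auto simp: grassmann_index_def one_enat_def)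
      then have "S = {} \<or> S = {1}" "T = {} \<or> T = {1}" by auto
      then show ?thesis by (auto simp: ge_empty)
    qed
  qed
  have half: "enat_half k = 0 \<Longrightarrow> 1 \<le> k \<Longrightarrow> k = 1" for k
    by (cases k) (auto simp: zero_enat_def one_enat_def)
  have Q: "Q = {} \<or> Q = ?B" "Q' = {} \<or> Q' = ?B"
    using R R' by (auto simp: admissible_def off_pos_def)
  show ?thesis
  proof (cases "Q = ?B \<and> Q' = ?B")
    case False
    then have "depth m Q = 0" using Q eq by (metis depth_def)
    then have "Q = {} \<or> enat_half m = 0" "Q' = {} \<or> enat_half m' = 0"
      using eq unfolding depth_def by metis+
    then have "Q = {} \<or> m = 1" "Q' = {} \<or> m' = 1" using m half by blast+
    moreover have "Q \<subseteq> ?B" "Q' \<subseteq> ?B" using Q by auto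
    ultimately show ?thesis by (intro equalityI comm)
  next
    case True
    \<comment> \<open>Two different numbers with the same half are finite; the smaller one is even
      and the larger one its successor.\<close>
    have mono: "mat_identities (supermats a ?B ?B :: 'f gr rfm set) = mat_identities (supermats b ?B ?B)"
      if "enat_half a = enat_half b" "a < b" for a b
    proof -
      from that obtain a' b' where ab: "a = enat a'" "b = enat b'" by (cases a; cases b) auto
      with that have "a' div 2 = b' div 2" "a' < b'" by simp_all
      then have "b' = Suc a'" "even a'" by presburger+
      then show ?thesis using even_generators_suffice[of a' ?B, where 'f = 'f] mat_identities_antimono[OF supermats_mono[of a b]] that ab
        by (intro equalityI) auto
    qed
    from True have QB: "Q = ?B" "Q' = ?B" by blast+
    have h: "enat_half m = enat_half m'" using eq ne unfolding QB by (simp add: depth_def)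
    show ?thesis unfolding QB
    proof (cases m m' rule: linorder_cases)
      case less
      with h show "mat_identities (supermats m ?B ?B :: 'f gr rfm set) = mat_identities (supermats m' ?B ?B)"
        by (rule mono)
    next
      case greater
      with h[symmetric] show "mat_identities (supermats m ?B ?B :: 'f gr rfm set) = mat_identities (supermats m' ?B ?B)"
        by (rule mono[symmetric])
    qed simp
  qed
qed

section \<open>Classification of the graded-simple algebras\<close>

context associative_algebra
begin

lemma linear_functional_finsum:
  assumes T: "\<And>x y. x \<in> carrier A \<Longrightarrow> y \<in> carrier A \<Longrightarrow> T (x \<oplus> y) = T x + (T y :: 'f)"
    "\<And>c x. x \<in> carrier A \<Longrightarrow> T (c \<odot> x) = c * T x"
    and "finite X" "X \<subseteq> carrier A"
  shows "T (\<Oplus>b\<in>X. c b \<odot> b) = (\<Sum>b\<in>X. c b * T b)"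
  using assms(3,4)
proof (induction X)
  case empty
  have "T \<zero> = T (0 \<odot> \<zero>)" by simp
  then show ?case using T(2)[of \<zero> 0] by simp
next
  case (insert b X)
  then have "(\<Oplus>b\<in>insert b X. c b \<odot> b) = c b \<odot> b \<oplus> (\<Oplus>b\<in>X. c b \<odot> b)"
    by (intro finsum_insert) (auto intro!: smult_closed)
  moreover have "(\<Oplus>b\<in>X. c b \<odot> b) \<in> carrier A" using insert by (intro finsum_closed) auto
  ultimately show ?case using insert by (simp add: T)
qed

lemma coordinates_exist:
  assumes "fin_dim"
  shows "\<exists>B (crd :: 'v \<Rightarrow> 'v \<Rightarrow> 'f). finite B \<and> B \<subseteq> carrier A \<and>
    (\<forall>x\<in>carrier A. \<forall>y\<in>carrier A. \<forall>b\<in>B. crd (x \<oplus> y) b = crd x b + crd y b) \<and>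
    (\<forall>c. \<forall>x\<in>carrier A. \<forall>b\<in>B. crd (c \<odot> x) b = c * crd x b) \<and>
    (\<forall>x\<in>carrier A. x = (\<Oplus>b\<in>B. crd x b \<odot> b))"
proof -
  obtain B where B: "finite B" "basis B" using finite_basis_exists[OF assms] by blast
  then have BA: "B \<subseteq> carrier A" by (simp add: basis_def)
  have uniq: "\<exists>!a. a \<in> B \<rightarrow>\<^sub>E UNIV \<and> lincomb a B = v" if "v \<in> carrier A" for v
    using basis_criterion[OF B(1) BA] B(2) that by simp
  define crd where "crd v = (THE a. a \<in> B \<rightarrow>\<^sub>E UNIV \<and> lincomb a B = v)" for v
  have crd: "crd v \<in> B \<rightarrow>\<^sub>E UNIV" "lincomb (crd v) B = v" if "v \<in> carrier A" for v
    using theI'[OF uniq[OF that]] by (simp_all add: crd_def)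
  have crdI: "crd v b = a b" if "v \<in> carrier A" "lincomb a B = v" "b \<in> B" for v a b
  proof -
    have "lincomb (restrict a B) B = lincomb a B"
      using BA by (intro lincomb_cong) auto
    then have "restrict a B = crd v" using uniq[OF that(1)] crd[OF that(1)] that(2) by (metis restrict_PiE_iff UNIV_I)
    then show ?thesis using that(3) by (metis restrict_apply')
  qed
  show ?thesis
  proof (intro exI[of _ B] exI[of _ crd] conjI B(1) BA ballI allI)
    fix x y b assume x: "x \<in> carrier A" and y: "y \<in> carrier A" and b: "b \<in> B"
    have "lincomb (\<lambda>v. crd x v + crd y v) B = lincomb (crd x) B \<oplus> lincomb (crd y) B"
      using lincomb_sum[OF B(1) BA, of "crd x" "crd y"] by simp
    then show "crd (x \<oplus> y) b = crd x b + crd y b"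
      using crd x y b by (intro crdI) auto
  next
    fix c x b assume x: "x \<in> carrier A" and b: "b \<in> B"
    have "lincomb (\<lambda>v. c * crd x v) B = c \<odot> lincomb (crd x) B"
      using lincomb_smult[OF BA, of "crd x" c] by simp
    then show "crd (c \<odot> x) b = c * crd x b"
      using crd x b by (intro crdI) auto
  next
    fix x assume "x \<in> carrier A"
    then show "x = (\<Oplus>b\<in>B. crd x b \<odot> b)" using crd(2)[of x] by (simp add: lincomb_def)
  qed
qed

text \<open>The left regular representation on the algebra with a unit adjoined (row and column \<open>0\<close>),
  which makes it faithful.\<close>

lemma matrix_representation:
  assumes "fin_dim"
  obtains h and M :: "'v \<Rightarrow> 'f rfm" where
    "\<And>x y. x \<in> carrier A \<Longrightarrow> y \<in> carrier A \<Longrightarrow> M (x \<oplus> y) = M x + M y"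
    "\<And>x y. x \<in> carrier A \<Longrightarrow> y \<in> carrier A \<Longrightarrow> M (x \<otimes> y) = M x * M y"
    "\<And>c x. x \<in> carrier A \<Longrightarrow> M (c \<odot> x) = rscal c * M x"
    "inj_on M (carrier A)" "\<And>x. x \<in> carrier A \<Longrightarrow> blocked h (M x)"
proof -
  from coordinates_exist[OF assms] obtain B and crd :: "'v \<Rightarrow> 'v \<Rightarrow> 'f"
    where *: "finite B \<and> B \<subseteq> carrier A \<and>
      (\<forall>x\<in>carrier A. \<forall>y\<in>carrier A. \<forall>b\<in>B. crd (x \<oplus> y) b = crd x b + crd y b) \<and>
      (\<forall>c. \<forall>x\<in>carrier A. \<forall>b\<in>B. crd (c \<odot> x) b = c * crd x b) \<and>
      (\<forall>x\<in>carrier A. x = (\<Oplus>b\<in>B. crd x b \<odot> b))" by (elim exE)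
  then have B: "finite B" "B \<subseteq> carrier A"
    and add: "\<And>x y b. x \<in> carrier A \<Longrightarrow> y \<in> carrier A \<Longrightarrow> b \<in> B \<Longrightarrow> crd (x \<oplus> y) b = crd x b + crd y b"
    and smult: "\<And>c x b. x \<in> carrier A \<Longrightarrow> b \<in> B \<Longrightarrow> crd (c \<odot> x) b = c * crd x b"
    and expand: "\<And>x. x \<in> carrier A \<Longrightarrow> x = (\<Oplus>b\<in>B. crd x b \<odot> b)"
    by blast+
  define N where "N = card B"
  obtain \<beta> where \<beta>: "bij_betw \<beta> {..<N} B" using ex_bij_betw_nat_finite[OF B(1)] by (auto simp: N_def atLeast0LessThan)
  have \<beta>B: "i < N \<Longrightarrow> \<beta> i \<in> B" for i using \<beta> by (auto simp: bij_betw_def)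
  have \<beta>A: "i < N \<Longrightarrow> \<beta> i \<in> carrier A" for i using \<beta>B B(2) by auto
  define f where "f x i j = (if i = 0 \<or> N < i \<or> N < j then 0 else if j = 0 then crd x (\<beta> (i - 1))
      else crd (x \<otimes> \<beta> (j - 1)) (\<beta> (i - 1)))" for x and i j :: nat
  define M where "M x = Abs_rfm (f x)" for x
  have ent: "ent (M x) = f x" for x
    unfolding M_def by (rule Abs_rfm_inverse) (auto simp: f_def intro!: finite_subset[of _ "{..N}"] split: if_splits)
  have mult_crd: "crd (x \<otimes> y) b = (\<Sum>k<N. crd y (\<beta> k) * crd (x \<otimes> \<beta> k) b)"
    if "x \<in> carrier A" "y \<in> carrier A" "b \<in> B" for x y b
  proof -
    have "crd (x \<otimes> y) b = crd (x \<otimes> (\<Oplus>b\<in>B. crd y b \<odot> b)) b" using expand[OF that(2)] by simp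
    also have "\<dots> = (\<Sum>b'\<in>B. crd y b' * crd (x \<otimes> b') b)"
    proof (rule linear_functional_finsum[where T = "\<lambda>y. crd (x \<otimes> y) b", OF _ _ B])
      fix y' z assume yz: "y' \<in> carrier A" "z \<in> carrier A"
      show "crd (x \<otimes> (y' \<oplus> z)) b = crd (x \<otimes> y') b + crd (x \<otimes> z) b"
        using that yz by (simp only: distrib_left add mult_closed)
    next
      fix c y' assume "y' \<in> carrier A"
      then show "crd (x \<otimes> (c \<odot> y')) b = c * crd (x \<otimes> y') b"
        using that by (simp only: smult_mult_right smult mult_closed)
    qed
    also have "\<dots> = (\<Sum>k<N. crd y (\<beta> k) * crd (x \<otimes> \<beta> k) b)"
      by (rule sum.reindex_bij_betw[OF \<beta>, symmetric])
    finally show ?thesis .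
  qed
  show ?thesis
  proof (rule that[of M "Suc N"])
    fix x y assume xy: "x \<in> carrier A" "y \<in> carrier A"
    show "M (x \<oplus> y) = M x + M y"
      by (rule rfm_eqI) (use xy \<beta>A \<beta>B in \<open>auto simp: ent f_def add distrib_right mult_closed\<close>)
    show "M (x \<otimes> y) = M x * M y"
    proof (rule rfm_eqI)
      fix i j
      have "ent (M x * M y) i j = (\<Sum>k\<in>{..<Suc N}. f x i k * f y k j)"
        unfolding ent[symmetric] by (rule ent_mult) (auto simp: ent f_def split: if_splits)
      also have "\<dots> = (\<Sum>k<N. f x i (Suc k) * f y (Suc k) j)"
        unfolding sum.lessThan_Suc_shift by (simp add: f_def)
      also have "\<dots> = f (x \<otimes> y) i j"
      proof (cases "i = 0 \<or> N < i \<or> N < j")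
        case False
        define z where "z = (if j = 0 then y else y \<otimes> \<beta> (j - 1))"
        have z: "z \<in> carrier A" using xy \<beta>A False by (auto simp: z_def mult_closed)
        have "f y (Suc k) j = crd z (\<beta> k)" if "k < N" for k using that False by (auto simp: f_def z_def)
        moreover have "f x i (Suc k) = crd (x \<otimes> \<beta> k) (\<beta> (i - 1))" if "k < N" for k
          using that False by (auto simp: f_def)
        ultimately have "(\<Sum>k<N. f x i (Suc k) * f y (Suc k) j) = (\<Sum>k<N. crd z (\<beta> k) * crd (x \<otimes> \<beta> k) (\<beta> (i - 1)))"
          by (intro sum.cong) auto
        also have "\<dots> = crd (x \<otimes> z) (\<beta> (i - 1))" using xy z \<beta>B False by (intro mult_crd[symmetric]) auto
        also have "\<dots> = f (x \<otimes> y) i j"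
        proof (cases "j = 0")
          case True
          then show ?thesis using False by (auto simp: f_def z_def)
        next
          case j: False
          then have "\<beta> (j - 1) \<in> carrier A" using False by (intro \<beta>A) auto
          then show ?thesis using False j xy by (auto simp: f_def z_def mult_assoc)
        qed
        finally show ?thesis .
      qed (auto simp: f_def)
      finally show "ent (M (x \<otimes> y)) i j = ent (M x * M y) i j" by (simp add: ent)
    qed
  next
    fix c x assume x: "x \<in> carrier A"
    show "M (c \<odot> x) = rscal c * M x"
      by (rule rfm_eqI) (use x \<beta>A \<beta>B in \<open>auto simp: ent f_def smult smult_mult_left mult_closed\<close>)
  next
    show "inj_on M (carrier A)"
    proof (rule inj_onI)
      fix x y assume xy: "x \<in> carrier A" "y \<in> carrier A" and eq: "M x = M y"
      have "crd x b = crd y b" if b: "b \<in> B" for b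
      proof -
        obtain k where "k < N" "\<beta> k = b" using \<beta> b by (auto simp: bij_betw_def)
        then show ?thesis using arg_cong[OF eq, of "\<lambda>M. ent M (Suc k) 0"] by (simp add: ent f_def)
      qed
      then have "(\<Oplus>b\<in>B. crd x b \<odot> b) = (\<Oplus>b\<in>B. crd y b \<odot> b)"
        using B by (intro finsum_cong') auto
      then show "x = y" using expand xy by metis
    qed
    show "blocked (Suc N) (M x)" for x by (auto simp: blocked_def ent f_def split: if_splits)
  qed
qed

end

interpretation sc: central_hom "rscal :: 'f :: field \<Rightarrow> 'f rfm"
  by standard (auto simp: rscal_add rscal_mult rdiag_one intro!: rscal_commute mult.commute)

interpretation rvs: vector_space "\<lambda>c (X :: 'f :: field rfm). rscal c * X"
  by standard (auto simp: distrib_left distrib_right rscal_add rscal_mult mult.assoc rdiag_one)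

section \<open>Finite dimension of spaces of matrices of bounded size\<close>

lemma blocked_in_span: "blocked h X \<Longrightarrow> X \<in> rvs.span ((\<lambda>(i, j). runit 1 i j) ` ({..<h} \<times> {..<h}))"
proof -
  assume X: "blocked h X"
  have "rscal (ent X i j) * runit 1 i j \<in> rvs.span ((\<lambda>(i, j). runit 1 i j) ` ({..<h} \<times> {..<h}))"
    if "i < h" "j < h" for i j
    using that by (intro rvs.span_scale rvs.span_base) auto
  then have "(\<Sum>i<h. \<Sum>j<h. runit (ent X i j) i j) \<in> rvs.span ((\<lambda>(i, j). runit 1 i j) ` ({..<h} \<times> {..<h}))"
    by (intro rvs.span_sum) (simp add: rscal_runit)
  then show ?thesis using blocked_sum_runit[OF X] by simp
qed

lemma blocked_independent_bound:
  assumes "rvs.independent S" "\<And>X. X \<in> S \<Longrightarrow> blocked h X"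
  shows "finite S \<and> card S \<le> h * h"
proof -
  let ?T = "(\<lambda>(i, j). runit 1 i j :: 'a rfm) ` ({..<h} \<times> {..<h})"
  have "finite S \<and> card S \<le> card ?T"
    by (rule rvs.independent_span_bound) (use assms blocked_in_span in auto)
  moreover have "card ?T \<le> h * h" using card_image_le[of "{..<h} \<times> {..<h}"] by simp
  ultimately show ?thesis by linarith
qed

text \<open>The ambient space of row-finite matrices is infinite-dimensional; the common bound
  \<open>h\<close> makes the two bases finite, so that their sizes can be compared.\<close>

lemma blocked_dim_less:
  assumes "rvs.subspace V" "V \<subset> W" "\<And>X. X \<in> W \<Longrightarrow> blocked h X"
  shows "rvs.dim V < rvs.dim W"
proof -
  obtain B where B: "B \<subseteq> V" "rvs.independent B" "V \<subseteq> rvs.span B" "card B = rvs.dim V"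
    by (rule rvs.basis_exists)
  obtain C where C: "C \<subseteq> W" "rvs.independent C" "W \<subseteq> rvs.span C" "card C = rvs.dim W"
    by (rule rvs.basis_exists)
  have "blocked h X" if "X \<in> C \<or> X \<in> B" for X using that B(1) C(1) assms(2,3) by blast
  then have finC: "finite C" and finB: "finite B"
    using blocked_independent_bound[OF C(2), of h] blocked_independent_bound[OF B(2), of h] by simp_all
  obtain x where x: "x \<in> W" "x \<notin> V" using assms(2) by blast
  have "rvs.span B \<subseteq> V" using B(1) assms(1) by (rule rvs.span_minimal)
  then have "x \<notin> rvs.span B" using x by blast
  then have "rvs.independent (insert x B)" "x \<notin> B"
    using B(2) by (auto simp: rvs.independent_insert rvs.span_base)
  moreover have "insert x B \<subseteq> rvs.span C" using x(1) B(1) assms(2) C(3) by blast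
  ultimately have "card (insert x B) \<le> card C"
    using rvs.independent_span_bound[OF finC] by blast
  then show ?thesis using finB \<open>x \<notin> B\<close> B(4) C(4) by simp
qed

text \<open>The axioms force \<open>'g\<close> to have two elements. The type stays abstract because sums of degrees of type
  \<^typ>\<open>bit\<close> are rewritten into case distinctions.\<close>

locale matrix_graded_simple =
  fixes R :: "'g :: {ab_group_add, one} \<Rightarrow> 'f :: alg_closed_field rfm set" and h :: nat
  assumes double [simp]: "(g :: 'g) + g = 0" and degree_cases: "(g :: 'g) = 0 \<or> g = 1"
    and zero_in: "0 \<in> R g"
    and add_in: "x \<in> R g \<Longrightarrow> y \<in> R g \<Longrightarrow> x + y \<in> R g"
    and scale_in: "x \<in> R g \<Longrightarrow> rscal c * x \<in> R g"
    and mult_in: "x \<in> R g \<Longrightarrow> y \<in> R g' \<Longrightarrow> x * y \<in> R (g + g')"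
    and disjoint: "R 0 \<inter> R 1 \<subseteq> {0}"
    and in_blocked: "x \<in> R g \<Longrightarrow> blocked h x"
    and nontrivial: "\<exists>g g'. \<exists>x\<in>R g. \<exists>y\<in>R g'. x * y \<noteq> 0"
    and simple: "\<And>I. (\<And>g. I g \<subseteq> R g) \<Longrightarrow> (\<And>g. rvs.subspace (I g)) \<Longrightarrow>
      (\<And>g g' x y. x \<in> R g \<Longrightarrow> y \<in> I g' \<Longrightarrow> x * y \<in> I (g + g')) \<Longrightarrow>
      (\<And>g g' x y. x \<in> R g \<Longrightarrow> y \<in> I g' \<Longrightarrow> y * x \<in> I (g + g')) \<Longrightarrow>
      (\<forall>g. I g = {0}) \<or> (\<forall>g. I g = R g)"
begin

lemma degree_cancel [simp]: "g + s + s = (g :: 'g)"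
  by (simp add: add.assoc)

lemma diff_in: "x \<in> R g \<Longrightarrow> y \<in> R g \<Longrightarrow> x - y \<in> R g"
  using add_in[of x g "rscal (- 1) * y"] scale_in[of y g "- 1"]
  by (simp add: rvs.scale_minus_left[of 1, simplified] rdiag_one)

lemma sum_in: "(\<And>i. i \<in> S \<Longrightarrow> f i \<in> R g) \<Longrightarrow> sum f S \<in> R g"
  by (induction S rule: infinite_finite_induct) (auto simp: zero_in add_in)

lemma subspaceI:
  assumes "0 \<in> V" "\<And>x y. x \<in> V \<Longrightarrow> y \<in> V \<Longrightarrow> x + y \<in> V" "\<And>c x. x \<in> V \<Longrightarrow> rscal c * x \<in> V"
  shows "rvs.subspace V"
  using assms by (auto simp: rvs.subspace_def)

lemma scale_left_commute: "x * (rscal c * y) = rscal c * (x * y)" for c :: 'f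
  by (metis mult.assoc sc.central)

text \<open>The homogeneous elements annihilated by all multiplications from the left form a graded
  ideal. Some product is nonzero, so it is not everything, hence it is zero.\<close>

lemma left_annihilator:
  assumes x: "x \<in> R g" and ann: "\<And>g' y. y \<in> R g' \<Longrightarrow> y * x = 0"
  shows "x = 0"
proof -
  define I where "I g = {x \<in> R g. \<forall>g'. \<forall>y\<in>R g'. y * x = 0}" for g
  have "(\<forall>g. I g = {0}) \<or> (\<forall>g. I g = R g)"
  proof (rule simple)
    show "rvs.subspace (I g)" for g
      by (rule subspaceI) (auto simp: I_def zero_in add_in scale_in distrib_left scale_left_commute)
    fix g g' x y assume x: "x \<in> R g" and y: "y \<in> I g'"
    have "x * y = 0" using x y by (auto simp: I_def)
    then show "x * y \<in> I (g + g')" by (simp add: I_def zero_in)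
    show "y * x \<in> I (g + g')"
      using x y mult_in[of y g' x g] by (auto simp: I_def mult.assoc[symmetric] add.commute)
  qed (auto simp: I_def)
  moreover have "\<not> (\<forall>g. I g = R g)" using nontrivial unfolding I_def by blast
  moreover have "x \<in> I g" unfolding I_def using x ann by blast
  ultimately show ?thesis by blast
qed

definition left_ideal :: "('g \<Rightarrow> 'f rfm set) \<Rightarrow> bool" where
  "left_ideal I \<longleftrightarrow> (\<forall>g. I g \<subseteq> R g \<and> rvs.subspace (I g)) \<and>
     (\<forall>g g' x y. x \<in> R g \<longrightarrow> y \<in> I g' \<longrightarrow> x * y \<in> I (g + g'))"

text \<open>The part of degree \<open>g\<close> of \<open>L v\<close> comes from degree
  \<open>g + s\<close>, because adding \<open>s\<close> twice changes nothing.\<close>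

lemma left_ideal_orbit:
  assumes L: "left_ideal L" and v: "v \<in> R s"
  shows "left_ideal (\<lambda>g. (\<lambda>x. x * v) ` L (g + s))"
  unfolding left_ideal_def
proof (intro conjI allI impI)
  fix g
  have LR: "L (g + s) \<subseteq> R (g + s)" "rvs.subspace (L (g + s))" using L by (auto simp: left_ideal_def)
  show "(\<lambda>x. x * v) ` L (g + s) \<subseteq> R g"
    using LR(1) mult_in[OF _ v, of _ "g + s"] by auto
  show "rvs.subspace ((\<lambda>x. x * v) ` L (g + s))"
  proof (rule subspaceI)
    show "0 \<in> (\<lambda>x. x * v) ` L (g + s)" using rvs.subspace_0[OF LR(2)] by force
    fix x y assume "x \<in> (\<lambda>x. x * v) ` L (g + s)" "y \<in> (\<lambda>x. x * v) ` L (g + s)"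
    then show "x + y \<in> (\<lambda>x. x * v) ` L (g + s)"
      using rvs.subspace_add[OF LR(2)] by (auto simp: distrib_right[symmetric])
  next
    fix c x assume "x \<in> (\<lambda>x. x * v) ` L (g + s)"
    then show "rscal c * x \<in> (\<lambda>x. x * v) ` L (g + s)"
      using rvs.subspace_scale[OF LR(2)] by (auto simp: mult.assoc[symmetric])
  qed
next
  fix g g' x y assume "x \<in> R g" "y \<in> (\<lambda>x. x * v) ` L (g' + s)"
  then obtain z where z: "z \<in> L (g' + s)" "y = z * v" by blast
  then have "x * z \<in> L (g + (g' + s))" using L \<open>x \<in> R g\<close> unfolding left_ideal_def by blast
  moreover have "x * y = (x * z) * v" by (simp add: z(2) mult.assoc)
  ultimately show "x * y \<in> (\<lambda>x. x * v) ` L (g + g' + s)"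
    unfolding add.assoc by blast
qed

text \<open>Brauer's argument: a minimal graded left ideal is generated by an idempotent of degree \<open>0\<close>.\<close>

lemma minimal_idempotent:
  obtains e where "e \<in> R 0" "e \<noteq> 0" "e * e = e"
    "\<And>g x. x \<in> R g \<Longrightarrow> x * e = x \<Longrightarrow> x \<noteq> 0 \<Longrightarrow> \<exists>y\<in>R g. y * x = e"
proof -
  define nz where "nz I \<longleftrightarrow> left_ideal I \<and> (\<exists>g. I g \<noteq> {0})" for I
  have R: "left_ideal R" unfolding left_ideal_def
    using mult_in by (blast intro: subspaceI zero_in add_in scale_in)
  have "\<exists>g. R g \<noteq> {0}"
    using nontrivial by (metis mult_zero_left singletonD)
  then have "nz R" unfolding nz_def using R by blast
  then obtain L where L: "nz L" and min: "\<And>I. nz I \<Longrightarrow> rvs.dim (L 0) + rvs.dim (L 1) \<le> rvs.dim (I 0) + rvs.dim (I 1)"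
    using ex_has_least_nat[of nz R "\<lambda>I. rvs.dim (I 0) + rvs.dim (I 1)"] by blast
  have LR: "L g \<subseteq> R g" "rvs.subspace (L g)" for g using L by (auto simp: nz_def left_ideal_def)
  have Lmult: "x \<in> R g \<Longrightarrow> y \<in> L g' \<Longrightarrow> x * y \<in> L (g + g')" for x y g g'
    using L by (auto simp: nz_def left_ideal_def)
  have minimal: "I g = L g" if I: "left_ideal I" "\<And>g. I g \<subseteq> L g" "\<exists>g. I g \<noteq> {0}" for I g
  proof (rule ccontr)
    assume ne: "I g \<noteq> L g"
    have sub: "rvs.subspace (I g)" for g using I(1) by (auto simp: left_ideal_def)
    have le: "rvs.dim (I g) \<le> rvs.dim (L g)" for g
      using blocked_dim_less[OF sub, of g "L g" h] I(2)[of g] in_blocked LR(1)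
      by (metis less_imp_le order_refl psubsetI subsetD)
    have "rvs.dim (I g) < rvs.dim (L g)"
      using blocked_dim_less[OF sub, of g "L g" h] I(2)[of g] ne in_blocked LR(1) by blast
    then have "rvs.dim (I 0) + rvs.dim (I 1) < rvs.dim (L 0) + rvs.dim (L 1)"
      using le[of 0] le[of 1] degree_cases[of g] by auto
    moreover have "nz I" using I by (simp add: nz_def)
    ultimately show False using min[of I] by simp
  qed
  \<comment> \<open>If \<open>L L\<close> were zero, the graded ideal of all \<open>x\<close> with
    \<open>x L = 0\<close> would contain \<open>L\<close> and therefore be everything. Then
    \<open>R L = 0\<close>, against \<open>left_annihilator\<close>.\<close>
  have "\<exists>g g'. \<exists>w\<in>L g. \<exists>v\<in>L g'. w * v \<noteq> 0"
  proof (rule ccontr)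
    assume neg: "\<not> ?thesis"
    define I where "I g = {x \<in> R g. \<forall>g'. \<forall>y\<in>L g'. x * y = 0}" for g
    have "(\<forall>g. I g = {0}) \<or> (\<forall>g. I g = R g)"
    proof (rule simple)
      show "rvs.subspace (I g)" for g
        by (rule subspaceI) (auto simp: I_def zero_in add_in scale_in distrib_right mult.assoc)
      fix g g' x y assume x: "x \<in> R g" and y: "y \<in> I g'"
      then show "x * y \<in> I (g + g')" by (auto simp: I_def mult.assoc mult_in)
      have "y * x * z = 0" if "z \<in> L g''" for z g''
        using y Lmult[OF x that] by (auto simp: I_def mult.assoc)
      then show "y * x \<in> I (g + g')" using x y mult_in[of y g' x g] by (auto simp: I_def add.commute)
    qed (auto simp: I_def)
    moreover have "L g \<subseteq> I g" for g unfolding I_def using neg LR(1)[of g] by blast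
    moreover obtain g0 where "L g0 \<noteq> {0}" using L by (auto simp: nz_def)
    then obtain y0 where y0: "y0 \<in> L g0" "y0 \<noteq> 0" using rvs.subspace_0[OF LR(2)] by blast
    ultimately have "\<forall>g. I g = R g" by blast
    then have "y0 = 0" using y0(1) LR(1) by (intro left_annihilator[of y0 g0]) (auto simp: I_def)
    with y0 show False by simp
  qed
  then obtain g s w v where w: "w \<in> L g" and v: "v \<in> L s" and wv: "w * v \<noteq> 0" by blast
  have vR: "v \<in> R s" using v LR(1) by blast
  have LL: "left_ideal L" using L by (simp add: nz_def)
  \<comment> \<open>By minimality \<open>L v = L\<close>. This contains \<open>v\<close> itself, and
    a preimage of \<open>v\<close> of degree 0 will be the idempotent.\<close>
  have "(\<lambda>x. x * v) ` L (g' + s) = L g'" for g'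
  proof (rule minimal[where I = "\<lambda>g. (\<lambda>x. x * v) ` L (g + s)"])
    show "left_ideal (\<lambda>g. (\<lambda>x. x * v) ` L (g + s))" by (rule left_ideal_orbit[OF LL vR])
    show "(\<lambda>x. x * v) ` L (g + s) \<subseteq> L g" for g
      using Lmult[OF _ v, of _ "g + s"] LR(1) by auto
    show "\<exists>g. (\<lambda>x. x * v) ` L (g + s) \<noteq> {0}" using w wv by (intro exI[of _ "g + s"]) auto
  qed
  from this[of s] obtain e where e: "e \<in> L 0" "e * v = v" using v by (metis double imageE)
  have eR: "e \<in> R 0" using e LR(1) by blast
  \<comment> \<open>The annihilator of \<open>v\<close> in \<open>L\<close> is a proper graded left
    subideal, hence zero. As \<open>x * e - x\<close> belongs to it, \<open>e\<close> is a right
    unit of \<open>L\<close>.\<close>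
  define K where "K g = {x \<in> L g. x * v = 0}" for g
  have K: "K g = {0}" for g
  proof -
    have "left_ideal K" unfolding left_ideal_def
    proof (intro conjI allI impI)
      show "rvs.subspace (K g)" for g
        using LR(2) by (intro subspaceI) (auto simp: K_def rvs.subspace_0 rvs.subspace_add rvs.subspace_scale distrib_right mult.assoc)
    qed (use LR(1) Lmult in \<open>auto simp: K_def mult.assoc\<close>)
    moreover have "K g \<subseteq> L g" for g by (auto simp: K_def)
    moreover have "\<exists>g. K g \<noteq> L g" using w wv by (auto simp: K_def)
    ultimately have "\<not> (\<exists>g. K g \<noteq> {0})" using minimal by metis
    then show ?thesis by blast
  qed
  have absorb: "x * e = x" if "x \<in> L g" for x g
  proof -
    have "x * e \<in> L g" using Lmult[OF _ e(1), of x g] that LR(1) by auto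
    then have "x * e - x \<in> L g" using that by (rule rvs.subspace_diff[OF LR(2)])
    moreover have "(x * e - x) * v = 0" using e(2) by (simp add: left_diff_distrib mult.assoc)
    ultimately have "x * e - x \<in> K g" by (simp add: K_def)
    then show ?thesis using K by simp
  qed
  show ?thesis
  proof (rule that[OF eR])
    show "e \<noteq> 0" using e(2) wv by auto
    show "e * e = e" by (rule absorb[OF e(1)])
    fix g x assume x: "x \<in> R g" "x * e = x" "x \<noteq> 0"
    have xL: "x \<in> L g" using Lmult[OF x(1) e(1)] x(2) by simp
    \<comment> \<open>\<open>R x\<close> is a left ideal inside \<open>L\<close>, nonzero by
      \<open>left_annihilator\<close>, so it equals \<open>L\<close> and contains
      \<open>e\<close>.\<close>
    have "(\<lambda>y. y * x) ` R (g' + g) = L g'" for g'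
    proof (rule minimal[where I = "\<lambda>g'. (\<lambda>y. y * x) ` R (g' + g)"])
      show "left_ideal (\<lambda>g'. (\<lambda>y. y * x) ` R (g' + g))" by (rule left_ideal_orbit[OF R x(1)])
      show "(\<lambda>y. y * x) ` R (g' + g) \<subseteq> L g'" for g'
        using Lmult[OF _ xL, of _ "g' + g"] by auto
      obtain g' y where "y \<in> R g'" "y * x \<noteq> 0" using left_annihilator[OF x(1)] x(3) by blast
      then show "\<exists>g'. (\<lambda>y. y * x) ` R (g' + g) \<noteq> {0}" by (intro exI[of _ "g' + g"]) auto
    qed
    from this[of 0] have "e \<in> (\<lambda>y. y * x) ` R g" using e(1) by simp
    then show "\<exists>y\<in>R g. y * x = e" by blast
  qed
qed

end

text \<open>\<open>e R e\<close> is a graded division algebra.\<close>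

locale matrix_corner = matrix_graded_simple R h
  for R :: "'g :: {ab_group_add, one} \<Rightarrow> 'f :: alg_closed_field rfm set" and h +
  fixes e :: "'f rfm"
  assumes e: "e \<in> R 0" "e \<noteq> 0" "e * e = e"
    and left_inverse: "\<And>g x. x \<in> R g \<Longrightarrow> x * e = x \<Longrightarrow> x \<noteq> 0 \<Longrightarrow> \<exists>y\<in>R g. y * x = e"
begin

text \<open>The elements \<open>x\<close> with \<open>x R e = 0\<close> form a graded ideal that
  does not contain \<open>e\<close>, so it is zero. In other words, homogeneous elements act
  faithfully on \<open>R e\<close>.\<close>

lemma two_sided_annihilator:
  assumes x: "x \<in> R g" and ann: "\<And>g' y. y \<in> R g' \<Longrightarrow> x * y * e = 0"
  shows "x = 0"
proof -
  define I where "I g = {x \<in> R g. \<forall>g'. \<forall>y\<in>R g'. x * y * e = 0}" for g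
  have "(\<forall>g. I g = {0}) \<or> (\<forall>g. I g = R g)"
  proof (rule simple)
    show "rvs.subspace (I g)" for g
      by (rule subspaceI) (auto simp: I_def zero_in add_in scale_in distrib_right mult.assoc)
    fix g g' x y assume x: "x \<in> R g" and y: "y \<in> I g'"
    then show "x * y \<in> I (g + g')" by (auto simp: I_def mult.assoc mult_in)
    have "y * x * z * e = 0" if "z \<in> R g''" for z g''
    proof -
      have "y * (x * z) * e = 0" using y mult_in[OF x that] unfolding I_def by blast
      then show ?thesis by (simp add: mult.assoc)
    qed
    then show "y * x \<in> I (g + g')" using x y mult_in[of y g' x g] by (auto simp: I_def add.commute)
  qed (auto simp: I_def)
  moreover have "e \<notin> I 0" unfolding I_def using e by (auto intro!: exI[of _ 0] bexI[of _ e])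
  then have "\<not> (\<forall>g. I g = R g)" using e(1) by metis
  moreover have "x \<in> I g" unfolding I_def using x ann by blast
  ultimately show ?thesis by blast
qed

lemma two_sided_annihilator':
  assumes x: "x \<in> R g" and ann: "\<And>g' y. y \<in> R g' \<Longrightarrow> e * y * x = 0"
  shows "x = 0"
proof -
  define I where "I g = {x \<in> R g. \<forall>g'. \<forall>y\<in>R g'. e * y * x = 0}" for g
  have "(\<forall>g. I g = {0}) \<or> (\<forall>g. I g = R g)"
  proof (rule simple)
    show "rvs.subspace (I g)" for g
      by (rule subspaceI) (auto simp: I_def zero_in add_in scale_in distrib_left scale_left_commute)
    fix g g' x y assume x: "x \<in> R g" and y: "y \<in> I g'"
    have "e * z * (y * x) = 0" if "z \<in> R g''" for z g''
    proof -
      have "e * z * y = 0" using y that unfolding I_def by blast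
      then show ?thesis by (simp add: mult.assoc[symmetric])
    qed
    then show "y * x \<in> I (g + g')" using x y mult_in[of y g' x g] by (auto simp: I_def add.commute)
    have "e * z * (x * y) = 0" if "z \<in> R g''" for z g''
    proof -
      have "e * (z * x) * y = 0" using y mult_in[OF that x] unfolding I_def by blast
      then show ?thesis by (simp add: mult.assoc)
    qed
    then show "x * y \<in> I (g + g')" using x y mult_in[of x g y g'] by (auto simp: I_def)
  qed (auto simp: I_def)
  moreover have "e \<notin> I 0" unfolding I_def using e by (auto intro!: exI[of _ 0] bexI[of _ e])
  then have "\<not> (\<forall>g. I g = R g)" using e(1) by metis
  moreover have "x \<in> I g" unfolding I_def using x ann by blast
  ultimately show ?thesis by blast
qed

lemma peval_in: "x \<in> R 0 \<Longrightarrow> sc.peval x p * e \<in> R 0"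
proof (induction p)
  case (pCons a p)
  have "rscal a * e + x * (sc.peval x p * e) \<in> R 0"
    using mult_in[OF pCons.prems pCons.IH[OF pCons.prems]] e(1) by (auto intro: add_in scale_in)
  then show ?case by (simp add: distrib_right mult.assoc)
qed (simp add: zero_in)

text \<open>Take a polynomial of least degree that annihilates \<open>x\<close> in the corner, and a
  root \<open>c\<close> of it. The cofactor of the linear factor gives a nonzero element, which is
  left invertible; cancelling it leaves \<open>x = c e\<close>.\<close>

lemma even_corner:
  assumes x: "x \<in> R 0" "e * x = x" "x * e = x"
  shows "\<exists>c. x = rscal c * e"
proof -
  have xe: "x * e = e * x" using x by simp
  define Z where "Z p \<longleftrightarrow> p \<noteq> 0 \<and> sc.peval x p * e = 0" for p
  \<comment> \<open>Otherwise the elements \<open>x ^ i * e\<close> would be independent for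
    arbitrarily many exponents, against the bound \<open>h * h\<close>.\<close>
  have "\<exists>p. Z p"
  proof (rule ccontr)
    assume no: "\<not> (\<exists>p. Z p)"
    define F where "F n = (\<lambda>i. x ^ i * e) ` {..<n}" for n :: nat
    have inj: "inj_on (\<lambda>i. x ^ i * e) {..<n}" for n
    proof (rule inj_onI, rule ccontr)
      fix i j :: nat assume "x ^ i * e = x ^ j * e" "i \<noteq> j"
      then have "sc.peval x (monom 1 i - monom 1 j) * e = 0" "monom 1 i - monom 1 j \<noteq> (0 :: 'f poly)"
        using sc.peval_add[of x "monom 1 i - monom 1 j" "monom 1 j"]
        by (auto simp: sc.peval_monom left_diff_distrib algebra_simps) (metis degree_monom_eq one_neq_zero)
      then have "Z (monom 1 i - monom 1 j)" unfolding Z_def by blast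
      then show False using no by blast
    qed
    have "rvs.independent (F n)" for n
    proof
      assume "rvs.dependent (F n)"
      moreover have fin: "finite (F n)" by (simp add: F_def)
      ultimately have "\<exists>u. (\<exists>v\<in>F n. u v \<noteq> 0) \<and> (\<Sum>v\<in>F n. rscal (u v) * v) = 0"
        by (simp add: rvs.dependent_finite[OF fin])
      then obtain u where u: "(\<exists>v\<in>F n. u v \<noteq> 0)" "(\<Sum>v\<in>F n. rscal (u v) * v) = 0" by blast
      define p where "p = (\<Sum>i<n. Polynomial.smult (u (x ^ i * e)) (monom 1 i))"
      have "sc.peval x p * e = (\<Sum>i<n. rscal (u (x ^ i * e)) * (x ^ i * e))"
        by (simp only: p_def sc.peval_sum sc.peval_smult sc.peval_monom sum_distrib_right mult.assoc)
      also have "\<dots> = 0" using u(2) unfolding F_def by (simp add: sum.reindex[OF inj])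
      finally have "p = 0" using no by (auto simp: Z_def)
      moreover obtain i where "i < n" "u (x ^ i * e) \<noteq> 0" using u(1) by (auto simp: F_def)
      moreover have "coeff p i = u (x ^ i * e)" if "i < n" for i
        using that by (simp add: p_def coeff_sum if_distrib[of "(*) _"] cong: if_cong)
      ultimately show False by (metis coeff_0)
    qed
    moreover have "blocked h v" if "v \<in> F n" for v n
    proof -
      have "x ^ i * e \<in> R 0" for i using peval_in[OF x(1), of "monom 1 i"] by (simp add: sc.peval_monom)
      then show ?thesis using that in_blocked by (auto simp: F_def)
    qed
    ultimately have "card (F n) \<le> h * h" for n using blocked_independent_bound by blast
    moreover have "card (F n) = n" for n by (simp add: F_def card_image[OF inj])
    ultimately show False by (metis not_less_eq_eq order_refl)
  qed
  then obtain p where p: "Z p" and pmin: "\<And>q. Z q \<Longrightarrow> degree p \<le> degree q"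
    using ex_has_least_nat[of Z _ degree] by blast
  have "degree p \<noteq> 0"
  proof
    assume "degree p = 0"
    then obtain a where "p = [:a:]" by (rule degree_eq_zeroE)
    then have "a \<noteq> 0" "rscal a * e = 0" using p by (auto simp: Z_def)
    then show False using e(2) rvs.scale_eq_0_iff[of a e] by simp
  qed
  then obtain c where "poly p c = 0" using alg_closed_imp_poly_has_root by blast
  then obtain q where q: "p = [:- c, 1:] * q" by (metis dvdE poly_eq_0_iff_dvd)
  define t where "t = sc.peval x q * e"
  have "q \<noteq> 0" using p q by (auto simp: Z_def)
  then have "degree q < degree p" unfolding q by (subst degree_mult_eq) auto
  then have t0: "t \<noteq> 0" using pmin[of q] \<open>q \<noteq> 0\<close> by (auto simp: Z_def t_def)
  have "t \<in> R 0" "t * e = t" using peval_in[OF x(1)] e(3) by (auto simp: t_def mult.assoc)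
  then obtain y where y: "y * t = e" using left_inverse t0 by blast
  have lin: "sc.peval x [:- c, 1:] * e = x * e - rscal c * e"
    by (simp add: left_diff_distrib algebra_simps rdiag_one)
  have "sc.peval x p = sc.peval x q * sc.peval x [:- c, 1:]"
    unfolding q by (subst mult.commute) (simp only: sc.peval_mult)
  then have "sc.peval x p * e = sc.peval x q * (x * e - rscal c * e)"
    by (simp only: mult.assoc lin)
  then have z: "sc.peval x q * (x * e - rscal c * e) = 0" using p by (simp add: Z_def)
  have "e * (x * e - rscal c * e) = x * e - rscal c * e"
    using x e by (simp add: right_diff_distrib scale_left_commute)
  then have "t * (x * e - rscal c * e) = 0" using z by (simp add: t_def mult.assoc)
  then have "e * (x * e - rscal c * e) = 0" unfolding y[symmetric] by (simp add: mult.assoc)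
  then show ?thesis using x e by (intro exI[of _ c]) (simp add: right_diff_distrib scale_left_commute)
qed

text \<open>The square of \<open>u\<close> is a scalar multiple of \<open>e\<close>, nonzero because
  \<open>u\<close> has a left inverse, so a square root rescales \<open>u\<close> to a square root
  of \<open>e\<close>. An odd \<open>z\<close> is then \<open>(z * u') * u'\<close>, where the
  bracket is a scalar multiple of \<open>e\<close>.\<close>

lemma odd_corner:
  assumes u: "u \<in> R 1" "e * u = u" "u * e = u" "u \<noteq> 0"
  obtains u' where "u' \<in> R 1" "e * u' = u'" "u' * e = u'" "u' * u' = e"
    "\<And>z. z \<in> R 1 \<Longrightarrow> e * z = z \<Longrightarrow> z * e = z \<Longrightarrow> \<exists>c. z = rscal c * u'"
proof -
  have prod: "\<exists>c. z * w = rscal c * e"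
    if "z \<in> R 1" "e * z = z" "w \<in> R 1" "w * e = w" for z w
  proof (rule even_corner)
    show "z * w \<in> R 0" using mult_in[OF that(1,3)] by simp
    show "e * (z * w) = z * w" using that by (simp add: mult.assoc[symmetric])
    show "z * w * e = z * w" using that by (simp add: mult.assoc)
  qed
  obtain c where c: "u * u = rscal c * e" using prod u by blast
  obtain y where y: "y * u = e" using left_inverse u by blast
  have "c \<noteq> 0"
  proof
    assume "c = 0"
    then have "y * (u * u) = 0" by (simp add: c rscal_zero)
    then show False using y u by (simp add: mult.assoc[symmetric])
  qed
  obtain d where d: "d ^ 2 = inverse c" using nth_root_exists[of 2 "inverse c"] by auto
  have d0: "d \<noteq> 0" using d \<open>c \<noteq> 0\<close> by auto
  define u' where "u' = rscal d * u"
  have uu: "u' * u' = e"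
  proof -
    have "u' * u' = rscal d * (u * (rscal d * u))" by (simp only: u'_def mult.assoc)
    also have "u * (rscal d * u) = rscal d * (u * u)" by (rule scale_left_commute)
    also have "rscal d * (rscal d * (u * u)) = rscal (d * d * c) * e"
      by (simp only: c rscal_mult mult.assoc)
    finally show ?thesis using d \<open>c \<noteq> 0\<close> by (simp add: power2_eq_square rdiag_one)
  qed
  have u': "u' \<in> R 1" "e * u' = u'" "u' * e = u'"
    unfolding u'_def scale_left_commute mult.assoc using u scale_in by simp_all
  show ?thesis
  proof (rule that[OF u' uu])
    fix z assume z: "z \<in> R 1" "e * z = z" "z * e = z"
    obtain b where "z * u' = rscal b * e" using prod z u' by blast
    then have "z * (u' * u') = rscal b * (e * u')" by (simp add: mult.assoc[symmetric])
    then show "\<exists>c. z = rscal c * u'" using z(3) u'(2) by (auto simp only: uu)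
  qed
qed

end

section \<open>Biorthogonal systems in the left ideal R e and the right ideal e R\<close>

context matrix_corner
begin

text \<open>The triples consist of a degree, a vector in \<open>R e\<close> and a dual vector in
  \<open>e R\<close>, both of that degree, so that their pairing lands in degree 0. \<open>G\<close>
  restricts the degrees: both are used if the corner has no odd part, and only 0 otherwise.\<close>

definition biorthogonal :: "'g set \<Rightarrow> ('g \<times> 'f rfm \<times> 'f rfm) set \<Rightarrow> bool" where
  "biorthogonal G B \<longleftrightarrow> finite B \<and>
     (\<forall>(g, v, r)\<in>B. g \<in> G \<and> v \<in> R g \<and> r \<in> R g \<and> v * e = v \<and> e * r = r) \<and>
     (\<forall>(g, v, r)\<in>B. \<forall>(g', v', r')\<in>B. r * v' = (if (g, v, r) = (g', v', r') then e else 0))"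

lemma biorthogonalI:
  assumes "finite B"
    and "\<And>g v r. (g, v, r) \<in> B \<Longrightarrow> g \<in> G \<and> v \<in> R g \<and> r \<in> R g \<and> v * e = v \<and> e * r = r"
    and "\<And>g v r g' v' r'. (g, v, r) \<in> B \<Longrightarrow> (g', v', r') \<in> B \<Longrightarrow>
      r * v' = (if (g, v, r) = (g', v', r') then e else 0)"
  shows "biorthogonal G B"
  using assms unfolding biorthogonal_def split_paired_Ball_Sigma by (simp only: Ball_def split_paired_All prod.case simp_thms) blast

lemma biorthogonalD:
  assumes "biorthogonal G B" "(g, v, r) \<in> B"
  shows "g \<in> G" "v \<in> R g" "r \<in> R g" "v * e = v" "e * r = r" "r * v = e"
    "(g', v', r') \<in> B \<Longrightarrow> (g, v, r) \<noteq> (g', v', r') \<Longrightarrow> r * v' = 0"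
proof -
  have *: "case b of (g, v, r) \<Rightarrow> g \<in> G \<and> v \<in> R g \<and> r \<in> R g \<and> v * e = v \<and> e * r = r" if "b \<in> B" for b
    using assms(1) that unfolding biorthogonal_def by blast
  show "g \<in> G" "v \<in> R g" "r \<in> R g" "v * e = v" "e * r = r" using *[OF assms(2)] by simp_all
  have **: "case b of (g, v, r) \<Rightarrow> case b' of (g', v', r') \<Rightarrow> r * v' = (if (g, v, r) = (g', v', r') then e else 0)"
    if "b \<in> B" "b' \<in> B" for b b'
    using assms(1) that unfolding biorthogonal_def by fast
  show "r * v = e" using **[OF assms(2) assms(2)] by simp
  show "r * v' = 0" if "(g', v', r') \<in> B" "(g, v, r) \<noteq> (g', v', r')"
    using **[OF assms(2) that(1)] that(2) by (simp only: prod.case if_False)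
qed

lemma biorthogonal_card:
  assumes B: "biorthogonal G B" shows "card B \<le> h * h"
proof -
  let ?vec = "\<lambda>b :: 'g \<times> 'f rfm \<times> 'f rfm. fst (snd b)"
  have fin: "finite B" using B by (simp add: biorthogonal_def)
  have inj: "inj_on ?vec B"
  proof (rule inj_onI)
    fix b b' assume b: "b \<in> B" "b' \<in> B" "?vec b = ?vec b'"
    obtain g v r where bg: "b = (g, v, r)" by (cases b)
    obtain g' v' r' where bg': "b' = (g', v', r')" by (cases b')
    show "b = b'"
    proof (rule ccontr)
      assume "b \<noteq> b'"
      then have "r * v' = 0" using biorthogonalD(7)[OF B, of g v r g' v' r'] b by (auto simp: bg bg')
      moreover have "r * v = e" using biorthogonalD(6)[OF B, of g v r] b by (auto simp: bg)
      ultimately show False using b(3) e(2) by (simp add: bg bg')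
    qed
  qed
  have "rvs.independent (?vec ` B)"
  proof
    assume dep: "rvs.dependent (?vec ` B)"
    have "finite (?vec ` B)" using fin by simp
    from dep have "\<exists>u. (\<exists>v\<in>?vec ` B. u v \<noteq> 0) \<and> (\<Sum>v\<in>?vec ` B. rscal (u v) * v) = 0"
      by (simp add: rvs.dependent_finite[OF \<open>finite (?vec ` B)\<close>])
    then obtain u b where b: "b \<in> B" "u (?vec b) \<noteq> 0" and "(\<Sum>v\<in>?vec ` B. rscal (u v) * v) = 0" by blast
    then have sum: "(\<Sum>b\<in>B. rscal (u (?vec b)) * ?vec b) = 0" by (simp add: sum.reindex[OF inj])
    obtain g v r where bg: "b = (g, v, r)" by (cases b)
    have "0 = r * (\<Sum>b\<in>B. rscal (u (?vec b)) * ?vec b)" by (simp add: sum)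
    also have "\<dots> = (\<Sum>b'\<in>B. if b' = b then rscal (u v) * e else 0)"
      unfolding sum_distrib_left
    proof (rule sum.cong[OF refl])
      fix b' assume b': "b' \<in> B"
      obtain g' v' r' where bg': "b' = (g', v', r')" by (cases b')
      show "r * (rscal (u (?vec b')) * ?vec b') = (if b' = b then rscal (u v) * e else 0)"
        using biorthogonalD(6)[OF B, of g v r] biorthogonalD(7)[OF B, of g v r g' v' r'] b b'
        by (auto simp: bg bg' scale_left_commute)
    qed
    also have "\<dots> = rscal (u v) * e" using fin b(1) by simp
    finally show False using b(2) e(2) rvs.scale_eq_0_iff[of "u v" e] by (simp add: bg)
  qed
  moreover have "blocked h x" if "x \<in> ?vec ` B" for x
  proof -
    from that obtain g v r where "(g, v, r) \<in> B" "x = v" by auto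
    then show ?thesis using biorthogonalD(2)[OF B] in_blocked by blast
  qed
  ultimately have "card (?vec ` B) \<le> h * h" using blocked_independent_bound by blast
  then show ?thesis by (simp add: card_image[OF inj])
qed

text \<open>A system of largest size, which exists by \<open>biorthogonal_card\<close>, is complete:
  the nonzero remainder of an element that is not expanded correctly could be adjoined together with
  a dual vector.\<close>

lemma biorthogonal_complete:
  assumes dual: "\<And>g y. g \<in> G \<Longrightarrow> y \<in> R g \<Longrightarrow> y * e = y \<Longrightarrow> y \<noteq> 0 \<Longrightarrow> \<exists>r\<in>R g. e * r = r \<and> r * y = e"
  shows "\<exists>B. biorthogonal G B \<and> (\<forall>g\<in>G. \<forall>y\<in>R g. y * e = y \<longrightarrow> y = (\<Sum>(g, v, r)\<in>B. v * r * y))"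
proof -
  have "biorthogonal G {}" by (simp add: biorthogonal_def)
  then obtain B where B: "biorthogonal G B" and max: "\<And>B'. biorthogonal G B' \<Longrightarrow> card B' \<le> card B"
    using ex_has_greatest_nat[of "biorthogonal G" "{}" card "Suc (h * h)"] biorthogonal_card le_imp_less_Suc
    by blast
  have fin: "finite B" using B by (simp add: biorthogonal_def)
  note D = biorthogonalD[OF B]
  show ?thesis
  proof (intro exI[of _ B] conjI B ballI impI, rule ccontr)
    fix g y assume y: "g \<in> G" "y \<in> R g" "y * e = y" and ne: "y \<noteq> (\<Sum>(g, v, r)\<in>B. v * r * y)"
    define y' where "y' = y - (\<Sum>(g, v, r)\<in>B. v * r * y)"
    have y'0: "y' \<noteq> 0" using ne by (simp add: y'_def)
    have vr: "v * r \<in> R 0" if "(g, v, r) \<in> B" for g v r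
      using mult_in[OF D(2)[OF that] D(3)[OF that]] by simp
    have y'R: "y' \<in> R g" unfolding y'_def
      using mult_in[OF vr y(2)] y(2) by (intro diff_in sum_in) auto
    have y'e: "y' * e = y'"
      unfolding y'_def left_diff_distrib sum_distrib_right
      using y(3) by (intro arg_cong2[where f = "(-)"] sum.cong) (auto simp: mult.assoc)
    have ry': "r * y' = 0" if b: "(g0, v, r) \<in> B" for g0 v r
    proof -
      have "r * (\<Sum>(g, v, r)\<in>B. v * r * y) = (\<Sum>b'\<in>B. if b' = (g0, v, r) then r * y else 0)"
        unfolding sum_distrib_left
      proof (rule sum.cong[OF refl])
        fix b' assume b': "b' \<in> B"
        obtain g' v' r' where bg': "b' = (g', v', r')" by (cases b')
        show "r * (case b' of (g, v, r) \<Rightarrow> v * r * y) = (if b' = (g0, v, r) then r * y else 0)"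
          using D(5,6)[OF b] D(7)[OF b, of g' v' r'] b' by (auto simp: bg' mult.assoc[symmetric])
      qed
      also have "\<dots> = r * y" using fin b by simp
      finally show ?thesis by (simp add: y'_def right_diff_distrib)
    qed
    obtain r where r: "r \<in> R g" "e * r = r" "r * y' = e" using dual[OF y(1) y'R y'e y'0] by blast
    \<comment> \<open>As in Gram-Schmidt: the remainder \<open>y'\<close> is already orthogonal to
      the old dual vectors, and this correction makes the new dual vector vanish on the old vectors
      without changing its pairing with \<open>y'\<close>.\<close>
    define r' where "r' = r - (\<Sum>(g, v, s)\<in>B. r * v * s)"
    have r'R: "r' \<in> R g" unfolding r'_def
      using mult_in[OF r(1) vr] r(1) by (intro diff_in sum_in) (auto simp: mult.assoc)
    have er': "e * r' = r'"
      unfolding r'_def right_diff_distrib sum_distrib_left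
      using r(2) by (intro arg_cong2[where f = "(-)"] sum.cong) (auto simp: mult.assoc[symmetric])
    have r'y': "r' * y' = e"
    proof -
      have "(\<Sum>(g, v, s)\<in>B. r * v * s) * y' = 0"
        unfolding sum_distrib_right using ry' by (intro sum.neutral) (auto simp: mult.assoc)
      then show ?thesis by (simp add: r'_def left_diff_distrib r(3))
    qed
    have r'v: "r' * v = 0" if b: "(g0, v, s) \<in> B" for g0 v s
    proof -
      have "(\<Sum>(g, v, s)\<in>B. r * v * s) * v = (\<Sum>b'\<in>B. if b' = (g0, v, s) then r * v else 0)"
        unfolding sum_distrib_right
      proof (rule sum.cong[OF refl])
        fix b' assume b': "b' \<in> B"
        obtain g' v' s' where bg': "b' = (g', v', s')" by (cases b')
        show "(case b' of (g, v, s) \<Rightarrow> r * v * s) * v = (if b' = (g0, v, s) then r * v else 0)"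
          using D(4,6)[OF b] D(7)[of g' v' s' g0 v s] b b' by (auto simp: bg' mult.assoc)
      qed
      also have "\<dots> = r * v" using fin b by simp
      finally show ?thesis by (simp add: r'_def left_diff_distrib)
    qed
    have new: "(g, y', r') \<notin> B" using ry' r'y' e(2) by force
    have "biorthogonal G (insert (g, y', r') B)"
    proof (rule biorthogonalI)
      show "finite (insert (g, y', r') B)" using fin by simp
      show "g1 \<in> G \<and> v \<in> R g1 \<and> s \<in> R g1 \<and> v * e = v \<and> e * s = s"
        if "(g1, v, s) \<in> insert (g, y', r') B" for g1 v s
        using that y(1) y'R y'e r'R er' D(1-5)[of g1 v s] by auto
      show "s * v' = (if (g1, v, s) = (g', v', s') then e else 0)"
        if "(g1, v, s) \<in> insert (g, y', r') B" "(g', v', s') \<in> insert (g, y', r') B" for g1 v s g' v' s'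
        using that r'y' ry' r'v D(6,7) new by (cases "(g1, v, s) \<in> B"; cases "(g', v', s') \<in> B") auto
    qed
    then have "card (insert (g, y', r') B) \<le> card B" by (rule max)
    then show False using fin new by simp
  qed
qed

text \<open>Some \<open>e * z * y\<close> is a nonzero element of the corner and has to be turned
  into \<open>e\<close>: by a scalar if its degree is 0, and by an odd \<open>u\<close> with
  \<open>u * u = e\<close> as well if its degree is 1, which also restores the degree
  \<open>g = 0\<close> of the left factor. For \<open>g\<close> other than 0, the assumption
  \<open>odd\<close> excludes the second case.\<close>

lemma dual_exists:
  assumes y: "y \<in> R g" "y * e = y" "y \<noteq> 0"
    and odd: "g \<noteq> 0 \<Longrightarrow> (\<forall>x\<in>R 1. e * x = x \<longrightarrow> x * e = x \<longrightarrow> x = 0)"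
  shows "\<exists>r\<in>R g. e * r = r \<and> r * y = e"
proof -
  obtain g' z where z: "z \<in> R g'" "e * z * y \<noteq> 0" using two_sided_annihilator'[OF y(1)] y(3) by blast
  let ?x = "e * z * y"
  have ez: "e * z \<in> R g'" using mult_in[OF e(1) z(1)] by simp
  have x: "?x \<in> R (g' + g)" "e * ?x = ?x" "?x * e = ?x"
    using mult_in[OF ez y(1)] e(3) y(2) by (simp_all add: mult.assoc[symmetric]) (simp add: mult.assoc)
  show ?thesis
  proof (cases "g' = g")
    case True
    then obtain c where c: "?x = rscal c * e" using even_corner x by auto
    then have "c \<noteq> 0" using z(2) by (auto simp: rscal_zero)
    have "rscal (inverse c) * (e * z) * y = rscal (inverse c * c) * e"
      by (simp only: mult.assoc c[unfolded mult.assoc] rscal_mult)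
    then have "rscal (inverse c) * (e * z) * y = e" using \<open>c \<noteq> 0\<close> by (simp add: rdiag_one)
    moreover have "e * (rscal (inverse c) * (e * z)) = rscal (inverse c) * (e * z)"
      using e(3) by (simp add: scale_left_commute mult.assoc[symmetric]) (simp add: scale_left_commute mult.assoc)
    ultimately show ?thesis using scale_in[OF ez] True by blast
  next
    case False
    have g1: "g' + g = 1"
      using False degree_cases[of "g' + g"] by (metis add_right_imp_eq double)
    show ?thesis
    proof (cases "g = 0")
      case True
      obtain u where u: "u \<in> R 1" "e * u = u" "u * e = u" "u * u = e" and
        c: "\<And>z. z \<in> R 1 \<Longrightarrow> e * z = z \<Longrightarrow> z * e = z \<Longrightarrow> \<exists>c. z = rscal c * u"
        by (rule odd_corner[of ?x]) (use x z(2) g1 in \<open>simp_all\<close>)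
      obtain c where c: "?x = rscal c * u" using c[of ?x] x g1 by auto
      then have "c \<noteq> 0" using z(2) by (auto simp: rscal_zero)
      have g': "g' = 1" using g1 True by simp
      let ?r = "rscal (inverse c) * (u * (e * z))"
      have "?r * y = rscal (inverse c) * (u * ?x)" by (simp only: mult.assoc)
      also have "u * ?x = rscal c * (u * u)" unfolding c by (rule scale_left_commute)
      also have "rscal (inverse c) * (rscal c * (u * u)) = rscal (inverse c * c) * e" by (simp only: u(4) rscal_mult mult.assoc)
      also have "\<dots> = e" using \<open>c \<noteq> 0\<close> by (simp add: rdiag_one)
      finally have "?r * y = e" .
      moreover have "e * ?r = ?r"
        unfolding scale_left_commute using u(2) by (simp add: mult.assoc[symmetric])
      moreover have "?r \<in> R g" using mult_in[OF u(1) ez] g' True scale_in by simp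
      ultimately show ?thesis by blast
    next
      case False
      then show ?thesis using odd x z(2) g1 by metis
    qed
  qed
qed

end

section \<open>Coordinates with respect to matrix units\<close>

context matrix_graded_simple
begin

definition homsum :: "'f rfm \<Rightarrow> bool" where
  "homsum x \<longleftrightarrow> (\<exists>y\<in>R 0. \<exists>z\<in>R 1. x = y + z)"

lemma homsumI: "y \<in> R 0 \<Longrightarrow> z \<in> R 1 \<Longrightarrow> homsum (y + z)"
  by (auto simp: homsum_def)

lemma homsum_induct [consumes 1, case_names hom add]:
  assumes "homsum x" "\<And>g x. x \<in> R g \<Longrightarrow> P x" "\<And>x y. P x \<Longrightarrow> P y \<Longrightarrow> P (x + y)"
  shows "P x"
  using assms unfolding homsum_def by metis

lemma homsum_eq_0:
  assumes "y \<in> R g" "z \<in> R (g + 1)" "y + z = 0" shows "y = 0" "z = 0"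
proof -
  have "y = 0 - z" using assms(3) by (simp add: eq_neg_iff_add_eq_0)
  then have "y \<in> R (g + 1)" using diff_in[OF zero_in assms(2)] by simp
  then have "y \<in> R 0 \<inter> R 1" using assms(1) degree_cases[of g] by auto
  then show "y = 0" using disjoint by blast
  then show "z = 0" using assms(3) by simp
qed

end

text \<open>The products \<open>v i * r j\<close> are the matrix units. A unit of \<open>R\<close>
  is not postulated; \<open>complete\<close> says instead that the sum of the
  \<open>v i * r i\<close> acts as the identity on \<open>R e\<close>.\<close>

locale matrix_units = matrix_corner R h e
  for R :: "'g :: {ab_group_add, one} \<Rightarrow> 'f :: alg_closed_field rfm set" and h e +
  fixes n :: nat and v r :: "nat \<Rightarrow> 'f rfm" and dg :: "nat \<Rightarrow> 'g"
  assumes v_in: "i < n \<Longrightarrow> v i \<in> R (dg i)" and r_in: "i < n \<Longrightarrow> r i \<in> R (dg i)"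
    and v_e: "i < n \<Longrightarrow> v i * e = v i" and e_r: "i < n \<Longrightarrow> e * r i = r i"
    and r_v: "i < n \<Longrightarrow> j < n \<Longrightarrow> r i * v j = (if i = j then e else 0)"
    and complete: "y \<in> R g \<Longrightarrow> y * e = y \<Longrightarrow> y = (\<Sum>i<n. v i * r i * y)"
begin

definition entry :: "'f rfm \<Rightarrow> nat \<Rightarrow> nat \<Rightarrow> 'f rfm" where
  "entry x i j = r i * x * v j"

lemma n_pos: "0 < n"
  using complete[OF e(1,3)] e(2) by (cases n) auto

lemma entry_in:
  assumes "x \<in> R g" "i < n" "j < n" shows "entry x i j \<in> R (dg i + g + dg j)"
  unfolding entry_def using assms by (intro mult_in r_in v_in)

lemma e_entry: "i < n \<Longrightarrow> e * entry x i j = entry x i j"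
  by (simp add: entry_def mult.assoc[symmetric] e_r)

lemma entry_e: "j < n \<Longrightarrow> entry x i j * e = entry x i j"
  by (simp add: entry_def mult.assoc v_e)

lemma entry_add: "entry (x + y) i j = entry x i j + entry y i j"
  by (simp add: entry_def distrib_left distrib_right)

lemma entry_scale: "entry (rscal c * x) i j = rscal c * entry x i j"
  by (simp add: entry_def scale_left_commute mult.assoc)

lemma complete_homsum:
  assumes "homsum y" "j < n" shows "y * v j = (\<Sum>i<n. v i * entry y i j)"
  using assms(1)
proof (induction rule: homsum_induct)
  case (hom g x)
  have "x * v j \<in> R (g + dg j)" using hom v_in[OF assms(2)] by (rule mult_in)
  from complete[OF this] show ?case using v_e[OF assms(2)] by (simp add: entry_def mult.assoc)
next
  case (add x y)
  then show ?case by (simp add: distrib_right distrib_left entry_add sum.distrib)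
qed

lemma entry_mult:
  assumes "homsum y" "j < n" shows "entry (x * y) i j = (\<Sum>k<n. entry x i k * entry y k j)"
proof -
  have "entry (x * y) i j = r i * x * (y * v j)" by (simp add: entry_def mult.assoc)
  also have "\<dots> = (\<Sum>k<n. r i * x * (v k * entry y k j))"
    unfolding complete_homsum[OF assms] sum_distrib_left ..
  also have "\<dots> = (\<Sum>k<n. entry x i k * entry y k j)"
    by (simp only: mult.assoc[symmetric] entry_def[of x])
  finally show ?thesis .
qed

text \<open>An element without entries kills all \<open>v j\<close> and thus \<open>R e\<close>. So
  do its two homogeneous components, whose values lie in different degrees, and
  \<open>two_sided_annihilator\<close> applies to each.\<close>

lemma entry_eq_0:
  assumes x: "homsum x" and 0: "\<And>i j. i < n \<Longrightarrow> j < n \<Longrightarrow> entry x i j = 0"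
  shows "x = 0"
proof -
  have xv: "x * v j = 0" if "j < n" for j
    using 0[OF _ that] by (simp add: complete_homsum[OF x that])
  have xze: "x * z * e = 0" if "z \<in> R g" for z g
  proof -
    have "z * e \<in> R g" "z * e * e = z * e" using mult_in[OF that e(1)] e(3) by (simp_all add: mult.assoc)
    from complete[OF this] have "x * (z * e) = (\<Sum>i<n. x * v i * (r i * (z * e)))"
      by (metis (mono_tags, lifting) mult.assoc sum.cong sum_distrib_left)
    then show ?thesis using xv by (simp add: mult.assoc)
  qed
  obtain y z where yz: "y \<in> R 0" "z \<in> R 1" "x = y + z" using x by (auto simp: homsum_def)
  have "y * w * e = 0 \<and> z * w * e = 0" if w: "w \<in> R g" for w g
  proof -
    have "y * w * e \<in> R g" "z * w * e \<in> R (g + 1)"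
      using mult_in[OF mult_in[OF yz(1) w] e(1)] mult_in[OF mult_in[OF yz(2) w] e(1)] by (simp_all add: add.commute)
    moreover have "y * w * e + z * w * e = 0" using xze[OF w] by (simp add: yz(3) distrib_right)
    ultimately show ?thesis using homsum_eq_0 by blast
  qed
  then have "y = 0" "z = 0" using two_sided_annihilator yz(1,2) by blast+
  then show ?thesis by (simp add: yz(3))
qed

definition assemble :: "(nat \<Rightarrow> nat \<Rightarrow> 'f rfm) \<Rightarrow> 'f rfm" where
  "assemble w = (\<Sum>i<n. \<Sum>j<n. v i * w i j * r j)"

lemma assemble_in:
  assumes "\<And>i j. i < n \<Longrightarrow> j < n \<Longrightarrow> w i j \<in> R (dg i + g + dg j)"
  shows "assemble w \<in> R g"
  unfolding assemble_def
proof (intro sum_in)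
  fix i j assume "i \<in> {..<n}" "j \<in> {..<n}"
  then have ij: "i < n" "j < n" by auto
  have "v i * w i j * r j \<in> R (dg i + (dg i + g + dg j) + dg j)"
    using ij assms by (intro mult_in v_in r_in)
  moreover have "dg i + (dg i + g + dg j) + dg j = g"
    by (metis add.assoc add.commute degree_cancel)
  ultimately show "v i * w i j * r j \<in> R g" by simp
qed

lemma entry_assemble:
  assumes "i < n" "j < n" and w: "\<And>i j. i < n \<Longrightarrow> j < n \<Longrightarrow> e * w i j = w i j \<and> w i j * e = w i j"
  shows "entry (assemble w) i j = w i j"
proof -
  have "entry (assemble w) i j = (\<Sum>i'<n. \<Sum>j'<n. (r i * v i') * w i' j' * (r j' * v j))"
    unfolding entry_def assemble_def sum_distrib_left sum_distrib_right by (simp only: mult.assoc)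
  also have "\<dots> = (\<Sum>i'<n. if i' = i then (\<Sum>j'<n. if j' = j then w i j else 0) else 0)"
    using assms(1,2) w by (intro sum.cong refl) (auto simp: r_v if_distrib[of "(*) _"] cong: if_cong)
  also have "\<dots> = w i j" using assms by simp
  finally show ?thesis .
qed

end

context matrix_corner
begin

lemma one_neq: "(1 :: 'g) \<noteq> 0"
  using disjoint e(1,2) by auto

lemma matrix_units_of_list:
  assumes B: "biorthogonal G (set bs)" and dis: "distinct bs"
    and complete: "\<And>g y. y \<in> R g \<Longrightarrow> y * e = y \<Longrightarrow> y = (\<Sum>(g, v, r)\<in>set bs. v * r * y)"
  shows "matrix_units R h e (length bs) (\<lambda>i. fst (snd (bs ! i))) (\<lambda>i. snd (snd (bs ! i))) (\<lambda>i. fst (bs ! i))"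
proof
  fix i j assume i: "i < length bs"
  obtain g v r where b: "bs ! i = (g, v, r)" by (cases "bs ! i")
  have mem: "(g, v, r) \<in> set bs" using i b nth_mem by metis
  note D = biorthogonalD[OF B mem]
  show "fst (snd (bs ! i)) \<in> R (fst (bs ! i))" "snd (snd (bs ! i)) \<in> R (fst (bs ! i))"
    "fst (snd (bs ! i)) * e = fst (snd (bs ! i))" "e * snd (snd (bs ! i)) = snd (snd (bs ! i))"
    using D by (simp_all add: b)
  assume j: "j < length bs"
  obtain g' v' r' where b': "bs ! j = (g', v', r')" by (cases "bs ! j")
  have mem': "(g', v', r') \<in> set bs" using j b' nth_mem by metis
  have "i = j \<longleftrightarrow> (g, v, r) = (g', v', r')" using nth_eq_iff_index_eq[OF dis i j] b b' by simp
  moreover have "r * v' = e" if "(g, v, r) = (g', v', r')" using D(6) that by simp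
  moreover have "r * v' = 0" if "(g, v, r) \<noteq> (g', v', r')" using D(7)[OF mem' that] .
  ultimately show "snd (snd (bs ! i)) * fst (snd (bs ! j)) = (if i = j then e else 0)"
    unfolding b b' by auto
next
  fix y g assume y: "y \<in> R g" "y * e = y"
  have "(\<Sum>i<length bs. case bs ! i of (g, v, r) \<Rightarrow> v * r * y) = (\<Sum>(g, v, r)\<in>set bs. v * r * y)"
    by (rule sum.reindex_bij_betw[OF bij_betw_nth[OF dis refl refl]])
  then show "y = (\<Sum>i<length bs. fst (snd (bs ! i)) * snd (snd (bs ! i)) * y)"
    using complete[OF y] by (simp add: case_prod_beta)
qed

text \<open>Vectors of both degrees are present. Listing those of the more frequent degree
  \<open>d\<close> first gives \<open>l \<le> k\<close>; which degree this is does not matter, as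
  the degree of an entry only depends on the difference of two of them.\<close>

lemma matrix_units_even_corner:
  assumes odd: "\<And>x. x \<in> R 1 \<Longrightarrow> e * x = x \<Longrightarrow> x * e = x \<Longrightarrow> x = 0"
  shows "\<exists>k l d v r. l \<le> k \<and> matrix_units R h e (k + l) v r (\<lambda>i. if i < k then d else d + 1)"
proof -
  have dual: "\<exists>r\<in>R g. e * r = r \<and> r * y = e" if "y \<in> R g" "y * e = y" "y \<noteq> 0" for g y
    using dual_exists[OF that] odd by blast
  obtain B where B: "biorthogonal UNIV B"
    and c: "\<forall>g\<in>UNIV. \<forall>y\<in>R g. y * e = y \<longrightarrow> y = (\<Sum>(g, v, r)\<in>B. v * r * y)"
    using biorthogonal_complete[of UNIV, OF dual] by blast
  obtain xs where xs: "set xs = B" "distinct xs"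
    using finite_distinct_list[of B] B by (auto simp: biorthogonal_def)
  define us where "us d = filter (\<lambda>b. fst b = d) xs" for d
  have other: "fst b = d + 1 \<longleftrightarrow> fst b \<noteq> d" for b :: "'g \<times> 'f rfm \<times> 'f rfm" and d
    using degree_cases[of d] degree_cases[of "fst b"] one_neq by auto
  obtain d where d: "length (us (d + 1)) \<le> length (us d)"
    using double by (metis add.right_neutral add_0 linear)
  define bs where "bs = us d @ us (d + 1)"
  have set: "set bs = B" unfolding bs_def us_def other xs(1)[symmetric] by auto
  have dis: "distinct bs" unfolding bs_def us_def other using xs(2) by auto
  have "matrix_units R h e (length bs) (\<lambda>i. fst (snd (bs ! i))) (\<lambda>i. snd (snd (bs ! i))) (\<lambda>i. fst (bs ! i))"
    using matrix_units_of_list[of UNIV bs] B dis c unfolding set by blast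
  moreover have "fst (bs ! i) = (if i < length (us d) then d else d + 1)" if "i < length bs" for i
  proof -
    have "bs ! i \<in> set (us d)" if "i < length (us d)" using that by (simp add: bs_def nth_append)
    moreover have "bs ! i \<in> set (us (d + 1))" if "\<not> i < length (us d)"
      using that \<open>i < length bs\<close> by (simp add: bs_def nth_append)
    ultimately show ?thesis unfolding us_def by auto
  qed
  ultimately have "matrix_units R h e (length bs) (\<lambda>i. fst (snd (bs ! i))) (\<lambda>i. snd (snd (bs ! i)))
    (\<lambda>i. if i < length (us d) then d else d + 1)"
    unfolding matrix_units_def matrix_units_axioms_def by simp
  then show ?thesis using d unfolding bs_def length_append by blast
qed

text \<open>Vectors of degree 0 are enough: an odd \<open>y\<close> in \<open>R e\<close> equals
  \<open>(y * u) * u\<close>, and \<open>y * u\<close> is even.\<close>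

lemma matrix_units_odd_corner:
  assumes u: "u \<in> R 1" "e * u = u" "u * e = u" "u * u = e"
  shows "\<exists>n v r. matrix_units R h e n v r (\<lambda>i. 0)"
proof -
  have dual: "\<exists>r\<in>R g. e * r = r \<and> r * y = e" if "g \<in> {0}" "y \<in> R g" "y * e = y" "y \<noteq> 0" for g y
    using dual_exists[OF that(2-4)] that(1) by blast
  obtain B where B: "biorthogonal {0} B"
    and c: "\<forall>g\<in>{0}. \<forall>y\<in>R g. y * e = y \<longrightarrow> y = (\<Sum>(g, v, r)\<in>B. v * r * y)"
    using biorthogonal_complete[of "{0}", OF dual] by blast
  have c0: "y = (\<Sum>(g, v, r)\<in>B. v * r * y)" if "y \<in> R 0" "y * e = y" for y
    using c that by blast
  have c: "y = (\<Sum>(g, v, r)\<in>B. v * r * y)" if y: "y \<in> R g" "y * e = y" for g y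
  proof (cases "g = 0")
    case False
    then have "g = 1" using degree_cases by blast
    then have "y * u \<in> R 0" using mult_in[OF y(1) u(1)] by simp
    from c0[OF this] have "y * u * u = (\<Sum>(g, v, r)\<in>B. v * r * (y * u)) * u" using u(3) by (simp add: mult.assoc)
    also have "\<dots> = (\<Sum>(g, v, r)\<in>B. v * r * (y * u * u))"
      unfolding sum_distrib_right by (intro sum.cong) (auto simp: mult.assoc)
    finally show ?thesis using u(4) y(2) by (simp add: mult.assoc)
  qed (use c0 y in blast)
  obtain bs where bs: "set bs = B" "distinct bs"
    using finite_distinct_list[of B] B by (auto simp: biorthogonal_def)
  have "matrix_units R h e (length bs) (\<lambda>i. fst (snd (bs ! i))) (\<lambda>i. snd (snd (bs ! i))) (\<lambda>i. fst (bs ! i))"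
    using matrix_units_of_list[of "{0}" bs] B bs(2) c unfolding bs(1) by blast
  moreover have "fst (bs ! i) = 0" if "i < length bs" for i
  proof -
    have "bs ! i \<in> B" using that bs(1) by auto
    then show ?thesis using biorthogonalD(1)[OF B] by (cases "bs ! i") auto
  qed
  ultimately have "matrix_units R h e (length bs) (\<lambda>i. fst (snd (bs ! i))) (\<lambda>i. snd (snd (bs ! i))) (\<lambda>i. 0)"
    unfolding matrix_units_def matrix_units_axioms_def by simp
  then show ?thesis by blast
qed

end

section \<open>Realisation by the standard algebras\<close>

lemma grade_block_matrix_algebra:
  "grade (block_matrix_algebra k l :: ('f :: field, 'f mat) graded_algebra) g =
    {X \<in> carrier_mat (k + l) (k + l). \<forall>i<k + l. \<forall>j<k + l. X $$ (i, j) \<noteq> 0 \<longrightarrow> ((i < k) = (j < k)) = (g = 0)}"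
  (is "_ = ?S")
proof -
  show ?thesis
  proof (cases "g = 0")
    case True
    have "X \<in> ?S \<Longrightarrow> X = four_block_mat (mat k k (\<lambda>(i, j). X $$ (i, j))) (0\<^sub>m k l) (0\<^sub>m l k) (mat l l (\<lambda>(i, j). X $$ (i + k, j + k)))" for X
      using True by (intro eq_matI) auto
    then have "?S \<subseteq> {four_block_mat P (0\<^sub>m k l) (0\<^sub>m l k) S | P S. P \<in> carrier_mat k k \<and> S \<in> carrier_mat l l}"
      by (smt (verit, best) mat_carrier mem_Collect_eq subsetI)
    moreover have "{four_block_mat P (0\<^sub>m k l) (0\<^sub>m l k) S | P S. P \<in> carrier_mat k k \<and> S \<in> carrier_mat l l} \<subseteq> ?S"
      using True by (auto split: if_splits)
    ultimately show ?thesis using True by (simp add: block_matrix_algebra_def module.defs graded_algebra.defs)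
  next
    case False
    have "X \<in> ?S \<Longrightarrow> X = four_block_mat (0\<^sub>m k k) (mat k l (\<lambda>(i, j). X $$ (i, j + k))) (mat l k (\<lambda>(i, j). X $$ (i + k, j))) (0\<^sub>m l l)" for X
      using False by (intro eq_matI) auto
    then have "?S \<subseteq> {four_block_mat (0\<^sub>m k k) Q R (0\<^sub>m l l) | Q R. Q \<in> carrier_mat k l \<and> R \<in> carrier_mat l k}"
      by (smt (verit, best) mat_carrier mem_Collect_eq subsetI)
    moreover have "{four_block_mat (0\<^sub>m k k) Q R (0\<^sub>m l l) | Q R. Q \<in> carrier_mat k l \<and> R \<in> carrier_mat l k} \<subseteq> ?S"
      using False by (auto split: if_splits)
    ultimately show ?thesis using False by (simp add: block_matrix_algebra_def module.defs graded_algebra.defs)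
  qed
qed

lemma block_matrix_algebra_simps [simp]:
  "carrier (block_matrix_algebra k l) = carrier_mat (k + l) (k + l)"
  "X \<oplus>\<^bsub>block_matrix_algebra k l\<^esub> Y = X + Y"
  "X \<otimes>\<^bsub>block_matrix_algebra k l\<^esub> Y = X * Y"
  "c \<odot>\<^bsub>block_matrix_algebra k l\<^esub> X = c \<cdot>\<^sub>m X"
  "\<zero>\<^bsub>block_matrix_algebra k l\<^esub> = 0\<^sub>m (k + l) (k + l)"
  by (simp_all add: block_matrix_algebra_def module.defs module_mat_def ring_mat_def)

lemma rscal_sum: "rscal (sum f S) = (\<Sum>i\<in>S. rscal (f i))"
  by (induction S rule: infinite_finite_induct) (simp_all add: rscal_zero rscal_add)

context matrix_graded_simple
begin

text \<open>An isomorphism on the sums of homogeneous elements, with no demand on other matrices.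
  The type of degrees is abstract here, hence the translation into \<open>bit\<close> by
  cases.\<close>

definition realises :: "('f rfm \<Rightarrow> 'w) \<Rightarrow> ('f, 'w) graded_algebra \<Rightarrow> bool" where
  "realises \<phi> S \<longleftrightarrow>
     (\<forall>x y. homsum x \<longrightarrow> homsum y \<longrightarrow> \<phi> (x + y) = \<phi> x \<oplus>\<^bsub>S\<^esub> \<phi> y \<and> \<phi> (x * y) = \<phi> x \<otimes>\<^bsub>S\<^esub> \<phi> y \<and> (\<phi> x = \<phi> y \<longrightarrow> x = y)) \<and>
     (\<forall>c x. homsum x \<longrightarrow> \<phi> (rscal c * x) = c \<odot>\<^bsub>S\<^esub> \<phi> x) \<and>
     (\<forall>g. \<phi> ` R g = grade S (if g = 0 then 0 else 1))"

lemma scale_mult: "(rscal c * x) * (rscal d * y) = rscal (c * d) * (x * y)" for c d :: 'f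
proof -
  have "(rscal c * x) * (rscal d * y) = rscal c * (x * (rscal d * y))" by (rule mult.assoc)
  also have "x * (rscal d * y) = rscal d * (x * y)" by (rule scale_left_commute)
  finally show ?thesis by (simp only: rscal_mult mult.assoc)
qed

lemma homsum_diff: "homsum x \<Longrightarrow> homsum y \<Longrightarrow> homsum (x - y)"
proof -
  assume "homsum x" "homsum y"
  then obtain a b c d where *: "a \<in> R 0" "b \<in> R 1" "x = a + b" "c \<in> R 0" "d \<in> R 1" "y = c + d"
    by (auto simp: homsum_def)
  then have "x - y = (a - c) + (b - d)" by simp
  then show ?thesis using homsumI diff_in * by metis
qed

end

context matrix_units
begin

lemma eq_of_entries:
  assumes "homsum x" "homsum y" "\<And>i j. i < n \<Longrightarrow> j < n \<Longrightarrow> entry x i j = entry y i j"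
  shows "x = y"
proof -
  have "entry (x - y) i j = 0" if "i < n" "j < n" for i j
    using assms(3)[OF that] by (simp add: entry_def right_diff_distrib left_diff_distrib)
  then have "x - y = 0" using entry_eq_0[OF homsum_diff[OF assms(1,2)]] by blast
  then show ?thesis by simp
qed

lemma scalar_unique: "rscal a * e = rscal b * e \<longleftrightarrow> a = b"
  using rvs.scale_right_imp_eq[OF e(2)] by blast

text \<open>An entry lies in the corner, so it is a multiple of \<open>e\<close> if its degree is 0,
  and zero otherwise. Its degree differs from that of the element exactly if row and column are on
  different sides of \<open>k\<close>, which is the block grading.\<close>

lemma realises_block:
  assumes odd: "\<And>x. x \<in> R 1 \<Longrightarrow> e * x = x \<Longrightarrow> x * e = x \<Longrightarrow> x = 0"
    and n: "n = k + l" and dg: "\<And>i. i < n \<Longrightarrow> dg i = (if i < k then d else d + 1)"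
  shows "\<exists>\<phi>. realises \<phi> (block_matrix_algebra k l)"
proof -
  define cf where "cf y = (THE c. y = rscal c * e)" for y
  have cf [simp]: "cf (rscal c * e) = c" for c unfolding cf_def scalar_unique by simp
  have dgsum: "dg i + dg j = (if (i < k) = (j < k) then 0 else 1)" if "i < n" "j < n" for i j
    using that by (simp add: dg)
  have entry0: "entry x i j = 0" if "x \<in> R g" "i < n" "j < n" "((i < k) = (j < k)) \<noteq> (g = 0)" for x g i j
  proof -
    have "dg i + g + dg j = (dg i + dg j) + g" by (simp add: algebra_simps)
    also have "\<dots> = 1" using that dgsum[OF that(2,3)] degree_cases[of g] by auto
    finally have "entry x i j \<in> R 1" using entry_in[OF that(1-3)] by simp
    then show ?thesis using odd e_entry[OF that(2)] entry_e[OF that(3)] by blast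
  qed
  have ex: "\<exists>c. entry x i j = rscal c * e" if "homsum x" "i < n" "j < n" for x i j
    using that(1)
  proof (induction rule: homsum_induct)
    case (hom g x)
    show ?case
    proof (cases "((i < k) = (j < k)) = (g = 0)")
      case True
      have "dg i + g + dg j = (dg i + dg j) + g" by (simp add: algebra_simps)
      also have "\<dots> = 0" using True dgsum[OF that(2,3)] degree_cases[of g] by auto
      finally have "entry x i j \<in> R 0" using entry_in[OF hom that(2,3)] by simp
      then show ?thesis using even_corner e_entry[OF that(2)] entry_e[OF that(3)] by blast
    next
      case False
      then have "entry x i j = rscal 0 * e" using entry0[OF hom that(2,3)] by (simp add: rscal_zero)
      then show ?thesis by blast
    qed
  next
    case (add x y)
    then obtain a b where "entry x i j = rscal a * e" "entry y i j = rscal b * e" by blast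
    then have "entry (x + y) i j = rscal (a + b) * e" by (simp add: entry_add rscal_add distrib_right)
    then show ?case by blast
  qed
  have entry: "entry x i j = rscal (cf (entry x i j)) * e" if "homsum x" "i < n" "j < n" for x i j
    using ex[OF that] by auto
  define \<phi> where "\<phi> x = mat n n (\<lambda>(i, j). cf (entry x i j))" for x
  have "realises \<phi> (block_matrix_algebra k l)"
    unfolding realises_def block_matrix_algebra_simps
  proof (intro conjI allI impI)
    fix x y assume x: "homsum x" and y: "homsum y"
    have "cf (entry (x + y) i j) = cf (entry x i j) + cf (entry y i j)" if "i < n" "j < n" for i j
    proof -
      have "entry (x + y) i j = rscal (cf (entry x i j) + cf (entry y i j)) * e"
        unfolding entry_add rscal_add distrib_right using entry[OF x that] entry[OF y that] by simp
      then show ?thesis by simp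
    qed
    then show "\<phi> (x + y) = \<phi> x + \<phi> y" unfolding \<phi>_def by (intro eq_matI) auto
    have "cf (entry (x * y) i j) = (\<Sum>k<n. cf (entry x i k) * cf (entry y k j))" if "i < n" "j < n" for i j
    proof -
      have "entry (x * y) i j = (\<Sum>k<n. rscal (cf (entry x i k) * cf (entry y k j)) * e)"
        unfolding entry_mult[OF y that(2)]
      proof (rule sum.cong[OF refl])
        fix k assume "k \<in> {..<n}"
        then have "entry x i k * entry y k j = (rscal (cf (entry x i k)) * e) * (rscal (cf (entry y k j)) * e)"
          using entry[OF x that(1)] entry[OF y _ that(2)] by simp
        then show "entry x i k * entry y k j = rscal (cf (entry x i k) * cf (entry y k j)) * e"
          by (simp only: scale_mult e(3))
      qed
      then have "entry (x * y) i j = rscal (\<Sum>k<n. cf (entry x i k) * cf (entry y k j)) * e"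
        by (simp only: rscal_sum sum_distrib_right)
      then show ?thesis by simp
    qed
    then show "\<phi> (x * y) = \<phi> x * \<phi> y"
      unfolding \<phi>_def by (intro eq_matI) (auto simp: scalar_prod_def atLeast0LessThan)
    assume eq: "\<phi> x = \<phi> y"
    show "x = y"
    proof (rule eq_of_entries[OF x y])
      fix i j assume ij: "i < n" "j < n"
      then have "\<phi> x $$ (i, j) = \<phi> y $$ (i, j)" by (simp add: eq)
      then show "entry x i j = entry y i j" using entry[OF x ij] entry[OF y ij] ij by (simp add: \<phi>_def)
    qed
  next
    fix c x assume x: "homsum x"
    have "cf (entry (rscal c * x) i j) = c * cf (entry x i j)" if "i < n" "j < n" for i j
    proof -
      have "entry (rscal c * x) i j = rscal c * (rscal (cf (entry x i j)) * e)"
        unfolding entry_scale using entry[OF x that] by simp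
      then show ?thesis by (simp only: mult.assoc[symmetric] rscal_mult[symmetric] cf)
    qed
    then show "\<phi> (rscal c * x) = c \<cdot>\<^sub>m \<phi> x" unfolding \<phi>_def by (intro eq_matI) auto
  next
    fix g
    show "\<phi> ` R g = grade (block_matrix_algebra k l) (if g = 0 then 0 else 1)"
      unfolding grade_block_matrix_algebra
    proof (intro equalityI subsetI)
      fix X assume "X \<in> \<phi> ` R g"
      then obtain x where x: "x \<in> R g" "X = \<phi> x" by blast
      have "cf (entry x i j) = 0" if "i < n" "j < n" "((i < k) = (j < k)) \<noteq> (g = 0)" for i j
        using cf[of 0] by (simp add: entry0[OF x(1) that] rscal_zero)
      then show "X \<in> {X \<in> carrier_mat (k + l) (k + l). \<forall>i<k + l. \<forall>j<k + l. X $$ (i, j) \<noteq> 0 \<longrightarrow>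
          ((i < k) = (j < k)) = ((if g = 0 then 0 else 1 :: bit) = 0)}"
        unfolding x(2) \<phi>_def n by auto
    next
      fix X :: "'f mat" assume X: "X \<in> {X \<in> carrier_mat (k + l) (k + l). \<forall>i<k + l. \<forall>j<k + l. X $$ (i, j) \<noteq> 0 \<longrightarrow>
          ((i < k) = (j < k)) = ((if g = 0 then 0 else 1 :: bit) = 0)}"
      define w where "w i j = rscal (X $$ (i, j)) * e" for i j
      have in_R: "assemble w \<in> R g"
      proof (rule assemble_in)
        fix i j assume ij: "i < n" "j < n"
        show "w i j \<in> R (dg i + g + dg j)"
        proof (cases "X $$ (i, j) = 0")
          case True
          then show ?thesis by (simp add: w_def rscal_zero zero_in)
        next
          case False
          have "((i < k) = (j < k)) = ((if g = 0 then 0 else 1 :: bit) = 0)"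
            using X False ij unfolding n by blast
          then have *: "((i < k) = (j < k)) = (g = 0)" by auto
          have "dg i + g + dg j = (dg i + dg j) + g" by (simp add: algebra_simps)
          also have "\<dots> = 0" using * dgsum[OF ij] degree_cases[of g] by auto
          finally show ?thesis using e(1) scale_in by (simp add: w_def)
        qed
      qed
      have "entry (assemble w) i j = w i j" if "i < n" "j < n" for i j
        using that by (rule entry_assemble) (simp add: w_def scale_left_commute e(3) mult.assoc)
      then have "\<phi> (assemble w) = X"
        using X unfolding \<phi>_def n by (intro eq_matI) (auto simp: w_def)
      then show "X \<in> \<phi> ` R g" using in_R by blast
    qed
  qed
  then show ?thesis by blast
qed

text \<open>The entries have the form \<open>a e + b u\<close>, and such elements multiply like
  \<open>a + b \<epsilon>\<close>. As all \<open>dg i\<close> are 0, an entry has the degree of the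
  element, and a homogeneous one has only one of the two terms.\<close>

lemma realises_group:
  assumes u: "u \<in> R 1" "e * u = u" "u * e = u" "u * u = e"
    and odd: "\<And>x. x \<in> R 1 \<Longrightarrow> e * x = x \<Longrightarrow> x * e = x \<Longrightarrow> \<exists>c. x = rscal c * u"
    and dg: "\<And>i. i < n \<Longrightarrow> dg i = 0"
  shows "\<exists>\<phi>. realises \<phi> (group_matrix_algebra n)"
proof -
  define el where "el p = rscal (fst p) * e + rscal (snd p) * u" for p
  define cf where "cf y = (THE p. y = el p)" for y
  have u0: "u \<noteq> 0" using u(4) e(2) by auto
  have el_add: "el p + el q = el (fst p + fst q, snd p + snd q)" for p q
    by (simp add: el_def rscal_add algebra_simps)
  have el0: "p = (0, 0)" if "el p = 0" for p
  proof -
    have "rscal (fst p) * e = 0" "rscal (snd p) * u = 0"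
      using homsum_eq_0[of "rscal (fst p) * e" 0 "rscal (snd p) * u"] that scale_in e(1) u(1)
      by (simp_all add: el_def)
    then show ?thesis using rvs.scale_eq_0_iff e(2) u0 by (simp add: prod_eq_iff)
  qed
  have inj: "el p = el q \<longleftrightarrow> p = q" for p q
  proof
    assume "el p = el q"
    then have "el (fst p - fst q, snd p - snd q) = 0"
      using el_add[of "(fst p - fst q, snd p - snd q)" q] by simp
    then show "p = q" using el0 by (force simp: prod_eq_iff)
  qed simp
  have cf [simp]: "cf (el p) = p" for p by (simp add: cf_def inj)
  have el_mult: "el p * el q = el (fst p * fst q + snd p * snd q, fst p * snd q + snd p * fst q)" for p q
    unfolding el_def distrib_left distrib_right scale_mult e(3) u(2-4) fst_conv snd_conv rscal_add by (simp add: add_ac)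
  have el_scale: "rscal c * el p = el (c * fst p, c * snd p)" for c p
    by (simp only: el_def rscal_mult distrib_left mult.assoc fst_conv snd_conv)
  have el_zero: "el (0, 0) = 0" by (simp add: el_def rscal_zero)
  have el_sum: "(\<Sum>i\<in>S. el (f i)) = el (\<Sum>i\<in>S. fst (f i), \<Sum>i\<in>S. snd (f i))" for f and S :: "nat set"
    by (induction S rule: infinite_finite_induct) (simp_all add: el_zero el_add)
  have el_e: "e * el p = el p" "el p * e = el p" for p
    using e(3) u(2,3) by (simp_all add: el_def distrib_left distrib_right scale_left_commute mult.assoc)
  have ex: "\<exists>c. entry x i j = el (if g = 0 then (c, 0) else (0, c))" if "x \<in> R g" "i < n" "j < n" for x g i j
  proof -
    have "entry x i j \<in> R g" using entry_in[OF that] that(2,3) by (simp add: dg)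
    then have "\<exists>c. entry x i j = rscal c * (if g = 0 then e else u)"
      using even_corner odd e_entry[OF that(2)] entry_e[OF that(3)] degree_cases[of g] by auto
    then show ?thesis by (auto simp: el_def rscal_zero)
  qed
  have "\<exists>p. entry x i j = el p" if "homsum x" "i < n" "j < n" for x i j
    using that(1)
  proof (induction rule: homsum_induct)
    case (hom g x)
    then show ?case using ex[OF hom that(2,3)] by blast
  next
    case (add x y)
    then obtain p q where "entry x i j = el p" "entry y i j = el q" by blast
    then have "entry (x + y) i j = el (fst p + fst q, snd p + snd q)" by (simp add: entry_add el_add)
    then show ?case by blast
  qed
  then have entry: "entry x i j = el (cf (entry x i j))" if "homsum x" "i < n" "j < n" for x i j
    using that by (metis cf)
  define \<phi> where "\<phi> x = (mat n n (\<lambda>(i, j). fst (cf (entry x i j))), mat n n (\<lambda>(i, j). snd (cf (entry x i j))))" for x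
  have "realises \<phi> (group_matrix_algebra n)"
    unfolding realises_def
  proof (intro conjI allI impI)
    fix x y assume x: "homsum x" and y: "homsum y"
    have "cf (entry (x + y) i j) = (fst (cf (entry x i j)) + fst (cf (entry y i j)), snd (cf (entry x i j)) + snd (cf (entry y i j)))"
      if "i < n" "j < n" for i j
    proof -
      have "entry (x + y) i j = el (cf (entry x i j)) + el (cf (entry y i j))"
        unfolding entry_add using entry[OF x that] entry[OF y that] by simp
      then show ?thesis by (simp only: el_add cf)
    qed
    then show "\<phi> (x + y) = \<phi> x \<oplus>\<^bsub>group_matrix_algebra n\<^esub> \<phi> y"
      unfolding \<phi>_def group_matrix_algebra_def by (auto intro!: eq_matI)
    have "cf (entry (x * y) i j) =
      ((\<Sum>k<n. fst (cf (entry x i k)) * fst (cf (entry y k j))) + (\<Sum>k<n. snd (cf (entry x i k)) * snd (cf (entry y k j))),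
       (\<Sum>k<n. fst (cf (entry x i k)) * snd (cf (entry y k j))) + (\<Sum>k<n. snd (cf (entry x i k)) * fst (cf (entry y k j))))"
      if "i < n" "j < n" for i j
    proof -
      have "entry (x * y) i j = (\<Sum>k<n. el (cf (entry x i k)) * el (cf (entry y k j)))"
        unfolding entry_mult[OF y that(2)]
      proof (rule sum.cong[OF refl])
        fix k assume "k \<in> {..<n}"
        then show "entry x i k * entry y k j = el (cf (entry x i k)) * el (cf (entry y k j))"
          using entry[OF x that(1)] entry[OF y _ that(2)] by simp
      qed
      then show ?thesis by (simp only: el_mult el_sum cf fst_conv snd_conv sum.distrib)
    qed
    then show "\<phi> (x * y) = \<phi> x \<otimes>\<^bsub>group_matrix_algebra n\<^esub> \<phi> y"
      unfolding \<phi>_def group_matrix_algebra_def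
      by (auto intro!: eq_matI simp: scalar_prod_def atLeast0LessThan)
    assume eq: "\<phi> x = \<phi> y"
    show "x = y"
    proof (rule eq_of_entries[OF x y])
      fix i j assume ij: "i < n" "j < n"
      then have "fst (\<phi> x) $$ (i, j) = fst (\<phi> y) $$ (i, j)" "snd (\<phi> x) $$ (i, j) = snd (\<phi> y) $$ (i, j)"
        by (simp_all add: eq)
      then have "cf (entry x i j) = cf (entry y i j)" using ij by (simp add: \<phi>_def prod_eq_iff)
      then show "entry x i j = entry y i j" using entry[OF x ij] entry[OF y ij] by simp
    qed
  next
    fix c x assume x: "homsum x"
    have "cf (entry (rscal c * x) i j) = (c * fst (cf (entry x i j)), c * snd (cf (entry x i j)))"
      if "i < n" "j < n" for i j
    proof -
      have "entry (rscal c * x) i j = rscal c * el (cf (entry x i j))"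
        unfolding entry_scale using entry[OF x that] by simp
      then show ?thesis by (simp only: el_scale cf)
    qed
    then show "\<phi> (rscal c * x) = c \<odot>\<^bsub>group_matrix_algebra n\<^esub> \<phi> x"
      unfolding \<phi>_def group_matrix_algebra_def by (auto intro!: eq_matI)
  next
    fix g
    show "\<phi> ` R g = grade (group_matrix_algebra n) (if g = 0 then 0 else 1)"
    proof (intro equalityI subsetI)
      fix X assume "X \<in> \<phi> ` R g"
      then obtain x where x: "x \<in> R g" "X = \<phi> x" by blast
      have "if g = 0 then snd (cf (entry x i j)) = 0 else fst (cf (entry x i j)) = 0" if "i < n" "j < n" for i j
        using ex[OF x(1) that] by auto
      then show "X \<in> grade (group_matrix_algebra n) (if g = 0 then 0 else 1)"
        unfolding x(2) \<phi>_def group_matrix_algebra_def by (auto intro!: eq_matI)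
    next
      fix X :: "'f mat \<times> 'f mat" assume X: "X \<in> grade (group_matrix_algebra n) (if g = 0 then 0 else 1)"
      define w where "w i j = el (fst X $$ (i, j), snd X $$ (i, j))" for i j
      have in_R: "assemble w \<in> R g"
      proof (rule assemble_in)
        fix i j assume ij: "i < n" "j < n"
        have "w i j \<in> R g"
        proof (cases "g = 0")
          case True
          then have "snd X = 0\<^sub>m n n" using X by (auto simp: group_matrix_algebra_def)
          then have "w i j = rscal (fst X $$ (i, j)) * e" using ij by (simp add: w_def el_def rscal_zero)
          then show ?thesis using scale_in[OF e(1)] True by simp
        next
          case False
          then have "fst X = 0\<^sub>m n n" using X by (auto simp: group_matrix_algebra_def)
          then have "w i j = rscal (snd X $$ (i, j)) * u" using ij by (simp add: w_def el_def rscal_zero)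
          moreover have "g = 1" using False degree_cases by blast
          ultimately show ?thesis using scale_in[OF u(1)] by simp
        qed
        then show "w i j \<in> R (dg i + g + dg j)" using ij by (simp add: dg)
      qed
      have "entry (assemble w) i j = w i j" if "i < n" "j < n" for i j
        using that by (rule entry_assemble) (simp add: w_def el_e)
      moreover have "fst X \<in> carrier_mat n n" "snd X \<in> carrier_mat n n"
        using X by (auto simp: group_matrix_algebra_def split: if_splits)
      ultimately have "\<phi> (assemble w) = X"
        unfolding \<phi>_def by (auto simp: prod_eq_iff w_def intro!: eq_matI)
      then show "X \<in> \<phi> ` R g" using in_R by blast
    qed
  qed
  then show ?thesis by blast
qed

end

theorem (in matrix_graded_simple) matrix_classification:
  "(\<exists>k l \<phi>. l \<le> k \<and> 0 < k \<and> realises \<phi> (block_matrix_algebra k l)) \<or>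
   (\<exists>n \<phi>. 0 < n \<and> realises \<phi> (group_matrix_algebra n))"
proof -
  obtain e where e: "e \<in> R 0" "e \<noteq> 0" "e * e = e"
    "\<And>g x. x \<in> R g \<Longrightarrow> x * e = x \<Longrightarrow> x \<noteq> 0 \<Longrightarrow> \<exists>y\<in>R g. y * x = e"
    by (rule minimal_idempotent) blast
  interpret corner: matrix_corner R h e by standard (use e in blast)+
  show ?thesis
  proof (cases "\<forall>x\<in>R 1. e * x = x \<longrightarrow> x * e = x \<longrightarrow> x = 0")
    case True
    then have odd: "x = 0" if "x \<in> R 1" "e * x = x" "x * e = x" for x using that by blast
    have "\<exists>k l d v r. l \<le> k \<and> matrix_units R h e (k + l) v r (\<lambda>i. if i < k then d else d + 1)"
      by (rule corner.matrix_units_even_corner) (rule odd)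
    then obtain k l d v r where kl: "l \<le> k" and mu: "matrix_units R h e (k + l) v r (\<lambda>i. if i < k then d else d + 1)"
      by (elim exE conjE) (rule that)
    interpret mu: matrix_units R h e "k + l" v r "\<lambda>i. if i < k then d else d + 1" by (rule mu)
    have "\<exists>\<phi>. realises \<phi> (block_matrix_algebra k l)"
      by (rule mu.realises_block[of k l d]) (use True in auto)
    moreover have "0 < k" using mu.n_pos kl by arith
    ultimately show ?thesis using kl by blast
  next
    case False
    then obtain x where x: "x \<in> R 1" "e * x = x" "x * e = x" "x \<noteq> 0" by blast
    show ?thesis
    proof (rule corner.odd_corner[OF x])
      fix u assume u: "u \<in> R 1" "e * u = u" "u * e = u" "u * u = e"
        and uc: "\<And>z. z \<in> R 1 \<Longrightarrow> e * z = z \<Longrightarrow> z * e = z \<Longrightarrow> \<exists>c. z = rscal c * u"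
      obtain n v r where mu: "matrix_units R h e n v r (\<lambda>i. 0)"
        using corner.matrix_units_odd_corner[OF u] by blast
      interpret mu: matrix_units R h e n v r "\<lambda>i. 0" by (rule mu)
      have "\<exists>\<phi>. realises \<phi> (group_matrix_algebra n)"
        by (rule mu.realises_group[OF u]) (use uc in auto)
      then show ?thesis using mu.n_pos by blast
    qed
  qed
qed

section \<open>Transfer of the classification to abstract graded-simple algebras\<close>

context Z2_graded_algebra
begin

lemma grade_submodule: "submodule class_ring (grade A i) A"
  by (rule subspace.submod[OF grade_subspace])

lemma grade_carrier: "x \<in> grade A i \<Longrightarrow> x \<in> carrier A"
  using submodule.subset[OF grade_submodule] by blast

lemma grade_zero: "\<zero> \<in> grade A i"
  by (rule submodule.zero_closed[OF grade_submodule])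

lemma grade_add: "x \<in> grade A i \<Longrightarrow> y \<in> grade A i \<Longrightarrow> x \<oplus> y \<in> grade A i"
  by (rule submodule.m_closed[OF grade_submodule])

lemma grade_smult: "x \<in> grade A i \<Longrightarrow> c \<odot> x \<in> grade A i"
  by (rule submodule.smult_closed[OF grade_submodule]) simp_all

end

lemma standard_algebra_carrier:
  "carrier (block_matrix_algebra k l :: ('f :: field, 'f mat) graded_algebra) =
    {X \<oplus>\<^bsub>block_matrix_algebra k l\<^esub> Y |X Y. X \<in> grade (block_matrix_algebra k l) 0 \<and> Y \<in> grade (block_matrix_algebra k l) 1}"
  "carrier (group_matrix_algebra n :: ('f, 'f mat \<times> 'f mat) graded_algebra) =
    {X \<oplus>\<^bsub>group_matrix_algebra n\<^esub> Y |X Y. X \<in> grade (group_matrix_algebra n) 0 \<and> Y \<in> grade (group_matrix_algebra n) 1}"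
proof -
  define part where "part p X = mat (k + l) (k + l) (\<lambda>(i, j). if ((i < k) = (j < k)) = p then X $$ (i, j) else 0)"
    for p and X :: "'f mat"
  have "X = part True X + part False X" if "X \<in> carrier_mat (k + l) (k + l)" for X
    using that by (intro eq_matI) (auto simp: part_def)
  moreover have "part True X \<in> grade (block_matrix_algebra k l) 0" "part False X \<in> grade (block_matrix_algebra k l) 1" for X
    unfolding grade_block_matrix_algebra by (auto simp: part_def)
  ultimately show "carrier (block_matrix_algebra k l :: ('f, 'f mat) graded_algebra) =
    {X \<oplus>\<^bsub>block_matrix_algebra k l\<^esub> Y |X Y. X \<in> grade (block_matrix_algebra k l) 0 \<and> Y \<in> grade (block_matrix_algebra k l) 1}"
    unfolding block_matrix_algebra_simps
    by (intro equalityI subsetI CollectI) (blast, auto simp: grade_block_matrix_algebra)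
  have "(X, Y) = (X, 0\<^sub>m n n) \<oplus>\<^bsub>group_matrix_algebra n\<^esub> (0\<^sub>m n n, Y)"
      "(X, 0\<^sub>m n n) \<in> grade (group_matrix_algebra n) 0" "(0\<^sub>m n n, Y) \<in> grade (group_matrix_algebra n) 1"
    if "X \<in> carrier_mat n n" "Y \<in> carrier_mat n n" for X Y :: "'f mat"
    using that by (simp_all add: group_matrix_algebra_def)
  moreover have "X \<oplus>\<^bsub>group_matrix_algebra n\<^esub> Y \<in> carrier (group_matrix_algebra n)"
    if "X \<in> grade (group_matrix_algebra n) 0" "Y \<in> grade (group_matrix_algebra n) 1" for X Y :: "'f mat \<times> 'f mat"
    using that by (auto simp: group_matrix_algebra_def)
  moreover have "carrier (group_matrix_algebra n :: ('f, 'f mat \<times> 'f mat) graded_algebra) = carrier_mat n n \<times> carrier_mat n n"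
    by (simp add: group_matrix_algebra_def)
  ultimately show "carrier (group_matrix_algebra n :: ('f, 'f mat \<times> 'f mat) graded_algebra) =
    {X \<oplus>\<^bsub>group_matrix_algebra n\<^esub> Y |X Y. X \<in> grade (group_matrix_algebra n) 0 \<and> Y \<in> grade (group_matrix_algebra n) 1}"
    by (intro equalityI subsetI) (simp_all only: mem_Collect_eq, blast+)
qed

theorem graded_simple_classification:
  fixes A :: "('f :: alg_closed_field, 'v, 'z) graded_algebra_scheme"
  assumes "graded_simple_algebra A" "vectorspace.fin_dim class_ring A"
  shows "(\<exists>k l. l \<le> k \<and> 0 < k \<and> A \<cong>\<^sub>2 (block_matrix_algebra k l :: ('f, 'f mat) graded_algebra)) \<or>
    (\<exists>n>0. A \<cong>\<^sub>2 (group_matrix_algebra n :: ('f, 'f mat \<times> 'f mat) graded_algebra))"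
proof -
  interpret graded_simple_algebra A by fact
  obtain h and M :: "'v \<Rightarrow> 'f rfm" where
    Madd: "\<And>x y. x \<in> carrier A \<Longrightarrow> y \<in> carrier A \<Longrightarrow> M (x \<oplus>\<^bsub>A\<^esub> y) = M x + M y" and
    Mmult: "\<And>x y. x \<in> carrier A \<Longrightarrow> y \<in> carrier A \<Longrightarrow> M (x \<otimes>\<^bsub>A\<^esub> y) = M x * M y" and
    Mscale: "\<And>c x. x \<in> carrier A \<Longrightarrow> M (c \<odot>\<^bsub>A\<^esub> x) = rscal c * M x" and
    Minj: "inj_on M (carrier A)" and Mblocked: "\<And>x. x \<in> carrier A \<Longrightarrow> blocked h (M x)"
    by (rule matrix_representation[OF assms(2)]) blast
  have M0: "M \<zero>\<^bsub>A\<^esub> = 0" using Madd[of "\<zero>\<^bsub>A\<^esub>" "\<zero>\<^bsub>A\<^esub>"] by simp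
  have inj: "x = y" if "M x = M y" "x \<in> carrier A" "y \<in> carrier A" for x y
    using Minj that by (auto dest: inj_onD)
  note gc = grade_carrier
  define R where "R g = M ` grade A g" for g
  have bit: "g = 0 \<or> g = 1" for g :: bit by (cases g) auto
  have disj: "x = \<zero>\<^bsub>A\<^esub> \<and> y = \<zero>\<^bsub>A\<^esub>" if "x \<in> grade A 0" "y \<in> grade A 1" "M x + M y = 0" for x y
  proof -
    have "M y = M ((- 1) \<odot>\<^bsub>A\<^esub> x)"
      using that gc[OF that(1)] rvs.scale_minus_left[of 1 "M x"]
      by (simp add: Mscale rdiag_one eq_neg_iff_add_eq_0 add.commute)
    then have "y = (- 1) \<odot>\<^bsub>A\<^esub> x"
      using inj gc[OF that(2)] gc[OF grade_smult[OF that(1)]] by blast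
    then have "y \<in> grade A 0 \<inter> grade A 1" using that grade_smult by simp
    then have "y = \<zero>\<^bsub>A\<^esub>" using grade_disjoint by blast
    moreover from this have "M x = M \<zero>\<^bsub>A\<^esub>" using that(3) M0 by simp
    ultimately show ?thesis using inj gc[OF that(1)] by blast
  qed
  \<comment> \<open>Directness of the grading, seen through the representation. At the end it
    recovers the homogeneous components of an element of \<open>J\<close>.\<close>
  have uniq: "y = y' \<and> z = z'" if "y \<in> grade A 0" "y' \<in> grade A 0" "z \<in> grade A 1" "z' \<in> grade A 1"
    "M y + M z = M y' + M z'" for y y' z z'
  proof -
    let ?a = "y \<oplus>\<^bsub>A\<^esub> (- 1) \<odot>\<^bsub>A\<^esub> y'" and ?b = "z \<oplus>\<^bsub>A\<^esub> (- 1) \<odot>\<^bsub>A\<^esub> z'"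
    have ab: "?a \<in> grade A 0" "?b \<in> grade A 1" using that grade_add grade_smult by auto
    have Mab: "M ?a = M y - M y'" "M ?b = M z - M z'"
      using that gc gc[OF grade_smult] rvs.scale_minus_left[of 1]
      by (simp_all add: Madd Mscale rdiag_one)
    have "M ?a + M ?b = 0" using that(5) unfolding Mab by (simp add: algebra_simps)
    then have "M ?a = 0 \<and> M ?b = 0" using disj[OF ab] M0 by simp
    then have "M y = M y'" "M z = M z'" using Mab by auto
    then show ?thesis using inj gc that by blast
  qed
  interpret R: matrix_graded_simple R h
  proof
    fix g g' :: bit
    show "g + g = 0" by (cases g) auto
    show "g = 0 \<or> g = 1" by (rule bit)
    show "0 \<in> R g" unfolding R_def using grade_zero M0 by (metis image_eqI)
    show "x + y \<in> R g" if "x \<in> R g" "y \<in> R g" for x y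
    proof -
      from that obtain a b where ab: "a \<in> grade A g" "b \<in> grade A g" "x = M a" "y = M b"
        by (auto simp: R_def)
      have "x + y = M (a \<oplus>\<^bsub>A\<^esub> b)" using ab gc by (simp add: Madd)
      then show ?thesis unfolding R_def using ab grade_add by blast
    qed
    show "rscal c * x \<in> R g" if "x \<in> R g" for x c
    proof -
      from that obtain a where a: "a \<in> grade A g" "x = M a" by (auto simp: R_def)
      have "rscal c * x = M (c \<odot>\<^bsub>A\<^esub> a)" using a gc by (simp add: Mscale)
      then show ?thesis unfolding R_def using a grade_smult by blast
    qed
    show "x * y \<in> R (g + g')" if "x \<in> R g" "y \<in> R g'" for x y
    proof -
      from that obtain a b where ab: "a \<in> grade A g" "b \<in> grade A g'" "x = M a" "y = M b"
        by (auto simp: R_def)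
      from ab have "x * y = M (a \<otimes>\<^bsub>A\<^esub> b)" using gc by (simp add: Mmult)
      then show ?thesis unfolding R_def using ab grade_mult by blast
    qed
    show "R 0 \<inter> R 1 \<subseteq> {0}"
    proof
      fix x assume "x \<in> R 0 \<inter> R 1"
      then obtain a b where ab: "a \<in> grade A 0" "b \<in> grade A 1" "x = M a" "x = M b"
        by (auto simp: R_def)
      then have "a = b" using inj gc by metis
      then have "a = \<zero>\<^bsub>A\<^esub>" using ab grade_disjoint by blast
      then show "x \<in> {0}" using ab M0 by simp
    qed
    show "blocked h x" if "x \<in> R g" for x
      using that gc Mblocked by (auto simp: R_def)
    show "\<exists>g g'. \<exists>x\<in>R g. \<exists>y\<in>R g'. x * y \<noteq> 0"
    proof (rule ccontr)
      assume "\<not> ?thesis"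
      then have zero: "x * y = 0" if "x \<in> R g" "y \<in> R g'" for g g' x y using that by blast
      have MR: "\<exists>a\<in>R 0. \<exists>b\<in>R 1. M x = a + b" if "x \<in> carrier A" for x
        using grade_sum[OF that] gc Madd unfolding R_def by blast
      obtain x y where xy: "x \<in> carrier A" "y \<in> carrier A" "x \<otimes>\<^bsub>A\<^esub> y \<noteq> \<zero>\<^bsub>A\<^esub>"
        using mult_nonzero by blast
      obtain a b c d where *: "a \<in> R 0" "b \<in> R 1" "M x = a + b" "c \<in> R 0" "d \<in> R 1" "M y = c + d"
        using MR[OF xy(1)] MR[OF xy(2)] by blast
      have "a * c = 0" "a * d = 0" "b * c = 0" "b * d = 0" using * zero by blast+
      then have "M x * M y = 0" using * by (simp add: ring_distribs)
      then have "M (x \<otimes>\<^bsub>A\<^esub> y) = M \<zero>\<^bsub>A\<^esub>" using xy M0 by (simp add: Mmult)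
      then show False using xy inj[of "x \<otimes>\<^bsub>A\<^esub> y" "\<zero>\<^bsub>A\<^esub>"] mult_closed by blast
    qed
    fix I assume IR: "\<And>g. I g \<subseteq> R g" and Isub: "\<And>g. rvs.subspace (I g)"
      and Il: "\<And>g g' x y. x \<in> R g \<Longrightarrow> y \<in> I g' \<Longrightarrow> x * y \<in> I (g + g')"
      and Ir: "\<And>g g' x y. x \<in> R g \<Longrightarrow> y \<in> I g' \<Longrightarrow> y * x \<in> I (g + g')"
    \<comment> \<open>The graded ideal of \<open>A\<close> that corresponds to the family
      \<open>I\<close>; simplicity of \<open>A\<close> is applied to it.\<close>
    define J where "J = {y \<oplus>\<^bsub>A\<^esub> z |y z. y \<in> grade A 0 \<and> M y \<in> I 0 \<and> z \<in> grade A 1 \<and> M z \<in> I 1}"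
    have JI: "y \<oplus>\<^bsub>A\<^esub> z \<in> J" if "y \<in> grade A 0" "M y \<in> I 0" "z \<in> grade A 1" "M z \<in> I 1" for y z
      using that unfolding J_def by blast
    have I0: "M \<zero>\<^bsub>A\<^esub> \<in> I g" for g using rvs.subspace_0[OF Isub] by (simp add: M0)
    have Jhom: "y \<in> J" if "y \<in> grade A g" "M y \<in> I g" for y g
    proof (cases "g = 0")
      case True
      then show ?thesis using JI[of y "\<zero>\<^bsub>A\<^esub>"] that I0 grade_zero gc[OF that(1)] by simp
    next
      case False
      then have "g = 1" using bit by blast
      then show ?thesis using JI[of "\<zero>\<^bsub>A\<^esub>" y] that I0 grade_zero gc[OF that(1)] by simp
    qed
    have Jadd: "x \<oplus>\<^bsub>A\<^esub> y \<in> J" if xy: "x \<in> J" "y \<in> J" for x y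
    proof -
      obtain a b c d where *: "x = a \<oplus>\<^bsub>A\<^esub> b" "y = c \<oplus>\<^bsub>A\<^esub> d" "a \<in> grade A 0" "b \<in> grade A 1"
        "c \<in> grade A 0" "d \<in> grade A 1" "M a \<in> I 0" "M b \<in> I 1" "M c \<in> I 0" "M d \<in> I 1"
        using xy unfolding J_def by blast
      have car: "a \<in> carrier A" "b \<in> carrier A" "c \<in> carrier A" "d \<in> carrier A" using gc * by blast+
      have "x \<oplus>\<^bsub>A\<^esub> y = (a \<oplus>\<^bsub>A\<^esub> c) \<oplus>\<^bsub>A\<^esub> (b \<oplus>\<^bsub>A\<^esub> d)" using car by (simp add: * a_ac)
      moreover have "(a \<oplus>\<^bsub>A\<^esub> c) \<oplus>\<^bsub>A\<^esub> (b \<oplus>\<^bsub>A\<^esub> d) \<in> J"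
        using * car rvs.subspace_add[OF Isub] by (intro JI grade_add) (auto simp: Madd)
      ultimately show ?thesis by simp
    qed
    have Jcarrier: "J \<subseteq> carrier A" unfolding J_def using gc by blast
    have Jscale: "c \<odot>\<^bsub>A\<^esub> x \<in> J" if x: "x \<in> J" for c x
    proof -
      obtain a b where *: "x = a \<oplus>\<^bsub>A\<^esub> b" "a \<in> grade A 0" "b \<in> grade A 1" "M a \<in> I 0" "M b \<in> I 1"
        using x unfolding J_def by blast
      have car: "a \<in> carrier A" "b \<in> carrier A" using gc * by blast+
      have "c \<odot>\<^bsub>A\<^esub> x = c \<odot>\<^bsub>A\<^esub> a \<oplus>\<^bsub>A\<^esub> c \<odot>\<^bsub>A\<^esub> b" using car by (simp add: *(1) smult_r_distr)
      moreover have "c \<odot>\<^bsub>A\<^esub> a \<oplus>\<^bsub>A\<^esub> c \<odot>\<^bsub>A\<^esub> b \<in> J"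
        using * car rvs.subspace_scale[OF Isub] by (intro JI grade_smult) (auto simp: Mscale)
      ultimately show ?thesis by simp
    qed
    have hom_mult: "a \<otimes>\<^bsub>A\<^esub> b \<in> J \<and> b \<otimes>\<^bsub>A\<^esub> a \<in> J" if "a \<in> grade A g" "b \<in> grade A g'" "M b \<in> I g'" for a b g g'
    proof -
      have Ma: "M a \<in> R g" using that by (auto simp: R_def)
      have "M (a \<otimes>\<^bsub>A\<^esub> b) \<in> I (g + g')" "M (b \<otimes>\<^bsub>A\<^esub> a) \<in> I (g' + g)"
        using Il[OF Ma that(3)] Ir[OF Ma that(3)] Mmult[OF gc[OF that(1)] gc[OF that(2)]]
          Mmult[OF gc[OF that(2)] gc[OF that(1)]] by (simp_all only: add.commute[of g'])
      then show ?thesis using Jhom grade_mult that by blast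
    qed
    have Jmult: "x \<otimes>\<^bsub>A\<^esub> y \<in> J \<and> y \<otimes>\<^bsub>A\<^esub> x \<in> J" if x: "x \<in> carrier A" and y: "y \<in> J" for x y
    proof -
      obtain a b where *: "y = a \<oplus>\<^bsub>A\<^esub> b" "a \<in> grade A 0" "b \<in> grade A 1" "M a \<in> I 0" "M b \<in> I 1"
        using y unfolding J_def by blast
      obtain c d where **: "x = c \<oplus>\<^bsub>A\<^esub> d" "c \<in> grade A 0" "d \<in> grade A 1" using grade_sum[OF x] by blast
      have car: "a \<in> carrier A" "b \<in> carrier A" "c \<in> carrier A" "d \<in> carrier A" using gc * ** by blast+
      have "x \<otimes>\<^bsub>A\<^esub> y = (c \<otimes>\<^bsub>A\<^esub> a \<oplus>\<^bsub>A\<^esub> c \<otimes>\<^bsub>A\<^esub> b) \<oplus>\<^bsub>A\<^esub> (d \<otimes>\<^bsub>A\<^esub> a \<oplus>\<^bsub>A\<^esub> d \<otimes>\<^bsub>A\<^esub> b)"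
        "y \<otimes>\<^bsub>A\<^esub> x = (a \<otimes>\<^bsub>A\<^esub> c \<oplus>\<^bsub>A\<^esub> a \<otimes>\<^bsub>A\<^esub> d) \<oplus>\<^bsub>A\<^esub> (b \<otimes>\<^bsub>A\<^esub> c \<oplus>\<^bsub>A\<^esub> b \<otimes>\<^bsub>A\<^esub> d)"
        using car mult_closed by (simp_all add: *(1) **(1) distrib_left distrib_right a_ac)
      moreover have "c \<otimes>\<^bsub>A\<^esub> a \<in> J" "c \<otimes>\<^bsub>A\<^esub> b \<in> J" "d \<otimes>\<^bsub>A\<^esub> a \<in> J" "d \<otimes>\<^bsub>A\<^esub> b \<in> J"
        "a \<otimes>\<^bsub>A\<^esub> c \<in> J" "b \<otimes>\<^bsub>A\<^esub> c \<in> J" "a \<otimes>\<^bsub>A\<^esub> d \<in> J" "b \<otimes>\<^bsub>A\<^esub> d \<in> J"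
        using hom_mult * ** by blast+
      ultimately show ?thesis using Jadd by simp
    qed
    have "graded_ideal J A"
      unfolding graded_ideal_def
    proof (intro conjI ballI)
      show "VectorSpace.subspace class_ring J A"
      proof (rule subspace.intro)
        show "submodule class_ring J A"
          by unfold_locales (use Jcarrier Jadd Jscale Jhom[of "\<zero>\<^bsub>A\<^esub>" 0] grade_zero I0 in auto)
      qed unfold_locales
      show "\<exists>y\<in>J \<inter> grade A 0. \<exists>z\<in>J \<inter> grade A 1. x = y \<oplus>\<^bsub>A\<^esub> z" if "x \<in> J" for x
        using that Jhom unfolding J_def by blast
    qed (use Jmult in blast)+
    then have "J = {\<zero>\<^bsub>A\<^esub>} \<or> J = carrier A" by (rule simple)
    then show "(\<forall>g. I g = {0}) \<or> (\<forall>g. I g = R g)"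
    proof
      assume J: "J = {\<zero>\<^bsub>A\<^esub>}"
      have "w = 0" if w: "w \<in> I g" for w g
      proof -
        obtain y where "y \<in> grade A g" "w = M y" using w IR by (auto simp: R_def)
        then have "y \<in> J" using Jhom w by blast
        then show ?thesis using J \<open>w = M y\<close> M0 by simp
      qed
      then have "I g = {0}" for g using rvs.subspace_0[OF Isub] by blast
      then show ?thesis by blast
    next
      assume J: "J = carrier A"
      have "R g \<subseteq> I g" for g
      proof
        fix w assume "w \<in> R g"
        then obtain y where y: "y \<in> grade A g" "w = M y" by (auto simp: R_def)
        then have "y \<in> J" using J gc by blast
        then obtain a b where *: "y = a \<oplus>\<^bsub>A\<^esub> b" "a \<in> grade A 0" "b \<in> grade A 1" "M a \<in> I 0" "M b \<in> I 1"
          unfolding J_def by blast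
        have My: "M y = M a + M b" using * gc by (simp add: Madd)
        show "w \<in> I g"
        proof (cases "g = 0")
          case True
          have "a = y" using uniq[of a y b "\<zero>\<^bsub>A\<^esub>"] * y True My M0 grade_zero by auto
          then show ?thesis using * y True by simp
        next
          case False
          then have g: "g = 1" using bit by blast
          have "b = y" using uniq[of a "\<zero>\<^bsub>A\<^esub>" b y] * y g My M0 grade_zero by auto
          then show ?thesis using * y g by simp
        qed
      qed
      then show ?thesis using IR by blast
    qed
  qed
  have hom: "R.homsum (M x)" if "x \<in> carrier A" for x
    using grade_sum[OF that] gc Madd unfolding R.homsum_def R_def by blast
  have iso: "A \<cong>\<^sub>2 S" if \<phi>: "R.realises \<phi> S"
    and S: "carrier S = {X \<oplus>\<^bsub>S\<^esub> Y |X Y. X \<in> grade S 0 \<and> Y \<in> grade S 1}"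
    for \<phi> and S :: "('f, 'w) graded_algebra"
  proof -
    have add: "\<phi> (M x + M y) = \<phi> (M x) \<oplus>\<^bsub>S\<^esub> \<phi> (M y)" and mult: "\<phi> (M x * M y) = \<phi> (M x) \<otimes>\<^bsub>S\<^esub> \<phi> (M y)"
      and inj\<phi>: "\<phi> (M x) = \<phi> (M y) \<Longrightarrow> M x = M y" if "x \<in> carrier A" "y \<in> carrier A" for x y
      using \<phi> hom[OF that(1)] hom[OF that(2)] unfolding R.realises_def by blast+
    have scale: "\<phi> (rscal c * M x) = c \<odot>\<^bsub>S\<^esub> \<phi> (M x)" if "x \<in> carrier A" for c x
      using \<phi> hom[OF that] unfolding R.realises_def by blast
    have "\<phi> ` R g = grade S (if g = 0 then 0 else 1)" for g using \<phi> unfolding R.realises_def by blast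
    then have img: "(\<lambda>x. \<phi> (M x)) ` grade A g = grade S g" for g
      using bit[of g] by (auto simp: R_def image_image)
    have "(\<lambda>x. \<phi> (M x)) ` carrier A = carrier S"
    proof (intro equalityI subsetI)
      fix X assume "X \<in> (\<lambda>x. \<phi> (M x)) ` carrier A"
      then obtain x where x: "x \<in> carrier A" "X = \<phi> (M x)" by blast
      obtain y z where yz: "y \<in> grade A 0" "z \<in> grade A 1" "x = y \<oplus>\<^bsub>A\<^esub> z" using grade_sum[OF x(1)] by blast
      then have "X = \<phi> (M y) \<oplus>\<^bsub>S\<^esub> \<phi> (M z)" using x add gc Madd by simp
      then show "X \<in> carrier S" unfolding S using img yz(1,2) by blast
    next
      fix X assume "X \<in> carrier S"
      then obtain y z where yz: "y \<in> grade A 0" "z \<in> grade A 1" "X = \<phi> (M y) \<oplus>\<^bsub>S\<^esub> \<phi> (M z)"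
        unfolding S img[symmetric] by blast
      then have "X = \<phi> (M (y \<oplus>\<^bsub>A\<^esub> z))" using add gc Madd by simp
      moreover have "y \<oplus>\<^bsub>A\<^esub> z \<in> carrier A" using yz gc by blast
      ultimately show "X \<in> (\<lambda>x. \<phi> (M x)) ` carrier A" by blast
    qed
    moreover have "inj_on (\<lambda>x. \<phi> (M x)) (carrier A)" using inj\<phi> inj by (meson inj_onI)
    ultimately have "bij_betw (\<lambda>x. \<phi> (M x)) (carrier A) (carrier S)" by (simp add: bij_betw_def)
    then show ?thesis
      unfolding graded_isomorphic_def
      using add mult scale img Madd Mmult Mscale by (intro exI[of _ "\<lambda>x. \<phi> (M x)"]) simp
  qed
  show ?thesis
    using R.matrix_classification iso[OF _ standard_algebra_carrier(1)] iso[OF _ standard_algebra_carrier(2)] by blast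
qed

section \<open>Grassmann envelopes as algebras of supermatrices\<close>

lemma of_nat_bit: "(of_nat n :: bit) = (if even n then 0 else 1)"
  by (induction n) auto

section \<open>Closure of the envelope under its operations\<close>

context Z2_graded_algebra
begin

lemma envelope_iff:
  "x \<in> carrier (grassmann_envelope m A) \<longleftrightarrow> finite {S. x S \<noteq> \<zero>} \<and>
     (\<forall>S. x S \<in> grade A (of_nat (card S)) \<and> (x S \<noteq> \<zero> \<longrightarrow> S \<in> grassmann_index m))"
  using grade_zero unfolding grassmann_envelope_def by (simp add: subset_iff) metis

lemma envelope_simps:
  "x \<oplus>\<^bsub>grassmann_envelope m A\<^esub> y = (\<lambda>S. x S \<oplus> y S)"
  "c \<odot>\<^bsub>grassmann_envelope m A\<^esub> x = (\<lambda>S. c \<odot> x S)"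
  "\<zero>\<^bsub>grassmann_envelope m A\<^esub> = (\<lambda>S. \<zero>)"
  "x \<otimes>\<^bsub>grassmann_envelope m A\<^esub> y = (\<lambda>U. \<Oplus>S\<in>Pow U. shuffle_sign S (U - S) \<odot> (x S \<otimes> y (U - S)))"
  by (simp_all add: grassmann_envelope_def)

lemma envelope_carrier: "x \<in> carrier (grassmann_envelope m A) \<Longrightarrow> x S \<in> carrier A"
  using grade_carrier envelope_iff by blast

lemma envelope_infinite: "x \<in> carrier (grassmann_envelope m A) \<Longrightarrow> infinite S \<Longrightarrow> x S = \<zero>"
  unfolding envelope_iff grassmann_index_def by blast

lemma envelope_add:
  assumes x: "x \<in> carrier (grassmann_envelope m A)" and y: "y \<in> carrier (grassmann_envelope m A)"
  shows "x \<oplus>\<^bsub>grassmann_envelope m A\<^esub> y \<in> carrier (grassmann_envelope m A)"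
proof -
  have "{S. x S \<oplus> y S \<noteq> \<zero>} \<subseteq> {S. x S \<noteq> \<zero>} \<union> {S. y S \<noteq> \<zero>}" by auto
  then have "finite {S. x S \<oplus> y S \<noteq> \<zero>}"
    by (rule finite_subset) (use x y in \<open>auto simp: envelope_iff\<close>)
  moreover have "S \<in> grassmann_index m" if "x S \<oplus> y S \<noteq> \<zero>" for S
  proof -
    have "x S \<noteq> \<zero> \<or> y S \<noteq> \<zero>" using that by auto
    then show ?thesis using x y unfolding envelope_iff by blast
  qed
  moreover have "x S \<oplus> y S \<in> grade A (of_nat (card S))" for S
    using x y grade_add unfolding envelope_iff by blast
  ultimately show ?thesis unfolding envelope_simps envelope_iff by blast
qed

lemma envelope_smult:
  assumes x: "x \<in> carrier (grassmann_envelope m A)"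
  shows "c \<odot>\<^bsub>grassmann_envelope m A\<^esub> x \<in> carrier (grassmann_envelope m A)"
proof -
  have *: "x S \<noteq> \<zero>" if "c \<odot> x S \<noteq> \<zero>" for S using that by auto
  then have "{S. c \<odot> x S \<noteq> \<zero>} \<subseteq> {S. x S \<noteq> \<zero>}" by blast
  then have "finite {S. c \<odot> x S \<noteq> \<zero>}"
    by (rule finite_subset) (use x in \<open>auto simp: envelope_iff\<close>)
  moreover have "c \<odot> x S \<in> grade A (of_nat (card S))" for S
    using x grade_smult unfolding envelope_iff by blast
  ultimately show ?thesis using x * unfolding envelope_simps envelope_iff by blast
qed

lemma envelope_zero: "\<zero>\<^bsub>grassmann_envelope m A\<^esub> \<in> carrier (grassmann_envelope m A)"
  unfolding envelope_simps envelope_iff using grade_zero by simp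

lemma grade_finsum: "(\<And>i. i \<in> I \<Longrightarrow> f i \<in> grade A g) \<Longrightarrow> finsum A f I \<in> grade A g"
proof (induction I rule: infinite_finite_induct)
  case (insert i I)
  then have "finsum A f (insert i I) = f i \<oplus> finsum A f I"
    using grade_carrier by (intro finsum_insert) auto
  then show ?case using insert grade_add by simp
qed (simp_all add: grade_zero finsum_infinite)

lemma envelope_mult:
  assumes x: "x \<in> carrier (grassmann_envelope m A)" and y: "y \<in> carrier (grassmann_envelope m A)"
  shows "x \<otimes>\<^bsub>grassmann_envelope m A\<^esub> y \<in> carrier (grassmann_envelope m A)"
proof -
  define z where "z U = (\<Oplus>S\<in>Pow U. shuffle_sign S (U - S) \<odot> (x S \<otimes> y (U - S)))" for U
  have gr: "x S \<in> grade A (of_nat (card S))" "y S \<in> grade A (of_nat (card S))" for S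
    using x y by (auto simp: envelope_iff)
  have mult0: "a \<otimes> \<zero> = \<zero>" "\<zero> \<otimes> a = \<zero>" if "a \<in> carrier A" for a
  proof -
    have "a \<otimes> (0 \<odot> \<zero>) = 0 \<odot> (a \<otimes> \<zero>)" "(0 \<odot> \<zero>) \<otimes> a = 0 \<odot> (\<zero> \<otimes> a)"
      using that by (simp_all only: smult_mult_right smult_mult_left zero_closed)
    moreover have "a \<otimes> \<zero> \<in> carrier A" "\<zero> \<otimes> a \<in> carrier A" using that mult_closed by simp_all
    ultimately show "a \<otimes> \<zero> = \<zero>" "\<zero> \<otimes> a = \<zero>" using lmult_0 by simp_all
  qed
  have "z U \<in> grade A (of_nat (card U))" for U
  proof (cases "finite U")
    case True
    have "x S \<otimes> y (U - S) \<in> grade A (of_nat (card U))" if "S \<in> Pow U" for S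
    proof -
      have "card U = card S + card (U - S)"
        using that True by (metis PowD card_Diff_subset card_mono finite_subset le_add_diff_inverse)
      then show ?thesis using grade_mult[OF gr(1)[of S] gr(2)[of "U - S"]] by (simp only: of_nat_add)
    qed
    then show ?thesis unfolding z_def by (intro grade_finsum grade_smult)
  next
    case False
    then have "infinite (Pow U)" by simp
    then show ?thesis unfolding z_def using grade_zero by (simp add: finsum_infinite)
  qed
  moreover have supp: "\<exists>S T. x S \<noteq> \<zero> \<and> y T \<noteq> \<zero> \<and> U = S \<union> T" if "z U \<noteq> \<zero>" for U
  proof (rule ccontr)
    assume neg: "\<not> ?thesis"
    have "shuffle_sign S (U - S) \<odot> (x S \<otimes> y (U - S)) = \<zero>" if "S \<in> Pow U" for S
    proof -
      have "x S = \<zero> \<or> y (U - S) = \<zero>" using neg that by (metis PowD Un_Diff_cancel sup.absorb2)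
      then have "x S \<otimes> y (U - S) = \<zero>"
        using mult0 envelope_carrier[OF x] envelope_carrier[OF y] by metis
      then show ?thesis by simp
    qed
    then have "z U = (\<Oplus>S\<in>Pow U. \<zero>)" unfolding z_def by (intro finsum_cong') auto
    then show False using \<open>z U \<noteq> \<zero>\<close> by simp
  qed
  moreover have "finite {U. z U \<noteq> \<zero>}"
  proof (rule finite_subset)
    show "{U. z U \<noteq> \<zero>} \<subseteq> (\<lambda>(S, T). S \<union> T) ` ({S. x S \<noteq> \<zero>} \<times> {S. y S \<noteq> \<zero>})" using supp by auto
    show "finite ((\<lambda>(S, T). S \<union> T) ` ({S. x S \<noteq> \<zero>} \<times> {S. y S \<noteq> \<zero>}))"
      using x y by (auto simp: envelope_iff)
  qed
  moreover have "U \<in> grassmann_index m" if U: "z U \<noteq> \<zero>" for U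
  proof -
    obtain S T where *: "x S \<noteq> \<zero>" "y T \<noteq> \<zero>" "U = S \<union> T" using supp[OF U] by blast
    then have "S \<in> grassmann_index m" "T \<in> grassmann_index m" using x y by (auto simp: envelope_iff)
    then show ?thesis using *(3) by (auto simp: grassmann_index_def)
  qed
  ultimately show ?thesis unfolding envelope_simps envelope_iff z_def[symmetric] by blast
qed

lemma envelope_abelian_monoid: "abelian_monoid (grassmann_envelope m A)"
proof (rule abelian_monoidI)
  fix x y z assume "x \<in> carrier (grassmann_envelope m A)" "y \<in> carrier (grassmann_envelope m A)" "z \<in> carrier (grassmann_envelope m A)"
  then have "x S \<in> carrier A" "y S \<in> carrier A" "z S \<in> carrier A" for S using envelope_carrier by auto
  then show "x \<oplus>\<^bsub>grassmann_envelope m A\<^esub> y \<oplus>\<^bsub>grassmann_envelope m A\<^esub> z =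
      x \<oplus>\<^bsub>grassmann_envelope m A\<^esub> (y \<oplus>\<^bsub>grassmann_envelope m A\<^esub> z)"
    by (simp add: envelope_simps a_assoc)
next
  fix x y assume "x \<in> carrier (grassmann_envelope m A)" "y \<in> carrier (grassmann_envelope m A)"
  then have *: "x S \<in> carrier A" "y S \<in> carrier A" for S using envelope_carrier by auto
  then show "x \<oplus>\<^bsub>grassmann_envelope m A\<^esub> y = y \<oplus>\<^bsub>grassmann_envelope m A\<^esub> x"
    by (simp add: envelope_simps a_comm)
next
  fix x assume "x \<in> carrier (grassmann_envelope m A)"
  then have "x S \<in> carrier A" for S using envelope_carrier by auto
  then show "\<zero>\<^bsub>grassmann_envelope m A\<^esub> \<oplus>\<^bsub>grassmann_envelope m A\<^esub> x = x"
    by (simp add: envelope_simps)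
qed (rule envelope_zero envelope_add; assumption)+

end

text \<open>The map \<theta> is multiplicative on all of \<open>A\<close>, but injective only on
  each homogeneous part, and \<open>P i\<close> are the positions filled by degree \<open>i\<close>.
  This is enough because the coefficients of an element of the envelope are homogeneous, with a
  degree fixed by the monomial.\<close>

locale position_model = Z2_graded_algebra A
  for A :: "('f :: field, 'v, 'z) graded_algebra_scheme" (structure) +
  fixes \<theta> :: "'v \<Rightarrow> nat \<Rightarrow> nat \<Rightarrow> 'f" and h :: nat and P :: "bit \<Rightarrow> (nat \<times> nat) set"
  assumes \<theta>_add: "x \<in> carrier A \<Longrightarrow> y \<in> carrier A \<Longrightarrow> \<theta> (x \<oplus> y) a b = \<theta> x a b + \<theta> y a b"
    and \<theta>_smult: "x \<in> carrier A \<Longrightarrow> \<theta> (c \<odot> x) a b = c * \<theta> x a b"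
    and \<theta>_mult: "x \<in> carrier A \<Longrightarrow> y \<in> carrier A \<Longrightarrow> \<theta> (x \<otimes> y) a b = (\<Sum>k<h. \<theta> x a k * \<theta> y k b)"
    and \<theta>_inj: "x \<in> grade A i \<Longrightarrow> \<theta> x = (\<lambda>a b. 0) \<Longrightarrow> x = \<zero>"
    and \<theta>_support: "x \<in> grade A i \<Longrightarrow> \<theta> x a b \<noteq> 0 \<Longrightarrow> (a, b) \<in> P i"
    and \<theta>_surj: "(\<And>a b. N a b \<noteq> 0 \<Longrightarrow> (a, b) \<in> P i) \<Longrightarrow> \<exists>x\<in>grade A i. \<theta> x = N"
    and P_bound: "P i \<subseteq> {..<h} \<times> {..<h}"
begin

lemma \<theta>_zero: "\<theta> \<zero> a b = 0"
  using \<theta>_smult[OF zero_closed, of 0] by simp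

lemma \<theta>_finsum:
  "finite I \<Longrightarrow> (\<And>i. i \<in> I \<Longrightarrow> f i \<in> carrier A) \<Longrightarrow> \<theta> (finsum A f I) a b = (\<Sum>i\<in>I. \<theta> (f i) a b)"
proof (induction I rule: finite_induct)
  case (insert i I)
  then have "finsum A f (insert i I) = f i \<oplus> finsum A f I" by (intro finsum_insert) auto
  moreover have "finsum A f I \<in> carrier A" using insert by (intro finsum_closed) auto
  ultimately show ?case using insert by (simp add: \<theta>_add)
qed (simp add: \<theta>_zero)

text \<open>A relation rather than a map, since identities are transferred both ways;
  \<open>model_exists\<close> and \<open>modelled_exists\<close> supply partners on either
  side.\<close>

definition models :: "(nat set \<Rightarrow> 'v) \<Rightarrow> 'f gr rfm \<Rightarrow> bool" where
  "models x X \<longleftrightarrow> (\<forall>i j S. coef (ent X i j) S = \<theta> (x S) i j)"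

lemma models_unique: "models x X \<Longrightarrow> models x Y \<Longrightarrow> X = Y"
  by (rule rfm_coef_eqI) (simp add: models_def)

lemma models_zero: "models \<zero>\<^bsub>grassmann_envelope m A\<^esub> 0"
  by (simp add: models_def envelope_simps \<theta>_zero)

lemma models_0_imp_zero:
  assumes "models x 0" "x \<in> carrier (grassmann_envelope m A)"
  shows "x = \<zero>\<^bsub>grassmann_envelope m A\<^esub>"
  unfolding envelope_simps
proof
  fix S
  have "x S \<in> grade A (of_nat (card S))" using assms(2) by (auto simp: envelope_iff)
  moreover have "\<theta> (x S) = (\<lambda>a b. 0)" using assms(1) by (intro ext) (simp add: models_def)
  ultimately show "x S = \<zero>" by (rule \<theta>_inj)
qed

lemma models_add:
  assumes "x \<in> carrier (grassmann_envelope m A)" "y \<in> carrier (grassmann_envelope m A)" "models x X" "models y Y"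
  shows "models (x \<oplus>\<^bsub>grassmann_envelope m A\<^esub> y) (X + Y)"
  using assms(3,4) envelope_carrier[OF assms(1)] envelope_carrier[OF assms(2)]
  by (simp add: models_def envelope_simps \<theta>_add)

lemma models_smult:
  assumes "x \<in> carrier (grassmann_envelope m A)" "models x X"
  shows "models (c \<odot>\<^bsub>grassmann_envelope m A\<^esub> x) (rsc c * X)"
  using assms(2) envelope_carrier[OF assms(1)] by (simp add: models_def envelope_simps \<theta>_smult)

text \<open>Both products carry the same shuffle signs; only the sum over the middle matrix index
  has to be exchanged with the sum over subsets.\<close>

lemma models_mult:
  assumes x: "x \<in> carrier (grassmann_envelope m A)" and y: "y \<in> carrier (grassmann_envelope m A)"
    and X: "models x X" and Y: "models y Y"
  shows "models (x \<otimes>\<^bsub>grassmann_envelope m A\<^esub> y) (X * Y)"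
  unfolding models_def
proof (intro allI)
  fix i j U
  note car = envelope_carrier[OF x] envelope_carrier[OF y]
  show "coef (ent (X * Y) i j) U = \<theta> ((x \<otimes>\<^bsub>grassmann_envelope m A\<^esub> y) U) i j"
  proof (cases "finite U")
    case False
    then have "infinite (Pow U)" by simp
    then show ?thesis using False by (simp add: coef_infinite envelope_simps finsum_infinite \<theta>_zero)
  next
    case True
    have "ent X i k = 0" if "\<not> k < h" for k
    proof (rule gr_eqI)
      fix S
      have "x S \<in> grade A (of_nat (card S))" using x by (auto simp: envelope_iff)
      then have "\<theta> (x S) i k = 0" using \<theta>_support P_bound that by blast
      then show "coef (ent X i k) S = coef 0 S" using X by (simp add: models_def)
    qed
    then have "ent (X * Y) i j = (\<Sum>k<h. ent X i k * ent Y k j)"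
      by (intro ent_mult) (auto simp: not_less[symmetric])
    then have "coef (ent (X * Y) i j) U =
        (\<Sum>k<h. \<Sum>S\<in>Pow U. shuffle_sign S (U - S) * \<theta> (x S) i k * \<theta> (y (U - S)) k j)"
      using X Y by (simp add: coef_sum times_gr.rep_eq models_def)
    also have "\<dots> = (\<Sum>S\<in>Pow U. \<Sum>k<h. shuffle_sign S (U - S) * \<theta> (x S) i k * \<theta> (y (U - S)) k j)"
      by (rule sum.swap)
    also have "\<dots> = (\<Sum>S\<in>Pow U. \<theta> (shuffle_sign S (U - S) \<odot> (x S \<otimes> y (U - S))) i j)"
      using car mult_closed by (intro sum.cong refl) (simp add: \<theta>_smult \<theta>_mult sum_distrib_left mult.assoc)
    also have "\<dots> = \<theta> ((x \<otimes>\<^bsub>grassmann_envelope m A\<^esub> y) U) i j"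
      unfolding envelope_simps using True car mult_closed by (intro \<theta>_finsum[symmetric]) auto
    finally show ?thesis .
  qed
qed

lemma model_exists:
  assumes x: "x \<in> carrier (grassmann_envelope m A)"
  shows "\<exists>X\<in>supermats m (P 0) (P 1). models x X"
proof -
  have gr: "x S \<in> grade A (of_nat (card S))" for S using x by (auto simp: envelope_iff)
  define g where "g i j = Abs_gr (\<lambda>S. \<theta> (x S) i j)" for i j
  have g: "coef (g i j) S = \<theta> (x S) i j" for i j S
    unfolding g_def using envelope_infinite[OF x] by (subst Abs_gr_inverse) (auto simp: \<theta>_zero)
  define X where "X = (\<Sum>i<h. \<Sum>j<h. runit (g i j) i j)"
  have "ent X a b = (\<Sum>i<h. if i = a then (\<Sum>j<h. if j = b then g a b else 0) else 0)" for a b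
    unfolding X_def ent_sum by (intro sum.cong refl) (auto simp: ent_runit intro!: sum.neutral sum.cong)
  then have ent: "ent X a b = (if a < h \<and> b < h then g a b else 0)" for a b by simp
  have supp: "(i, j) \<in> P (of_nat (card S))" if "\<theta> (x S) i j \<noteq> 0" for i j S
    using \<theta>_support gr that by blast
  have X: "coef (ent X i j) S = \<theta> (x S) i j" for i j S
    using supp[of S i j] P_bound by (auto simp: ent g)
  have "X \<in> supermats m (P 0) (P 1)"
  proof (rule supermatsI)
    show "finite ({..<h} \<times> {..<h} \<times> {S. x S \<noteq> \<zero>})" using x by (simp add: envelope_iff)
    fix i j S assume "coef (ent X i j) S \<noteq> 0"
    then have nz: "\<theta> (x S) i j \<noteq> 0" by (simp add: X)
    then have x0: "x S \<noteq> \<zero>" using \<theta>_zero by auto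
    show "(i, j, S) \<in> {..<h} \<times> {..<h} \<times> {S. x S \<noteq> \<zero>}"
      using supp[OF nz] P_bound x0 by auto
    show "S \<in> grassmann_index m \<and> (i, j) \<in> (if even (card S) then P 0 else P 1)"
      using supp[OF nz] x x0 by (auto simp: envelope_iff of_nat_bit)
  qed
  then show ?thesis using X by (auto simp: models_def)
qed

lemma modelled_exists:
  assumes X: "X \<in> supermats m (P 0) (P 1)"
  shows "\<exists>x\<in>carrier (grassmann_envelope m A). models x X"
proof -
  have "\<exists>y\<in>grade A (of_nat (card S)). \<theta> y = (\<lambda>i j. coef (ent X i j) S)" for S
  proof (rule \<theta>_surj)
    fix a b assume nz: "coef (ent X a b) S \<noteq> 0"
    have "\<forall>i j S. coef (ent X i j) S \<noteq> 0 \<longrightarrow> S \<in> grassmann_index m \<and> (i, j) \<in> (if even (card S) then P 0 else P 1)"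
      using X by (simp add: supermats_def)
    then have "(a, b) \<in> (if even (card S) then P 0 else P 1)" using nz by blast
    then show "(a, b) \<in> P (of_nat (card S))" by (simp add: of_nat_bit split: if_splits)
  qed
  then have "\<exists>x. \<forall>S. x S \<in> grade A (of_nat (card S)) \<and> \<theta> (x S) = (\<lambda>i j. coef (ent X i j) S)"
    by (intro choice) blast
  then obtain x where x: "\<And>S. x S \<in> grade A (of_nat (card S))" "\<And>S. \<theta> (x S) = (\<lambda>i j. coef (ent X i j) S)"
    by blast
  have nz: "\<exists>i j. coef (ent X i j) S \<noteq> 0" if "x S \<noteq> \<zero>" for S
  proof (rule ccontr)
    assume "\<not> ?thesis"
    then have "\<theta> (x S) = (\<lambda>i j. 0)" by (auto simp: x(2))
    then show False using \<theta>_inj[OF x(1)] that by blast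
  qed
  have "finite ((\<lambda>(i, j, S). S) ` {(i, j, S). coef (ent X i j) S \<noteq> 0})"
    using X by (simp add: supermats_def)
  moreover have "{S. x S \<noteq> \<zero>} \<subseteq> (\<lambda>(i, j, S). S) ` {(i, j, S). coef (ent X i j) S \<noteq> 0}"
    using nz by force
  ultimately have "finite {S. x S \<noteq> \<zero>}" using finite_subset by blast
  moreover have "S \<in> grassmann_index m" if "x S \<noteq> \<zero>" for S
    using nz[OF that] X by (auto simp: supermats_def)
  ultimately have "x \<in> carrier (grassmann_envelope m A)" using x(1) by (simp add: envelope_iff)
  moreover have "models x X" unfolding models_def x(2) by simp
  ultimately show ?thesis by blast
qed

lemma models_word_value:
  assumes "\<And>v. \<rho> v \<in> carrier (grassmann_envelope m A)" "\<And>v. models (\<rho> v) (\<rho>' v)" "w \<noteq> []"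
  shows "word_value (grassmann_envelope m A) \<rho> w \<in> carrier (grassmann_envelope m A) \<and>
    models (word_value (grassmann_envelope m A) \<rho> w) (prod_list (map \<rho>' w))"
  using assms(3)
proof (induction w rule: induct_list012)
  case (3 i j w)
  then have IH: "word_value (grassmann_envelope m A) \<rho> (j # w) \<in> carrier (grassmann_envelope m A)"
    "models (word_value (grassmann_envelope m A) \<rho> (j # w)) (prod_list (map \<rho>' (j # w)))" by auto
  show ?case
    using envelope_mult[OF assms(1) IH(1)] models_mult[OF assms(1) IH(1) assms(2) IH(2)] by simp
qed (use assms in auto)

lemma models_poly_value:
  assumes \<rho>: "\<And>v. \<rho> v \<in> carrier (grassmann_envelope m A)" "\<And>v. models (\<rho> v) (\<rho>' v)"
    and f: "Poly_Mapping.lookup f [] = 0"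
  shows "poly_value (grassmann_envelope m A) \<rho> f \<in> carrier (grassmann_envelope m A) \<and>
    models (poly_value (grassmann_envelope m A) \<rho> f) (meval f \<rho>')"
proof -
  interpret E: abelian_monoid "grassmann_envelope m A" by (rule envelope_abelian_monoid)
  have "finsum (grassmann_envelope m A) (\<lambda>w. Poly_Mapping.lookup f w \<odot>\<^bsub>grassmann_envelope m A\<^esub> word_value (grassmann_envelope m A) \<rho> w) W
      \<in> carrier (grassmann_envelope m A) \<and>
    models (finsum (grassmann_envelope m A) (\<lambda>w. Poly_Mapping.lookup f w \<odot>\<^bsub>grassmann_envelope m A\<^esub> word_value (grassmann_envelope m A) \<rho> w) W)
      (\<Sum>w\<in>W. rsc (Poly_Mapping.lookup f w) * prod_list (map \<rho>' w))"
    if "finite W" "[] \<notin> W" for W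
    using that
  proof (induction W rule: finite_induct)
    case empty
    then show ?case using models_zero envelope_zero by simp
  next
    case (insert w W)
    let ?t = "\<lambda>w. Poly_Mapping.lookup f w \<odot>\<^bsub>grassmann_envelope m A\<^esub> word_value (grassmann_envelope m A) \<rho> w"
    have t: "?t v \<in> carrier (grassmann_envelope m A) \<and> models (?t v) (rsc (Poly_Mapping.lookup f v) * prod_list (map \<rho>' v))"
      if "v \<noteq> []" for v
      using models_word_value[of \<rho> m \<rho>' v] \<rho> that envelope_smult models_smult by blast
    have IH: "finsum (grassmann_envelope m A) ?t W \<in> carrier (grassmann_envelope m A)"
      "models (finsum (grassmann_envelope m A) ?t W) (\<Sum>w\<in>W. rsc (Poly_Mapping.lookup f w) * prod_list (map \<rho>' w))"
      using insert by auto
    have "v \<noteq> []" if "v \<in> insert w W" for v using insert.prems that by blast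
    then have "finsum (grassmann_envelope m A) ?t (insert w W) = ?t w \<oplus>\<^bsub>grassmann_envelope m A\<^esub> finsum (grassmann_envelope m A) ?t W"
      using insert.hyps t by (intro E.finsum_insert) auto
    moreover have "w \<noteq> []" using insert.prems by blast
    ultimately show ?case
      using envelope_add IH t[of w] models_add[of "?t w" m "finsum (grassmann_envelope m A) ?t W"] insert.hyps by simp
  qed
  moreover have "[] \<notin> Poly_Mapping.keys f" using f by (simp add: in_keys_iff)
  ultimately show ?thesis unfolding poly_value_def meval_def by simp
qed

text \<open>Every substitution on one side has a partner on the other. The values of
  \<open>f\<close> are then partners too, and zero is related to zero only.\<close>

theorem identities_grassmann_envelope:
  "identities (grassmann_envelope m A) = mat_identities (supermats m (P 0) (P 1))"
proof (intro equalityI subsetI)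
  fix f assume f: "f \<in> identities (grassmann_envelope m A)"
  then have f0: "Poly_Mapping.lookup f [] = 0" by (simp add: identities_def)
  have "meval f \<rho>' = 0" if \<rho>': "range \<rho>' \<subseteq> supermats m (P 0) (P 1)" for \<rho>'
  proof -
    have "\<forall>v. \<exists>x. x \<in> carrier (grassmann_envelope m A) \<and> models x (\<rho>' v)"
      using modelled_exists \<rho>' by blast
    then have "\<exists>\<rho>. \<forall>v. \<rho> v \<in> carrier (grassmann_envelope m A) \<and> models (\<rho> v) (\<rho>' v)" by (rule choice)
    then obtain \<rho> where \<rho>: "\<And>v. \<rho> v \<in> carrier (grassmann_envelope m A)" "\<And>v. models (\<rho> v) (\<rho>' v)" by blast
    have "poly_value (grassmann_envelope m A) \<rho> f = \<zero>\<^bsub>grassmann_envelope m A\<^esub>"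
      using f \<rho>(1) unfolding identities_def by blast
    then have "models \<zero>\<^bsub>grassmann_envelope m A\<^esub> (meval f \<rho>')" using models_poly_value[of \<rho> m \<rho>', OF \<rho> f0] by simp
    then show ?thesis using models_zero by (rule models_unique)
  qed
  then show "f \<in> mat_identities (supermats m (P 0) (P 1))" using f0 by (simp add: mat_identities_def)
next
  fix f :: "nat list \<Rightarrow>\<^sub>0 'f" assume f: "f \<in> mat_identities (supermats m (P 0) (P 1))"
  then have f0: "Poly_Mapping.lookup f [] = 0" by (simp add: mat_identities_def)
  have "poly_value (grassmann_envelope m A) \<rho> f = \<zero>\<^bsub>grassmann_envelope m A\<^esub>"
    if "range \<rho> \<subseteq> carrier (grassmann_envelope m A)" for \<rho>
  proof -
    have \<rho>1: "\<rho> v \<in> carrier (grassmann_envelope m A)" for v using that by blast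
    then have "\<forall>v. \<exists>X. X \<in> supermats m (P 0) (P 1) \<and> models (\<rho> v) X" using model_exists by blast
    then have "\<exists>\<rho>'. \<forall>v. \<rho>' v \<in> supermats m (P 0) (P 1) \<and> models (\<rho> v) (\<rho>' v)" by (rule choice)
    then obtain \<rho>' where \<rho>': "\<And>v. \<rho>' v \<in> supermats m (P 0) (P 1)" "\<And>v. models (\<rho> v) (\<rho>' v)" by blast
    have "meval f \<rho>' = 0" using f \<rho>'(1) unfolding mat_identities_def by blast
    then have "models (poly_value (grassmann_envelope m A) \<rho> f) 0"
      "poly_value (grassmann_envelope m A) \<rho> f \<in> carrier (grassmann_envelope m A)"
      using models_poly_value[of \<rho> m \<rho>', OF \<rho>1 \<rho>'(2) f0] by simp_all
    then show ?thesis by (rule models_0_imp_zero)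
  qed
  then show "f \<in> identities (grassmann_envelope m A)" using f0 by (simp add: identities_def)
qed

end

section \<open>Graded isomorphisms\<close>

definition graded_iso :: "('v \<Rightarrow> 'w) \<Rightarrow> ('f, 'v, 'y) graded_algebra_scheme \<Rightarrow> ('f, 'w, 'z) graded_algebra_scheme \<Rightarrow> bool" where
  "graded_iso \<phi> A B \<longleftrightarrow> bij_betw \<phi> (carrier A) (carrier B) \<and>
     (\<forall>x\<in>carrier A. \<forall>y\<in>carrier A. \<phi> (x \<oplus>\<^bsub>A\<^esub> y) = \<phi> x \<oplus>\<^bsub>B\<^esub> \<phi> y) \<and>
     (\<forall>x\<in>carrier A. \<forall>y\<in>carrier A. \<phi> (x \<otimes>\<^bsub>A\<^esub> y) = \<phi> x \<otimes>\<^bsub>B\<^esub> \<phi> y) \<and>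
     (\<forall>c. \<forall>x\<in>carrier A. \<phi> (c \<odot>\<^bsub>A\<^esub> x) = c \<odot>\<^bsub>B\<^esub> \<phi> x) \<and>
     (\<forall>i. \<phi> ` grade A i = grade B i)"

lemma graded_isomorphic_iff: "A \<cong>\<^sub>2 B \<longleftrightarrow> (\<exists>\<phi>. graded_iso \<phi> A B)"
  unfolding graded_isomorphic_def graded_iso_def ..

lemma graded_isoD:
  assumes "graded_iso \<phi> A B"
  shows "bij_betw \<phi> (carrier A) (carrier B)"
    "x \<in> carrier A \<Longrightarrow> y \<in> carrier A \<Longrightarrow> \<phi> (x \<oplus>\<^bsub>A\<^esub> y) = \<phi> x \<oplus>\<^bsub>B\<^esub> \<phi> y"
    "x \<in> carrier A \<Longrightarrow> y \<in> carrier A \<Longrightarrow> \<phi> (x \<otimes>\<^bsub>A\<^esub> y) = \<phi> x \<otimes>\<^bsub>B\<^esub> \<phi> y"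
    "x \<in> carrier A \<Longrightarrow> \<phi> (c \<odot>\<^bsub>A\<^esub> x) = c \<odot>\<^bsub>B\<^esub> \<phi> x" "\<phi> ` grade A i = grade B i"
  using assms unfolding graded_iso_def by simp_all

lemma graded_isomorphic_trans:
  assumes "A \<cong>\<^sub>2 B" "B \<cong>\<^sub>2 C" shows "A \<cong>\<^sub>2 C"
proof -
  obtain \<phi> \<psi> where "graded_iso \<phi> A B" "graded_iso \<psi> B C"
    using assms unfolding graded_isomorphic_iff by blast
  note \<phi> = graded_isoD[OF this(1)] and \<psi> = graded_isoD[OF this(2)]
  have "\<phi> x \<in> carrier B" if "x \<in> carrier A" for x using \<phi>(1) that by (rule bij_betw_apply)
  moreover have "(\<lambda>x. \<psi> (\<phi> x)) ` grade A i = grade C i" for i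
    unfolding image_image[symmetric] \<phi>(5) \<psi>(5) ..
  ultimately show ?thesis
    unfolding graded_isomorphic_iff graded_iso_def
    by (intro exI[of _ "\<psi> \<circ> \<phi>"] conjI bij_betw_trans[OF \<phi>(1) \<psi>(1)])
      (simp_all add: \<phi>(2-4) \<psi>(2-4))
qed

lemma (in Z2_graded_algebra) graded_isomorphic_sym:
  assumes "A \<cong>\<^sub>2 B" shows "B \<cong>\<^sub>2 A"
proof -
  obtain \<phi> where "graded_iso \<phi> A B"
    using assms unfolding graded_isomorphic_iff by blast
  note \<phi> = graded_isoD[OF this]
  define \<psi> where "\<psi> = inv_into (carrier A) \<phi>"
  have \<psi>\<phi>: "\<psi> (\<phi> x) = x" if "x \<in> carrier A" for x
    using \<phi>(1) that by (simp add: \<psi>_def bij_betw_inv_into_left)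
  have B: "\<exists>x\<in>carrier A. y = \<phi> x" if "y \<in> carrier B" for y
    using \<phi>(1) that by (auto simp: bij_betw_def)
  show ?thesis
    unfolding graded_isomorphic_iff graded_iso_def
  proof (intro exI[of _ \<psi>] conjI ballI allI)
    show "bij_betw \<psi> (carrier B) (carrier A)" unfolding \<psi>_def by (rule bij_betw_inv_into[OF \<phi>(1)])
    fix x y assume "x \<in> carrier B" "y \<in> carrier B"
    then obtain a b where ab: "a \<in> carrier A" "b \<in> carrier A" "x = \<phi> a" "y = \<phi> b" using B by blast
    have "x \<oplus>\<^bsub>B\<^esub> y = \<phi> (a \<oplus> b)" "x \<otimes>\<^bsub>B\<^esub> y = \<phi> (a \<otimes> b)" using ab \<phi>(2,3) by simp_all
    then show "\<psi> (x \<oplus>\<^bsub>B\<^esub> y) = \<psi> x \<oplus> \<psi> y" "\<psi> (x \<otimes>\<^bsub>B\<^esub> y) = \<psi> x \<otimes> \<psi> y"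
      using ab mult_closed by (simp_all add: \<psi>\<phi>)
  next
    fix c x assume "x \<in> carrier B"
    then obtain a where a: "a \<in> carrier A" "x = \<phi> a" using B by blast
    have "c \<odot>\<^bsub>B\<^esub> x = \<phi> (c \<odot> a)" using a \<phi>(4) by simp
    then show "\<psi> (c \<odot>\<^bsub>B\<^esub> x) = c \<odot> \<psi> x" using a by (simp add: \<psi>\<phi>)
  next
    fix i
    have "\<psi> ` \<phi> ` grade A i = grade A i"
      using \<psi>\<phi> grade_carrier by (force simp: image_image)
    then show "\<psi> ` grade B i = grade A i" by (simp add: \<phi>(5))
  qed
qed

section \<open>Envelopes of the standard algebras as supermatrices\<close>

lemma block_pos_iff: "(i, j) \<in> block_pos k l \<longleftrightarrow> i < k + l \<and> j < k + l \<and> (i < k) = (j < k)"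
  by (auto simp: block_pos_def)

lemma off_pos_iff: "(i, j) \<in> off_pos k l \<longleftrightarrow> i < k + l \<and> j < k + l \<and> (i < k) \<noteq> (j < k)"
  by (auto simp: off_pos_def)

lemma zero_smult_mat: "M \<in> carrier_mat n k \<Longrightarrow> 0 \<cdot>\<^sub>m M = (0\<^sub>m n k :: 'f :: field mat)"
  by (intro eq_matI) auto

lemma (in Z2_graded_algebra) identities_block_matrix_algebra:
  assumes "A \<cong>\<^sub>2 (block_matrix_algebra k l :: ('f, 'f mat) graded_algebra)"
  shows "identities (grassmann_envelope m A) = mat_identities (supermats m (block_pos k l) (off_pos k l))"
proof -
  let ?S = "block_matrix_algebra k l :: ('f, 'f mat) graded_algebra"
  obtain \<phi> where "graded_iso \<phi> A ?S" using assms unfolding graded_isomorphic_iff by blast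
  note iso = graded_isoD[OF this, unfolded block_matrix_algebra_simps]
  note bij = iso(1) and add = iso(2) and mult = iso(3) and scale = iso(4) and gr = iso(5)
  have car: "\<phi> x \<in> carrier_mat (k + l) (k + l)" if "x \<in> carrier A" for x
    using bij_betw_apply[OF bij that] by simp
  have \<phi>0: "\<phi> \<zero> = 0\<^sub>m (k + l) (k + l)"
    using scale[OF zero_closed, of 0] zero_smult_mat[OF car[OF zero_closed]] by simp
  define \<theta> where "\<theta> x a b = (if a < k + l \<and> b < k + l then \<phi> x $$ (a, b) else 0)" for x a b
  define P where "P i = (if i = 0 then block_pos k l else off_pos k l)" for i :: bit
  have P_iff: "(a, b) \<in> P i \<longleftrightarrow> a < k + l \<and> b < k + l \<and> ((a < k) = (b < k)) = (i = 0)" for a b i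
    by (auto simp: P_def block_pos_iff off_pos_iff)
  interpret position_model A \<theta> "k + l" P
  proof
    fix x y a b assume x: "x \<in> carrier A" and y: "y \<in> carrier A"
    show "\<theta> (x \<oplus> y) a b = \<theta> x a b + \<theta> y a b"
      using car[OF x] car[OF y] by (simp add: \<theta>_def add[OF x y])
    show "\<theta> (x \<otimes> y) a b = (\<Sum>k<k + l. \<theta> x a k * \<theta> y k b)"
      using car[OF x] car[OF y] by (simp add: \<theta>_def mult[OF x y] scalar_prod_def atLeast0LessThan)
  next
    fix x c a b assume x: "x \<in> carrier A"
    show "\<theta> (c \<odot> x) a b = c * \<theta> x a b" using car[OF x] by (simp add: \<theta>_def scale[OF x])
  next
    fix x i assume x: "x \<in> grade A i" and 0: "\<theta> x = (\<lambda>a b. 0)"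
    have "\<phi> x $$ (a, b) = 0" if "a < k + l" "b < k + l" for a b
      using fun_cong[OF fun_cong[OF 0], of a b] that by (simp add: \<theta>_def)
    then have "\<phi> x = \<phi> \<zero>" using car[OF grade_carrier[OF x]] unfolding \<phi>0 by (intro eq_matI) auto
    then show "x = \<zero>" using bij grade_carrier[OF x] by (auto simp: bij_betw_def dest: inj_onD)
  next
    fix x i a b assume x: "x \<in> grade A i" and nz: "\<theta> x a b \<noteq> 0"
    have "\<phi> x \<in> grade ?S i" using x gr by blast
    then show "(a, b) \<in> P i"
      using nz unfolding grade_block_matrix_algebra P_iff by (auto simp: \<theta>_def split: if_splits)
  next
    fix N :: "nat \<Rightarrow> nat \<Rightarrow> 'f" and i :: bit assume N: "\<And>a b. N a b \<noteq> 0 \<Longrightarrow> (a, b) \<in> P i"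
    have "mat (k + l) (k + l) (\<lambda>(a, b). N a b) \<in> grade ?S i"
      using N unfolding grade_block_matrix_algebra P_iff by auto
    then obtain x where x: "x \<in> grade A i" "\<phi> x = mat (k + l) (k + l) (\<lambda>(a, b). N a b)"
      unfolding gr[symmetric] by (metis imageE)
    have "\<theta> x = N" using N unfolding P_iff by (intro ext) (auto simp: \<theta>_def x(2))
    then show "\<exists>x\<in>grade A i. \<theta> x = N" using x(1) by blast
  next
    show "P i \<subseteq> {..<k + l} \<times> {..<k + l}" for i using P_iff by auto
  qed
  show ?thesis using identities_grassmann_envelope[of m] by (simp add: P_def)
qed

lemma (in Z2_graded_algebra) identities_group_matrix_algebra:
  assumes "A \<cong>\<^sub>2 (group_matrix_algebra n :: ('f, 'f mat \<times> 'f mat) graded_algebra)"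
  shows "identities (grassmann_envelope m A) = mat_identities (supermats m (block_pos n 0) (block_pos n 0))"
proof -
  let ?S = "group_matrix_algebra n :: ('f, 'f mat \<times> 'f mat) graded_algebra"
  obtain \<phi> where "graded_iso \<phi> A ?S" using assms unfolding graded_isomorphic_iff by blast
  note iso = graded_isoD[OF this]
  note bij = iso(1) and add = iso(2) and mult = iso(3) and scale = iso(4) and gr = iso(5)
  have car: "fst (\<phi> x) \<in> carrier_mat n n" "snd (\<phi> x) \<in> carrier_mat n n" if "x \<in> carrier A" for x
    using bij_betw_apply[OF bij that] by (auto simp: group_matrix_algebra_def)
  have add': "\<phi> (x \<oplus> y) = (fst (\<phi> x) + fst (\<phi> y), snd (\<phi> x) + snd (\<phi> y))" if "x \<in> carrier A" "y \<in> carrier A" for x y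
    by (simp add: add[OF that] group_matrix_algebra_def case_prod_beta)
  have mult': "\<phi> (x \<otimes> y) = (fst (\<phi> x) * fst (\<phi> y) + snd (\<phi> x) * snd (\<phi> y), fst (\<phi> x) * snd (\<phi> y) + snd (\<phi> x) * fst (\<phi> y))"
    if "x \<in> carrier A" "y \<in> carrier A" for x y
    by (simp add: mult[OF that] group_matrix_algebra_def case_prod_beta)
  have scale': "\<phi> (c \<odot> x) = (c \<cdot>\<^sub>m fst (\<phi> x), c \<cdot>\<^sub>m snd (\<phi> x))" if "x \<in> carrier A" for x c
    by (simp add: scale[OF that] group_matrix_algebra_def case_prod_beta)
  have \<phi>0: "\<phi> \<zero> = (0\<^sub>m n n, 0\<^sub>m n n)"
    using scale'[OF zero_closed, of 0] zero_smult_mat[OF car(1)[OF zero_closed]] zero_smult_mat[OF car(2)[OF zero_closed]]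
    by simp
  have gr': "if i = 0 then snd (\<phi> x) = 0\<^sub>m n n else fst (\<phi> x) = 0\<^sub>m n n" if "x \<in> grade A i" for x i
  proof -
    have "\<phi> x \<in> grade ?S i" using that gr by blast
    then show ?thesis by (auto simp: group_matrix_algebra_def split: if_splits)
  qed
  \<comment> \<open>The map \<open>X + \<epsilon> Y \<mapsto> X + Y\<close> is injective on both homogeneous parts, which suffices for the envelope.\<close>
  define \<theta> where "\<theta> x a b = (if a < n \<and> b < n then fst (\<phi> x) $$ (a, b) + snd (\<phi> x) $$ (a, b) else 0)" for x a b
  define P where "P i = block_pos n 0" for i :: bit
  have P_iff: "(a, b) \<in> P i \<longleftrightarrow> a < n \<and> b < n" for a b i
    by (auto simp: P_def block_pos_iff)
  interpret position_model A \<theta> n P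
  proof
    fix x y a b assume x: "x \<in> carrier A" and y: "y \<in> carrier A"
    note c = car[OF x] car[OF y]
    show "\<theta> (x \<oplus> y) a b = \<theta> x a b + \<theta> y a b"
      using c by (simp add: \<theta>_def add'[OF x y])
    show "\<theta> (x \<otimes> y) a b = (\<Sum>k<n. \<theta> x a k * \<theta> y k b)"
      using c by (simp add: \<theta>_def mult'[OF x y] scalar_prod_def atLeast0LessThan algebra_simps sum.distrib)
  next
    fix x c a b assume x: "x \<in> carrier A"
    show "\<theta> (c \<odot> x) a b = c * \<theta> x a b" using car[OF x] by (simp add: \<theta>_def scale'[OF x] algebra_simps)
  next
    fix x i assume x: "x \<in> grade A i" and 0: "\<theta> x = (\<lambda>a b. 0)"
    have sum0: "fst (\<phi> x) $$ (a, b) + snd (\<phi> x) $$ (a, b) = 0" if "a < n" "b < n" for a b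
      using fun_cong[OF fun_cong[OF 0], of a b] that by (simp add: \<theta>_def)
    have "fst (\<phi> x) = 0\<^sub>m n n \<and> snd (\<phi> x) = 0\<^sub>m n n"
    proof (cases "i = 0")
      case True
      then have s: "snd (\<phi> x) = 0\<^sub>m n n" using gr'[OF x] by simp
      then have "fst (\<phi> x) = 0\<^sub>m n n" using car[OF grade_carrier[OF x]] sum0 by (intro eq_matI) auto
      then show ?thesis using s by simp
    next
      case False
      then have s: "fst (\<phi> x) = 0\<^sub>m n n" using gr'[OF x] by simp
      then have "snd (\<phi> x) = 0\<^sub>m n n" using car[OF grade_carrier[OF x]] sum0 by (intro eq_matI) auto
      then show ?thesis using s by simp
    qed
    then have "\<phi> x = \<phi> \<zero>" by (simp add: \<phi>0 prod_eq_iff)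
    then show "x = \<zero>" using bij grade_carrier[OF x] by (auto simp: bij_betw_def dest: inj_onD)
  next
    fix x i a b assume "\<theta> x a b \<noteq> 0"
    then show "(a, b) \<in> P i" unfolding P_iff by (auto simp: \<theta>_def split: if_splits)
  next
    fix N :: "nat \<Rightarrow> nat \<Rightarrow> 'f" and i :: bit assume N: "\<And>a b. N a b \<noteq> 0 \<Longrightarrow> (a, b) \<in> P i"
    let ?N = "mat n n (\<lambda>(a, b). N a b)"
    have "(if i = 0 then (?N, 0\<^sub>m n n) else (0\<^sub>m n n, ?N)) \<in> grade ?S i"
      by (simp add: group_matrix_algebra_def)
    then obtain x where x: "x \<in> grade A i" "\<phi> x = (if i = 0 then (?N, 0\<^sub>m n n) else (0\<^sub>m n n, ?N))"
      unfolding gr[symmetric] by (metis imageE)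
    have "\<theta> x = N" using N unfolding P_iff by (intro ext) (auto simp: \<theta>_def x(2))
    then show "\<exists>x\<in>grade A i. \<theta> x = N" using x(1) by blast
  next
    show "P i \<subseteq> {..<n} \<times> {..<n}" for i using P_iff by auto
  qed
  show ?thesis using identities_grassmann_envelope[of m] by (simp add: P_def)
qed

text \<open>The triple names an isomorphism class and at the same time determines the identities of
  the envelope for each \<open>m\<close>. M_k(F) and M_k(F Z_2) share \<open>k\<close> and
  \<open>l = 0\<close> and are distinguished by \<open>Q\<close>, which is empty for the
  former.\<close>

definition has_kind :: "('f :: field, 'v, 'z) graded_algebra_scheme \<Rightarrow> nat \<Rightarrow> nat \<Rightarrow> (nat \<times> nat) set \<Rightarrow> bool" where
  "has_kind A k l Q \<longleftrightarrow> 0 < k \<and> l \<le> k \<and>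
     (Q = off_pos k l \<and> A \<cong>\<^sub>2 (block_matrix_algebra k l :: ('f, 'f mat) graded_algebra) \<or>
      l = 0 \<and> Q = block_pos k 0 \<and> A \<cong>\<^sub>2 (group_matrix_algebra k :: ('f, 'f mat \<times> 'f mat) graded_algebra))"

lemma has_kind_admissible: "has_kind A k l Q \<Longrightarrow> admissible k l Q"
  by (auto simp: has_kind_def admissible_def)

lemma has_kind_exists:
  fixes A :: "('f :: alg_closed_field, 'v, 'z) graded_algebra_scheme"
  assumes "graded_simple_algebra A" "vectorspace.fin_dim class_ring A"
  shows "\<exists>k l Q. has_kind A k l Q"
  using graded_simple_classification[OF assms] unfolding has_kind_def by blast

lemma (in Z2_graded_algebra) has_kind_identities:
  "has_kind A k l Q \<Longrightarrow> identities (grassmann_envelope m A) = mat_identities (supermats m (block_pos k l) Q)"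
  using identities_block_matrix_algebra identities_group_matrix_algebra unfolding has_kind_def by blast

lemma (in Z2_graded_algebra) has_kind_isomorphic:
  assumes "A \<cong>\<^sub>2 B" "has_kind A k l Q" shows "has_kind B k l Q"
proof -
  have BA: "B \<cong>\<^sub>2 A" using assms(1) by (rule graded_isomorphic_sym)
  have "A \<cong>\<^sub>2 (block_matrix_algebra k l :: ('f, 'f mat) graded_algebra) \<Longrightarrow> B \<cong>\<^sub>2 (block_matrix_algebra k l :: ('f, 'f mat) graded_algebra)"
    by (rule graded_isomorphic_trans[OF BA])
  moreover have "A \<cong>\<^sub>2 (group_matrix_algebra k :: ('f, 'f mat \<times> 'f mat) graded_algebra) \<Longrightarrow> B \<cong>\<^sub>2 (group_matrix_algebra k :: ('f, 'f mat \<times> 'f mat) graded_algebra)"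
    by (rule graded_isomorphic_trans[OF BA])
  ultimately show ?thesis using assms(2) unfolding has_kind_def by blast
qed

lemma off_pos_0: "off_pos k 0 = {}"
  by (simp add: off_pos_def)

lemma block_pos_nonempty: "0 < k \<Longrightarrow> block_pos k l \<noteq> {}"
  by (auto simp: block_pos_def)

lemma admissible_cases:
  assumes "admissible k l Q" "admissible k l Q'" "Q \<noteq> Q'"
  shows "l = 0 \<and> (Q = {} \<and> Q' = block_pos k 0 \<or> Q' = {} \<and> Q = block_pos k 0)"
  using assms off_pos_0 by (auto simp: admissible_def)

lemma enat_half_0: "1 \<le> m \<Longrightarrow> enat_half m = 0 \<longleftrightarrow> m = 1"
  by (cases m) (auto simp: one_enat_def zero_enat_def)

text \<open>The kinds are told apart by the identities of the envelope of \<open>A\<close> itself,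
  taken with two generators. One generator would be too few: the depth of M_k(F Z_2) is then 0 like
  that of M_k(F), whereas for two it is 1.\<close>

lemma has_kind_unique:
  fixes A :: "('f :: field_char_0, 'v, 'z) graded_algebra_scheme"
  assumes "Z2_graded_algebra A" and kind: "has_kind A k l Q" "has_kind A k' l' Q'"
  shows "k = k'" "l = l'" "Q = Q'"
proof -
  interpret Z2_graded_algebra A by fact
  have 2: "(1 :: enat) \<le> 2" by (simp add: one_enat_def numeral_eq_enat)
  note adm = has_kind_admissible[OF kind(1)] has_kind_admissible[OF kind(2)]
  have "mat_identities (supermats 2 (block_pos k l) Q :: 'f gr rfm set) = mat_identities (supermats 2 (block_pos k' l') Q')"
    using has_kind_identities kind by metis
  then have eq: "k = k'" "l = l'" "l = 0 \<longrightarrow> depth 2 Q = depth 2 Q'"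
    using mat_identities_determine[OF adm 2 2] by blast+
  show "k = k'" "l = l'" by fact+
  have "enat_half 2 \<noteq> 0" by (simp add: numeral_eq_enat zero_enat_def)
  moreover have "block_pos k 0 \<noteq> {}" using kind(1) block_pos_nonempty by (simp add: has_kind_def)
  moreover have "admissible k l Q'" using adm(2) eq(1,2) by simp
  ultimately show "Q = Q'"
    using admissible_cases[OF adm(1), of Q'] eq(3) unfolding depth_def by metis
qed

text \<open>Both algebras are isomorphic to the same standard algebra: for \<open>l = 0\<close> the
  set \<open>Q\<close> decides which, because \<open>off_pos k 0\<close> is empty and
  \<open>block_pos k 0\<close> is not.\<close>

lemma has_kind_determines:
  fixes A :: "('f :: field, 'v, 'y) graded_algebra_scheme" and B :: "('f, 'w, 'z) graded_algebra_scheme"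
  assumes "Z2_graded_algebra A" "Z2_graded_algebra B" and A: "has_kind A k l Q" and B: "has_kind B k l Q"
  shows "A \<cong>\<^sub>2 B"
proof -
  interpret B: Z2_graded_algebra B by fact
  have "off_pos k l \<noteq> block_pos k 0" if "l = 0" "0 < k"
    using that block_pos_nonempty[of k 0] by (simp add: off_pos_0)
  then consider "A \<cong>\<^sub>2 (block_matrix_algebra k l :: ('f, 'f mat) graded_algebra)" "B \<cong>\<^sub>2 (block_matrix_algebra k l :: ('f, 'f mat) graded_algebra)"
    | "A \<cong>\<^sub>2 (group_matrix_algebra k :: ('f, 'f mat \<times> 'f mat) graded_algebra)" "B \<cong>\<^sub>2 (group_matrix_algebra k :: ('f, 'f mat \<times> 'f mat) graded_algebra)"
    using A B unfolding has_kind_def by blast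
  then show ?thesis
  proof cases
    case 1
    then show ?thesis by (rule graded_isomorphic_trans[OF _ B.graded_isomorphic_sym])
  next
    case 2
    then show ?thesis by (rule graded_isomorphic_trans[OF _ B.graded_isomorphic_sym])
  qed
qed

theorem theorem12:
  fixes A :: "('f :: {alg_closed_field, field_char_0}, 'a) graded_algebra"
    and B :: "('f, 'b) graded_algebra"
    and m m' :: enat
  assumes "graded_simple_algebra A" and "vectorspace.fin_dim class_ring A"
    and "graded_simple_algebra B" and "vectorspace.fin_dim class_ring B"
    and "1 \<le> m" and "1 \<le> m'"
  shows "identities (grassmann_envelope m A) = identities (grassmann_envelope m' B) \<longleftrightarrow>
      (\<exists>n>0. A \<cong>\<^sub>2 matrix_algebra n \<and> B \<cong>\<^sub>2 group_matrix_algebra n \<and> m' = 1)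
    \<or> (\<exists>n>0. B \<cong>\<^sub>2 matrix_algebra n \<and> A \<cong>\<^sub>2 group_matrix_algebra n \<and> m = 1)
    \<or> (A \<cong>\<^sub>2 B \<and>
        ((\<exists>n>0. A \<cong>\<^sub>2 group_matrix_algebra n) \<longrightarrow> enat_half m = enat_half m') \<and>
        ((\<exists>k l. k \<ge> l \<and> l > 0 \<and> A \<cong>\<^sub>2 block_matrix_algebra k l) \<longrightarrow> m = m'))"
    (is "?I \<longleftrightarrow> ?T1 \<or> ?T2 \<or> ?T3")
proof -
  interpret A: graded_simple_algebra A by fact
  interpret B: graded_simple_algebra B by fact
  have ZA: "Z2_graded_algebra A" and ZB: "Z2_graded_algebra B" by unfold_locales
  have matrix: "has_kind C n 0 {}" if "0 < n" "C \<cong>\<^sub>2 (matrix_algebra n :: ('f, 'f mat) graded_algebra)"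
    for n and C :: "('f, 'v) graded_algebra"
    using that by (simp add: has_kind_def off_pos_0 block_matrix_algebra_0)
  have group: "has_kind C n 0 (block_pos n 0)"
    if "0 < n" "C \<cong>\<^sub>2 (group_matrix_algebra n :: ('f, 'f mat \<times> 'f mat) graded_algebra)"
    for n and C :: "('f, 'v) graded_algebra"
    using that by (simp add: has_kind_def)
  obtain k l Q where kind: "has_kind A k l Q" using has_kind_exists assms(1,2) by blast
  obtain k' l' Q' where kind': "has_kind B k' l' Q'" using has_kind_exists assms(3,4) by blast
  note adm = has_kind_admissible[OF kind] and adm' = has_kind_admissible[OF kind']
  show ?thesis
  proof
    assume ?I
    then have "mat_identities (supermats m (block_pos k l) Q :: 'f gr rfm set) =
        mat_identities (supermats m' (block_pos k' l') Q')"
      using A.has_kind_identities[OF kind] B.has_kind_identities[OF kind'] by simp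
    then have eq: "k = k'" "l = l'" "0 < l \<longrightarrow> m = m'" "l = 0 \<longrightarrow> depth m Q = depth m' Q'"
      using mat_identities_determine[OF adm adm' assms(5,6)] by blast+
    have k: "0 < k" using kind by (simp add: has_kind_def)
    show "?T1 \<or> ?T2 \<or> ?T3"
    proof (cases "Q = Q'")
      case True
      have "has_kind B k l Q" using kind' eq(1,2) True by simp
      with ZA ZB kind have "A \<cong>\<^sub>2 B" by (rule has_kind_determines)
      moreover have "enat_half m = enat_half m'"
        if "0 < n" "A \<cong>\<^sub>2 (group_matrix_algebra n :: ('f, 'f mat \<times> 'f mat) graded_algebra)" for n
      proof -
        have "l = 0" "Q = block_pos n 0" using has_kind_unique[OF ZA kind group[OF that]] by blast+
        then show ?thesis using eq(4) True block_pos_nonempty[OF that(1)] by (simp add: depth_def)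
      qed
      moreover have "m = m'"
        if "l'' \<le> k''" "0 < l''" "A \<cong>\<^sub>2 (block_matrix_algebra k'' l'' :: ('f, 'f mat) graded_algebra)" for k'' l''
      proof -
        have "has_kind A k'' l'' (off_pos k'' l'')" using that by (simp add: has_kind_def)
        then have "l = l''" using has_kind_unique[OF ZA kind] by blast
        then show ?thesis using eq(3) that by simp
      qed
      ultimately show ?thesis by blast
    next
      \<comment> \<open>With equal \<open>k\<close> and \<open>l\<close>, different \<open>Q\<close>
        mean M_k(F) against M_k(F Z_2). The depth of the former is 0, hence so is that of the
        latter, whose number of generators has half 0 and must be 1.\<close>
      case False
      then have l: "l = 0" and cases: "Q = {} \<and> Q' = block_pos k 0 \<or> Q' = {} \<and> Q = block_pos k 0"
        using admissible_cases[of k l Q Q'] adm adm' eq(1,2) by auto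
      have ne: "block_pos k 0 \<noteq> {}" using k by (rule block_pos_nonempty)
      from cases show ?thesis
      proof
        assume QQ: "Q = {} \<and> Q' = block_pos k 0"
        then have "A \<cong>\<^sub>2 (matrix_algebra k :: ('f, 'f mat) graded_algebra)"
          "B \<cong>\<^sub>2 (group_matrix_algebra k :: ('f, 'f mat \<times> 'f mat) graded_algebra)"
          using kind kind' ne eq(1,2) l by (auto simp: has_kind_def block_matrix_algebra_0 off_pos_0)
        moreover have "m' = 1" using eq(4) l QQ ne enat_half_0[OF assms(6)] by (simp add: depth_def)
        ultimately show ?thesis using k by blast
      next
        assume QQ: "Q' = {} \<and> Q = block_pos k 0"
        then have "B \<cong>\<^sub>2 (matrix_algebra k :: ('f, 'f mat) graded_algebra)"
          "A \<cong>\<^sub>2 (group_matrix_algebra k :: ('f, 'f mat \<times> 'f mat) graded_algebra)"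
          using kind kind' ne eq(1,2) l by (auto simp: has_kind_def block_matrix_algebra_0 off_pos_0)
        moreover have "m = 1" using eq(4) l QQ ne enat_half_0[OF assms(5)] by (simp add: depth_def)
        ultimately show ?thesis using k by blast
      qed
    qed
  next
    have same: ?I if "has_kind A n 0 R" "has_kind B n 0 R'" "depth m R = depth m' R'" for n R R'
      using mat_identities_depth[OF has_kind_admissible[OF that(1)] has_kind_admissible[OF that(2)] assms(5,6) that(3)]
        A.has_kind_identities[OF that(1)] B.has_kind_identities[OF that(2)] by simp
    have half1: "enat_half 1 = 0" using enat_half_0[of 1] by simp
    assume "?T1 \<or> ?T2 \<or> ?T3"
    then show ?I
    proof (elim disjE)
      assume ?T1
      then obtain n where n: "0 < n" "A \<cong>\<^sub>2 matrix_algebra n" "B \<cong>\<^sub>2 group_matrix_algebra n" "m' = 1" by blast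
      show ?thesis by (rule same[OF matrix[OF n(1,2)] group[OF n(1,3)]]) (simp add: depth_def n(4) half1)
    next
      assume ?T2
      then obtain n where n: "0 < n" "B \<cong>\<^sub>2 matrix_algebra n" "A \<cong>\<^sub>2 group_matrix_algebra n" "m = 1" by blast
      show ?thesis by (rule same[OF group[OF n(1,3)] matrix[OF n(1,2)]]) (simp add: depth_def n(4) half1)
    next
      assume 3: ?T3
      then have "A \<cong>\<^sub>2 B" by blast
      then have kindB: "has_kind B k l Q" using kind by (rule A.has_kind_isomorphic)
      show ?thesis
      proof (cases "l = 0")
        case True
        \<comment> \<open>For M_k(F) both depths are 0 whatever \<open>m\<close> and
          \<open>m'\<close> are, in accordance with the absence of a condition on them in this
          case.\<close>
        have "depth m Q = depth m' Q"
        proof (cases "Q = {}")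
          case False
          then have "0 < k" "A \<cong>\<^sub>2 (group_matrix_algebra k :: ('f, 'f mat \<times> 'f mat) graded_algebra)"
            using kind True by (auto simp: has_kind_def off_pos_0)
          then show ?thesis using 3 by (auto simp: depth_def)
        qed (simp add: depth_def)
        then show ?thesis using same kind kindB True by blast
      next
        case False
        then have "l \<le> k" "0 < l" "A \<cong>\<^sub>2 (block_matrix_algebra k l :: ('f, 'f mat) graded_algebra)"
          using kind by (auto simp: has_kind_def)
        then have "m = m'" using 3 by blast
        then show ?thesis using A.has_kind_identities[OF kind] B.has_kind_identities[OF kindB] by simp
      qed
    qed
  qed
qed

end
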